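(* Let $\mathcal{E}$ be an exact category. The following hold: (1) $\operatorname{eff}(\mathcal{E})$ is a percolating subcategory of $\operatorname{mod}_{\mathsf{adm}}(\mathcal{E})$. Hence the quotient $\operatorname{mod}_{\mathsf{adm}}(\mathcal{E})/\operatorname{eff}(\mathcal{E})$ exists (in the category of exact categories). (2) $\operatorname{mod}_{\mathsf{adm}}(\mathcal{E})/\operatorname{eff}(\mathcal{E})$ is equivalent to $\mathcal{E}$ as an exact category.
   Context: All categories are essentially small and additive; subcategories are full and closed under isomorphisms. Exact categories are in the sense of Quillen: an additive category with a chosen class of kernel-cokernel pairs (conflations), closed under isomorphism and satisfying Quillen's axioms; the kernel part of a conflation is an inflation, the cokernel part a deflation. No idempotent completeness is assumed. A functor between exact categories is exact if it is additive and maps conflations to conflations. Equivalent as exact categories means there is an equivalence of categories which is exact with exact quasi-inverse. A morphism $f$ is admissible if $f=m\circ p$ with $p$ a deflation and $m$ an inflation; the middle object of this (essentially unique) factorization is the image of $f$. $\operatorname{Mod}(\mathcal{E})$ is the abelian category of additive contravariant functors $\mathcal{E}\to \mathsf{Ab}$. $\operatorname{mod}_{\mathsf{adm}}(\mathcal{E})$ is the full subcategory of those $F$ admitting an exact sequence $\operatorname{Hom}_{\mathcal{E}}(-,X)\xrightarrow{\operatorname{Hom}_{\mathcal{E}}(-,f)}\operatorname{Hom}_{\mathcal{E}}(-,Y)\to F\to 0$ with $f\colon X\to Y$ an admissible morphism in $\mathcal{E}$. It is extension-closed in $\operatorname{Mod}(\mathcal{E})$ and is regarded as an exact category whose conflations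 are the short exact sequences of $\operatorname{Mod}(\mathcal{E})$ with all terms in $\operatorname{mod}_{\mathsf{adm}}(\mathcal{E})$. $\operatorname{eff}(\mathcal{E})$ is the full subcategory of $\operatorname{mod}_{\mathsf{adm}}(\mathcal{E})$ of functors $F$ that only admit zero morphisms to representable functors $\operatorname{Hom}_{\mathcal{E}}(-,X)$, $X\in\mathcal{E}$. A nonempty full subcategory $\mathcal{A}$ of an exact category $\mathcal{E}'$ is percolating if: (A1) for every conflation $X\rightarrowtail Y\twoheadrightarrow Z$ in $\mathcal{E}'$, $Y\in\mathcal{A}$ if and only if $X,Z\in\mathcal{A}$; (A2) every morphism $X\to A$ with $A\in\mathcal{A}$ is admissible with image in $\mathcal{A}$; and (A2$^{\mathrm{op}}$) every morphism $A\to X$ with $A\in\mathcal{A}$ is admissible with image in $\mathcal{A}$. The quotient $\mathcal{E}'/\mathcal{A}$ is an exact category with an exact functor $Q\colon\mathcal{E}'\to\mathcal{E}'/\mathcal{A}$ with $Q(\mathcal{A})\cong 0$ that is 2-universal among exact functors from $\mathcal{E}'$ to exact categories sending all objects of $\mathcal{A}$ to $0$. For $\mathcal{A}$ percolating it is realized as the localization $\mathcal{E}'[\Sigma^{-1}]$, where $\Sigma$ is the set of admissible morphisms with kernel and cokernel in $\mathcal{A}$, with conflations the sequences isomorphic to images of conflations of $\mathcal{E}'$. *)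

theory Defs
  imports "HOL-Algebra.Coset"
begin

section \<open>Additive categories\<close>

text \<open>A category is given by a set of objects and a set of arrows. Full subcategories are given
  by their sets of objects.\<close>

record ('o, 'm) cat =
  Obj :: "'o set"
  Arr :: "'m set"
  Dom :: "'m \<Rightarrow> 'o"
  Cod :: "'m \<Rightarrow> 'o"
  Idn :: "'o \<Rightarrow> 'm"
  Cmp :: "'m \<Rightarrow> 'm \<Rightarrow> 'm" (infixr \<open>\<star>\<index>\<close> 75)

record ('o, 'm) pcat = "('o, 'm) cat" +
  Plus :: "'m \<Rightarrow> 'm \<Rightarrow> 'm" (infixl \<open>\<boxplus>\<index>\<close> 65)
  Zero :: "'o \<Rightarrow> 'o \<Rightarrow> 'm"

definition Hom :: "('o, 'm, 'x) cat_scheme \<Rightarrow> 'o \<Rightarrow> 'o \<Rightarrow> 'm set" where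
  "Hom C X Y = {f \<in> Arr C. Dom C f = X \<and> Cod C f = Y}"

locale category =
  fixes C :: "('o, 'm, 'x) cat_scheme" (structure)
  assumes dom_in: "f \<in> Arr C \<Longrightarrow> Dom C f \<in> Obj C"
    and cod_in: "f \<in> Arr C \<Longrightarrow> Cod C f \<in> Obj C"
    and idn_in: "X \<in> Obj C \<Longrightarrow> Idn C X \<in> Hom C X X"
    and cmp_in: "f \<in> Hom C X Y \<Longrightarrow> g \<in> Hom C Y Z \<Longrightarrow> g \<star> f \<in> Hom C X Z"
    and idn_left: "f \<in> Hom C X Y \<Longrightarrow> Idn C Y \<star> f = f"
    and idn_right: "f \<in> Hom C X Y \<Longrightarrow> f \<star> Idn C X = f"
    and cmp_assoc: "f \<in> Hom C W X \<Longrightarrow> g \<in> Hom C X Y \<Longrightarrow> h \<in> Hom C Y Z \<Longrightarrow>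
      (h \<star> g) \<star> f = h \<star> (g \<star> f)"

definition is_iso_arr :: "('o, 'm, 'x) cat_scheme \<Rightarrow> 'm \<Rightarrow> bool" where
  "is_iso_arr C f \<longleftrightarrow> f \<in> Arr C \<and>
     (\<exists>g \<in> Hom C (Cod C f) (Dom C f). g \<star>\<^bsub>C\<^esub> f = Idn C (Dom C f) \<and> f \<star>\<^bsub>C\<^esub> g = Idn C (Cod C f))"

definition isomorphic_objs :: "('o, 'm, 'x) cat_scheme \<Rightarrow> 'o \<Rightarrow> 'o \<Rightarrow> bool" where
  "isomorphic_objs C X Y \<longleftrightarrow> (\<exists>f \<in> Hom C X Y. is_iso_arr C f)"

definition is_zero_obj :: "('o, 'm, 'x) cat_scheme \<Rightarrow> 'o \<Rightarrow> bool" where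
  "is_zero_obj C Z \<longleftrightarrow> Z \<in> Obj C \<and>
     (\<forall>X \<in> Obj C. (\<exists>!f. f \<in> Hom C X Z) \<and> (\<exists>!f. f \<in> Hom C Z X))"

definition hom_group :: "('o, 'm, 'x) pcat_scheme \<Rightarrow> 'o \<Rightarrow> 'o \<Rightarrow> 'm monoid" where
  "hom_group C X Y = \<lparr>carrier = Hom C X Y, mult = Plus C, one = Zero C X Y\<rparr>"

locale preadditive_category = category C
  for C :: "('o, 'm, 'x) pcat_scheme" (structure) +
  assumes hom_comm_group: "X \<in> Obj C \<Longrightarrow> Y \<in> Obj C \<Longrightarrow> comm_group (hom_group C X Y)"
    and cmp_plus_left: "f \<in> Hom C X Y \<Longrightarrow> g \<in> Hom C Y Z \<Longrightarrow> h \<in> Hom C Y Z \<Longrightarrow>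
      (g \<boxplus> h) \<star> f = (g \<star> f) \<boxplus> (h \<star> f)"
    and cmp_plus_right: "f \<in> Hom C X Y \<Longrightarrow> g \<in> Hom C X Y \<Longrightarrow> h \<in> Hom C Y Z \<Longrightarrow>
      h \<star> (f \<boxplus> g) = (h \<star> f) \<boxplus> (h \<star> g)"

locale additive_category = preadditive_category C
  for C :: "('o, 'm, 'x) pcat_scheme" (structure) +
  assumes ex_zero_obj: "\<exists>Z. is_zero_obj C Z"
    and ex_biproduct: "X \<in> Obj C \<Longrightarrow> Y \<in> Obj C \<Longrightarrow>
      \<exists>S \<in> Obj C. \<exists>i \<in> Hom C X S. \<exists>j \<in> Hom C Y S. \<exists>p \<in> Hom C S X. \<exists>q \<in> Hom C S Y.
        p \<star> i = Idn C X \<and> q \<star> j = Idn C Y \<and> p \<star> j = Zero C Y X \<and> q \<star> i = Zero C X Y \<and>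
        (i \<star> p) \<boxplus> (j \<star> q) = Idn C S"

definition full_sub :: "('o, 'm) pcat \<Rightarrow> 'o set \<Rightarrow> ('o, 'm) pcat" where
  "full_sub C S = C\<lparr>Obj := Obj C \<inter> S, Arr := {f \<in> Arr C. Dom C f \<in> S \<and> Cod C f \<in> S}\<rparr>"


section \<open>Exact categories\<close>

definition is_kernel :: "('o, 'm, 'x) pcat_scheme \<Rightarrow> 'm \<Rightarrow> 'm \<Rightarrow> bool" where
  "is_kernel C k f \<longleftrightarrow> k \<in> Arr C \<and> f \<in> Arr C \<and> Cod C k = Dom C f \<and>
     f \<star>\<^bsub>C\<^esub> k = Zero C (Dom C k) (Cod C f) \<and>
     (\<forall>h \<in> Arr C. Cod C h = Dom C f \<longrightarrow> f \<star>\<^bsub>C\<^esub> h = Zero C (Dom C h) (Cod C f) \<longrightarrow>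
        (\<exists>!u. u \<in> Hom C (Dom C h) (Dom C k) \<and> k \<star>\<^bsub>C\<^esub> u = h))"

definition is_cokernel :: "('o, 'm, 'x) pcat_scheme \<Rightarrow> 'm \<Rightarrow> 'm \<Rightarrow> bool" where
  "is_cokernel C c f \<longleftrightarrow> c \<in> Arr C \<and> f \<in> Arr C \<and> Dom C c = Cod C f \<and>
     c \<star>\<^bsub>C\<^esub> f = Zero C (Dom C f) (Cod C c) \<and>
     (\<forall>h \<in> Arr C. Dom C h = Cod C f \<longrightarrow> h \<star>\<^bsub>C\<^esub> f = Zero C (Dom C f) (Cod C h) \<longrightarrow>
        (\<exists>!u. u \<in> Hom C (Cod C c) (Cod C h) \<and> u \<star>\<^bsub>C\<^esub> c = h))"

text \<open>In \<^term>\<open>is_pushout C f g f' g'\<close>, the arrow \<^term>\<open>f'\<close> is the one opposite to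
  \<^term>\<open>f\<close>; likewise for pullbacks.\<close>

definition is_pushout :: "('o, 'm, 'x) cat_scheme \<Rightarrow> 'm \<Rightarrow> 'm \<Rightarrow> 'm \<Rightarrow> 'm \<Rightarrow> bool" where
  "is_pushout C f g f' g' \<longleftrightarrow> f \<in> Arr C \<and> g \<in> Arr C \<and> f' \<in> Arr C \<and> g' \<in> Arr C \<and>
     Dom C f = Dom C g \<and> Dom C f' = Cod C g \<and> Dom C g' = Cod C f \<and> Cod C f' = Cod C g' \<and>
     f' \<star>\<^bsub>C\<^esub> g = g' \<star>\<^bsub>C\<^esub> f \<and>
     (\<forall>a \<in> Arr C. \<forall>b \<in> Arr C.
        Dom C a = Cod C g \<longrightarrow> Dom C b = Cod C f \<longrightarrow> Cod C a = Cod C b \<longrightarrow> a \<star>\<^bsub>C\<^esub> g = b \<star>\<^bsub>C\<^esub> f \<longrightarrow>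
        (\<exists>!u. u \<in> Hom C (Cod C f') (Cod C a) \<and> u \<star>\<^bsub>C\<^esub> f' = a \<and> u \<star>\<^bsub>C\<^esub> g' = b))"

definition is_pullback :: "('o, 'm, 'x) cat_scheme \<Rightarrow> 'm \<Rightarrow> 'm \<Rightarrow> 'm \<Rightarrow> 'm \<Rightarrow> bool" where
  "is_pullback C f g f' g' \<longleftrightarrow> f \<in> Arr C \<and> g \<in> Arr C \<and> f' \<in> Arr C \<and> g' \<in> Arr C \<and>
     Cod C f = Cod C g \<and> Cod C f' = Dom C g \<and> Cod C g' = Dom C f \<and> Dom C f' = Dom C g' \<and>
     g \<star>\<^bsub>C\<^esub> f' = f \<star>\<^bsub>C\<^esub> g' \<and>
     (\<forall>a \<in> Arr C. \<forall>b \<in> Arr C.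
        Cod C a = Dom C g \<longrightarrow> Cod C b = Dom C f \<longrightarrow> Dom C a = Dom C b \<longrightarrow> g \<star>\<^bsub>C\<^esub> a = f \<star>\<^bsub>C\<^esub> b \<longrightarrow>
        (\<exists>!u. u \<in> Hom C (Dom C a) (Dom C f') \<and> f' \<star>\<^bsub>C\<^esub> u = a \<and> g' \<star>\<^bsub>C\<^esub> u = b))"

definition isomorphic_seqs :: "('o, 'm, 'x) cat_scheme \<Rightarrow> 'm \<times> 'm \<Rightarrow> 'm \<times> 'm \<Rightarrow> bool" where
  "isomorphic_seqs C = (\<lambda>(i, p) (j, q).
     i \<in> Arr C \<and> p \<in> Arr C \<and> j \<in> Arr C \<and> q \<in> Arr C \<and> Cod C i = Dom C p \<and> Cod C j = Dom C q \<and>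
     (\<exists>a \<in> Hom C (Dom C i) (Dom C j). \<exists>b \<in> Hom C (Cod C i) (Cod C j). \<exists>c \<in> Hom C (Cod C p) (Cod C q).
        is_iso_arr C a \<and> is_iso_arr C b \<and> is_iso_arr C c \<and>
        j \<star>\<^bsub>C\<^esub> a = b \<star>\<^bsub>C\<^esub> i \<and> q \<star>\<^bsub>C\<^esub> b = c \<star>\<^bsub>C\<^esub> p))"

record ('o, 'm) excat = "('o, 'm) pcat" +
  Conf :: "('m \<times> 'm) set"

definition inflation :: "('o, 'm, 'x) excat_scheme \<Rightarrow> 'm \<Rightarrow> bool" where
  "inflation C i \<longleftrightarrow> (\<exists>p. (i, p) \<in> Conf C)"

definition deflation :: "('o, 'm, 'x) excat_scheme \<Rightarrow> 'm \<Rightarrow> bool" where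
  "deflation C p \<longleftrightarrow> (\<exists>i. (i, p) \<in> Conf C)"

locale exact_category = additive_category C
  for C :: "('o, 'm, 'x) excat_scheme" (structure) +
  assumes conf_kernel: "(i, p) \<in> Conf C \<Longrightarrow> is_kernel C i p"
    and conf_cokernel: "(i, p) \<in> Conf C \<Longrightarrow> is_cokernel C p i"
    and conf_iso_closed: "(i, p) \<in> Conf C \<Longrightarrow> isomorphic_seqs C (i, p) (j, q) \<Longrightarrow> (j, q) \<in> Conf C"
    and inflation_idn: "X \<in> Obj C \<Longrightarrow> inflation C (Idn C X)"
    and deflation_idn: "X \<in> Obj C \<Longrightarrow> deflation C (Idn C X)"
    and inflation_cmp: "inflation C i \<Longrightarrow> inflation C j \<Longrightarrow> Cod C i = Dom C j \<Longrightarrow> inflation C (j \<star> i)"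
    and deflation_cmp: "deflation C p \<Longrightarrow> deflation C q \<Longrightarrow> Cod C p = Dom C q \<Longrightarrow> deflation C (q \<star> p)"
    and inflation_pushout: "inflation C i \<Longrightarrow> f \<in> Arr C \<Longrightarrow> Dom C f = Dom C i \<Longrightarrow>
      \<exists>i' f'. is_pushout C i f i' f' \<and> inflation C i'"
    and deflation_pullback: "deflation C p \<Longrightarrow> f \<in> Arr C \<Longrightarrow> Cod C f = Cod C p \<Longrightarrow>
      \<exists>p' f'. is_pullback C p f p' f' \<and> deflation C p'"

definition is_image :: "('o, 'm, 'x) excat_scheme \<Rightarrow> 'm \<Rightarrow> 'o \<Rightarrow> bool" where
  "is_image C f I \<longleftrightarrow> (\<exists>p m. deflation C p \<and> inflation C m \<and> Cod C p = I \<and> Dom C m = I \<and> f = m \<star>\<^bsub>C\<^esub> p)"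

definition admissible :: "('o, 'm, 'x) excat_scheme \<Rightarrow> 'm \<Rightarrow> bool" where
  "admissible C f \<longleftrightarrow> (\<exists>I. is_image C f I)"


section \<open>Exact functors and exact equivalences\<close>

record ('o, 'm, 'p, 'q) ftor =
  FObj :: "'o \<Rightarrow> 'p"
  FArr :: "'m \<Rightarrow> 'q"

locale exact_functor = A: exact_category A + B: exact_category B
  for A :: "('o, 'm, 'x) excat_scheme" and B :: "('p, 'q, 'y) excat_scheme"
    and F :: "('o, 'm, 'p, 'q) ftor" +
  assumes fobj_in: "X \<in> Obj A \<Longrightarrow> FObj F X \<in> Obj B"
    and farr_in: "f \<in> Hom A X Y \<Longrightarrow> FArr F f \<in> Hom B (FObj F X) (FObj F Y)"
    and farr_idn: "X \<in> Obj A \<Longrightarrow> FArr F (Idn A X) = Idn B (FObj F X)"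
    and farr_cmp: "f \<in> Hom A X Y \<Longrightarrow> g \<in> Hom A Y Z \<Longrightarrow> FArr F (g \<star>\<^bsub>A\<^esub> f) = FArr F g \<star>\<^bsub>B\<^esub> FArr F f"
    and farr_plus: "f \<in> Hom A X Y \<Longrightarrow> g \<in> Hom A X Y \<Longrightarrow> FArr F (f \<boxplus>\<^bsub>A\<^esub> g) = FArr F f \<boxplus>\<^bsub>B\<^esub> FArr F g"
    and farr_conf: "(i, p) \<in> Conf A \<Longrightarrow> (FArr F i, FArr F p) \<in> Conf B"

definition id_ftor :: "('o, 'm, 'o, 'm) ftor" where
  "id_ftor = \<lparr>FObj = (\<lambda>X. X), FArr = (\<lambda>f. f)\<rparr>"

definition comp_ftor :: "('p, 'q, 'r, 's) ftor \<Rightarrow> ('o, 'm, 'p, 'q) ftor \<Rightarrow> ('o, 'm, 'r, 's) ftor" where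
  "comp_ftor G F = \<lparr>FObj = FObj G \<circ> FObj F, FArr = FArr G \<circ> FArr F\<rparr>"

definition nat_trans :: "('o, 'm, 'x) cat_scheme \<Rightarrow> ('p, 'q, 'y) cat_scheme \<Rightarrow>
    ('o, 'm, 'p, 'q) ftor \<Rightarrow> ('o, 'm, 'p, 'q) ftor \<Rightarrow> ('o \<Rightarrow> 'q) \<Rightarrow> bool" where
  "nat_trans A B F G \<eta> \<longleftrightarrow> (\<forall>X \<in> Obj A. \<eta> X \<in> Hom B (FObj F X) (FObj G X)) \<and>
     (\<forall>f \<in> Arr A. \<eta> (Cod A f) \<star>\<^bsub>B\<^esub> FArr F f = FArr G f \<star>\<^bsub>B\<^esub> \<eta> (Dom A f))"

definition isomorphic_ftors :: "('o, 'm, 'x) cat_scheme \<Rightarrow> ('p, 'q, 'y) cat_scheme \<Rightarrow>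
    ('o, 'm, 'p, 'q) ftor \<Rightarrow> ('o, 'm, 'p, 'q) ftor \<Rightarrow> bool" where
  "isomorphic_ftors A B F G \<longleftrightarrow>
     (\<exists>\<eta>. nat_trans A B F G \<eta> \<and> (\<forall>X \<in> Obj A. is_iso_arr B (\<eta> X)))"

definition exact_equivalent :: "('o, 'm, 'x) excat_scheme \<Rightarrow> ('p, 'q, 'y) excat_scheme \<Rightarrow> bool" where
  "exact_equivalent A B \<longleftrightarrow> (\<exists>F G. exact_functor A B F \<and> exact_functor B A G \<and>
     isomorphic_ftors A A (comp_ftor G F) id_ftor \<and> isomorphic_ftors B B (comp_ftor F G) id_ftor)"


section \<open>Percolating subcategories and quotients\<close>

locale percolating_subcategory = exact_category C
  for C :: "('o, 'm, 'x) excat_scheme" (structure) and A :: "'o set" +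
  assumes subset: "A \<subseteq> Obj C"
    and replete: "X \<in> A \<Longrightarrow> isomorphic_objs C X Y \<Longrightarrow> Y \<in> A"
    and nonempty: "A \<noteq> {}"
    and A1: "(i, p) \<in> Conf C \<Longrightarrow> Cod C i \<in> A \<longleftrightarrow> Dom C i \<in> A \<and> Cod C p \<in> A"
    and A2: "f \<in> Arr C \<Longrightarrow> Cod C f \<in> A \<Longrightarrow> admissible C f \<and> (\<forall>I. is_image C f I \<longrightarrow> I \<in> A)"
    and A2op: "f \<in> Arr C \<Longrightarrow> Dom C f \<in> A \<Longrightarrow> admissible C f \<and> (\<forall>I. is_image C f I \<longrightarrow> I \<in> A)"

text \<open>The exact functor \<^term>\<open>Q\<close> from \<^term>\<open>C\<close> to \<^term>\<open>K\<close> exhibits \<^term>\<open>K\<close> as the quotient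
  of \<^term>\<open>C\<close> by \<^term>\<open>A\<close>: it kills \<^term>\<open>A\<close>, and for every exact category \<^term>\<open>D\<close>,
  precomposition with \<^term>\<open>Q\<close> is an equivalence (essentially surjective and fully faithful) from
  the category of exact functors from \<^term>\<open>K\<close> to \<^term>\<open>D\<close> to the category of exact functors
  from \<^term>\<open>C\<close> to \<^term>\<open>D\<close> killing \<^term>\<open>A\<close>. HOL does not quantify over types inside formulas,
  so the types of objects and arrows of \<^term>\<open>D\<close> are passed as a type argument, left
  arbitrary in theorems.\<close>

definition is_exact_quotient :: "('p \<times> 'q) itself \<Rightarrow> ('o, 'm) excat \<Rightarrow> 'o set \<Rightarrow> ('k, 'l) excat \<Rightarrow>
    ('o, 'm, 'k, 'l) ftor \<Rightarrow> bool" where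
  "is_exact_quotient T C A K Q \<longleftrightarrow>
     exact_functor C K Q \<and> (\<forall>X \<in> A. is_zero_obj K (FObj Q X)) \<and>
     (\<forall>D :: ('p, 'q) excat. exact_category D \<longrightarrow>
        (\<forall>F. exact_functor C D F \<longrightarrow> (\<forall>X \<in> A. is_zero_obj D (FObj F X)) \<longrightarrow>
           (\<exists>G. exact_functor K D G \<and> isomorphic_ftors C D (comp_ftor G Q) F)) \<and>
        (\<forall>G H \<eta>. exact_functor K D G \<longrightarrow> exact_functor K D H \<longrightarrow>
           nat_trans C D (comp_ftor G Q) (comp_ftor H Q) \<eta> \<longrightarrow>
           (\<exists>\<theta>. (nat_trans K D G H \<theta> \<and> (\<forall>X \<in> Obj C. \<theta> (FObj Q X) = \<eta> X)) \<and>
              (\<forall>\<theta>'. nat_trans K D G H \<theta>' \<and> (\<forall>X \<in> Obj C. \<theta>' (FObj Q X) = \<eta> X) \<longrightarrow>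
                 (\<forall>Y \<in> Obj K. \<theta>' Y = \<theta> Y)))))"


subsection \<open>Localization at a set of arrows\<close>

text \<open>The Gabriel-Zisman localization: an arrow from \<^term>\<open>X\<close> to \<^term>\<open>Y\<close> is a class of zigzags
  modulo the congruence making each backward step inverse to the corresponding forward step.
  Zigzags are read from left to right, starting at \<^term>\<open>X\<close>.\<close>

datatype 'm step = Fwd 'm | Bwd 'm

fun zigzag :: "('o, 'm, 'x) cat_scheme \<Rightarrow> 'm set \<Rightarrow> 'o \<Rightarrow> 'o \<Rightarrow> 'm step list \<Rightarrow> bool" where
  "zigzag C S X Y [] \<longleftrightarrow> X \<in> Obj C \<and> X = Y"
| "zigzag C S X Y (Fwd f # w) \<longleftrightarrow> f \<in> Arr C \<and> Dom C f = X \<and> zigzag C S (Cod C f) Y w"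
| "zigzag C S X Y (Bwd s # w) \<longleftrightarrow> s \<in> S \<and> Cod C s = X \<and> zigzag C S (Dom C s) Y w"

inductive zz_eq :: "('o, 'm, 'x) cat_scheme \<Rightarrow> 'm set \<Rightarrow> 'o \<Rightarrow> 'o \<Rightarrow> 'm step list \<Rightarrow> 'm step list \<Rightarrow> bool"
  for C :: "('o, 'm, 'x) cat_scheme" and S :: "'m set" where
  zz_refl: "zigzag C S X Y w \<Longrightarrow> zz_eq C S X Y w w"
| zz_sym: "zz_eq C S X Y v w \<Longrightarrow> zz_eq C S X Y w v"
| zz_trans: "zz_eq C S X Y u v \<Longrightarrow> zz_eq C S X Y v w \<Longrightarrow> zz_eq C S X Y u w"
| zz_append: "zz_eq C S X Y v w \<Longrightarrow> zz_eq C S Y Z v' w' \<Longrightarrow> zz_eq C S X Z (v @ v') (w @ w')"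
| zz_idn: "X \<in> Obj C \<Longrightarrow> zz_eq C S X X [Fwd (Idn C X)] []"
| zz_cmp: "f \<in> Hom C X Y \<Longrightarrow> g \<in> Hom C Y Z \<Longrightarrow> zz_eq C S X Z [Fwd f, Fwd g] [Fwd (g \<star>\<^bsub>C\<^esub> f)]"
| zz_fwd_bwd: "s \<in> S \<Longrightarrow> s \<in> Hom C X Y \<Longrightarrow> zz_eq C S X X [Fwd s, Bwd s] []"
| zz_bwd_fwd: "s \<in> S \<Longrightarrow> s \<in> Hom C X Y \<Longrightarrow> zz_eq C S Y Y [Bwd s, Fwd s] []"

definition zz_arrow :: "('o, 'm, 'x) cat_scheme \<Rightarrow> 'm set \<Rightarrow> 'o \<Rightarrow> 'o \<Rightarrow> 'm step list \<Rightarrow>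
    'o \<times> 'o \<times> 'm step list set" where
  "zz_arrow C S X Y w = (X, Y, {v. zz_eq C S X Y w v})"

definition localization :: "('o, 'm, 'x) cat_scheme \<Rightarrow> 'm set \<Rightarrow> ('o, 'o \<times> 'o \<times> 'm step list set) cat" where
  "localization C S =
     \<lparr>Obj = Obj C,
      Arr = {zz_arrow C S X Y w |X Y w. zigzag C S X Y w},
      Dom = (\<lambda>(X, Y, W). X),
      Cod = (\<lambda>(X, Y, W). Y),
      Idn = (\<lambda>X. zz_arrow C S X X []),
      Cmp = (\<lambda>(Y', Z, W') (X, Y, W). (X, Z, {u. \<exists>w \<in> W. \<exists>w' \<in> W'. zz_eq C S X Z (w @ w') u}))\<rparr>"

definition loc_ftor :: "('o, 'm, 'x) cat_scheme \<Rightarrow> 'm set \<Rightarrow>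
    ('o, 'm, 'o, 'o \<times> 'o \<times> 'm step list set) ftor" where
  "loc_ftor C S = \<lparr>FObj = (\<lambda>X. X), FArr = (\<lambda>f. zz_arrow C S (Dom C f) (Cod C f) [Fwd f])\<rparr>"

text \<open>The fraction \<open>s\<^sup>-\<^sup>1 f\<close>.\<close>

definition loc_frac :: "('o, 'm, 'x) cat_scheme \<Rightarrow> 'm set \<Rightarrow> 'm \<Rightarrow> 'm \<Rightarrow> 'o \<times> 'o \<times> 'm step list set" where
  "loc_frac C S s f = zz_arrow C S (Dom C f) (Dom C s) [Fwd f, Bwd s]"


subsection \<open>The quotient by a percolating subcategory\<close>

definition quot_arrows :: "('o, 'm, 'x) excat_scheme \<Rightarrow> 'o set \<Rightarrow> 'm set" where
  "quot_arrows C A = {s \<in> Arr C. admissible C s \<and>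
     (\<exists>k. is_kernel C k s \<and> Dom C k \<in> A) \<and> (\<exists>c. is_cokernel C c s \<and> Cod C c \<in> A)}"

definition quot_ftor :: "('o, 'm) excat \<Rightarrow> 'o set \<Rightarrow> ('o, 'm, 'o, 'o \<times> 'o \<times> 'm step list set) ftor" where
  "quot_ftor C A = loc_ftor C (quot_arrows C A)"

text \<open>The group structure on the Hom-sets of the localization is the only one that can make the
  localization functor additive: fractions are added over a common denominator.\<close>

definition exact_quot :: "('o, 'm) excat \<Rightarrow> 'o set \<Rightarrow> ('o, 'o \<times> 'o \<times> 'm step list set) excat" where
  "exact_quot C A = (let S = quot_arrows C A; L = localization C S; Q = loc_ftor C S in
     \<lparr>Obj = Obj L, Arr = Arr L, Dom = Dom L, Cod = Cod L, Idn = Idn L, Cmp = Cmp L,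
      Plus = (\<lambda>x y. THE z. \<exists>s \<in> S. \<exists>f \<in> Arr C. \<exists>g \<in> Arr C.
         Dom C f = Dom C g \<and> Cod C f = Cod C s \<and> Cod C g = Cod C s \<and>
         x = loc_frac C S s f \<and> y = loc_frac C S s g \<and> z = loc_frac C S s (f \<boxplus>\<^bsub>C\<^esub> g)),
      Zero = (\<lambda>X Y. FArr Q (Zero C X Y)),
      Conf = {(i, p). \<exists>(j, q) \<in> Conf C. isomorphic_seqs L (FArr Q j, FArr Q q) (i, p)}\<rparr>)"


section \<open>Modules over an additive category\<close>

text \<open>Contravariant functors with values in the abelian groups carried by subsets of the type
  \<^typ>\<open>'v\<close>, which plays the role of the universe of sets.\<close>

record ('o, 'm, 'v) presheaf =
  PObj :: "'o \<Rightarrow> 'v monoid"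
  PArr :: "'m \<Rightarrow> 'v \<Rightarrow> 'v"

type_synonym ('o, 'm, 'v) presheaf_map =
  "('o, 'm, 'v) presheaf \<times> ('o, 'm, 'v) presheaf \<times> ('o \<Rightarrow> 'v \<Rightarrow> 'v)"

definition is_module :: "('o, 'm, 'x) pcat_scheme \<Rightarrow> ('o, 'm, 'v) presheaf \<Rightarrow> bool" where
  "is_module C F \<longleftrightarrow>
     (\<forall>X \<in> Obj C. comm_group (PObj F X)) \<and>
     (\<forall>f \<in> Arr C. PArr F f \<in> hom (PObj F (Cod C f)) (PObj F (Dom C f))) \<and>
     (\<forall>X \<in> Obj C. \<forall>u \<in> carrier (PObj F X). PArr F (Idn C X) u = u) \<and>
     (\<forall>X Y Z. \<forall>f \<in> Hom C X Y. \<forall>g \<in> Hom C Y Z. \<forall>u \<in> carrier (PObj F Z).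
        PArr F (g \<star>\<^bsub>C\<^esub> f) u = PArr F f (PArr F g u)) \<and>
     (\<forall>X Y. \<forall>f \<in> Hom C X Y. \<forall>g \<in> Hom C X Y. \<forall>u \<in> carrier (PObj F Y).
        PArr F (f \<boxplus>\<^bsub>C\<^esub> g) u = PArr F f u \<otimes>\<^bsub>PObj F X\<^esub> PArr F g u)"

text \<open>Extensionality makes equality of natural transformations coincide with equality of their
  components.\<close>

definition is_module_map :: "('o, 'm, 'x) pcat_scheme \<Rightarrow> ('o, 'm, 'v) presheaf \<Rightarrow>
    ('o, 'm, 'v) presheaf \<Rightarrow> ('o \<Rightarrow> 'v \<Rightarrow> 'v) \<Rightarrow> bool" where
  "is_module_map C F G \<eta> \<longleftrightarrow> \<eta> \<in> extensional (Obj C) \<and>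
     (\<forall>X \<in> Obj C. \<eta> X \<in> hom (PObj F X) (PObj G X) \<inter> extensional (carrier (PObj F X))) \<and>
     (\<forall>f \<in> Arr C. \<forall>u \<in> carrier (PObj F (Cod C f)).
        \<eta> (Dom C f) (PArr F f u) = PArr G f (\<eta> (Cod C f) u))"

definition mod_cat :: "('o, 'm, 'x) pcat_scheme \<Rightarrow> (('o, 'm, 'v) presheaf, ('o, 'm, 'v) presheaf_map) pcat" where
  "mod_cat C =
     \<lparr>Obj = {F. is_module C F},
      Arr = {(F, G, \<eta>). is_module C F \<and> is_module C G \<and> is_module_map C F G \<eta>},
      Dom = (\<lambda>(F, G, \<eta>). F),
      Cod = (\<lambda>(F, G, \<eta>). G),
      Idn = (\<lambda>F. (F, F, \<lambda>X \<in> Obj C. \<lambda>u \<in> carrier (PObj F X). u)),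
      Cmp = (\<lambda>(G', H, \<theta>) (F, G, \<eta>). (F, H, \<lambda>X \<in> Obj C. \<lambda>u \<in> carrier (PObj F X). \<theta> X (\<eta> X u))),
      Plus = (\<lambda>(F', G', \<theta>) (F, G, \<eta>).
         (F, G, \<lambda>X \<in> Obj C. \<lambda>u \<in> carrier (PObj F X). \<theta> X u \<otimes>\<^bsub>PObj G X\<^esub> \<eta> X u)),
      Zero = (\<lambda>F G. (F, G, \<lambda>X \<in> Obj C. \<lambda>u \<in> carrier (PObj F X). \<one>\<^bsub>PObj G X\<^esub>))\<rparr>"

text \<open>Exactness in a category of modules, computed objectwise.\<close>

definition exact_at :: "('o, 'm, 'x) pcat_scheme \<Rightarrow> ('o, 'm, 'v) presheaf_map \<Rightarrow>
    ('o, 'm, 'v) presheaf_map \<Rightarrow> bool" where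
  "exact_at C = (\<lambda>(F, G, \<eta>) (G', H, \<theta>). G = G' \<and>
     (\<forall>X \<in> Obj C. \<eta> X ` carrier (PObj F X) = kernel (PObj G X) (PObj H X) (\<theta> X)))"

definition pointwise_inj :: "('o, 'm, 'x) pcat_scheme \<Rightarrow> ('o, 'm, 'v) presheaf_map \<Rightarrow> bool" where
  "pointwise_inj C = (\<lambda>(F, G, \<eta>). \<forall>X \<in> Obj C. inj_on (\<eta> X) (carrier (PObj F X)))"

definition pointwise_surj :: "('o, 'm, 'x) pcat_scheme \<Rightarrow> ('o, 'm, 'v) presheaf_map \<Rightarrow> bool" where
  "pointwise_surj C = (\<lambda>(F, G, \<eta>). \<forall>X \<in> Obj C. \<eta> X ` carrier (PObj F X) = carrier (PObj G X))"

definition short_exact :: "('o, 'm, 'x) pcat_scheme \<Rightarrow> ('o, 'm, 'v) presheaf_map \<Rightarrow>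
    ('o, 'm, 'v) presheaf_map \<Rightarrow> bool" where
  "short_exact C i p \<longleftrightarrow> i \<in> Arr (mod_cat C) \<and> p \<in> Arr (mod_cat C) \<and>
     pointwise_inj C i \<and> exact_at C i p \<and> pointwise_surj C p"

text \<open>The functor represented by \<^term>\<open>X\<close>, with its Hom-groups transported to \<^typ>\<open>'v\<close> along
  \<^term>\<open>e\<close>, which is meant to be injective on the arrows of \<^term>\<open>C\<close>. With such an injection
  \<^typ>\<open>'v\<close> is large enough to carry all cokernels of maps between representable functors.\<close>

definition repr :: "('o, 'm, 'x) pcat_scheme \<Rightarrow> ('m \<Rightarrow> 'v) \<Rightarrow> 'o \<Rightarrow> ('o, 'm, 'v) presheaf" where
  "repr C e X = (let d = inv_into (Arr C) e in
     \<lparr>PObj = (\<lambda>W. \<lparr>carrier = e ` Hom C W X, mult = (\<lambda>u v. e (d u \<boxplus>\<^bsub>C\<^esub> d v)), one = e (Zero C W X)\<rparr>),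
      PArr = (\<lambda>f u. e (d u \<star>\<^bsub>C\<^esub> f))\<rparr>)"

definition repr_map :: "('o, 'm, 'x) pcat_scheme \<Rightarrow> ('m \<Rightarrow> 'v) \<Rightarrow> 'm \<Rightarrow> ('o, 'm, 'v) presheaf_map" where
  "repr_map C e f = (repr C e (Dom C f), repr C e (Cod C f),
     \<lambda>W \<in> Obj C. \<lambda>u \<in> e ` Hom C W (Dom C f). e (f \<star>\<^bsub>C\<^esub> inv_into (Arr C) e u))"

definition adm_presented :: "('o, 'm, 'x) excat_scheme \<Rightarrow> ('m \<Rightarrow> 'v) \<Rightarrow> ('o, 'm, 'v) presheaf set" where
  "adm_presented C e = {F \<in> Obj (mod_cat C). \<exists>f \<in> Arr C. admissible C f \<and>
     (\<exists>\<pi> \<in> Hom (mod_cat C) (repr C e (Cod C f)) F. exact_at C (repr_map C e f) \<pi> \<and> pointwise_surj C \<pi>)}"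

definition mod_adm :: "('o, 'm, 'x) excat_scheme \<Rightarrow> ('m \<Rightarrow> 'v) \<Rightarrow>
    (('o, 'm, 'v) presheaf, ('o, 'm, 'v) presheaf_map) excat" where
  "mod_adm C e = (let M = full_sub (mod_cat C) (adm_presented C e) in
     pcat.extend M (excat.fields {(i, p). i \<in> Arr M \<and> p \<in> Arr M \<and> short_exact C i p}))"

definition eff :: "('o, 'm, 'x) excat_scheme \<Rightarrow> ('m \<Rightarrow> 'v) \<Rightarrow> ('o, 'm, 'v) presheaf set" where
  "eff C e = {F \<in> Obj (mod_adm C e). \<forall>X \<in> Obj C. \<forall>\<phi> \<in> Hom (mod_cat C) F (repr C e X).
     \<phi> = Zero (mod_cat C) F (repr C e X)}"

end

(* Extend the cokernel of the presenting arrow to modules: F = coker (X -> Y) with f : X -> Y admissible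
   is sent to coker f. This is a reflection onto the representables, and the unit F -> y (coker f)
   factors as an epimorphism with effaceable kernel followed by a monomorphism with effaceable cokernel,
   because f = m p with p a deflation and m an inflation. A horseshoe argument in E lifts short exact
   sequences of modules to presentations; it gives the extension closure, the exactness of the
   reflection, and the percolation axioms. Once the unit lies in the set of arrows inverted by the
   quotient, every zigzag between X and Y has a normal form: unit, representable arrow, inverse unit. Hence
   the localization is equivalent to E, and the exact structure of the quotient and its universal
   property are transported along this equivalence. *)

theory Submission
  imports Defs
begin

section \<open>Additive categories\<close>

text \<open>If F is the cokernel of m p, with c the cokernel of m, then the kernel, the image and
  the cokernel of the unit at F are presented by p, by m and by c. The outer two presentations are
  deflations, and an admissibly presented module is effaceable exactly when some deflation presents
  it. The obstacle is that admissibility belongs to one presentation: kernels, images and cokernels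
  of maps of modules need new admissible presentations, built from pullbacks and matrices in E.
  Modules are therefore handled through generalized elements, that is arrows out of representables,
  which the Yoneda lemma and projectivity turn into arrows of E. A second obstacle is that arrows of
  the localization are classes of zigzags. The reflection inverts the arrows in question and the
  units are among them, so the value of a zigzag in E is a complete invariant; sums and conflations
  of the quotient are checked on these values, in place of a calculus of fractions. The embedding of
  E into modules is only left exact, and an inverted arrow measures how far it is from being
  exact.\<close>

lemma hom_iff: "f \<in> Hom C X Y \<longleftrightarrow> f \<in> Arr C \<and> Dom C f = X \<and> Cod C f = Y"
  by (simp add: Hom_def)

lemma isomorphic_seqsE:
  assumes "isomorphic_seqs C (i, p) (j, q)"
  obtains a b c where "i \<in> Arr C" "p \<in> Arr C" "j \<in> Arr C" "q \<in> Arr C" "Cod C i = Dom C p" "Cod C j = Dom C q"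
    "is_iso_arr C a" "is_iso_arr C b" "is_iso_arr C c" "Dom C a = Dom C i" "Cod C a = Dom C j"
    "Dom C b = Cod C i" "Cod C b = Cod C j" "Dom C c = Cod C p" "Cod C c = Cod C q"
    "j \<star>\<^bsub>C\<^esub> a = b \<star>\<^bsub>C\<^esub> i" "q \<star>\<^bsub>C\<^esub> b = c \<star>\<^bsub>C\<^esub> p"
  using assms unfolding isomorphic_seqs_def prod.case Bex_def hom_iff by blast

definition inv_arr :: "('o, 'm, 'x) cat_scheme \<Rightarrow> 'm \<Rightarrow> 'm" where
  "inv_arr C f = (SOME g. g \<in> Hom C (Cod C f) (Dom C f) \<and>
     g \<star>\<^bsub>C\<^esub> f = Idn C (Dom C f) \<and> f \<star>\<^bsub>C\<^esub> g = Idn C (Cod C f))"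

context category
begin

lemma dom_obj [simp]: "f \<in> Arr C \<Longrightarrow> Dom C f \<in> Obj C"
  by (rule dom_in)

lemma cod_obj [simp]: "f \<in> Arr C \<Longrightarrow> Cod C f \<in> Obj C"
  by (rule cod_in)

lemma idn_arr [simp]:
  assumes "X \<in> Obj C"
  shows "Idn C X \<in> Arr C" "Dom C (Idn C X) = X" "Cod C (Idn C X) = X"
  using idn_in[OF assms] by (simp_all add: hom_iff)

lemma cmp_arr [simp]:
  assumes "f \<in> Arr C" "g \<in> Arr C" "Cod C f = Dom C g"
  shows "g \<star> f \<in> Arr C" "Dom C (g \<star> f) = Dom C f" "Cod C (g \<star> f) = Cod C g"
  using cmp_in[of f "Dom C f" "Cod C f" g "Cod C g"] assms by (simp_all add: hom_iff)

lemma idn_cmp [simp]: "f \<in> Arr C \<Longrightarrow> Cod C f = Y \<Longrightarrow> Idn C Y \<star> f = f"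
  using idn_left[of f "Dom C f" Y] by (simp add: hom_iff)

lemma cmp_idn [simp]: "f \<in> Arr C \<Longrightarrow> Dom C f = X \<Longrightarrow> f \<star> Idn C X = f"
  using idn_right[of f X "Cod C f"] by (simp add: hom_iff)

lemma assoc [simp]:
  "f \<in> Arr C \<Longrightarrow> g \<in> Arr C \<Longrightarrow> h \<in> Arr C \<Longrightarrow> Cod C f = Dom C g \<Longrightarrow> Cod C g = Dom C h \<Longrightarrow>
    (h \<star> g) \<star> f = h \<star> g \<star> f"
  using cmp_assoc[of f "Dom C f" "Cod C f" g "Cod C g" h "Cod C h"] by (simp add: hom_iff)

text \<open>Since \<open>assoc\<close> nests composites to the right, an equation
  \<open>a \<star> b = c\<close> no longer matches inside a longer composite. With a tail
  \<open>x\<close> attached it is a usable rewrite rule again.\<close>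

lemma cmp_reduce:
  "a \<star> b = c \<Longrightarrow> a \<in> Arr C \<Longrightarrow> b \<in> Arr C \<Longrightarrow> x \<in> Arr C \<Longrightarrow> Cod C b = Dom C a \<Longrightarrow> Cod C x = Dom C b \<Longrightarrow>
    a \<star> b \<star> x = c \<star> x"
  by (metis assoc)

lemma inv_arr:
  assumes "is_iso_arr C f"
  shows "f \<in> Arr C" "inv_arr C f \<in> Arr C" "Dom C (inv_arr C f) = Cod C f" "Cod C (inv_arr C f) = Dom C f"
    "inv_arr C f \<star> f = Idn C (Dom C f)" "f \<star> inv_arr C f = Idn C (Cod C f)"
proof -
  have "\<exists>g. g \<in> Hom C (Cod C f) (Dom C f) \<and> g \<star> f = Idn C (Dom C f) \<and> f \<star> g = Idn C (Cod C f)"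
    using assms unfolding is_iso_arr_def by blast
  from someI_ex[OF this, folded inv_arr_def] assms
  show "f \<in> Arr C" "inv_arr C f \<in> Arr C" "Dom C (inv_arr C f) = Cod C f" "Cod C (inv_arr C f) = Dom C f"
    "inv_arr C f \<star> f = Idn C (Dom C f)" "f \<star> inv_arr C f = Idn C (Cod C f)"
    by (simp_all add: hom_iff is_iso_arr_def)
qed

lemma inv_arr_cmp:
  assumes "is_iso_arr C f" "x \<in> Arr C"
  shows "Cod C x = Dom C f \<Longrightarrow> inv_arr C f \<star> f \<star> x = x" "Cod C x = Cod C f \<Longrightarrow> f \<star> inv_arr C f \<star> x = x"
  using inv_arr[OF assms(1)] assms(2) by (simp_all add: cmp_reduce)

lemma iso_arrI:
  "f \<in> Arr C \<Longrightarrow> g \<in> Arr C \<Longrightarrow> Dom C g = Cod C f \<Longrightarrow> Cod C g = Dom C f \<Longrightarrow>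
    g \<star> f = Idn C (Dom C f) \<Longrightarrow> f \<star> g = Idn C (Cod C f) \<Longrightarrow> is_iso_arr C f"
  unfolding is_iso_arr_def by (auto simp: hom_iff)

lemma iso_idn [simp]: "X \<in> Obj C \<Longrightarrow> is_iso_arr C (Idn C X)"
  by (rule iso_arrI[of _ "Idn C X"]) auto

lemma iso_inv: "is_iso_arr C f \<Longrightarrow> is_iso_arr C (inv_arr C f)"
  by (rule iso_arrI[of _ f]) (auto simp: inv_arr)

lemma iso_cmp:
  assumes "is_iso_arr C f" "is_iso_arr C g" "Cod C f = Dom C g"
  shows "is_iso_arr C (g \<star> f)"
  using assms inv_arr[OF assms(1)] inv_arr[OF assms(2)]
  by (intro iso_arrI[of _ "inv_arr C f \<star> inv_arr C g"]) (auto simp: inv_arr_cmp)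

lemma iso_mono:
  assumes "is_iso_arr C f" "f \<star> x = f \<star> y" "x \<in> Arr C" "y \<in> Arr C" "Cod C x = Dom C f" "Cod C y = Dom C f"
  shows "x = y"
  by (metis assms inv_arr_cmp(1))

lemma iso_epi:
  assumes "is_iso_arr C f" "x \<star> f = y \<star> f" "x \<in> Arr C" "y \<in> Arr C" "Dom C x = Cod C f" "Dom C y = Cod C f"
  shows "x = y"
proof -
  have "(x \<star> f) \<star> inv_arr C f = (y \<star> f) \<star> inv_arr C f" by (simp add: assms(2))
  then show ?thesis using assms(3-) inv_arr[OF assms(1)] by simp
qed

end

section \<open>Arithmetic of Hom-groups\<close>

definition neg :: "('o, 'm, 'x) pcat_scheme \<Rightarrow> 'm \<Rightarrow> 'm" where
  "neg C f = inv\<^bsub>hom_group C (Dom C f) (Cod C f)\<^esub> f"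

context preadditive_category
begin

lemma zero_arr [simp]:
  assumes "X \<in> Obj C" "Y \<in> Obj C"
  shows "Zero C X Y \<in> Arr C" "Dom C (Zero C X Y) = X" "Cod C (Zero C X Y) = Y"
proof -
  interpret comm_group "hom_group C X Y" by (rule hom_comm_group[OF assms])
  show "Zero C X Y \<in> Arr C" "Dom C (Zero C X Y) = X" "Cod C (Zero C X Y) = Y"
    using one_closed by (simp_all add: hom_group_def hom_iff)
qed

lemma plus_arr [simp]:
  assumes "f \<in> Arr C" "g \<in> Arr C" "Dom C f = Dom C g" "Cod C f = Cod C g"
  shows "f \<boxplus> g \<in> Arr C" "Dom C (f \<boxplus> g) = Dom C g" "Cod C (f \<boxplus> g) = Cod C g"
proof -
  interpret comm_group "hom_group C (Dom C g) (Cod C g)" using assms by (intro hom_comm_group) auto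
  show "f \<boxplus> g \<in> Arr C" "Dom C (f \<boxplus> g) = Dom C g" "Cod C (f \<boxplus> g) = Cod C g"
    using m_closed[of f g] assms by (simp_all add: hom_group_def hom_iff)
qed

lemma plus_zero [simp]:
  assumes "f \<in> Arr C" "Dom C f = X" "Cod C f = Y"
  shows "f \<boxplus> Zero C X Y = f" "Zero C X Y \<boxplus> f = f"
proof -
  interpret comm_group "hom_group C X Y" using assms by (intro hom_comm_group) auto
  show "f \<boxplus> Zero C X Y = f" "Zero C X Y \<boxplus> f = f"
    using r_one[of f] l_one[of f] assms by (simp_all add: hom_group_def hom_iff)
qed

lemma plus_comm:
  assumes "f \<in> Arr C" "g \<in> Arr C" "Dom C f = Dom C g" "Cod C f = Cod C g"
  shows "f \<boxplus> g = g \<boxplus> f"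
proof -
  interpret comm_group "hom_group C (Dom C g) (Cod C g)" using assms by (intro hom_comm_group) auto
  show ?thesis
    using m_comm[of f g] assms by (simp add: hom_group_def hom_iff)
qed

lemma plus_assoc:
  assumes "f \<in> Arr C" "g \<in> Arr C" "h \<in> Arr C" "Dom C f = Dom C g" "Cod C f = Cod C g"
    "Dom C g = Dom C h" "Cod C g = Cod C h"
  shows "(f \<boxplus> g) \<boxplus> h = f \<boxplus> (g \<boxplus> h)"
proof -
  interpret comm_group "hom_group C (Dom C h) (Cod C h)" using assms by (intro hom_comm_group) auto
  show ?thesis
    using m_assoc[of f g h] assms by (simp add: hom_group_def hom_iff)
qed

lemma plus_lcomm:
  assumes "f \<in> Arr C" "g \<in> Arr C" "h \<in> Arr C" "Dom C f = Dom C g" "Cod C f = Cod C g"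
    "Dom C g = Dom C h" "Cod C g = Cod C h"
  shows "f \<boxplus> (g \<boxplus> h) = g \<boxplus> (f \<boxplus> h)"
  using plus_assoc[of f g h] plus_assoc[of g f h] plus_comm[of f g] assms by simp

lemmas plus_ac = plus_assoc plus_comm plus_lcomm

lemma neg_arr [simp]:
  assumes "f \<in> Arr C"
  shows "neg C f \<in> Arr C" "Dom C (neg C f) = Dom C f" "Cod C (neg C f) = Cod C f"
proof -
  interpret comm_group "hom_group C (Dom C f) (Cod C f)" using assms by (intro hom_comm_group) auto
  show "neg C f \<in> Arr C" "Dom C (neg C f) = Dom C f" "Cod C (neg C f) = Cod C f"
    using inv_closed[of f] assms unfolding neg_def by (simp_all add: hom_group_def hom_iff)
qed

lemma plus_neg [simp]:
  assumes "f \<in> Arr C"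
  shows "f \<boxplus> neg C f = Zero C (Dom C f) (Cod C f)" "neg C f \<boxplus> f = Zero C (Dom C f) (Cod C f)"
proof -
  interpret comm_group "hom_group C (Dom C f) (Cod C f)" using assms by (intro hom_comm_group) auto
  show "f \<boxplus> neg C f = Zero C (Dom C f) (Cod C f)" "neg C f \<boxplus> f = Zero C (Dom C f) (Cod C f)"
    using r_inv[of f] l_inv[of f] assms unfolding neg_def by (simp_all add: hom_group_def hom_iff)
qed

lemma plus_cancel:
  assumes "f \<boxplus> g = f \<boxplus> h" "f \<in> Arr C" "g \<in> Arr C" "h \<in> Arr C" "Dom C f = Dom C g" "Cod C f = Cod C g"
    "Dom C g = Dom C h" "Cod C g = Cod C h"
  shows "g = h"
proof -
  have "neg C f \<boxplus> (f \<boxplus> g) = neg C f \<boxplus> (f \<boxplus> h)" by (simp add: assms)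
  then show ?thesis using assms(2-) by (simp add: plus_assoc[symmetric])
qed

lemma plus_cancel_neg [simp]:
  assumes "f \<in> Arr C" "g \<in> Arr C" "Dom C f = Dom C g" "Cod C f = Cod C g"
  shows "f \<boxplus> (neg C f \<boxplus> g) = g" "neg C f \<boxplus> (f \<boxplus> g) = g"
  using assms by (simp_all add: plus_assoc[symmetric])

lemma plus_neg_cancel [simp]:
  assumes "f \<in> Arr C" "g \<in> Arr C" "Dom C f = Dom C g" "Cod C f = Cod C g"
  shows "f \<boxplus> (g \<boxplus> neg C f) = g" "neg C f \<boxplus> (g \<boxplus> f) = g"
  using assms by (simp_all add: plus_lcomm[of f g "neg C f"] plus_lcomm[of "neg C f" g f])

lemma cmp_plus_l [simp]:
  "f \<in> Arr C \<Longrightarrow> g \<in> Arr C \<Longrightarrow> h \<in> Arr C \<Longrightarrow> Cod C f = Dom C g \<Longrightarrow> Dom C g = Dom C h \<Longrightarrow> Cod C g = Cod C h \<Longrightarrow>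
    (g \<boxplus> h) \<star> f = (g \<star> f) \<boxplus> (h \<star> f)"
  using cmp_plus_left[of f "Dom C f" "Cod C f" g "Cod C g" h] by (simp add: hom_iff)

lemma cmp_plus_r [simp]:
  "f \<in> Arr C \<Longrightarrow> g \<in> Arr C \<Longrightarrow> h \<in> Arr C \<Longrightarrow> Cod C g = Dom C h \<Longrightarrow> Dom C f = Dom C g \<Longrightarrow> Cod C f = Cod C g \<Longrightarrow>
    h \<star> (f \<boxplus> g) = (h \<star> f) \<boxplus> (h \<star> g)"
  using cmp_plus_right[of f "Dom C f" "Cod C f" g h "Cod C h"] by (simp add: hom_iff)

text \<open>Serves to derive preservation of zero from preservation of sums: an additive map sends a
  zero arrow to an arrow equal to its own double.\<close>

lemma plus_eq_self:
  assumes "f \<boxplus> f = f" "f \<in> Arr C"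
  shows "f = Zero C (Dom C f) (Cod C f)"
  using plus_cancel[of f f "Zero C (Dom C f) (Cod C f)"] assms by simp

lemma zero_cmp [simp]:
  assumes "f \<in> Arr C" "Cod C f = X" "Y \<in> Obj C"
  shows "Zero C X Y \<star> f = Zero C (Dom C f) Y"
proof -
  have X: "X \<in> Obj C" using assms by auto
  have "(Zero C X Y \<boxplus> Zero C X Y) \<star> f = Zero C X Y \<star> f" using X assms by (simp del: cmp_plus_l)
  then have "(Zero C X Y \<star> f) \<boxplus> (Zero C X Y \<star> f) = Zero C X Y \<star> f" using assms X by (simp del: plus_zero)
  from plus_eq_self[OF this] show ?thesis using assms X by simp
qed

lemma cmp_zero [simp]:
  assumes "f \<in> Arr C" "Dom C f = X" "W \<in> Obj C"
  shows "f \<star> Zero C W X = Zero C W (Cod C f)"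
proof -
  have X: "X \<in> Obj C" using assms by auto
  have "f \<star> (Zero C W X \<boxplus> Zero C W X) = f \<star> Zero C W X" using X assms by (simp del: cmp_plus_r)
  then have "(f \<star> Zero C W X) \<boxplus> (f \<star> Zero C W X) = f \<star> Zero C W X" using assms X by (simp del: plus_zero)
  from plus_eq_self[OF this] show ?thesis using assms X by simp
qed

lemma neg_unique:
  assumes "f \<boxplus> g = Zero C (Dom C f) (Cod C f)" "f \<in> Arr C" "g \<in> Arr C" "Dom C f = Dom C g" "Cod C f = Cod C g"
  shows "g = neg C f"
  by (rule plus_cancel[of f]) (use assms in simp_all)

lemma neg_cmp [simp]:
  assumes "f \<in> Arr C" "g \<in> Arr C" "Cod C f = Dom C g"
  shows "neg C g \<star> f = neg C (g \<star> f)" "g \<star> neg C f = neg C (g \<star> f)"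
proof -
  have "g \<star> f \<boxplus> neg C g \<star> f = (g \<boxplus> neg C g) \<star> f" using assms by (simp del: plus_neg)
  then show "neg C g \<star> f = neg C (g \<star> f)" using assms by (intro neg_unique) simp_all
  have "g \<star> f \<boxplus> g \<star> neg C f = g \<star> (f \<boxplus> neg C f)" using assms by (simp del: plus_neg)
  then show "g \<star> neg C f = neg C (g \<star> f)" using assms by (intro neg_unique) simp_all
qed

lemma eq_if_diff_zero:
  assumes "f \<boxplus> neg C g = Zero C (Dom C f) (Cod C f)" "f \<in> Arr C" "g \<in> Arr C" "Dom C f = Dom C g" "Cod C f = Cod C g"
  shows "f = g"
proof -
  have "g \<boxplus> (f \<boxplus> neg C g) = g" using assms by simp
  then show ?thesis using assms(2-) by (simp add: plus_lcomm)
qed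

lemma neg_neg [simp]: "f \<in> Arr C \<Longrightarrow> neg C (neg C f) = f"
  by (rule neg_unique[symmetric]) auto

lemma neg_zero [simp]: "X \<in> Obj C \<Longrightarrow> Y \<in> Obj C \<Longrightarrow> neg C (Zero C X Y) = Zero C X Y"
  by (rule neg_unique[symmetric]) auto

section \<open>Kernels, cokernels and zero objects\<close>

lemma kernelD:
  assumes "is_kernel C k f"
  shows "k \<in> Arr C" "f \<in> Arr C" "Cod C k = Dom C f" "f \<star> k = Zero C (Dom C k) (Cod C f)"
  using assms unfolding is_kernel_def by blast+

lemma kernel_fac:
  assumes "is_kernel C k f" "h \<in> Arr C" "Cod C h = Dom C f" "f \<star> h = Zero C (Dom C h) (Cod C f)"
  obtains u where "u \<in> Arr C" "Dom C u = Dom C h" "Cod C u = Dom C k" "k \<star> u = h"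
  using assms unfolding is_kernel_def by (metis hom_iff)

lemma kernel_mono:
  assumes "is_kernel C k f" "k \<star> x = k \<star> y" "x \<in> Arr C" "y \<in> Arr C" "Dom C x = Dom C y"
    "Cod C x = Dom C k" "Cod C y = Dom C k"
  shows "x = y"
proof -
  note k = kernelD[OF assms(1)]
  have "\<exists>!u. u \<in> Hom C (Dom C (k \<star> x)) (Dom C k) \<and> k \<star> u = k \<star> x"
    using assms(1) k assms(2-) unfolding is_kernel_def
    by (elim conjE allE ballE[where x = "k \<star> x"] impE) (auto simp: k(4)[THEN cmp_reduce])
  then show ?thesis using assms k by (auto simp: hom_iff)
qed

lemma kernelI:
  assumes "k \<in> Arr C" "f \<in> Arr C" "Cod C k = Dom C f" "f \<star> k = Zero C (Dom C k) (Cod C f)"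
    and "\<And>h. h \<in> Arr C \<Longrightarrow> Cod C h = Dom C f \<Longrightarrow> f \<star> h = Zero C (Dom C h) (Cod C f) \<Longrightarrow>
      \<exists>u \<in> Arr C. Dom C u = Dom C h \<and> Cod C u = Dom C k \<and> k \<star> u = h"
    and "\<And>x y. x \<in> Arr C \<Longrightarrow> y \<in> Arr C \<Longrightarrow> Dom C x = Dom C y \<Longrightarrow> Cod C x = Dom C k \<Longrightarrow> Cod C y = Dom C k \<Longrightarrow>
      k \<star> x = k \<star> y \<Longrightarrow> x = y"
  shows "is_kernel C k f"
  unfolding is_kernel_def
proof (intro conjI ballI impI)
  fix h assume h: "h \<in> Arr C" "Cod C h = Dom C f" "f \<star> h = Zero C (Dom C h) (Cod C f)"
  from assms(5)[OF this] obtain u where "u \<in> Arr C" "Dom C u = Dom C h" "Cod C u = Dom C k" "k \<star> u = h" by blast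
  then show "\<exists>!u. u \<in> Hom C (Dom C h) (Dom C k) \<and> k \<star> u = h"
    using assms(6) by (auto simp: hom_iff intro!: ex1I[of _ u])
qed (use assms in auto)

lemma cokernelD:
  assumes "is_cokernel C c f"
  shows "c \<in> Arr C" "f \<in> Arr C" "Dom C c = Cod C f" "c \<star> f = Zero C (Dom C f) (Cod C c)"
  using assms unfolding is_cokernel_def by blast+

lemma cokernel_fac:
  assumes "is_cokernel C c f" "h \<in> Arr C" "Dom C h = Cod C f" "h \<star> f = Zero C (Dom C f) (Cod C h)"
  obtains u where "u \<in> Arr C" "Dom C u = Cod C c" "Cod C u = Cod C h" "u \<star> c = h"
  using assms unfolding is_cokernel_def by (metis hom_iff)

lemma cokernel_epi:
  assumes "is_cokernel C c f" "x \<star> c = y \<star> c" "x \<in> Arr C" "y \<in> Arr C" "Cod C x = Cod C y"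
    "Dom C x = Cod C c" "Dom C y = Cod C c"
  shows "x = y"
proof -
  note k = cokernelD[OF assms(1)]
  have "\<exists>!u. u \<in> Hom C (Cod C c) (Cod C (x \<star> c)) \<and> u \<star> c = x \<star> c"
    using assms(1) k assms(3-) unfolding is_cokernel_def
    by (elim conjE allE ballE[where x = "x \<star> c"] impE) auto
  then show ?thesis using assms k by (auto simp: hom_iff)
qed

lemma cokernelI:
  assumes "c \<in> Arr C" "f \<in> Arr C" "Dom C c = Cod C f" "c \<star> f = Zero C (Dom C f) (Cod C c)"
    and "\<And>h. h \<in> Arr C \<Longrightarrow> Dom C h = Cod C f \<Longrightarrow> h \<star> f = Zero C (Dom C f) (Cod C h) \<Longrightarrow>
      \<exists>u \<in> Arr C. Dom C u = Cod C c \<and> Cod C u = Cod C h \<and> u \<star> c = h"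
    and "\<And>x y. x \<in> Arr C \<Longrightarrow> y \<in> Arr C \<Longrightarrow> Cod C x = Cod C y \<Longrightarrow> Dom C x = Cod C c \<Longrightarrow> Dom C y = Cod C c \<Longrightarrow>
      x \<star> c = y \<star> c \<Longrightarrow> x = y"
  shows "is_cokernel C c f"
  unfolding is_cokernel_def
proof (intro conjI ballI impI)
  fix h assume h: "h \<in> Arr C" "Dom C h = Cod C f" "h \<star> f = Zero C (Dom C f) (Cod C h)"
  from assms(5)[OF this] obtain u where "u \<in> Arr C" "Dom C u = Cod C c" "Cod C u = Cod C h" "u \<star> c = h" by blast
  then show "\<exists>!u. u \<in> Hom C (Cod C c) (Cod C h) \<and> u \<star> c = h"
    using assms(6) by (auto simp: hom_iff intro!: ex1I[of _ u])
qed (use assms in auto)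

lemma zero_objI:
  assumes "Z \<in> Obj C" "Idn C Z = Zero C Z Z"
  shows "is_zero_obj C Z"
  unfolding is_zero_obj_def
proof (intro conjI ballI assms(1) ex1I)
  fix X f assume X: "X \<in> Obj C"
  show "Zero C X Z \<in> Hom C X Z" "Zero C Z X \<in> Hom C Z X" using X assms by (auto simp: hom_iff)
  { assume f: "f \<in> Hom C X Z"
    then have "f = Idn C Z \<star> f" by (simp add: hom_iff)
    then show "f = Zero C X Z" using f assms by (auto simp: hom_iff) }
  { assume f: "f \<in> Hom C Z X"
    then have "f = f \<star> Idn C Z" by (simp add: hom_iff)
    then show "f = Zero C Z X" using f assms by (auto simp: hom_iff) }
qed

lemma zero_objD:
  assumes "is_zero_obj C Z"
  shows "Z \<in> Obj C" "f \<in> Arr C \<Longrightarrow> Cod C f = Z \<Longrightarrow> f = Zero C (Dom C f) Z"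
    "f \<in> Arr C \<Longrightarrow> Dom C f = Z \<Longrightarrow> f = Zero C Z (Cod C f)" "Idn C Z = Zero C Z Z"
proof -
  show Z: "Z \<in> Obj C" using assms by (simp add: is_zero_obj_def)
  have *: "X \<in> Obj C \<Longrightarrow> f \<in> Hom C X Z \<Longrightarrow> g \<in> Hom C X Z \<Longrightarrow> f = g" for X f g
    using assms unfolding is_zero_obj_def by blast
  have **: "X \<in> Obj C \<Longrightarrow> f \<in> Hom C Z X \<Longrightarrow> g \<in> Hom C Z X \<Longrightarrow> f = g" for X f g
    using assms unfolding is_zero_obj_def by blast
  show "f = Zero C (Dom C f) Z" if "f \<in> Arr C" "Cod C f = Z"
    by (rule *[of "Dom C f"]) (use that Z in \<open>simp_all add: hom_iff\<close>)
  show "f = Zero C Z (Cod C f)" if "f \<in> Arr C" "Dom C f = Z"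
    by (rule **[of "Cod C f"]) (use that Z in \<open>simp_all add: hom_iff\<close>)
  show "Idn C Z = Zero C Z Z"
    by (rule *[of Z]) (use Z in \<open>simp_all add: hom_iff\<close>)
qed

lemma iso_zero_obj:
  assumes "is_zero_obj C X" "is_iso_arr C f" "Dom C f = X \<and> Cod C f = Y \<or> Dom C f = Y \<and> Cod C f = X"
  shows "is_zero_obj C Y"
proof -
  have *: "is_zero_obj C (Cod C g)" if "is_iso_arr C g" "is_zero_obj C (Dom C g)" for g
  proof (rule zero_objI)
    note g = inv_arr[OF that(1)]
    have "Idn C (Cod C g) = g \<star> Idn C (Dom C g) \<star> inv_arr C g" using g by simp
    also have "\<dots> = Zero C (Cod C g) (Cod C g)" unfolding zero_objD(4)[OF that(2)] using g by simp
    finally show "Idn C (Cod C g) = Zero C (Cod C g) (Cod C g)" .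
  qed (simp add: inv_arr that)
  show ?thesis using *[of f] *[of "inv_arr C f"] assms inv_arr[OF assms(2)] iso_inv[OF assms(2)] by auto
qed

section \<open>Biproducts and shears\<close>

definition biprod where
  "biprod X Y S i j p q \<longleftrightarrow> X \<in> Obj C \<and> Y \<in> Obj C \<and> S \<in> Obj C \<and> i \<in> Arr C \<and> j \<in> Arr C \<and> p \<in> Arr C \<and> q \<in> Arr C \<and>
     Dom C i = X \<and> Cod C i = S \<and> Dom C j = Y \<and> Cod C j = S \<and> Dom C p = S \<and> Cod C p = X \<and> Dom C q = S \<and> Cod C q = Y \<and>
     p \<star> i = Idn C X \<and> q \<star> j = Idn C Y \<and> p \<star> j = Zero C Y X \<and> q \<star> i = Zero C X Y \<and>
     (i \<star> p) \<boxplus> (j \<star> q) = Idn C S"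

lemma biprodD:
  assumes "biprod X Y S i j p q"
  shows "X \<in> Obj C" "Y \<in> Obj C" "S \<in> Obj C" "i \<in> Arr C" "j \<in> Arr C" "p \<in> Arr C" "q \<in> Arr C"
     "Dom C i = X" "Cod C i = S" "Dom C j = Y" "Cod C j = S" "Dom C p = S" "Cod C p = X" "Dom C q = S" "Cod C q = Y"
     "p \<star> i = Idn C X" "q \<star> j = Idn C Y" "p \<star> j = Zero C Y X" "q \<star> i = Zero C X Y"
     "(i \<star> p) \<boxplus> (j \<star> q) = Idn C S"
  using assms unfolding biprod_def by blast+

lemma biprod_cmp:
  assumes b: "biprod X Y S i j p q" and x: "x \<in> Arr C"
  shows "Cod C x = X \<Longrightarrow> p \<star> i \<star> x = x" "Cod C x = X \<Longrightarrow> q \<star> i \<star> x = Zero C (Dom C x) Y"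
     "Cod C x = Y \<Longrightarrow> q \<star> j \<star> x = x" "Cod C x = Y \<Longrightarrow> p \<star> j \<star> x = Zero C (Dom C x) X"
     "Cod C x = S \<Longrightarrow> i \<star> p \<star> x \<boxplus> j \<star> q \<star> x = x"
proof -
  note b = biprodD[OF b]
  show "Cod C x = X \<Longrightarrow> p \<star> i \<star> x = x" "Cod C x = X \<Longrightarrow> q \<star> i \<star> x = Zero C (Dom C x) Y"
     "Cod C x = Y \<Longrightarrow> q \<star> j \<star> x = x" "Cod C x = Y \<Longrightarrow> p \<star> j \<star> x = Zero C (Dom C x) X"
    using b x by (simp_all add: b(16-19)[THEN cmp_reduce])
  assume "Cod C x = S"
  then have "(i \<star> p \<boxplus> j \<star> q) \<star> x = x" using b x by (simp del: cmp_plus_l)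
  then show "i \<star> p \<star> x \<boxplus> j \<star> q \<star> x = x" using b(1-19) \<open>Cod C x = S\<close> x by simp
qed

lemma biprod_eq_into:
  assumes b: "biprod X Y S i j p q" and "x \<in> Arr C" "y \<in> Arr C" "Cod C x = S" "Cod C y = S" "p \<star> x = p \<star> y" "q \<star> x = q \<star> y"
  shows "x = y"
  by (metis assms biprod_cmp(5))

lemma biprod_out:
  assumes b: "biprod X Y S i j p q" and x: "x \<in> Arr C" "Dom C x = S"
  shows "x \<star> i \<star> p \<boxplus> x \<star> j \<star> q = x"
proof -
  note b = biprodD[OF b]
  have "x \<star> (i \<star> p \<boxplus> j \<star> q) = x" using b x by (simp del: cmp_plus_r)
  then show "x \<star> i \<star> p \<boxplus> x \<star> j \<star> q = x" using b(1-19) x by simp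
qed

lemma biprod_eq_from:
  assumes b: "biprod X Y S i j p q" and "x \<in> Arr C" "y \<in> Arr C" "Dom C x = S" "Dom C y = S" "x \<star> i = y \<star> i" "x \<star> j = y \<star> j"
  shows "x = y"
proof -
  have "x \<star> i \<star> p = y \<star> i \<star> p" "x \<star> j \<star> q = y \<star> j \<star> q"
    using assms(2-) biprodD[OF b] by (metis assoc)+
  then show ?thesis using biprod_out[OF b] assms by metis
qed

lemma biprod_swap:
  assumes "biprod X Y S i j p q"
  shows "biprod Y X S j i q p"
  using biprodD[OF assms] by (simp add: biprod_def plus_comm)

text \<open>A change of basis of \<open>S\<close> by the unipotent automorphism with entry
  \<open>t\<close>. The graph of \<open>t\<close> replaces the second inclusion, so graphs become
  split inclusions.\<close>

lemma biprod_shear_in: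
  assumes b: "biprod X Y S i j p q" and t: "t \<in> Arr C" "Dom C t = Y" "Cod C t = X"
  shows "biprod X Y S i (i \<star> t \<boxplus> j) (p \<boxplus> neg C (t \<star> q)) q"
proof -
  note bD = biprodD[OF b] and bc = biprod_cmp[OF b]
  have "i \<star> (p \<boxplus> neg C (t \<star> q)) \<boxplus> (i \<star> t \<boxplus> j) \<star> q =
    (i \<star> p \<boxplus> j \<star> q) \<boxplus> (i \<star> t \<star> q \<boxplus> neg C (i \<star> t \<star> q))"
    using bD(1-19) t by (simp add: plus_ac)
  then show ?thesis using bD t by (simp add: biprod_def bc)
qed

text \<open>The dual change of basis: the row with entries \<open>t\<close> and the identity becomes
  a projection of a biproduct.\<close>

lemma biprod_shear_out:
  assumes b: "biprod X Y S i j p q" and t: "t \<in> Arr C" "Dom C t = X" "Cod C t = Y"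
  shows "biprod X Y S (i \<boxplus> neg C (j \<star> t)) j p (q \<boxplus> t \<star> p)"
proof -
  note bD = biprodD[OF b] and bc = biprod_cmp[OF b]
  have "(i \<boxplus> neg C (j \<star> t)) \<star> p \<boxplus> j \<star> (q \<boxplus> t \<star> p) =
    (i \<star> p \<boxplus> j \<star> q) \<boxplus> (j \<star> t \<star> p \<boxplus> neg C (j \<star> t \<star> p))"
    using bD(1-19) t by (simp add: plus_ac)
  then show ?thesis using bD t by (simp add: biprod_def bc)
qed

end

lemma (in additive_category) biprodE:
  assumes "X \<in> Obj C" "Y \<in> Obj C"
  obtains S i j p q where "biprod X Y S i j p q"
proof -
  obtain S i j p q where "S \<in> Obj C" "i \<in> Hom C X S" "j \<in> Hom C Y S" "p \<in> Hom C S X" "q \<in> Hom C S Y"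
    "p \<star> i = Idn C X \<and> q \<star> j = Idn C Y \<and> p \<star> j = Zero C Y X \<and> q \<star> i = Zero C X Y \<and> (i \<star> p) \<boxplus> (j \<star> q) = Idn C S"
    using ex_biproduct[OF assms] by (elim bexE)
  with assms have "biprod X Y S i j p q" by (simp add: biprod_def hom_iff)
  then show thesis by (rule that)
qed

section \<open>Pullbacks, pushouts and exact categories\<close>

context category
begin

lemma pullbackD:
  assumes "is_pullback C f g f' g'"
  shows "f \<in> Arr C" "g \<in> Arr C" "f' \<in> Arr C" "g' \<in> Arr C" "Cod C f = Cod C g" "Cod C f' = Dom C g"
    "Cod C g' = Dom C f" "Dom C f' = Dom C g'" "g \<star> f' = f \<star> g'"
  using assms unfolding is_pullback_def by blast+

lemma pullback_fac:
  assumes "is_pullback C f g f' g'" "a \<in> Arr C" "b \<in> Arr C" "Cod C a = Dom C g" "Cod C b = Dom C f"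
    "Dom C a = Dom C b" "g \<star> a = f \<star> b"
  obtains u where "u \<in> Arr C" "Dom C u = Dom C a" "Cod C u = Dom C f'" "f' \<star> u = a" "g' \<star> u = b"
  using assms unfolding is_pullback_def hom_iff by blast

lemma pullback_eq:
  assumes pb: "is_pullback C f g f' g'" and x: "x \<in> Arr C" "y \<in> Arr C" "Dom C x = Dom C y" "Cod C x = Dom C f'"
    "Cod C y = Dom C f'" "f' \<star> x = f' \<star> y" "g' \<star> x = g' \<star> y"
  shows "x = y"
proof -
  note pD = pullbackD[OF pb]
  have e: "g \<star> f' \<star> x = f \<star> g' \<star> x"
    using pD x(1-5) by (metis assoc)
  have *: "\<exists>!u. u \<in> Hom C (Dom C a) (Dom C f') \<and> f' \<star> u = a \<and> g' \<star> u = b"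
    if "a \<in> Arr C" "b \<in> Arr C" "Cod C a = Dom C g" "Cod C b = Dom C f" "Dom C a = Dom C b" "g \<star> a = f \<star> b" for a b
    using pb that unfolding is_pullback_def by blast
  have "\<exists>!u. u \<in> Hom C (Dom C (f' \<star> x)) (Dom C f') \<and> f' \<star> u = f' \<star> x \<and> g' \<star> u = g' \<star> x"
    by (intro *) (use e pD(1-8) x(1-5) in simp_all)
  then show ?thesis using x pD(3,4,6,7,8) by (elim ex1E) (auto simp: hom_iff)
qed

lemma pullbackI:
  assumes "f \<in> Arr C" "g \<in> Arr C" "f' \<in> Arr C" "g' \<in> Arr C" "Cod C f = Cod C g" "Cod C f' = Dom C g"
    "Cod C g' = Dom C f" "Dom C f' = Dom C g'" "g \<star> f' = f \<star> g'"
    and "\<And>a b. a \<in> Arr C \<Longrightarrow> b \<in> Arr C \<Longrightarrow> Cod C a = Dom C g \<Longrightarrow> Cod C b = Dom C f \<Longrightarrow>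
      Dom C a = Dom C b \<Longrightarrow> g \<star> a = f \<star> b \<Longrightarrow>
      \<exists>u \<in> Arr C. Dom C u = Dom C a \<and> Cod C u = Dom C f' \<and> f' \<star> u = a \<and> g' \<star> u = b"
    and "\<And>x y. x \<in> Arr C \<Longrightarrow> y \<in> Arr C \<Longrightarrow> Dom C x = Dom C y \<Longrightarrow> Cod C x = Dom C f' \<Longrightarrow> Cod C y = Dom C f' \<Longrightarrow>
      f' \<star> x = f' \<star> y \<Longrightarrow> g' \<star> x = g' \<star> y \<Longrightarrow> x = y"
  shows "is_pullback C f g f' g'"
  unfolding is_pullback_def
proof (intro conjI ballI impI)
  fix a b assume "a \<in> Arr C" "b \<in> Arr C" "Cod C a = Dom C g" "Cod C b = Dom C f"
      "Dom C a = Dom C b" "g \<star> a = f \<star> b"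
  from assms(10)[OF this] obtain u where "u \<in> Arr C" "Dom C u = Dom C a" "Cod C u = Dom C f'" "f' \<star> u = a" "g' \<star> u = b" by blast
  then show "\<exists>!u. u \<in> Hom C (Dom C a) (Dom C f') \<and> f' \<star> u = a \<and> g' \<star> u = b"
    using assms(11) by (auto simp: hom_iff intro!: ex1I[of _ u])
qed (use assms(1-9) in auto)

lemma pushoutD:
  assumes "is_pushout C f g f' g'"
  shows "f \<in> Arr C" "g \<in> Arr C" "f' \<in> Arr C" "g' \<in> Arr C" "Dom C f = Dom C g" "Dom C f' = Cod C g"
    "Dom C g' = Cod C f" "Cod C f' = Cod C g'" "f' \<star> g = g' \<star> f"
  using assms unfolding is_pushout_def by blast+

lemma pushout_fac:
  assumes "is_pushout C f g f' g'" "a \<in> Arr C" "b \<in> Arr C" "Dom C a = Cod C g" "Dom C b = Cod C f"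
    "Cod C a = Cod C b" "a \<star> g = b \<star> f"
  obtains u where "u \<in> Arr C" "Dom C u = Cod C f'" "Cod C u = Cod C a" "u \<star> f' = a" "u \<star> g' = b"
  using assms unfolding is_pushout_def hom_iff by blast

lemma pushout_eq:
  assumes po: "is_pushout C f g f' g'" and x: "x \<in> Arr C" "y \<in> Arr C" "Cod C x = Cod C y" "Dom C x = Cod C f'"
    "Dom C y = Cod C f'" "x \<star> f' = y \<star> f'" "x \<star> g' = y \<star> g'"
  shows "x = y"
proof -
  note pD = pushoutD[OF po]
  have e: "(x \<star> f') \<star> g = (x \<star> g') \<star> f"
    using pD x(1-5) by (metis assoc)
  have *: "\<exists>!u. u \<in> Hom C (Cod C f') (Cod C a) \<and> u \<star> f' = a \<and> u \<star> g' = b"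
    if "a \<in> Arr C" "b \<in> Arr C" "Dom C a = Cod C g" "Dom C b = Cod C f" "Cod C a = Cod C b" "a \<star> g = b \<star> f" for a b
    using po that unfolding is_pushout_def by blast
  have "\<exists>!u. u \<in> Hom C (Cod C f') (Cod C (x \<star> f')) \<and> u \<star> f' = x \<star> f' \<and> u \<star> g' = x \<star> g'"
    by (intro *) (use e pD(1-8) x(1-5) in simp_all)
  then show ?thesis using x pD(3,4,6,7,8) by (elim ex1E) (auto simp: hom_iff)
qed

lemma pushoutI:
  assumes "f \<in> Arr C" "g \<in> Arr C" "f' \<in> Arr C" "g' \<in> Arr C" "Dom C f = Dom C g" "Dom C f' = Cod C g"
    "Dom C g' = Cod C f" "Cod C f' = Cod C g'" "f' \<star> g = g' \<star> f"
    and "\<And>a b. a \<in> Arr C \<Longrightarrow> b \<in> Arr C \<Longrightarrow> Dom C a = Cod C g \<Longrightarrow> Dom C b = Cod C f \<Longrightarrow>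
      Cod C a = Cod C b \<Longrightarrow> a \<star> g = b \<star> f \<Longrightarrow>
      \<exists>u \<in> Arr C. Dom C u = Cod C f' \<and> Cod C u = Cod C a \<and> u \<star> f' = a \<and> u \<star> g' = b"
    and "\<And>x y. x \<in> Arr C \<Longrightarrow> y \<in> Arr C \<Longrightarrow> Cod C x = Cod C y \<Longrightarrow> Dom C x = Cod C f' \<Longrightarrow> Dom C y = Cod C f' \<Longrightarrow>
      x \<star> f' = y \<star> f' \<Longrightarrow> x \<star> g' = y \<star> g' \<Longrightarrow> x = y"
  shows "is_pushout C f g f' g'"
  unfolding is_pushout_def
proof (intro conjI ballI impI)
  fix a b assume "a \<in> Arr C" "b \<in> Arr C" "Dom C a = Cod C g" "Dom C b = Cod C f"
      "Cod C a = Cod C b" "a \<star> g = b \<star> f"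
  from assms(10)[OF this] obtain u where "u \<in> Arr C" "Dom C u = Cod C f'" "Cod C u = Cod C a" "u \<star> f' = a" "u \<star> g' = b" by blast
  then show "\<exists>!u. u \<in> Hom C (Cod C f') (Cod C a) \<and> u \<star> f' = a \<and> u \<star> g' = b"
    using assms(11) by (auto simp: hom_iff intro!: ex1I[of _ u])
qed (use assms(1-9) in auto)

lemma pullback_iso:
  assumes "is_pullback C f g f1 g1" "is_pullback C f g f2 g2"
  obtains u where "is_iso_arr C u" "Dom C u = Dom C f1" "Cod C u = Dom C f2" "f2 \<star> u = f1" "g2 \<star> u = g1"
proof -
  note p1 = pullbackD[OF assms(1)] and p2 = pullbackD[OF assms(2)]
  obtain u where u: "u \<in> Arr C" "Dom C u = Dom C f1" "Cod C u = Dom C f2" "f2 \<star> u = f1" "g2 \<star> u = g1"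
    by (rule pullback_fac[OF assms(2) p1(3,4)]) (use p1 in auto)
  obtain v where v: "v \<in> Arr C" "Dom C v = Dom C f2" "Cod C v = Dom C f1" "f1 \<star> v = f2" "g1 \<star> v = g2"
    by (rule pullback_fac[OF assms(1) p2(3,4)]) (use p2 in auto)
  have uD: "u \<in> Arr C" "Dom C u = Dom C g1" "Cod C u = Dom C g2" using u p1 p2 by auto
  have vD: "v \<in> Arr C" "Dom C v = Dom C g2" "Cod C v = Dom C g1" using v p1 p2 by auto
  have "v \<star> u = Idn C (Dom C g1)"
    by (rule pullback_eq[OF assms(1)])
      (use uD vD u(4,5) v(4,5) p1 p2 in \<open>simp_all add: v(4,5)[THEN cmp_reduce]\<close>)
  moreover have "u \<star> v = Idn C (Dom C g2)"
    by (rule pullback_eq[OF assms(2)])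
      (use uD vD u(4,5) v(4,5) p1 p2 in \<open>simp_all add: u(4,5)[THEN cmp_reduce]\<close>)
  ultimately have "is_iso_arr C u"
    by (intro iso_arrI[of _ v]) (use uD vD in auto)
  with u that show thesis by blast
qed

lemma pushout_iso:
  assumes "is_pushout C f g f1 g1" "is_pushout C f g f2 g2"
  obtains u where "is_iso_arr C u" "Dom C u = Cod C f1" "Cod C u = Cod C f2" "u \<star> f1 = f2" "u \<star> g1 = g2"
proof -
  note p1 = pushoutD[OF assms(1)] and p2 = pushoutD[OF assms(2)]
  obtain u where u: "u \<in> Arr C" "Dom C u = Cod C f1" "Cod C u = Cod C f2" "u \<star> f1 = f2" "u \<star> g1 = g2"
    by (rule pushout_fac[OF assms(1) p2(3,4)]) (use p2 in auto)
  obtain v where v: "v \<in> Arr C" "Dom C v = Cod C f2" "Cod C v = Cod C f1" "v \<star> f2 = f1" "v \<star> g2 = g1"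
    by (rule pushout_fac[OF assms(2) p1(3,4)]) (use p1 in auto)
  have uD: "u \<in> Arr C" "Dom C u = Cod C g1" "Cod C u = Cod C g2" using u p1 p2 by auto
  have vD: "v \<in> Arr C" "Dom C v = Cod C g2" "Cod C v = Cod C g1" using v p1 p2 by auto
  have "v \<star> u = Idn C (Cod C g1)"
    by (rule pushout_eq[OF assms(1)]) (use uD vD u(4,5) v(4,5) p1 p2 in simp_all)
  moreover have "u \<star> v = Idn C (Cod C g2)"
    by (rule pushout_eq[OF assms(2)]) (use uD vD u(4,5) v(4,5) p1 p2 in simp_all)
  ultimately have "is_iso_arr C u"
    by (intro iso_arrI[of _ v]) (use uD vD in auto)
  with u that show thesis by blast
qed

end

context preadditive_category
begin

lemma kernel_iso:
  assumes "is_kernel C k f" "is_kernel C l f"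
  obtains u where "is_iso_arr C u" "Dom C u = Dom C k" "Cod C u = Dom C l" "l \<star> u = k"
proof -
  note k = kernelD[OF assms(1)] and l = kernelD[OF assms(2)]
  obtain u where u: "u \<in> Arr C" "Dom C u = Dom C k" "Cod C u = Dom C l" "l \<star> u = k"
    by (rule kernel_fac[OF assms(2) k(1,3,4)])
  obtain v where v: "v \<in> Arr C" "Dom C v = Dom C l" "Cod C v = Dom C k" "k \<star> v = l"
    by (rule kernel_fac[OF assms(1) l(1,3,4)])
  have "v \<star> u = Idn C (Dom C k)"
    by (rule kernel_mono[OF assms(1)]) (use u v k l in \<open>simp_all add: v(4)[THEN cmp_reduce]\<close>)
  moreover have "u \<star> v = Idn C (Dom C l)"
    by (rule kernel_mono[OF assms(2)]) (use u v k l in \<open>simp_all add: u(4)[THEN cmp_reduce]\<close>)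
  ultimately have "is_iso_arr C u"
    by (intro iso_arrI[of _ v]) (use u v in auto)
  with u that show thesis by blast
qed

lemma cokernel_iso:
  assumes "is_cokernel C c f" "is_cokernel C d f"
  obtains u where "is_iso_arr C u" "Dom C u = Cod C c" "Cod C u = Cod C d" "u \<star> c = d"
proof -
  note c = cokernelD[OF assms(1)] and d = cokernelD[OF assms(2)]
  obtain u where u: "u \<in> Arr C" "Dom C u = Cod C c" "Cod C u = Cod C d" "u \<star> c = d"
    by (rule cokernel_fac[OF assms(1) d(1,3,4)])
  obtain v where v: "v \<in> Arr C" "Dom C v = Cod C d" "Cod C v = Cod C c" "v \<star> d = c"
    by (rule cokernel_fac[OF assms(2) c(1,3,4)])
  have "v \<star> u = Idn C (Cod C c)"
    by (rule cokernel_epi[OF assms(1)]) (use u v c d in simp_all)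
  moreover have "u \<star> v = Idn C (Cod C d)"
    by (rule cokernel_epi[OF assms(2)]) (use u v c d in simp_all)
  ultimately have "is_iso_arr C u"
    by (intro iso_arrI[of _ v]) (use u v in auto)
  with u that show thesis by blast
qed

text \<open>The new cokernel is induced on the pushout by the zero arrow and \<open>c\<close>.
  Pushing out thus keeps the cokernel object, which is how the cokernels in \<open>horseshoe\<close>
  are identified.\<close>

lemma pushout_cokernel:
  assumes po: "is_pushout C i f i' f'" and c: "is_cokernel C c i"
  obtains c' where "is_cokernel C c' i'" "Cod C c' = Cod C c" "c' \<star> f' = c"
proof -
  note p = pushoutD[OF po] and cD = cokernelD[OF c]
  obtain c' where c': "c' \<in> Arr C" "Dom C c' = Cod C i'" "Cod C c' = Cod C (Zero C (Cod C f) (Cod C c))"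
      "c' \<star> i' = Zero C (Cod C f) (Cod C c)" "c' \<star> f' = c"
    by (rule pushout_fac[OF po, of "Zero C (Cod C f) (Cod C c)" c]) (use p cD in auto)
  then have c'3: "Cod C c' = Cod C c" using p cD by simp
  have "is_cokernel C c' i'"
  proof (rule cokernelI)
    fix h assume h: "h \<in> Arr C" "Dom C h = Cod C i'" "h \<star> i' = Zero C (Dom C i') (Cod C h)"
    have "(h \<star> f') \<star> i = (h \<star> i') \<star> f" using h(1,2) p by simp
    then have z: "(h \<star> f') \<star> i = Zero C (Dom C i) (Cod C (h \<star> f'))" unfolding h(3) using h(1,2) p by simp
    obtain u where u: "u \<in> Arr C" "Dom C u = Cod C c" "Cod C u = Cod C (h \<star> f')" "u \<star> c = h \<star> f'"
      by (rule cokernel_fac[OF c _ _ z]) (use h p in auto)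
    have "u \<star> c' = h"
      by (rule pushout_eq[OF po]) (use u h p c' c'3 in auto)
    with u c'3 h p show "\<exists>u\<in>Arr C. Dom C u = Cod C c' \<and> Cod C u = Cod C h \<and> u \<star> c' = h" by auto
  next
    fix x y assume xy: "x \<in> Arr C" "y \<in> Arr C" "Cod C x = Cod C y" "Dom C x = Cod C c'" "Dom C y = Cod C c'"
      "x \<star> c' = y \<star> c'"
    have "(x \<star> c') \<star> f' = (y \<star> c') \<star> f'" by (simp add: xy(6))
    then have "x \<star> c = y \<star> c" using xy(1-5) c' p by simp
    then show "x = y" by (rule cokernel_epi[OF c]) (use xy c'3 in auto)
  qed (use c' c'3 p in auto)
  with c' c'3 that show thesis by blast
qed

end

section \<open>Invariance of conflations under isomorphism\<close>

context exact_category
begin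

lemma confD:
  assumes "(i, p) \<in> Conf C"
  shows "i \<in> Arr C" "p \<in> Arr C" "Cod C i = Dom C p" "p \<star> i = Zero C (Dom C i) (Cod C p)"
  using kernelD[OF conf_kernel[OF assms]] by auto

lemma conf_transfer:
  assumes "(i, p) \<in> Conf C" "is_iso_arr C a" "is_iso_arr C b" "is_iso_arr C c" "j \<in> Arr C" "q \<in> Arr C"
    "Cod C j = Dom C q" "Dom C a = Dom C i" "Cod C a = Dom C j" "Dom C b = Cod C i" "Cod C b = Cod C j"
    "Dom C c = Cod C p" "Cod C c = Cod C q" "j \<star> a = b \<star> i" "q \<star> b = c \<star> p"
  shows "(j, q) \<in> Conf C"
proof (rule conf_iso_closed[OF assms(1)])
  show "isomorphic_seqs C (i, p) (j, q)"
    unfolding isomorphic_seqs_def prod.case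
  proof (intro conjI bexI)
    show "is_iso_arr C a" "is_iso_arr C b" "is_iso_arr C c" "j \<star> a = b \<star> i" "q \<star> b = c \<star> p" by fact+
  qed (use confD[OF assms(1)] assms(2-) in \<open>auto simp: hom_iff inv_arr(1)\<close>)
qed

lemma deflation_pre_iso:
  assumes "deflation C p" "is_iso_arr C u" "Cod C u = Dom C p"
  shows "deflation C (p \<star> u)"
proof -
  obtain i where i: "(i, p) \<in> Conf C" using assms(1) by (auto simp: deflation_def)
  note iD = confD[OF i] and uD = inv_arr[OF assms(2)]
  have "(inv_arr C u \<star> i, p \<star> u) \<in> Conf C"
    by (rule conf_transfer[OF i, of "Idn C (Dom C i)" "inv_arr C u" "Idn C (Cod C p)"])
      (use iD uD assms in \<open>auto simp: iso_inv\<close>)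
  then show ?thesis by (auto simp: deflation_def)
qed

lemma deflation_post_iso:
  assumes "deflation C p" "is_iso_arr C u" "Dom C u = Cod C p"
  shows "deflation C (u \<star> p)"
proof -
  obtain i where i: "(i, p) \<in> Conf C" using assms(1) by (auto simp: deflation_def)
  note iD = confD[OF i] and uD = inv_arr[OF assms(2)]
  have "(i, u \<star> p) \<in> Conf C"
    by (rule conf_transfer[OF i, of "Idn C (Dom C i)" "Idn C (Cod C i)" u])
      (use iD uD assms in auto)
  then show ?thesis by (auto simp: deflation_def)
qed

lemma inflation_pre_iso:
  assumes "inflation C i" "is_iso_arr C u" "Cod C u = Dom C i"
  shows "inflation C (i \<star> u)"
proof -
  obtain p where i: "(i, p) \<in> Conf C" using assms(1) by (auto simp: inflation_def)
  note iD = confD[OF i] and uD = inv_arr[OF assms(2)]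
  have "(i \<star> u, p) \<in> Conf C"
    by (rule conf_transfer[OF i, of "inv_arr C u" "Idn C (Cod C i)" "Idn C (Cod C p)"])
      (use iD uD assms in \<open>auto simp: iso_inv\<close>)
  then show ?thesis by (auto simp: inflation_def)
qed

lemma inflation_post_iso:
  assumes "inflation C i" "is_iso_arr C u" "Dom C u = Cod C i"
  shows "inflation C (u \<star> i)"
proof -
  obtain p where i: "(i, p) \<in> Conf C" using assms(1) by (auto simp: inflation_def)
  note iD = confD[OF i] and uD = inv_arr[OF assms(2)]
  have "(u \<star> i, p \<star> inv_arr C u) \<in> Conf C"
    by (rule conf_transfer[OF i, of "Idn C (Dom C i)" u "Idn C (Cod C p)"])
      (use iD uD assms in auto)
  then show ?thesis by (auto simp: inflation_def)
qed

lemma deflation_arr: "deflation C p \<Longrightarrow> p \<in> Arr C"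
  by (auto simp: deflation_def dest: confD)

lemma inflation_arr: "inflation C p \<Longrightarrow> p \<in> Arr C"
  by (auto simp: inflation_def dest: confD)

lemma deflation_conf:
  assumes "deflation C p" "is_kernel C k p"
  shows "(k, p) \<in> Conf C"
proof -
  obtain i where i: "(i, p) \<in> Conf C" using assms(1) by (auto simp: deflation_def)
  obtain u where u: "is_iso_arr C u" "Dom C u = Dom C i" "Cod C u = Dom C k" "k \<star> u = i"
    by (rule kernel_iso[OF conf_kernel[OF i] assms(2)])
  show ?thesis
    by (rule conf_transfer[OF i, of u "Idn C (Cod C i)" "Idn C (Cod C p)"])
      (use u confD[OF i] kernelD[OF assms(2)] in auto)
qed

lemma inflation_conf:
  assumes "inflation C i" "is_cokernel C c i"
  shows "(i, c) \<in> Conf C"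
proof -
  obtain p where p: "(i, p) \<in> Conf C" using assms(1) by (auto simp: inflation_def)
  obtain u where u: "is_iso_arr C u" "Dom C u = Cod C p" "Cod C u = Cod C c" "u \<star> p = c"
    by (rule cokernel_iso[OF conf_cokernel[OF p] assms(2)])
  show ?thesis
    by (rule conf_transfer[OF p, of "Idn C (Dom C i)" "Idn C (Cod C i)" u])
      (use u confD[OF p] cokernelD[OF assms(2)] in auto)
qed

text \<open>The axiom \<open>deflation_pullback\<close> supplies one pullback square with this
  property; any other one differs from it by an isomorphism.\<close>

lemma deflation_pb:
  assumes "is_pullback C p f p' f'" "deflation C p"
  shows "deflation C p'"
proof -
  note pD = pullbackD[OF assms(1)]
  obtain p'' f'' where *: "is_pullback C p f p'' f''" "deflation C p''"
    using deflation_pullback[OF assms(2) pD(2)] pD by auto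
  obtain u where "is_iso_arr C u" "Dom C u = Dom C p'" "Cod C u = Dom C p''" "p'' \<star> u = p'"
    by (rule pullback_iso[OF assms(1) *(1)])
  with deflation_pre_iso[OF *(2)] show ?thesis by auto
qed

lemma inflation_po:
  assumes "is_pushout C i f i' f'" "inflation C i"
  shows "inflation C i'"
proof -
  note pD = pushoutD[OF assms(1)]
  obtain i'' f'' where *: "is_pushout C i f i'' f''" "inflation C i''"
    using inflation_pushout[OF assms(2) pD(2)] pD by auto
  obtain u where "is_iso_arr C u" "Dom C u = Cod C i''" "Cod C u = Cod C i'" "u \<star> i'' = i'"
    by (rule pushout_iso[OF *(1) assms(1)])
  with inflation_post_iso[OF *(2)] show ?thesis by auto
qed

text \<open>The identity of \<open>Dom C t\<close> is an inflation whose cokernel is both zero and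
  epic, hence has zero target. The arrow \<open>t\<close> is this cokernel followed by an
  isomorphism of zero objects.\<close>

lemma zero_deflation:
  assumes t: "t \<in> Arr C" and z: "is_zero_obj C (Cod C t)"
  shows "deflation C t"
proof -
  obtain p where p: "(Idn C (Dom C t), p) \<in> Conf C"
    using inflation_idn[of "Dom C t"] t by (auto simp: inflation_def)
  note pD = confD[OF p]
  have pz: "p = Zero C (Dom C t) (Cod C p)" using pD t by simp
  have "Idn C (Cod C p) \<star> p = Zero C (Cod C p) (Cod C p) \<star> p" using pD t pz by simp
  then have "Idn C (Cod C p) = Zero C (Cod C p) (Cod C p)"
    by (rule cokernel_epi[OF conf_cokernel[OF p]]) (use pD in auto)
  then have zp: "is_zero_obj C (Cod C p)" by (intro zero_objI) (use pD in auto)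
  let ?u = "Zero C (Cod C p) (Cod C t)"
  have u: "is_iso_arr C ?u"
    by (rule iso_arrI[of _ "Zero C (Cod C t) (Cod C p)"]) (use pD t zero_objD(4)[OF zp] zero_objD(4)[OF z] in auto)
  have "?u \<star> p = t"
    using zero_objD(2)[OF z t] pD t by simp
  then show ?thesis using deflation_post_iso[OF _ u, of p] p pD t by (auto simp: deflation_def)
qed

lemma zero_inflation:
  assumes t: "t \<in> Arr C" and z: "is_zero_obj C (Dom C t)"
  shows "inflation C t"
proof -
  obtain i where i: "(i, Idn C (Cod C t)) \<in> Conf C"
    using deflation_idn[of "Cod C t"] t by (auto simp: deflation_def)
  note iD = confD[OF i]
  have iz: "i = Zero C (Dom C i) (Cod C t)" using iD t by simp
  have "i \<star> Idn C (Dom C i) = i \<star> Zero C (Dom C i) (Dom C i)" using iD t iz by simp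
  then have "Idn C (Dom C i) = Zero C (Dom C i) (Dom C i)"
    by (rule kernel_mono[OF conf_kernel[OF i]]) (use iD in auto)
  then have zp: "is_zero_obj C (Dom C i)" by (intro zero_objI) (use iD in auto)
  let ?u = "Zero C (Dom C t) (Dom C i)"
  have u: "is_iso_arr C ?u"
    by (rule iso_arrI[of _ "Zero C (Dom C i) (Dom C t)"]) (use iD t zero_objD(4)[OF zp] zero_objD(4)[OF z] in auto)
  have "i \<star> ?u = t"
    using zero_objD(3)[OF z t] iD t by simp
  then show ?thesis using inflation_pre_iso[OF _ u, of i] i iD t by (auto simp: inflation_def)
qed

section \<open>Split sequences and matrices over biproducts\<close>

lemma biprod_kernel:
  assumes b: "biprod X Y S i j p q"
  shows "is_kernel C i q"
proof (rule kernelI)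
  note bD = biprodD[OF b] biprod_cmp[OF b]
  fix h assume h: "h \<in> Arr C" "Cod C h = Dom C q" "q \<star> h = Zero C (Dom C h) (Cod C q)"
  have "i \<star> p \<star> h = h" using biprod_cmp(5)[OF b h(1)] h bD(1-19) by simp
  with h bD show "\<exists>u\<in>Arr C. Dom C u = Dom C h \<and> Cod C u = Dom C i \<and> i \<star> u = h"
    by (intro bexI[of _ "p \<star> h"]) auto
next
  note bD = biprodD[OF b] biprod_cmp[OF b]
  fix x y assume xy: "x \<in> Arr C" "y \<in> Arr C" "Dom C x = Dom C y" "Cod C x = Dom C i" "Cod C y = Dom C i" and e: "i \<star> x = i \<star> y"
  from e have "p \<star> i \<star> x = p \<star> i \<star> y" by simp
  then show "x = y" using xy bD by simp
qed (use biprodD[OF b] in auto)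

text \<open>The projection \<open>q\<close> is the pullback of the deflation
  \<open>X \<rightarrow> 0\<close> along \<open>Y \<rightarrow> 0\<close>.\<close>

lemma biprod_conf:
  assumes b: "biprod X Y S i j p q"
  shows "(i, q) \<in> Conf C"
proof -
  note bD = biprodD[OF b] biprod_cmp[OF b]
  obtain Z where z: "is_zero_obj C Z" using ex_zero_obj by blast
  note zD = zero_objD[OF z]
  have "is_pullback C (Zero C X Z) (Zero C Y Z) q p"
  proof (rule pullbackI)
    fix a c assume "a \<in> Arr C" "c \<in> Arr C" "Cod C a = Dom C (Zero C Y Z)" "Cod C c = Dom C (Zero C X Z)" "Dom C a = Dom C c"
    with bD zD(1) show "\<exists>u\<in>Arr C. Dom C u = Dom C a \<and> Cod C u = Dom C q \<and> q \<star> u = a \<and> p \<star> u = c"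
      by (intro bexI[of _ "i \<star> c \<boxplus> j \<star> a"]) auto
  next
    fix x y assume "x \<in> Arr C" "y \<in> Arr C" "Dom C x = Dom C y" "Cod C x = Dom C q" "Cod C y = Dom C q"
      "q \<star> x = q \<star> y" "p \<star> x = p \<star> y"
    then show "x = y" using biprod_eq_into[OF b] bD(14) by simp
  qed (use bD zD in auto)
  then have "deflation C q"
    by (rule deflation_pb) (use zero_deflation[of "Zero C X Z"] bD z zD in auto)
  then show ?thesis by (rule deflation_conf[OF _ biprod_kernel[OF b]])
qed

text \<open>The direct sum of \<open>d\<close> and an identity is the pullback of \<open>d\<close>
  along the projection \<open>p'\<close>.\<close>

lemma biprod_deflation_sum:
  assumes b: "biprod X B S i j p q" and b': "biprod I B S' i' j' p' q'"
    and d: "deflation C d" "Dom C d = X" "Cod C d = I"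
  shows "deflation C (i' \<star> d \<star> p \<boxplus> j' \<star> q)"
proof -
  note bD = biprodD[OF b] biprod_cmp[OF b] biprodD[OF b'] biprod_cmp[OF b'] deflation_arr[OF d(1)] d(2,3)
  have "is_pullback C d p' (i' \<star> d \<star> p \<boxplus> j' \<star> q) p"
  proof (rule pullbackI)
    fix a c assume ac: "a \<in> Arr C" "c \<in> Arr C" "Cod C a = Dom C p'" "Cod C c = Dom C d" "Dom C a = Dom C c" "p' \<star> a = d \<star> c"
    have e: "i' \<star> d \<star> c \<boxplus> j' \<star> q' \<star> a = a" using biprod_cmp(5)[OF b', of a] ac bD(21-40) by simp
    with bD ac show "\<exists>u\<in>Arr C. Dom C u = Dom C a \<and> Cod C u = Dom C (i' \<star> d \<star> p \<boxplus> j' \<star> q) \<and> (i' \<star> d \<star> p \<boxplus> j' \<star> q) \<star> u = a \<and> p \<star> u = c"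
      by (intro bexI[of _ "i \<star> c \<boxplus> j \<star> q' \<star> a"]) auto
  next
    fix x y assume xy: "x \<in> Arr C" "y \<in> Arr C" "Dom C x = Dom C y" "Cod C x = Dom C (i' \<star> d \<star> p \<boxplus> j' \<star> q)" "Cod C y = Dom C (i' \<star> d \<star> p \<boxplus> j' \<star> q)"
      "(i' \<star> d \<star> p \<boxplus> j' \<star> q) \<star> x = (i' \<star> d \<star> p \<boxplus> j' \<star> q) \<star> y" "p \<star> x = p \<star> y"
    have "q' \<star> (i' \<star> d \<star> p \<boxplus> j' \<star> q) \<star> x = q' \<star> (i' \<star> d \<star> p \<boxplus> j' \<star> q) \<star> y" using xy(6) by simp
    then have "q \<star> x = q \<star> y" using xy(1-5) bD by simp
    then show "x = y" by (intro biprod_eq_into[OF b xy(1,2) _ _ xy(7)]) (use xy(4,5) bD in auto)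
  qed (use bD in auto)
  then show ?thesis by (rule deflation_pb[OF _ d(1)])
qed

text \<open>The dual square is a statement of its own, because \<open>horseshoe\<close> also reads
  the cokernel of the matrix off it.\<close>

lemma biprod_pushout:
  assumes b: "biprod X B S i j p q" and b': "biprod I B S' i' j' p' q'"
    and d: "d \<in> Arr C" "Dom C d = X" "Cod C d = I"
  shows "is_pushout C d i (i' \<star> d \<star> p \<boxplus> j' \<star> q) i'"
proof (rule pushoutI)
  note bD = biprodD[OF b] biprod_cmp[OF b] biprodD[OF b'] biprod_cmp[OF b'] d
  fix a c assume ac: "a \<in> Arr C" "c \<in> Arr C" "Dom C a = Cod C i" "Dom C c = Cod C d" "Cod C a = Cod C c" "a \<star> i = c \<star> d"
  have "a \<star> i \<star> p = (a \<star> i) \<star> p" using ac(1-5) bD by simp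
  then have "a \<star> i \<star> p = c \<star> d \<star> p" unfolding ac(6) using ac(1-5) bD by simp
  then have e: "c \<star> d \<star> p \<boxplus> a \<star> j \<star> q = a" using biprod_out[OF b, of a] ac bD(1-15) by simp
  with bD ac show "\<exists>u\<in>Arr C. Dom C u = Cod C (i' \<star> d \<star> p \<boxplus> j' \<star> q) \<and> Cod C u = Cod C a \<and> u \<star> (i' \<star> d \<star> p \<boxplus> j' \<star> q) = a \<and> u \<star> i' = c"
    by (intro bexI[of _ "c \<star> p' \<boxplus> a \<star> j \<star> q'"]) auto
next
  note bD = biprodD[OF b] biprod_cmp[OF b] biprodD[OF b'] biprod_cmp[OF b'] d
  fix x y assume xy: "x \<in> Arr C" "y \<in> Arr C" "Cod C x = Cod C y" "Dom C x = Cod C (i' \<star> d \<star> p \<boxplus> j' \<star> q)" "Dom C y = Cod C (i' \<star> d \<star> p \<boxplus> j' \<star> q)"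
    "x \<star> (i' \<star> d \<star> p \<boxplus> j' \<star> q) = y \<star> (i' \<star> d \<star> p \<boxplus> j' \<star> q)" "x \<star> i' = y \<star> i'"
  have "(x \<star> (i' \<star> d \<star> p \<boxplus> j' \<star> q)) \<star> j = (y \<star> (i' \<star> d \<star> p \<boxplus> j' \<star> q)) \<star> j" using xy(6) by simp
  then have "x \<star> j' = y \<star> j'" using xy(1-5) bD by simp
  then show "x = y" by (intro biprod_eq_from[OF b' xy(1,2) _ _ xy(7)]) (use xy(4,5) bD in auto)
qed (use biprodD[OF b] biprod_cmp[OF b] biprodD[OF b'] biprod_cmp[OF b'] d in auto)

lemma biprod_inflation_sum:
  assumes "biprod X B S i j p q" "biprod I B S' i' j' p' q'" "inflation C d" "Dom C d = X" "Cod C d = I"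
  shows "inflation C (i' \<star> d \<star> p \<boxplus> j' \<star> q)"
  by (rule inflation_po[OF biprod_pushout]) (use assms inflation_arr in auto)

text \<open>The column with entries \<open>t\<close> and \<open>k\<close> is the graph of
  \<open>t\<close>, an inflation by shearing, followed by the direct sum of the identity and
  \<open>k\<close>.\<close>

lemma inflation_into_biprod:
  assumes b: "biprod I X S i j p q" and k: "inflation C k" "Cod C k = X"
    and t: "t \<in> Arr C" "Dom C t = Dom C k" "Cod C t = I"
  shows "inflation C (i \<star> t \<boxplus> j \<star> k)"
proof -
  note kA = inflation_arr[OF k(1)]
  obtain S0 i0 j0 p0 q0 where b0: "biprod I (Dom C k) S0 i0 j0 p0 q0"
    by (rule biprodE[of I "Dom C k"]) (use kA t in auto)
  note bD = biprodD[OF b] biprod_cmp[OF b] biprodD[OF b0] biprod_cmp[OF b0] kA k(2) t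
  have 1: "inflation C (i0 \<star> t \<boxplus> j0)"
    using biprod_conf[OF biprod_swap[OF biprod_shear_in[OF b0 t]]] by (auto simp: inflation_def)
  have 2: "inflation C (j \<star> k \<star> q0 \<boxplus> i \<star> p0)"
    by (rule biprod_inflation_sum[OF biprod_swap[OF b0] biprod_swap[OF b]]) (use k in auto)
  have "(j \<star> k \<star> q0 \<boxplus> i \<star> p0) \<star> (i0 \<star> t \<boxplus> j0) = i \<star> t \<boxplus> j \<star> k"
    using bD by (simp add: plus_comm)
  then show ?thesis using inflation_cmp[OF 1 2] bD by simp
qed

text \<open>The row with entries \<open>t\<close> and \<open>g\<close> is the direct sum of the
  identity and \<open>g\<close>, followed by a sheared projection.\<close>

lemma deflation_from_biprod:
  assumes b: "biprod Y X S i j p q" and g: "deflation C g" "Dom C g = X"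
    and t: "t \<in> Arr C" "Dom C t = Y" "Cod C t = Cod C g"
  shows "deflation C (t \<star> p \<boxplus> g \<star> q)"
proof -
  note gA = deflation_arr[OF g(1)]
  obtain S0 i0 j0 p0 q0 where b0: "biprod Y (Cod C g) S0 i0 j0 p0 q0"
    by (rule biprodE[of Y "Cod C g"]) (use gA t in auto)
  note bD = biprodD[OF b] biprod_cmp[OF b] biprodD[OF b0] biprod_cmp[OF b0] gA g(2) t
  have 1: "deflation C (q0 \<boxplus> t \<star> p0)"
    using biprod_conf[OF biprod_shear_out[OF b0 t]] by (auto simp: deflation_def)
  have 2: "deflation C (j0 \<star> g \<star> q \<boxplus> i0 \<star> p)"
    by (rule biprod_deflation_sum[OF biprod_swap[OF b] biprod_swap[OF b0]]) (use g in auto)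
  have "(q0 \<boxplus> t \<star> p0) \<star> (j0 \<star> g \<star> q \<boxplus> i0 \<star> p) = t \<star> p \<boxplus> g \<star> q"
    using bD by (simp add: plus_comm)
  then show ?thesis using deflation_cmp[OF 2 1] bD by simp
qed

section \<open>Admissible arrows\<close>

lemma admissibleI: "deflation C p \<Longrightarrow> inflation C m \<Longrightarrow> Cod C p = Dom C m \<Longrightarrow> admissible C (m \<star> p)"
  unfolding admissible_def is_image_def by auto

lemma admissibleE:
  assumes "admissible C f"
  obtains p m where "deflation C p" "inflation C m" "Cod C p = Dom C m" "f = m \<star> p"
  using assms unfolding admissible_def is_image_def by metis

lemma deflation_admissible: "deflation C p \<Longrightarrow> admissible C p"
  using admissibleI[of p "Idn C (Cod C p)"] inflation_idn deflation_arr by simp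

lemma inflation_admissible: "inflation C p \<Longrightarrow> admissible C p"
  using admissibleI[of "Idn C (Dom C p)" p] deflation_idn inflation_arr by simp

lemma inflationE:
  assumes "inflation C i" obtains p where "(i, p) \<in> Conf C"
  using assms by (auto simp: inflation_def)

lemma deflationE:
  assumes "deflation C p" obtains i where "(i, p) \<in> Conf C"
  using assms by (auto simp: deflation_def)

lemma deflation_epi:
  assumes "deflation C p" "x \<star> p = y \<star> p" "x \<in> Arr C" "y \<in> Arr C" "Cod C x = Cod C y" "Dom C x = Cod C p" "Dom C y = Cod C p"
  shows "x = y"
  using assms(1) cokernel_epi[OF conf_cokernel assms(2-)] by (auto simp: deflation_def)

lemma inflation_mono:
  assumes "inflation C i" "i \<star> x = i \<star> y" "x \<in> Arr C" "y \<in> Arr C" "Dom C x = Dom C y" "Cod C x = Dom C i" "Cod C y = Dom C i"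
  shows "x = y"
  using assms(1) kernel_mono[OF conf_kernel assms(2-)] by (auto simp: inflation_def)

lemma kernel_post_inflation:
  assumes k: "is_kernel C k p" and m: "inflation C m" "Dom C m = Cod C p"
  shows "is_kernel C k (m \<star> p)"
proof (rule kernelI)
  note kD = kernelD[OF k] and mA = inflation_arr[OF m(1)]
  fix h assume h: "h \<in> Arr C" "Cod C h = Dom C (m \<star> p)" "(m \<star> p) \<star> h = Zero C (Dom C h) (Cod C (m \<star> p))"
  have "m \<star> p \<star> h = m \<star> Zero C (Dom C h) (Cod C p)" using h kD(1-3) mA m by simp
  then have "p \<star> h = Zero C (Dom C h) (Cod C p)" by (rule inflation_mono[OF m(1)]) (use h kD(1-3) mA m in auto)
  then obtain u where "u \<in> Arr C" "Dom C u = Dom C h" "Cod C u = Dom C k" "k \<star> u = h"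
    using kernel_fac[OF k h(1)] h kD mA m by auto
  then show "\<exists>u\<in>Arr C. Dom C u = Dom C h \<and> Cod C u = Dom C k \<and> k \<star> u = h" by blast
qed (use kernelD[OF k] inflation_arr[OF m(1)] m in \<open>auto intro: kernel_mono[OF k]\<close>)

lemma cokernel_pre_deflation:
  assumes c: "is_cokernel C c m" and p: "deflation C p" "Cod C p = Dom C m"
  shows "is_cokernel C c (m \<star> p)"
proof (rule cokernelI)
  note cD = cokernelD[OF c] and pA = deflation_arr[OF p(1)]
  fix h assume h: "h \<in> Arr C" "Dom C h = Cod C (m \<star> p)" "h \<star> (m \<star> p) = Zero C (Dom C (m \<star> p)) (Cod C h)"
  have "(h \<star> m) \<star> p = Zero C (Dom C m) (Cod C h) \<star> p" using h cD(1-3) pA p by simp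
  then have "h \<star> m = Zero C (Dom C m) (Cod C h)" by (rule deflation_epi[OF p(1)]) (use h cD(1-3) pA p in auto)
  then obtain u where "u \<in> Arr C" "Dom C u = Cod C c" "Cod C u = Cod C h" "u \<star> c = h"
    using cokernel_fac[OF c h(1)] h cD pA p by auto
  then show "\<exists>u\<in>Arr C. Dom C u = Cod C c \<and> Cod C u = Cod C h \<and> u \<star> c = h" by blast
next
  note cD = cokernelD[OF c] and pA = deflation_arr[OF p(1)]
  show "c \<star> m \<star> p = Zero C (Dom C (m \<star> p)) (Cod C c)"
    using cD pA p cD(4)[THEN cmp_reduce, of p] by simp
qed (use cokernelD[OF c] deflation_arr[OF p(1)] p in \<open>auto intro: cokernel_epi[OF c]\<close>)

text \<open>\<^term>\<open>a\<close> is the off-diagonal entry of the matrix \<^term>\<open>f\<close>; it sends the kernel \<^term>\<open>k2\<close> into the image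
  of \<open>m1 p1\<close>, with corestriction \<^term>\<open>b\<close>, and this is what makes \<^term>\<open>f\<close> admissible.\<close>

lemma horseshoe:
  assumes p1: "deflation C p1" and m1: "(m1, c1) \<in> Conf C" and pm1: "Cod C p1 = Dom C m1"
    and p2: "(k2, p2) \<in> Conf C" and m2: "(m2, c2) \<in> Conf C" and pm2: "Cod C p2 = Dom C m2"
    and a: "a \<in> Arr C" "Dom C a = Dom C p2" "Cod C a = Cod C m1"
    and b: "b \<in> Arr C" "Dom C b = Dom C k2" "Cod C b = Dom C m1" "m1 \<star> b = a \<star> k2"
    and bX: "biprod (Dom C p1) (Dom C p2) SX i j p q" and bY: "biprod (Cod C m1) (Cod C m2) SY i' j' p' q'"
    and f: "f = i' \<star> m1 \<star> p1 \<star> p \<boxplus> (i' \<star> a \<star> q \<boxplus> j' \<star> m2 \<star> p2 \<star> q)"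
  obtains c \<alpha> \<beta> where "admissible C f" "is_cokernel C c f" "(\<alpha>, \<beta>) \<in> Conf C" "Dom C \<alpha> = Cod C c1" "Cod C \<alpha> = Cod C c"
    "Cod C \<beta> = Cod C c2" "\<alpha> \<star> c1 = c \<star> i'" "\<beta> \<star> c = c2 \<star> q'"
proof -
  have im: "inflation C m1" "inflation C m2" and dp2: "deflation C p2"
    using m1 m2 p2 by (auto simp: inflation_def deflation_def)
  note A = deflation_arr[OF p1] confD[OF m1] confD[OF m2] confD[OF p2] a b pm1 pm2
  obtain S1 u1 v1 r1 s1 where b1: "biprod (Dom C m1) (Dom C p2) S1 u1 v1 r1 s1"
    by (rule biprodE[of "Dom C m1" "Dom C p2"]) (use A in auto)
  obtain S2 u2 v2 r2 s2 where b2: "biprod (Cod C m1) (Dom C m2) S2 u2 v2 r2 s2"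
    by (rule biprodE[of "Cod C m1" "Dom C m2"]) (use A in auto)
  note D1 = biprodD[OF b1] biprod_cmp(1-4)[OF b1]
  note D2 = biprodD[OF b2] biprod_cmp(1-4)[OF b2]
  note DX = biprodD[OF bX] biprod_cmp(1-4)[OF bX]
  note DY = biprodD[OF bY] biprod_cmp(1-4)[OF bY]
  \<comment> \<open>In matrix form \<open>f\<close> is \<open>M N P\<close>, where \<open>P\<close>
    is \<open>p1\<close> plus the identity, \<open>M\<close> is the identity plus \<open>m2\<close>,
    and \<open>N\<close> is triangular with diagonal \<open>m1\<close>, \<open>p2\<close> and corner
    \<open>a\<close>. What remains is to factor \<open>N\<close>.\<close>
  define P where "P = u1 \<star> p1 \<star> p \<boxplus> v1 \<star> q"
  define M where "M = j' \<star> m2 \<star> s2 \<boxplus> i' \<star> r2"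
  define N where "N = u2 \<star> m1 \<star> r1 \<boxplus> (u2 \<star> a \<star> s1 \<boxplus> v2 \<star> p2 \<star> s1)"
  have P: "deflation C P" unfolding P_def
    by (rule biprod_deflation_sum[OF bX b1 p1]) (use A in auto)
  have M: "inflation C M" unfolding M_def
    by (rule biprod_inflation_sum[OF biprod_swap[OF b2] biprod_swap[OF bY] im(2)]) (use A in auto)
  have Pt: "P \<in> Arr C" "Dom C P = SX" "Cod C P = S1"
    unfolding P_def using A D1 DX by auto
  have Mt: "M \<in> Arr C" "Dom C M = S2" "Cod C M = SY"
    unfolding M_def using A D2 DY by auto
  have Nt: "N \<in> Arr C" "Dom C N = S1" "Cod C N = S2"
    unfolding N_def using A D1 D2 by auto
  have Mu: "M \<star> u2 = i'" "M \<star> v2 = j' \<star> m2" unfolding M_def using A D2 DY by auto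
  have Nu: "N \<star> u1 = u2 \<star> m1" "N \<star> v1 = u2 \<star> a \<boxplus> v2 \<star> p2" unfolding N_def using A D1 D2 by auto
  have fMNP: "f = M \<star> N \<star> P"
  proof (rule biprod_eq_from[OF bX])
    have "P \<star> i = u1 \<star> p1" "P \<star> j = v1" unfolding P_def using A D1 DX by auto
    with A D1 D2 DX DY Pt Mt Nt Nu Mu show "f \<star> i = (M \<star> N \<star> P) \<star> i" "f \<star> j = (M \<star> N \<star> P) \<star> j"
      unfolding f by (simp_all add: Nu[THEN cmp_reduce] Mu[THEN cmp_reduce])
  qed (use A D1 D2 DX DY Pt Mt Nt in \<open>auto simp: f\<close>)
  \<comment> \<open>The kernel of \<open>N\<close> is sought as the column with entries
    \<open>-b\<close> and \<open>k2\<close>: the first row of \<open>N\<close> gives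
    \<open>a k2 - m1 b = 0\<close>, the second \<open>p2 k2 = 0\<close>. It is an inflation because
    \<open>k2\<close> is one.\<close>
  define \<kappa> where "\<kappa> = u1 \<star> neg C b \<boxplus> v1 \<star> k2"
  have \<kappa>: "inflation C \<kappa>" unfolding \<kappa>_def
    by (rule inflation_into_biprod[OF b1]) (use A p2 in \<open>auto simp: inflation_def\<close>)
  obtain d where d: "(\<kappa>, d) \<in> Conf C" using \<kappa> by (rule inflationE)
  have \<kappa>t: "\<kappa> \<in> Arr C" "Dom C \<kappa> = Dom C k2" "Cod C \<kappa> = S1" unfolding \<kappa>_def using A D1 by auto
  have dd: "deflation C d" using d by (auto simp: deflation_def)
  note dt = confD[OF d, unfolded \<kappa>t]
  have "N \<star> \<kappa> = Zero C (Dom C \<kappa>) (Cod C N)"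
    unfolding \<kappa>_def using A D1 D2 Nt Nu by (simp add: Nu[THEN cmp_reduce])
  then obtain n where n: "n \<in> Arr C" "Dom C n = Cod C d" "Cod C n = S2" "n \<star> d = N"
    using cokernel_fac[OF conf_cokernel[OF d] Nt(1)] Nt \<kappa>t by auto
  have dk: "d \<star> v1 \<star> k2 = d \<star> u1 \<star> b"
  proof (rule eq_if_diff_zero)
    have "d \<star> \<kappa> = neg C (d \<star> u1 \<star> b) \<boxplus> d \<star> v1 \<star> k2" unfolding \<kappa>_def using A D1 dt(1-3) by simp
    then show "d \<star> v1 \<star> k2 \<boxplus> neg C (d \<star> u1 \<star> b) = Zero C (Dom C (d \<star> v1 \<star> k2)) (Cod C (d \<star> v1 \<star> k2))"
      using A D1 dt by (simp add: plus_comm)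
  qed (use A D1 dt in auto)
  have nd: "n \<star> d \<star> x = N \<star> x" if "x \<in> Arr C" "Cod C x = S1" for x
    using that n dt Nt by (simp add: n(4)[THEN cmp_reduce])
  \<comment> \<open>\<open>N\<close> is \<open>n\<close> after the deflation \<open>d\<close>. As
    the pushout of \<open>m1\<close> along \<open>d \<star> u1\<close>, the arrow \<open>n\<close>
    is an inflation with the same cokernel object as \<open>m1\<close>.\<close>
  have po: "is_pushout C m1 (d \<star> u1) n u2"
  proof (rule pushoutI)
    show "n \<star> d \<star> u1 = u2 \<star> m1" using nd[of u1] D1 Nu by simp
  next
    fix x v assume xv: "x \<in> Arr C" "v \<in> Arr C" "Dom C x = Cod C (d \<star> u1)" "Dom C v = Cod C m1" "Cod C x = Cod C v"
      "x \<star> d \<star> u1 = v \<star> m1"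
    have xt: "Dom C x = Cod C d" using xv D1 dt by simp
    \<comment> \<open>The map out of \<open>S2\<close> has to be \<open>v\<close> on the summand
      \<open>Cod C m1\<close>. On \<open>Dom C m2\<close> it is found from what remains of
      \<open>x \<star> d\<close> on \<open>Dom C p2\<close> after subtracting
      \<open>v \<star> a\<close>: this difference kills \<open>k2\<close>, so it descends along
      \<open>p2\<close>.\<close>
    define y where "y = x \<star> d \<star> v1 \<boxplus> neg C (v \<star> a)"
    have yt: "y \<in> Arr C" "Dom C y = Dom C p2" "Cod C y = Cod C v" unfolding y_def using xv xt D1 dt A by auto
    have "(x \<star> d \<star> u1) \<star> b = (v \<star> m1) \<star> b" by (simp add: xv(6))
    then have "x \<star> d \<star> u1 \<star> b = v \<star> a \<star> k2" using xv(1-5) xt D1 dt(1-3) A by simp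
    then have "y \<star> k2 = Zero C (Dom C k2) (Cod C y)"
      unfolding y_def using xv(1-5) xt D1 dt A by (simp add: dk)
    then obtain w where w: "w \<in> Arr C" "Dom C w = Dom C m2" "Cod C w = Cod C v" "w \<star> p2 = y"
      using cokernel_fac[OF conf_cokernel[OF p2] yt(1)] yt A by auto
    let ?w = "v \<star> r2 \<boxplus> w \<star> s2"
    have wt: "?w \<in> Arr C" "Dom C ?w = S2" "Cod C ?w = Cod C v" using w xv D2 by auto
    have wu: "?w \<star> u2 = v" using w xv D2 wt A by simp
    have wv: "?w \<star> v2 = w" using w xv D2 wt A by simp
    have "(?w \<star> n) \<star> d = x \<star> d"
    proof (rule biprod_eq_from[OF b1])
      have "?w \<star> N \<star> u1 = v \<star> m1" using wt wu xv D2 A by (simp add: Nu wu[THEN cmp_reduce] del: cmp_plus_l)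
      then show "((?w \<star> n) \<star> d) \<star> u1 = (x \<star> d) \<star> u1"
        using wt n Nt dt D1 xv xt by (simp add: nd Nu del: cmp_plus_l)
      have "?w \<star> N \<star> v1 = v \<star> a \<boxplus> y"
        using wt wu wv w xv D2 A by (simp add: Nu wu[THEN cmp_reduce] wv[THEN cmp_reduce] del: cmp_plus_l)
      also have "\<dots> = x \<star> d \<star> v1"
        unfolding y_def using xv xt D1 dt A by (simp add: plus_comm)
      finally show "((?w \<star> n) \<star> d) \<star> v1 = (x \<star> d) \<star> v1"
        using wt n Nt dt D1 xv xt by (simp add: nd del: cmp_plus_l)
    qed (use wt n dt xv xt in auto)
    then have "?w \<star> n = x" by (rule deflation_epi[OF dd]) (use wt n dt xv xt in auto)
    with wt wu n xv show "\<exists>u\<in>Arr C. Dom C u = Cod C n \<and> Cod C u = Cod C x \<and> u \<star> n = x \<and> u \<star> u2 = v"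
      by (intro bexI[of _ ?w]) (auto simp del: cmp_plus_l)
  next
    fix x y assume xy: "x \<in> Arr C" "y \<in> Arr C" "Cod C x = Cod C y" "Dom C x = Cod C n" "Dom C y = Cod C n"
      "x \<star> n = y \<star> n" "x \<star> u2 = y \<star> u2"
    have "(x \<star> n) \<star> d \<star> v1 = (y \<star> n) \<star> d \<star> v1" by (simp add: xy(6))
    then have 1: "x \<star> N \<star> v1 = y \<star> N \<star> v1" using xy(1-5) n D1 dt by (simp add: nd)
    have "(x \<star> u2) \<star> a = (y \<star> u2) \<star> a" by (simp add: xy(7))
    then have 2: "x \<star> u2 \<star> a = y \<star> u2 \<star> a" using xy(1-5) n D2 A by simp
    have 3: "y \<star> u2 \<star> a \<boxplus> x \<star> v2 \<star> p2 = y \<star> u2 \<star> a \<boxplus> y \<star> v2 \<star> p2"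
      using 1 xy(1-5) n D2 A by (simp add: Nu 2)
    have "(x \<star> v2) \<star> p2 = (y \<star> v2) \<star> p2"
      using plus_cancel[OF 3] xy(1-5) n D2 A by simp
    then have "x \<star> v2 = y \<star> v2" by (rule deflation_epi[OF dp2]) (use xy n D2 A in auto)
    then show "x = y" using biprod_eq_from[OF b2 xy(1,2)] xy(4,5,7) n(3) by simp
  qed (use A n D1 D2 dt in auto)
  have ni: "inflation C n" using inflation_po[OF po im(1)] .
  obtain cN where cN: "is_cokernel C cN n" "Cod C cN = Cod C c1" "cN \<star> u2 = c1"
    by (rule pushout_cokernel[OF po conf_cokernel[OF m1]])
  note cNt = cokernelD[OF cN(1)]
  have cNc: "(n, cN) \<in> Conf C" using inflation_conf[OF ni cN(1)] .
  \<comment> \<open>Pushing \<open>M\<close> out along the cokernel of \<open>n\<close> produces the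
    cokernel \<open>c\<close> of \<open>M \<star> n\<close>. The opposite arrow \<open>M'\<close> is
    the inflation between cokernels, and its own cokernel is that of \<open>M\<close>, which comes
    from \<open>m2\<close>.\<close>
  obtain M' c where po2: "is_pushout C M cN M' c" "inflation C M'"
    using inflation_pushout[OF M cNt(1)] cNt n Mt by auto
  note p2D = pushoutD[OF po2(1)]
  obtain cM where cM: "is_cokernel C cM M" "Cod C cM = Cod C c2" "cM \<star> j' = c2"
    by (rule pushout_cokernel[OF biprod_pushout[OF biprod_swap[OF b2] biprod_swap[OF bY]] conf_cokernel[OF m2], folded M_def])
      (use A in auto)
  note cMt = cokernelD[OF cM(1)]
  have "cM \<star> i' = (cM \<star> M) \<star> u2" using cMt(1-3) Mt Mu D2 by simp
  then have cMi: "cM \<star> i' = Zero C (Cod C m1) (Cod C c2)" using cMt Mt Mu D2 cM(2) confD(2)[OF m2] by simp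
  have cMq: "cM = c2 \<star> q'"
    by (rule biprod_eq_from[OF bY]) (use cMt Mt cM(2,3) cMi DY A in auto)
  obtain \<beta> where \<beta>: "is_cokernel C \<beta> M'" "Cod C \<beta> = Cod C cM" "\<beta> \<star> c = cM"
    by (rule pushout_cokernel[OF po2(1) cM(1)])
  have \<alpha>\<beta>: "(M', \<beta>) \<in> Conf C" using inflation_conf[OF po2(2) \<beta>(1)] .
  have fd: "f = (M \<star> n) \<star> (d \<star> P)"
    using fMNP Mt n dt Pt by (simp add: nd)
  have dP: "deflation C (d \<star> P)" using deflation_cmp[OF P dd] Pt dt by simp
  have Mn: "inflation C (M \<star> n)" using inflation_cmp[OF ni M] Mt n by simp
  have "is_cokernel C c (M \<star> n)"
  proof (rule cokernelI)
    have "c \<star> M \<star> n = (c \<star> M) \<star> n" using p2D n Mt by simp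
    also have "\<dots> = (M' \<star> cN) \<star> n" by (simp only: p2D(9))
    also have "\<dots> = M' \<star> cN \<star> n" using p2D(1-8) cNt(1-3) n(1-3) Mt by simp
    finally show "c \<star> M \<star> n = Zero C (Dom C (M \<star> n)) (Cod C c)"
      using p2D n Mt cNt dt by simp
  next
    fix h assume h: "h \<in> Arr C" "Dom C h = Cod C (M \<star> n)" "h \<star> M \<star> n = Zero C (Dom C (M \<star> n)) (Cod C h)"
    have "(h \<star> M) \<star> n = Zero C (Dom C n) (Cod C (h \<star> M))" using h n Mt by simp
    then obtain u where u: "u \<in> Arr C" "Dom C u = Cod C cN" "Cod C u = Cod C h" "u \<star> cN = h \<star> M"
      using cokernel_fac[OF cN(1), of "h \<star> M"] h n Mt by auto
    obtain w where w: "w \<in> Arr C" "Dom C w = Cod C M'" "Cod C w = Cod C u" "w \<star> M' = u" "w \<star> c = h"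
      by (rule pushout_fac[OF po2(1) u(1) h(1)]) (use u h n Mt in auto)
    with u p2D show "\<exists>u\<in>Arr C. Dom C u = Cod C c \<and> Cod C u = Cod C h \<and> u \<star> c = h" by auto
  next
    fix x y assume xy: "x \<in> Arr C" "y \<in> Arr C" "Cod C x = Cod C y" "Dom C x = Cod C c" "Dom C y = Cod C c" "x \<star> c = y \<star> c"
    have "(x \<star> c) \<star> M = (y \<star> c) \<star> M" by (simp add: xy(6))
    then have "x \<star> M' \<star> cN = y \<star> M' \<star> cN" using xy(1-5) p2D(1-9) by simp
    then have "(x \<star> M') \<star> cN = (y \<star> M') \<star> cN" using xy(1-5) p2D(1-8) by simp
    then have "x \<star> M' = y \<star> M'" by (rule cokernel_epi[OF cN(1)]) (use xy p2D in auto)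
    then show "x = y" using pushout_eq[OF po2(1) xy(1,2,3)] xy(4-6) p2D(8) by simp
  qed (use p2D n Mt in auto)
  then have "is_cokernel C c f" unfolding fd
    by (rule cokernel_pre_deflation[OF _ dP]) (use Mt n dt Pt in auto)
  moreover have "admissible C f" unfolding fd
    by (rule admissibleI[OF dP Mn]) (use Mt n dt Pt in auto)
  moreover have "M' \<star> c1 = c \<star> i'"
  proof -
    have "M' \<star> c1 = (M' \<star> cN) \<star> u2" using p2D(1-8) cNt(1-3) n D2 cN(3) by simp
    also have "\<dots> = c \<star> i'" unfolding p2D(9) using p2D(1-8) Mt D2 Mu by simp
    finally show ?thesis .
  qed
  ultimately show thesis
    using that[of c M' \<beta>] \<alpha>\<beta> p2D cNt cN(2) \<beta> cM(2) cMq by simp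
qed

text \<open>With \<open>c\<close> the cokernel of \<open>m\<close>, the kernel \<open>j\<close> of
  \<open>c \<star> g\<close> is the preimage under \<open>g\<close> of the image of
  \<open>m\<close>. The row factors through \<open>j\<close>, and the other factor is a pullback of
  \<open>q\<close>: the lift \<open>f\<close> splits that pullback into \<open>Dom C q\<close> and
  the kernel of \<open>g\<close>. In \<open>admissible_into_Eff\<close> the row presents the kernel
  of a map of modules.\<close>

lemma admissible_pullback_resolution:
  assumes q: "deflation C q" and m: "inflation C m" "Cod C q = Dom C m"
    and g: "(k, g) \<in> Conf C" "Cod C g = Cod C m"
    and f: "f \<in> Arr C" "Dom C f = Dom C q" "Cod C f = Dom C g" "g \<star> f = m \<star> q"
    and b: "biprod (Dom C q) (Dom C k) S u v r s"
  shows "admissible C (f \<star> r \<boxplus> k \<star> s)"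
proof -
  obtain c where c: "(m, c) \<in> Conf C" using m(1) by (rule inflationE)
  have dg: "deflation C g" and dc: "deflation C c" using g c by (auto simp: deflation_def)
  note A = deflation_arr[OF q] confD[OF g(1)] confD[OF c] m(2) g(2) f biprodD[OF b] biprod_cmp(1-4)[OF b]
  have "deflation C (c \<star> g)" using deflation_cmp[OF dg dc] A by simp
  then obtain j where j: "(j, c \<star> g) \<in> Conf C" by (rule deflationE)
  note jt = confD[OF j]
  have kj: "c \<star> g \<star> j = Zero C (Dom C j) (Cod C c)" using jt A by simp
  have "c \<star> g \<star> f = Zero C (Dom C f) (Cod C c)" using A by (simp add: confD(4)[OF c, THEN cmp_reduce])
  then obtain f' where f': "f' \<in> Arr C" "Dom C f' = Dom C f" "Cod C f' = Dom C j" "j \<star> f' = f"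
    using kernel_fac[OF conf_kernel[OF j], of f] A by auto
  have "c \<star> g \<star> k = Zero C (Dom C k) (Cod C c)" using A by simp
  then obtain k' where k': "k' \<in> Arr C" "Dom C k' = Dom C k" "Cod C k' = Dom C j" "j \<star> k' = k"
    using kernel_fac[OF conf_kernel[OF j], of k] A by auto
  obtain g' where g': "g' \<in> Arr C" "Dom C g' = Dom C j" "Cod C g' = Dom C m" "m \<star> g' = g \<star> j"
    using kernel_fac[OF conf_kernel[OF c], of "g \<star> j"] A kj jt by auto
  have ij: "inflation C j" using j by (auto simp: inflation_def)
  note B = jt(1,2,3) f' k' g'
  have mg: "m \<star> g' \<star> x = g \<star> j \<star> x" if "x \<in> Arr C" "Cod C x = Dom C j" for x
    using that A B by (simp add: g'(4)[THEN cmp_reduce])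
  have g'f: "g' \<star> f' = q"
    by (rule inflation_mono[OF m(1)]) (use A B in \<open>auto simp: mg\<close>)
  have g'k: "g' \<star> k' = Zero C (Dom C k) (Dom C m)"
    by (rule inflation_mono[OF m(1)]) (use A B in \<open>auto simp: mg\<close>)
  let ?t = "f' \<star> r \<boxplus> k' \<star> s"
  have tt: "?t \<in> Arr C" "Dom C ?t = S" "Cod C ?t = Dom C j" using A B by auto
  have "is_pullback C q g' ?t r"
  proof (rule pullbackI)
    show "g' \<star> ?t = q \<star> r" using A B g'f g'k by (simp add: g'f[THEN cmp_reduce] g'k[THEN cmp_reduce])
  next
    fix x y assume xy: "x \<in> Arr C" "y \<in> Arr C" "Cod C x = Dom C g'" "Cod C y = Dom C q" "Dom C x = Dom C y" "g' \<star> x = q \<star> y"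
    \<comment> \<open>The error of the lift \<open>f' \<star> y\<close>. Its image under
      \<open>j\<close> is killed by \<open>g\<close>, so it comes from \<open>k\<close>.\<close>
    let ?z = "x \<boxplus> neg C (f' \<star> y)"
    have zt: "?z \<in> Arr C" "Dom C ?z = Dom C y" "Cod C ?z = Dom C j" using xy A B by auto
    have "g' \<star> ?z = Zero C (Dom C y) (Dom C m)" using xy A B by (simp add: g'f[THEN cmp_reduce])
    then have "m \<star> g' \<star> ?z = Zero C (Dom C y) (Cod C m)" using xy A B by simp
    then have "g \<star> j \<star> ?z = Zero C (Dom C y) (Cod C m)" using zt by (simp add: mg del: cmp_plus_r)
    then obtain w where w: "w \<in> Arr C" "Dom C w = Dom C y" "Cod C w = Dom C k" "k \<star> w = j \<star> ?z"
      using kernel_fac[OF conf_kernel[OF g(1)], of "j \<star> ?z"] zt A(1-30) B by (auto simp del: cmp_plus_r)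
    have "j \<star> k' \<star> w = j \<star> ?z" using w B zt by (simp add: k'(4)[THEN cmp_reduce] del: cmp_plus_r)
    then have kw: "k' \<star> w = ?z" by (rule inflation_mono[OF ij]) (use w B zt in auto)
    have "?t \<star> (u \<star> y \<boxplus> v \<star> w) = f' \<star> y \<boxplus> k' \<star> w" using w xy A B by simp
    also have "\<dots> = x" unfolding kw using xy A B by (simp add: plus_lcomm)
    finally show "\<exists>u\<in>Arr C. Dom C u = Dom C x \<and> Cod C u = Dom C ?t \<and> ?t \<star> u = x \<and> r \<star> u = y"
      using w xy A B by (intro bexI[of _ "u \<star> y \<boxplus> v \<star> w"]) auto
  next
    fix x y assume xy: "x \<in> Arr C" "y \<in> Arr C" "Dom C x = Dom C y" "Cod C x = Dom C ?t" "Cod C y = Dom C ?t"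
       "?t \<star> x = ?t \<star> y" "r \<star> x = r \<star> y"
    have "j \<star> ?t \<star> x = j \<star> ?t \<star> y" using xy(6) by simp
    then have 1: "f \<star> r \<star> y \<boxplus> k \<star> s \<star> x = f \<star> r \<star> y \<boxplus> k \<star> s \<star> y"
      using xy(1-5,7) A B tt by (simp add: f'(4)[THEN cmp_reduce] k'(4)[THEN cmp_reduce])
    have "k \<star> s \<star> x = k \<star> s \<star> y" by (rule plus_cancel[OF 1]) (use xy(1-5) tt A in auto)
    then have "s \<star> x = s \<star> y" by (rule kernel_mono[OF conf_kernel[OF g(1)]]) (use xy(1-5) tt A in auto)
    then show "x = y" using biprod_eq_into[OF b xy(1,2)] xy(4,5,7) tt by simp
  qed (use A B in auto)
  then have dt: "deflation C ?t" using q by (rule deflation_pb)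
  have "f \<star> r \<boxplus> k \<star> s = j \<star> ?t" using A B by (simp add: f'(4)[THEN cmp_reduce] k'(4)[THEN cmp_reduce])
  then show ?thesis using admissibleI[OF dt ij] tt by simp
qed

text \<open>The identity of the middle object kills an arrow \<open>i\<close> with zero source, so
  it factors through the cokernel \<open>p\<close>.\<close>

lemma conf_zero_left:
  assumes ip: "(i, p) \<in> Conf C" and z: "is_zero_obj C (Dom C i)"
  shows "is_iso_arr C p"
proof -
  note D = confD[OF ip]
  have "Idn C (Dom C p) \<star> i = Zero C (Dom C i) (Cod C (Idn C (Dom C p)))"
    using D zero_objD(3)[OF z D(1)] by simp
  then obtain v where v: "v \<in> Arr C" "Dom C v = Cod C p" "Cod C v = Dom C p" "v \<star> p = Idn C (Dom C p)"
    using cokernel_fac[OF conf_cokernel[OF ip], of "Idn C (Dom C p)"] D by auto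
  have "p \<star> v = Idn C (Cod C p)"
    by (rule cokernel_epi[OF conf_cokernel[OF ip]]) (use v D in auto)
  then show ?thesis by (intro iso_arrI[of _ v]) (use v D in auto)
qed

lemma conf_zero_right:
  assumes ip: "(i, p) \<in> Conf C" and z: "is_zero_obj C (Cod C p)"
  shows "is_iso_arr C i"
proof -
  note D = confD[OF ip]
  have "p \<star> Idn C (Dom C p) = Zero C (Dom C (Idn C (Dom C p))) (Cod C p)"
    using D zero_objD(2)[OF z D(2)] by simp
  then obtain v where v: "v \<in> Arr C" "Dom C v = Cod C i" "Cod C v = Dom C i" "i \<star> v = Idn C (Cod C i)"
    using kernel_fac[OF conf_kernel[OF ip], of "Idn C (Dom C p)"] D by auto
  have "v \<star> i = Idn C (Dom C i)"
    by (rule kernel_mono[OF conf_kernel[OF ip]]) (use v D in \<open>auto simp: v(4)[THEN cmp_reduce]\<close>)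
  then show ?thesis by (intro iso_arrI[of _ v]) (use v D in auto)
qed

lemma conf_zero_mid:
  assumes ip: "(i, p) \<in> Conf C"
  shows "is_zero_obj C (Cod C i) \<longleftrightarrow> is_zero_obj C (Dom C i) \<and> is_zero_obj C (Cod C p)"
proof
  note D = confD[OF ip]
  assume z: "is_zero_obj C (Cod C i)"
  have "i \<star> Idn C (Dom C i) = i \<star> Zero C (Dom C i) (Dom C i)" using zero_objD(2)[OF z D(1)] D by simp
  then have "Idn C (Dom C i) = Zero C (Dom C i) (Dom C i)" by (rule kernel_mono[OF conf_kernel[OF ip]]) (use D in auto)
  moreover have "Idn C (Cod C p) \<star> p = Zero C (Cod C p) (Cod C p) \<star> p" using zero_objD(3)[OF z D(2)] D by simp
  then have "Idn C (Cod C p) = Zero C (Cod C p) (Cod C p)" by (rule cokernel_epi[OF conf_cokernel[OF ip]]) (use D in auto)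
  ultimately show "is_zero_obj C (Dom C i) \<and> is_zero_obj C (Cod C p)" using D by (auto intro: zero_objI)
next
  note D = confD[OF ip]
  assume "is_zero_obj C (Dom C i) \<and> is_zero_obj C (Cod C p)"
  with iso_zero_obj[OF _ conf_zero_left[OF ip]] D show "is_zero_obj C (Cod C i)" by auto
qed

end

section \<open>Arrows inverted by an exact functor\<close>

context exact_functor
begin

lemma F_arr [simp]:
  assumes "f \<in> Arr A"
  shows "FArr F f \<in> Arr B" "Dom B (FArr F f) = FObj F (Dom A f)" "Cod B (FArr F f) = FObj F (Cod A f)"
  using farr_in[of f "Dom A f" "Cod A f"] assms by (auto simp: hom_iff)

lemma F_cmp: "f \<in> Arr A \<Longrightarrow> g \<in> Arr A \<Longrightarrow> Cod A f = Dom A g \<Longrightarrow> FArr F (g \<star>\<^bsub>A\<^esub> f) = FArr F g \<star>\<^bsub>B\<^esub> FArr F f"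
  by (rule farr_cmp[of f "Dom A f" "Cod A f" g "Cod A g"]) (auto simp: hom_iff)

lemma F_plus: "f \<in> Arr A \<Longrightarrow> g \<in> Arr A \<Longrightarrow> Dom A f = Dom A g \<Longrightarrow> Cod A f = Cod A g \<Longrightarrow>
    FArr F (f \<boxplus>\<^bsub>A\<^esub> g) = FArr F f \<boxplus>\<^bsub>B\<^esub> FArr F g"
  by (rule farr_plus[of f "Dom A f" "Cod A f" g]) (auto simp: hom_iff)

lemma F_iso:
  assumes "is_iso_arr A f"
  shows "is_iso_arr B (FArr F f)"
proof -
  note f = A.inv_arr[OF assms]
  show ?thesis
    by (rule B.iso_arrI[of _ "FArr F (inv_arr A f)"]) (use f in \<open>simp_all add: F_cmp[symmetric] farr_idn\<close>)
qed

text \<open>For \<open>s = m p\<close> the kernel of \<open>s\<close> is that of \<open>p\<close>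
  and its cokernel is that of \<open>m\<close>, up to isomorphism with the witnesses in
  \<open>quot_arrows\<close>. Both go to zero, so the images of \<open>p\<close> and
  \<open>m\<close> each sit in a conflation with one zero end.\<close>

lemma F_quot_arrow:
  assumes z: "\<And>X. X \<in> N \<Longrightarrow> is_zero_obj B (FObj F X)" and s: "s \<in> quot_arrows A N"
  shows "is_iso_arr B (FArr F s)"
proof -
  obtain k c where sA: "s \<in> Arr A" "admissible A s" and k: "is_kernel A k s" "Dom A k \<in> N"
    and c: "is_cokernel A c s" "Cod A c \<in> N"
    using s unfolding quot_arrows_def by auto
  obtain p m where pm: "deflation A p" "inflation A m" "Cod A p = Dom A m" "s = m \<star>\<^bsub>A\<^esub> p"
    using sA(2) by (rule A.admissibleE)
  obtain i where i: "(i, p) \<in> Conf A" using pm(1) by (rule A.deflationE)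
  obtain d where d: "(m, d) \<in> Conf A" using pm(2) by (rule A.inflationE)
  have ki: "is_kernel A i s" unfolding pm(4)
    by (rule A.kernel_post_inflation[OF A.conf_kernel[OF i] pm(2)]) (simp add: pm)
  have cd: "is_cokernel A d s" unfolding pm(4)
    by (rule A.cokernel_pre_deflation[OF A.conf_cokernel[OF d] pm(1)]) (simp add: pm)
  obtain u where u: "is_iso_arr A u" "Dom A u = Dom A k" "Cod A u = Dom A i"
    using A.kernel_iso[OF k(1) ki] by metis
  obtain v where v: "is_iso_arr A v" "Dom A v = Cod A c" "Cod A v = Cod A d"
    using A.cokernel_iso[OF c(1) cd] by metis
  note iD = A.confD[OF i] and dD = A.confD[OF d]
  have "is_zero_obj B (FObj F (Dom A i))"
    using B.iso_zero_obj[OF z[OF k(2)] F_iso[OF u(1)]] A.inv_arr(1)[OF u(1)] u by simp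
  then have 1: "is_iso_arr B (FArr F p)"
    using B.conf_zero_left[OF farr_conf[OF i]] iD by simp
  have "is_zero_obj B (FObj F (Cod A d))"
    using B.iso_zero_obj[OF z[OF c(2)] F_iso[OF v(1)]] A.inv_arr(1)[OF v(1)] v by simp
  then have 2: "is_iso_arr B (FArr F m)"
    using B.conf_zero_right[OF farr_conf[OF d]] dD by simp
  show ?thesis unfolding pm(4) using B.iso_cmp[OF 1 2] iD dD pm(3) by (simp add: F_cmp)
qed

end

section \<open>Transport of exact structures along equivalences\<close>

text \<open>The category laws are assumed for \<^term>\<open>E\<close> only: the laws of \<^term>\<open>K\<close> are reflected by the
  faithful \<^term>\<open>F\<close>, so that they need not be checked for classes of zigzags.\<close>

locale fully_faithful = E: additive_category E
  for K :: "('o, 'm, 'x) pcat_scheme" and E :: "('p, 'q, 'y) pcat_scheme" +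
  fixes P :: "'o \<Rightarrow> 'p" and F :: "'m \<Rightarrow> 'q"
  assumes K_dom: "f \<in> Arr K \<Longrightarrow> Dom K f \<in> Obj K" and K_cod: "f \<in> Arr K \<Longrightarrow> Cod K f \<in> Obj K"
    and P_obj: "X \<in> Obj K \<Longrightarrow> P X \<in> Obj E"
    and F_arr: "f \<in> Arr K \<Longrightarrow> F f \<in> Arr E" "f \<in> Arr K \<Longrightarrow> Dom E (F f) = P (Dom K f)"
      "f \<in> Arr K \<Longrightarrow> Cod E (F f) = P (Cod K f)"
    and F_full: "h \<in> Arr E \<Longrightarrow> X \<in> Obj K \<Longrightarrow> Y \<in> Obj K \<Longrightarrow> Dom E h = P X \<Longrightarrow> Cod E h = P Y \<Longrightarrow>
      \<exists>f \<in> Arr K. Dom K f = X \<and> Cod K f = Y \<and> F f = h"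
    and F_faithful: "f \<in> Arr K \<Longrightarrow> g \<in> Arr K \<Longrightarrow> Dom K f = Dom K g \<Longrightarrow> Cod K f = Cod K g \<Longrightarrow> F f = F g \<Longrightarrow> f = g"
    and K_idn: "X \<in> Obj K \<Longrightarrow> Idn K X \<in> Arr K" "X \<in> Obj K \<Longrightarrow> Dom K (Idn K X) = X" "X \<in> Obj K \<Longrightarrow> Cod K (Idn K X) = X"
      "X \<in> Obj K \<Longrightarrow> F (Idn K X) = Idn E (P X)"
    and K_cmp: "f \<in> Arr K \<Longrightarrow> g \<in> Arr K \<Longrightarrow> Cod K f = Dom K g \<Longrightarrow> g \<star>\<^bsub>K\<^esub> f \<in> Arr K"
      "f \<in> Arr K \<Longrightarrow> g \<in> Arr K \<Longrightarrow> Cod K f = Dom K g \<Longrightarrow> Dom K (g \<star>\<^bsub>K\<^esub> f) = Dom K f"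
      "f \<in> Arr K \<Longrightarrow> g \<in> Arr K \<Longrightarrow> Cod K f = Dom K g \<Longrightarrow> Cod K (g \<star>\<^bsub>K\<^esub> f) = Cod K g"
      "f \<in> Arr K \<Longrightarrow> g \<in> Arr K \<Longrightarrow> Cod K f = Dom K g \<Longrightarrow> F (g \<star>\<^bsub>K\<^esub> f) = F g \<star>\<^bsub>E\<^esub> F f"
    and K_plus: "f \<in> Arr K \<Longrightarrow> g \<in> Arr K \<Longrightarrow> Dom K f = Dom K g \<Longrightarrow> Cod K f = Cod K g \<Longrightarrow> f \<boxplus>\<^bsub>K\<^esub> g \<in> Arr K"
      "f \<in> Arr K \<Longrightarrow> g \<in> Arr K \<Longrightarrow> Dom K f = Dom K g \<Longrightarrow> Cod K f = Cod K g \<Longrightarrow> Dom K (f \<boxplus>\<^bsub>K\<^esub> g) = Dom K g"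
      "f \<in> Arr K \<Longrightarrow> g \<in> Arr K \<Longrightarrow> Dom K f = Dom K g \<Longrightarrow> Cod K f = Cod K g \<Longrightarrow> Cod K (f \<boxplus>\<^bsub>K\<^esub> g) = Cod K g"
      "f \<in> Arr K \<Longrightarrow> g \<in> Arr K \<Longrightarrow> Dom K f = Dom K g \<Longrightarrow> Cod K f = Cod K g \<Longrightarrow> F (f \<boxplus>\<^bsub>K\<^esub> g) = F f \<boxplus>\<^bsub>E\<^esub> F g"
    and K_zero: "X \<in> Obj K \<Longrightarrow> Y \<in> Obj K \<Longrightarrow> Zero K X Y \<in> Arr K" "X \<in> Obj K \<Longrightarrow> Y \<in> Obj K \<Longrightarrow> Dom K (Zero K X Y) = X"
      "X \<in> Obj K \<Longrightarrow> Y \<in> Obj K \<Longrightarrow> Cod K (Zero K X Y) = Y" "X \<in> Obj K \<Longrightarrow> Y \<in> Obj K \<Longrightarrow> F (Zero K X Y) = Zero E (P X) (P Y)"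
    and ess_surj: "Z \<in> Obj E \<Longrightarrow> \<exists>X \<in> Obj K. \<exists>u. is_iso_arr E u \<and> Dom E u = Z \<and> Cod E u = P X"
begin

lemmas F_simps [simp] = K_dom K_cod P_obj F_arr K_idn K_cmp K_plus K_zero

lemma full:
  assumes "h \<in> Arr E" "X \<in> Obj K" "Y \<in> Obj K" "Dom E h = P X" "Cod E h = P Y"
  obtains f where "f \<in> Arr K" "Dom K f = X" "Cod K f = Y" "F f = h"
  using F_full[OF assms] by auto

sublocale K: preadditive_category K
proof (intro preadditive_category.intro category.intro preadditive_category_axioms.intro)
  fix X Y assume XY: "X \<in> Obj K" "Y \<in> Obj K"
  show "comm_group (hom_group K X Y)"
  proof (rule comm_groupI)
    fix x assume x: "x \<in> carrier (hom_group K X Y)"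
    then have x': "x \<in> Arr K" "Dom K x = X" "Cod K x = Y" by (auto simp: hom_group_def hom_iff)
    obtain y where "y \<in> Arr K" "Dom K y = X" "Cod K y = Y" "F y = neg E (F x)"
      by (rule full[of "neg E (F x)" X Y]) (use x' XY in auto)
    with x' XY show "\<exists>y\<in>carrier (hom_group K X Y). y \<otimes>\<^bsub>hom_group K X Y\<^esub> x = \<one>\<^bsub>hom_group K X Y\<^esub>"
      by (intro bexI[of _ y]) (auto intro!: F_faithful simp: hom_group_def hom_iff)
  qed (use XY in \<open>auto intro!: F_faithful simp: hom_group_def hom_iff E.plus_ac\<close>)
qed (auto intro!: F_faithful simp: hom_iff)

lemma iso_iff: "is_iso_arr K f \<longleftrightarrow> f \<in> Arr K \<and> is_iso_arr E (F f)"
proof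
  assume "is_iso_arr K f"
  note f = K.inv_arr[OF this]
  have "F (inv_arr K f) \<star>\<^bsub>E\<^esub> F f = Idn E (P (Dom K f))" "F f \<star>\<^bsub>E\<^esub> F (inv_arr K f) = Idn E (P (Cod K f))"
    using f by (simp_all add: K_cmp(4)[symmetric] del: K_cmp(4))
  with f show "f \<in> Arr K \<and> is_iso_arr E (F f)"
    by (intro conjI E.iso_arrI[of _ "F (inv_arr K f)"]) auto
next
  assume "f \<in> Arr K \<and> is_iso_arr E (F f)"
  then have f: "f \<in> Arr K" "is_iso_arr E (F f)" by auto
  note g = E.inv_arr[OF f(2)]
  obtain h where "h \<in> Arr K" "Dom K h = Cod K f" "Cod K h = Dom K f" "F h = inv_arr E (F f)"
    by (rule full[of "inv_arr E (F f)" "Cod K f" "Dom K f"]) (use f g in auto)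
  with f g show "is_iso_arr K f" by (intro K.iso_arrI[of _ h] F_faithful) auto
qed

text \<open>A universal property in \<open>E\<close> holds in particular against the objects
  \<open>P X\<close>. Fullness supplies the factorization in \<open>K\<close>, faithfulness its
  uniqueness.\<close>

lemma reflect_kernel:
  assumes "is_kernel E (F k) (F f)" "k \<in> Arr K" "f \<in> Arr K" "Cod K k = Dom K f"
  shows "is_kernel K k f"
proof (rule K.kernelI)
  note kD = E.kernelD[OF assms(1)]
  show "f \<star>\<^bsub>K\<^esub> k = Zero K (Dom K k) (Cod K f)" using assms kD by (intro F_faithful) auto
  fix h assume h: "h \<in> Arr K" "Cod K h = Dom K f" "f \<star>\<^bsub>K\<^esub> h = Zero K (Dom K h) (Cod K f)"
  have "F f \<star>\<^bsub>E\<^esub> F h = Zero E (Dom E (F h)) (Cod E (F f))" using arg_cong[OF h(3), of F] h(1,2) assms by simp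
  then obtain u where u: "u \<in> Arr E" "Dom E u = P (Dom K h)" "Cod E u = P (Dom K k)" "F k \<star>\<^bsub>E\<^esub> u = F h"
    using E.kernel_fac[OF assms(1), of "F h"] h assms by auto
  obtain v where "v \<in> Arr K" "Dom K v = Dom K h" "Cod K v = Dom K k" "F v = u"
    by (rule full[OF u(1) _ _ u(2,3)]) (use h assms in auto)
  with u h assms show "\<exists>u\<in>Arr K. Dom K u = Dom K h \<and> Cod K u = Dom K k \<and> k \<star>\<^bsub>K\<^esub> u = h"
    by (intro bexI[of _ v]) (auto intro!: F_faithful)
next
  fix x y assume xy: "x \<in> Arr K" "y \<in> Arr K" "Dom K x = Dom K y" "Cod K x = Dom K k" "Cod K y = Dom K k" "k \<star>\<^bsub>K\<^esub> x = k \<star>\<^bsub>K\<^esub> y"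
  have "F k \<star>\<^bsub>E\<^esub> F x = F k \<star>\<^bsub>E\<^esub> F y" using arg_cong[OF xy(6), of F] xy(1-5) assms by simp
  then have "F x = F y" by (rule E.kernel_mono[OF assms(1)]) (use xy assms in auto)
  then show "x = y" using xy by (intro F_faithful) auto
qed (use assms in auto)

lemma reflect_cokernel:
  assumes "is_cokernel E (F k) (F f)" "k \<in> Arr K" "f \<in> Arr K" "Dom K k = Cod K f"
  shows "is_cokernel K k f"
proof (rule K.cokernelI)
  note kD = E.cokernelD[OF assms(1)]
  show "k \<star>\<^bsub>K\<^esub> f = Zero K (Dom K f) (Cod K k)" using assms kD by (intro F_faithful) auto
  fix h assume h: "h \<in> Arr K" "Dom K h = Cod K f" "h \<star>\<^bsub>K\<^esub> f = Zero K (Dom K f) (Cod K h)"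
  have "F h \<star>\<^bsub>E\<^esub> F f = Zero E (Dom E (F f)) (Cod E (F h))" using arg_cong[OF h(3), of F] h(1,2) assms by simp
  then obtain u where u: "u \<in> Arr E" "Dom E u = P (Cod K k)" "Cod E u = P (Cod K h)" "u \<star>\<^bsub>E\<^esub> F k = F h"
    using E.cokernel_fac[OF assms(1), of "F h"] h assms by auto
  obtain v where "v \<in> Arr K" "Dom K v = Cod K k" "Cod K v = Cod K h" "F v = u"
    by (rule full[OF u(1) _ _ u(2,3)]) (use h assms in auto)
  with u h assms show "\<exists>u\<in>Arr K. Dom K u = Cod K k \<and> Cod K u = Cod K h \<and> u \<star>\<^bsub>K\<^esub> k = h"
    by (intro bexI[of _ v]) (auto intro!: F_faithful)
next
  fix x y assume xy: "x \<in> Arr K" "y \<in> Arr K" "Cod K x = Cod K y" "Dom K x = Cod K k" "Dom K y = Cod K k" "x \<star>\<^bsub>K\<^esub> k = y \<star>\<^bsub>K\<^esub> k"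
  have "F x \<star>\<^bsub>E\<^esub> F k = F y \<star>\<^bsub>E\<^esub> F k" using arg_cong[OF xy(6), of F] xy(1-5) assms by simp
  then have "F x = F y" by (rule E.cokernel_epi[OF assms(1)]) (use xy assms in auto)
  then show "x = y" using xy by (intro F_faithful) auto
qed (use assms in auto)

lemma reflect_pushout:
  assumes "is_pushout E (F f) (F g) (F f') (F g')" "f \<in> Arr K" "g \<in> Arr K" "f' \<in> Arr K" "g' \<in> Arr K" "Dom K f = Dom K g"
    "Dom K f' = Cod K g" "Dom K g' = Cod K f" "Cod K f' = Cod K g'"
  shows "is_pushout K f g f' g'"
proof (rule K.pushoutI)
  note D = E.pushoutD[OF assms(1)]
  show "f' \<star>\<^bsub>K\<^esub> g = g' \<star>\<^bsub>K\<^esub> f" using assms(2-) D by (intro F_faithful) auto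
  fix a b assume ab: "a \<in> Arr K" "b \<in> Arr K" "Dom K a = Cod K g" "Dom K b = Cod K f" "Cod K a = Cod K b" "a \<star>\<^bsub>K\<^esub> g = b \<star>\<^bsub>K\<^esub> f"
  have "F a \<star>\<^bsub>E\<^esub> F g = F b \<star>\<^bsub>E\<^esub> F f" using arg_cong[OF ab(6), of F] ab(1-5) assms(2-) by simp
  then obtain u where u: "u \<in> Arr E" "Dom E u = P (Cod K f')" "Cod E u = P (Cod K a)" "u \<star>\<^bsub>E\<^esub> F f' = F a" "u \<star>\<^bsub>E\<^esub> F g' = F b"
    using E.pushout_fac[OF assms(1), of "F a" "F b"] ab(1-5) assms(2-) by auto
  obtain v where "v \<in> Arr K" "Dom K v = Cod K f'" "Cod K v = Cod K a" "F v = u"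
    by (rule full[OF u(1) _ _ u(2,3)]) (use ab assms in auto)
  with u ab assms(2-) show "\<exists>u\<in>Arr K. Dom K u = Cod K f' \<and> Cod K u = Cod K a \<and> u \<star>\<^bsub>K\<^esub> f' = a \<and> u \<star>\<^bsub>K\<^esub> g' = b"
    by (intro bexI[of _ v]) (auto intro!: F_faithful)
next
  fix x y assume xy: "x \<in> Arr K" "y \<in> Arr K" "Cod K x = Cod K y" "Dom K x = Cod K f'" "Dom K y = Cod K f'" "x \<star>\<^bsub>K\<^esub> f' = y \<star>\<^bsub>K\<^esub> f'"
    "x \<star>\<^bsub>K\<^esub> g' = y \<star>\<^bsub>K\<^esub> g'"
  have 1: "F x \<star>\<^bsub>E\<^esub> F f' = F y \<star>\<^bsub>E\<^esub> F f'" using arg_cong[OF xy(6), of F] xy(1-5) assms(2-) by simp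
  have 2: "F x \<star>\<^bsub>E\<^esub> F g' = F y \<star>\<^bsub>E\<^esub> F g'" using arg_cong[OF xy(7), of F] xy(1-5) assms(2-) by simp
  have "F x = F y" by (rule E.pushout_eq[OF assms(1) _ _ _ _ _ 1 2]) (use xy assms in auto)
  then show "x = y" using xy by (intro F_faithful) auto
qed (use assms in auto)

lemma reflect_pullback:
  assumes "is_pullback E (F f) (F g) (F f') (F g')" "f \<in> Arr K" "g \<in> Arr K" "f' \<in> Arr K" "g' \<in> Arr K" "Cod K f = Cod K g"
    "Cod K f' = Dom K g" "Cod K g' = Dom K f" "Dom K f' = Dom K g'"
  shows "is_pullback K f g f' g'"
proof (rule K.pullbackI)
  note D = E.pullbackD[OF assms(1)]
  show "g \<star>\<^bsub>K\<^esub> f' = f \<star>\<^bsub>K\<^esub> g'" using assms(2-) D by (intro F_faithful) auto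
  fix a b assume ab: "a \<in> Arr K" "b \<in> Arr K" "Cod K a = Dom K g" "Cod K b = Dom K f" "Dom K a = Dom K b" "g \<star>\<^bsub>K\<^esub> a = f \<star>\<^bsub>K\<^esub> b"
  have "F g \<star>\<^bsub>E\<^esub> F a = F f \<star>\<^bsub>E\<^esub> F b" using arg_cong[OF ab(6), of F] ab(1-5) assms(2-) by simp
  then obtain u where u: "u \<in> Arr E" "Dom E u = P (Dom K a)" "Cod E u = P (Dom K f')" "F f' \<star>\<^bsub>E\<^esub> u = F a" "F g' \<star>\<^bsub>E\<^esub> u = F b"
    using E.pullback_fac[OF assms(1), of "F a" "F b"] ab(1-5) assms(2-) by auto
  obtain v where "v \<in> Arr K" "Dom K v = Dom K a" "Cod K v = Dom K f'" "F v = u"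
    by (rule full[OF u(1) _ _ u(2,3)]) (use ab assms in auto)
  with u ab assms(2-) show "\<exists>u\<in>Arr K. Dom K u = Dom K a \<and> Cod K u = Dom K f' \<and> f' \<star>\<^bsub>K\<^esub> u = a \<and> g' \<star>\<^bsub>K\<^esub> u = b"
    by (intro bexI[of _ v]) (auto intro!: F_faithful)
next
  fix x y assume xy: "x \<in> Arr K" "y \<in> Arr K" "Dom K x = Dom K y" "Cod K x = Dom K f'" "Cod K y = Dom K f'" "f' \<star>\<^bsub>K\<^esub> x = f' \<star>\<^bsub>K\<^esub> y"
    "g' \<star>\<^bsub>K\<^esub> x = g' \<star>\<^bsub>K\<^esub> y"
  have 1: "F f' \<star>\<^bsub>E\<^esub> F x = F f' \<star>\<^bsub>E\<^esub> F y" using arg_cong[OF xy(6), of F] xy(1-5) assms(2-) by simp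
  have 2: "F g' \<star>\<^bsub>E\<^esub> F x = F g' \<star>\<^bsub>E\<^esub> F y" using arg_cong[OF xy(7), of F] xy(1-5) assms(2-) by simp
  have "F x = F y" by (rule E.pullback_eq[OF assms(1) _ _ _ _ _ 1 2]) (use xy assms in auto)
  then show "x = y" using xy by (intro F_faithful) auto
qed (use assms in auto)

text \<open>Zero objects and biproducts of \<open>E\<close> may fail to be of the form
  \<open>P X\<close>, so they are first moved along the isomorphisms of
  \<open>ess_surj\<close>.\<close>

sublocale K: additive_category K
proof unfold_locales
  obtain Z where Z: "is_zero_obj E Z" using E.ex_zero_obj by blast
  then obtain X u where X: "X \<in> Obj K" "is_iso_arr E u" "Dom E u = Z" "Cod E u = P X"
    using ess_surj[of Z] E.zero_objD(1) by blast
  have "is_zero_obj E (P X)" using E.iso_zero_obj[OF Z X(2)] X by simp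
  then have "is_zero_obj K X" using X(1) E.zero_objD(4) by (intro K.zero_objI F_faithful) auto
  then show "\<exists>Z. is_zero_obj K Z" by blast
next
  fix X Y assume XY: "X \<in> Obj K" "Y \<in> Obj K"
  obtain S0 i0 j0 p0 q0 where b0: "E.biprod (P X) (P Y) S0 i0 j0 p0 q0"
    by (rule E.biprodE[of "P X" "P Y"]) (use XY in auto)
  note D = E.biprodD[OF b0]
  obtain S u where S: "S \<in> Obj K" "is_iso_arr E u" "Dom E u = S0" "Cod E u = P S"
    using ess_surj[OF D(3)] by blast
  note u = E.inv_arr[OF S(2)] E.inv_arr_cmp[OF S(2)]
  obtain i where i: "i \<in> Arr K" "Dom K i = X" "Cod K i = S" "F i = u \<star>\<^bsub>E\<^esub> i0"
    by (rule full[of "u \<star>\<^bsub>E\<^esub> i0" X S]) (use XY S D u in auto)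
  obtain j where j: "j \<in> Arr K" "Dom K j = Y" "Cod K j = S" "F j = u \<star>\<^bsub>E\<^esub> j0"
    by (rule full[of "u \<star>\<^bsub>E\<^esub> j0" Y S]) (use XY S D u in auto)
  obtain p where p: "p \<in> Arr K" "Dom K p = S" "Cod K p = X" "F p = p0 \<star>\<^bsub>E\<^esub> inv_arr E u"
    by (rule full[of "p0 \<star>\<^bsub>E\<^esub> inv_arr E u" S X]) (use XY S D u in auto)
  obtain q where q: "q \<in> Arr K" "Dom K q = S" "Cod K q = Y" "F q = q0 \<star>\<^bsub>E\<^esub> inv_arr E u"
    by (rule full[of "q0 \<star>\<^bsub>E\<^esub> inv_arr E u" S Y]) (use XY S D u in auto)
  have "u \<star>\<^bsub>E\<^esub> (i0 \<star>\<^bsub>E\<^esub> p0 \<boxplus>\<^bsub>E\<^esub> j0 \<star>\<^bsub>E\<^esub> q0) \<star>\<^bsub>E\<^esub> inv_arr E u = Idn E (P S)"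
    using D u S by (simp del: E.cmp_plus_l E.cmp_plus_r)
  then have *: "u \<star>\<^bsub>E\<^esub> i0 \<star>\<^bsub>E\<^esub> p0 \<star>\<^bsub>E\<^esub> inv_arr E u \<boxplus>\<^bsub>E\<^esub> u \<star>\<^bsub>E\<^esub> j0 \<star>\<^bsub>E\<^esub> q0 \<star>\<^bsub>E\<^esub> inv_arr E u = Idn E (P S)"
    using D(1-19) u S by simp
  have "p \<star>\<^bsub>K\<^esub> i = Idn K X \<and> q \<star>\<^bsub>K\<^esub> j = Idn K Y \<and> p \<star>\<^bsub>K\<^esub> j = Zero K Y X \<and> q \<star>\<^bsub>K\<^esub> i = Zero K X Y \<and>
        (i \<star>\<^bsub>K\<^esub> p) \<boxplus>\<^bsub>K\<^esub> (j \<star>\<^bsub>K\<^esub> q) = Idn K S"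
    using XY i j p q S D u * by (intro conjI F_faithful) auto
  then show "\<exists>S \<in> Obj K. \<exists>i \<in> Hom K X S. \<exists>j \<in> Hom K Y S. \<exists>p \<in> Hom K S X. \<exists>q \<in> Hom K S Y.
        p \<star>\<^bsub>K\<^esub> i = Idn K X \<and> q \<star>\<^bsub>K\<^esub> j = Idn K Y \<and> p \<star>\<^bsub>K\<^esub> j = Zero K Y X \<and> q \<star>\<^bsub>K\<^esub> i = Zero K X Y \<and>
        (i \<star>\<^bsub>K\<^esub> p) \<boxplus>\<^bsub>K\<^esub> (j \<star>\<^bsub>K\<^esub> q) = Idn K S"
    using i j p q S(1) by (intro bexI[of _ S] bexI[of _ i] bexI[of _ j] bexI[of _ p] bexI[of _ q]) (auto simp: hom_iff)
qed

end

section \<open>Transport of the exact structure\<close>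

locale exact_transport = fully_faithful K E P F + E: exact_category E
  for K :: "('o, 'm, 'x) excat_scheme" and E :: "('p, 'q, 'y) excat_scheme" and P F +
  assumes conf_iff: "(i, p) \<in> Conf K \<longleftrightarrow> i \<in> Arr K \<and> p \<in> Arr K \<and> Cod K i = Dom K p \<and> (F i, F p) \<in> Conf E"
begin

text \<open>Membership in \<open>Conf K\<close> asks for a second arrow in \<open>K\<close> itself,
  so the cokernel in \<open>E\<close> is moved to an object \<open>P X\<close> before it is
  lifted.\<close>

lemma inflation_iff: "inflation K i \<longleftrightarrow> i \<in> Arr K \<and> inflation E (F i)"
proof
  assume "i \<in> Arr K \<and> inflation E (F i)"
  then obtain p where i: "i \<in> Arr K" and p: "(F i, p) \<in> Conf E" by (auto simp: inflation_def)
  note D = E.confD[OF p]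
  obtain X u where X: "X \<in> Obj K" "is_iso_arr E u" "Dom E u = Cod E p" "Cod E u = P X"
    using ess_surj[of "Cod E p"] D by auto
  note u = E.inv_arr[OF X(2)]
  obtain q where "q \<in> Arr K" "Dom K q = Cod K i" "Cod K q = X" "F q = u \<star>\<^bsub>E\<^esub> p"
    by (rule full[of "u \<star>\<^bsub>E\<^esub> p" "Cod K i" X]) (use X u D i in auto)
  moreover have "(F i, u \<star>\<^bsub>E\<^esub> p) \<in> Conf E"
    by (rule E.conf_transfer[OF p, of "Idn E (P (Dom K i))" "Idn E (P (Cod K i))" u]) (use D u X i in auto)
  ultimately show "inflation K i" using i by (auto simp: inflation_def conf_iff)
qed (auto simp: inflation_def conf_iff)

lemma deflation_iff: "deflation K p \<longleftrightarrow> p \<in> Arr K \<and> deflation E (F p)"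
proof
  assume "p \<in> Arr K \<and> deflation E (F p)"
  then obtain i where p: "p \<in> Arr K" and i: "(i, F p) \<in> Conf E" by (auto simp: deflation_def)
  note D = E.confD[OF i]
  obtain X u where X: "X \<in> Obj K" "is_iso_arr E u" "Dom E u = Dom E i" "Cod E u = P X"
    using ess_surj[of "Dom E i"] D by auto
  note u = E.inv_arr[OF X(2)]
  obtain q where "q \<in> Arr K" "Dom K q = X" "Cod K q = Dom K p" "F q = i \<star>\<^bsub>E\<^esub> inv_arr E u"
    by (rule full[of "i \<star>\<^bsub>E\<^esub> inv_arr E u" X "Dom K p"]) (use X u D p in auto)
  moreover have "(i \<star>\<^bsub>E\<^esub> inv_arr E u, F p) \<in> Conf E"
    by (rule E.conf_transfer[OF i, of u "Idn E (P (Dom K p))" "Idn E (P (Cod K p))"]) (use D u X p in auto)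
  ultimately show "deflation K p" using p by (auto simp: deflation_def conf_iff)
qed (auto simp: deflation_def conf_iff)

sublocale K: exact_category K
proof unfold_locales
  show "is_kernel K i p" if "(i, p) \<in> Conf K" for i p
    using that unfolding conf_iff by (auto intro: reflect_kernel E.conf_kernel)
  show "is_cokernel K p i" if "(i, p) \<in> Conf K" for i p
    using that unfolding conf_iff by (auto intro: reflect_cokernel E.conf_cokernel)
  show "(j, q) \<in> Conf K" if "(i, p) \<in> Conf K" "isomorphic_seqs K (i, p) (j, q)" for i p j q
  proof -
    note ip = that(1)[unfolded conf_iff]
    from that(2) obtain a b c where *: "j \<in> Arr K" "q \<in> Arr K" "Cod K j = Dom K q" "is_iso_arr K a" "is_iso_arr K b" "is_iso_arr K c"
      "Dom K a = Dom K i" "Cod K a = Dom K j" "Dom K b = Cod K i" "Cod K b = Cod K j" "Dom K c = Cod K p" "Cod K c = Cod K q"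
      "j \<star>\<^bsub>K\<^esub> a = b \<star>\<^bsub>K\<^esub> i" "q \<star>\<^bsub>K\<^esub> b = c \<star>\<^bsub>K\<^esub> p"
      unfolding isomorphic_seqs_def by (auto simp: hom_iff)
    have abc: "a \<in> Arr K" "b \<in> Arr K" "c \<in> Arr K" "is_iso_arr E (F a)" "is_iso_arr E (F b)" "is_iso_arr E (F c)"
      using *(4-6) unfolding iso_iff by auto
    have "F (j \<star>\<^bsub>K\<^esub> a) = F (b \<star>\<^bsub>K\<^esub> i)" "F (q \<star>\<^bsub>K\<^esub> b) = F (c \<star>\<^bsub>K\<^esub> p)" by (simp_all only: *(13,14))
    moreover have "F (j \<star>\<^bsub>K\<^esub> a) = F j \<star>\<^bsub>E\<^esub> F a" by (rule K_cmp(4)) (use * abc in auto)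
    moreover have "F (b \<star>\<^bsub>K\<^esub> i) = F b \<star>\<^bsub>E\<^esub> F i" by (rule K_cmp(4)) (use * abc ip in auto)
    moreover have "F (q \<star>\<^bsub>K\<^esub> b) = F q \<star>\<^bsub>E\<^esub> F b" by (rule K_cmp(4)) (use * abc in auto)
    moreover have "F (c \<star>\<^bsub>K\<^esub> p) = F c \<star>\<^bsub>E\<^esub> F p" by (rule K_cmp(4)) (use * abc ip in auto)
    ultimately have eqs: "F j \<star>\<^bsub>E\<^esub> F a = F b \<star>\<^bsub>E\<^esub> F i" "F q \<star>\<^bsub>E\<^esub> F b = F c \<star>\<^bsub>E\<^esub> F p"
      by (simp_all only:)
    have "(F j, F q) \<in> Conf E"
      by (rule E.conf_transfer[of "F i" "F p" "F a" "F b" "F c"]) (use ip abc * eqs in simp_all)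
    then show ?thesis unfolding conf_iff using * by simp
  qed
  show "inflation K (Idn K X)" if "X \<in> Obj K" for X
    using that E.inflation_idn by (simp add: inflation_iff)
  show "deflation K (Idn K X)" if "X \<in> Obj K" for X
    using that E.deflation_idn by (simp add: deflation_iff)
  show "inflation K (j \<star>\<^bsub>K\<^esub> i)" if "inflation K i" "inflation K j" "Cod K i = Dom K j" for i j
    using that E.inflation_cmp by (auto simp: inflation_iff)
  show "deflation K (j \<star>\<^bsub>K\<^esub> i)" if "deflation K i" "deflation K j" "Cod K i = Dom K j" for i j
    using that E.deflation_cmp by (auto simp: deflation_iff)
  show "\<exists>i' f'. is_pushout K i f i' f' \<and> inflation K i'"
    if h: "inflation K i" "f \<in> Arr K" "Dom K f = Dom K i" for i f
  proof -
    have i: "i \<in> Arr K" "inflation E (F i)" using h(1) by (auto simp: inflation_iff)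
    obtain a b where ab: "is_pushout E (F i) (F f) a b"
      using E.inflation_pushout[OF i(2), of "F f"] h i by auto
    note D = E.pushoutD[OF ab]
    \<comment> \<open>Composing with the isomorphism \<open>u\<close> puts the corner of the pushout
      into the image of \<open>P\<close>, where the square can be lifted to
      \<open>K\<close>.\<close>
    obtain X u where X: "X \<in> Obj K" "is_iso_arr E u" "Dom E u = Cod E a" "Cod E u = P X"
      using ess_surj[of "Cod E a"] D by auto
    note u = E.inv_arr[OF X(2)] E.inv_arr_cmp[OF X(2)]
    obtain a' where a': "a' \<in> Arr K" "Dom K a' = Cod K f" "Cod K a' = X" "F a' = u \<star>\<^bsub>E\<^esub> a"
      by (rule full[of "u \<star>\<^bsub>E\<^esub> a" "Cod K f" X]) (use X u D h in auto)
    obtain b' where b': "b' \<in> Arr K" "Dom K b' = Cod K i" "Cod K b' = X" "F b' = u \<star>\<^bsub>E\<^esub> b"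
      by (rule full[of "u \<star>\<^bsub>E\<^esub> b" "Cod K i" X]) (use X u D i in auto)
    have po: "is_pushout E (F i) (F f) (u \<star>\<^bsub>E\<^esub> a) (u \<star>\<^bsub>E\<^esub> b)"
    proof (rule E.pushoutI)
      fix x y assume xy: "x \<in> Arr E" "y \<in> Arr E" "Dom E x = Cod E (F f)" "Dom E y = Cod E (F i)" "Cod E x = Cod E y" "x \<star>\<^bsub>E\<^esub> F f = y \<star>\<^bsub>E\<^esub> F i"
      obtain v where v: "v \<in> Arr E" "Dom E v = Cod E a" "Cod E v = Cod E x" "v \<star>\<^bsub>E\<^esub> a = x" "v \<star>\<^bsub>E\<^esub> b = y"
        by (rule E.pushout_fac[OF ab xy])
      then show "\<exists>v\<in>Arr E. Dom E v = Cod E (u \<star>\<^bsub>E\<^esub> a) \<and> Cod E v = Cod E x \<and> v \<star>\<^bsub>E\<^esub> (u \<star>\<^bsub>E\<^esub> a) = x \<and> v \<star>\<^bsub>E\<^esub> (u \<star>\<^bsub>E\<^esub> b) = y"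
        by (intro bexI[of _ "v \<star>\<^bsub>E\<^esub> inv_arr E u"]) (use u D X in auto)
    next
      fix x y assume xy: "x \<in> Arr E" "y \<in> Arr E" "Cod E x = Cod E y" "Dom E x = Cod E (u \<star>\<^bsub>E\<^esub> a)" "Dom E y = Cod E (u \<star>\<^bsub>E\<^esub> a)"
        "x \<star>\<^bsub>E\<^esub> (u \<star>\<^bsub>E\<^esub> a) = y \<star>\<^bsub>E\<^esub> (u \<star>\<^bsub>E\<^esub> a)" "x \<star>\<^bsub>E\<^esub> (u \<star>\<^bsub>E\<^esub> b) = y \<star>\<^bsub>E\<^esub> (u \<star>\<^bsub>E\<^esub> b)"
      have "x \<star>\<^bsub>E\<^esub> u = y \<star>\<^bsub>E\<^esub> u" by (rule E.pushout_eq[OF ab]) (use xy u D X in auto)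
      then show "x = y" by (rule E.iso_epi[OF X(2)]) (use xy u D X in auto)
    next
      have "u \<star>\<^bsub>E\<^esub> a \<star>\<^bsub>E\<^esub> F f = u \<star>\<^bsub>E\<^esub> b \<star>\<^bsub>E\<^esub> F i" by (simp add: D(9))
      then show "(u \<star>\<^bsub>E\<^esub> a) \<star>\<^bsub>E\<^esub> F f = (u \<star>\<^bsub>E\<^esub> b) \<star>\<^bsub>E\<^esub> F i" using u D(1-8) X by simp
    qed (use u D X in auto)
    have "is_pushout K i f a' b'"
      by (rule reflect_pushout) (use po a' b' i h in auto)
    moreover have "inflation K a'"
      using E.inflation_po[OF po i(2)] a' by (simp add: inflation_iff)
    ultimately show ?thesis by blast
  qed
  show "\<exists>p' f'. is_pullback K p f p' f' \<and> deflation K p'"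
    if h: "deflation K p" "f \<in> Arr K" "Cod K f = Cod K p" for p f
  proof -
    have i: "p \<in> Arr K" "deflation E (F p)" using h(1) by (auto simp: deflation_iff)
    obtain a b where ab: "is_pullback E (F p) (F f) a b"
      using E.deflation_pullback[OF i(2), of "F f"] h i by auto
    note D = E.pullbackD[OF ab]
    obtain X v where X: "X \<in> Obj K" "is_iso_arr E v" "Dom E v = Dom E a" "Cod E v = P X"
      using ess_surj[of "Dom E a"] D by auto
    define u where "u = inv_arr E v"
    have ui: "is_iso_arr E u" "Dom E u = P X" "Cod E u = Dom E a"
      unfolding u_def using E.iso_inv[OF X(2)] E.inv_arr[OF X(2)] X by auto
    note u = ui E.inv_arr[OF ui(1)] E.inv_arr_cmp[OF ui(1)]
    obtain a' where a': "a' \<in> Arr K" "Dom K a' = X" "Cod K a' = Dom K f" "F a' = a \<star>\<^bsub>E\<^esub> u"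
      by (rule full[of "a \<star>\<^bsub>E\<^esub> u" X "Dom K f"]) (use X u D h in auto)
    obtain b' where b': "b' \<in> Arr K" "Dom K b' = X" "Cod K b' = Dom K p" "F b' = b \<star>\<^bsub>E\<^esub> u"
      by (rule full[of "b \<star>\<^bsub>E\<^esub> u" X "Dom K p"]) (use X u D i in auto)
    have pb: "is_pullback E (F p) (F f) (a \<star>\<^bsub>E\<^esub> u) (b \<star>\<^bsub>E\<^esub> u)"
    proof (rule E.pullbackI)
      fix x y assume xy: "x \<in> Arr E" "y \<in> Arr E" "Cod E x = Dom E (F f)" "Cod E y = Dom E (F p)" "Dom E x = Dom E y" "F f \<star>\<^bsub>E\<^esub> x = F p \<star>\<^bsub>E\<^esub> y"
      obtain w where w: "w \<in> Arr E" "Dom E w = Dom E x" "Cod E w = Dom E a" "a \<star>\<^bsub>E\<^esub> w = x" "b \<star>\<^bsub>E\<^esub> w = y"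
        by (rule E.pullback_fac[OF ab xy])
      then show "\<exists>v\<in>Arr E. Dom E v = Dom E x \<and> Cod E v = Dom E (a \<star>\<^bsub>E\<^esub> u) \<and> (a \<star>\<^bsub>E\<^esub> u) \<star>\<^bsub>E\<^esub> v = x \<and> (b \<star>\<^bsub>E\<^esub> u) \<star>\<^bsub>E\<^esub> v = y"
        by (intro bexI[of _ "inv_arr E u \<star>\<^bsub>E\<^esub> w"]) (use u D X in auto)
    next
      fix x y assume xy: "x \<in> Arr E" "y \<in> Arr E" "Dom E x = Dom E y" "Cod E x = Dom E (a \<star>\<^bsub>E\<^esub> u)" "Cod E y = Dom E (a \<star>\<^bsub>E\<^esub> u)"
        "(a \<star>\<^bsub>E\<^esub> u) \<star>\<^bsub>E\<^esub> x = (a \<star>\<^bsub>E\<^esub> u) \<star>\<^bsub>E\<^esub> y" "(b \<star>\<^bsub>E\<^esub> u) \<star>\<^bsub>E\<^esub> x = (b \<star>\<^bsub>E\<^esub> u) \<star>\<^bsub>E\<^esub> y"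
      have "u \<star>\<^bsub>E\<^esub> x = u \<star>\<^bsub>E\<^esub> y" by (rule E.pullback_eq[OF ab]) (use xy u D X in auto)
      then show "x = y" by (rule E.iso_mono[OF ui(1)]) (use xy u D X in auto)
    next
      have "(F f \<star>\<^bsub>E\<^esub> a) \<star>\<^bsub>E\<^esub> u = (F p \<star>\<^bsub>E\<^esub> b) \<star>\<^bsub>E\<^esub> u" by (simp add: D(9))
      then show "F f \<star>\<^bsub>E\<^esub> a \<star>\<^bsub>E\<^esub> u = F p \<star>\<^bsub>E\<^esub> b \<star>\<^bsub>E\<^esub> u" using u D(1-8) X by simp
    qed (use u D X in auto)
    have "is_pullback K p f a' b'"
      by (rule reflect_pullback) (use pb a' b' i h in auto)
    moreover have "deflation K a'"
      using E.deflation_pb[OF pb i(2)] a' by (simp add: deflation_iff)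
    ultimately show ?thesis by blast
  qed
qed

end

section \<open>Quotients along a reflection\<close>

lemma zigzag_append:
  "zigzag C S X Y v \<Longrightarrow> zigzag C S Y Z w \<Longrightarrow> zigzag C S X Z (v @ w)"
  by (induction C S X Y v rule: zigzag.induct) auto

context category
begin

lemma zigzag_obj:
  assumes "S \<subseteq> Arr C"
  shows "zigzag C S X Y w \<Longrightarrow> X \<in> Obj C \<and> Y \<in> Obj C"
proof (induction w arbitrary: X)
  case (Cons a w)
  then show ?case using assms by (cases a) auto
qed simp

lemma zz_eq_zigzag:
  assumes S: "S \<subseteq> Arr C" and "zz_eq C S X Y v w"
  shows "zigzag C S X Y v \<and> zigzag C S X Y w"
  using assms(2)
proof induction
  case (zz_append X Y v w Z v' w')
  then show ?case by (auto intro: zigzag_append)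
qed (use S in \<open>auto simp: hom_iff\<close>)

lemma zz_arrow_eq_iff:
  assumes "zigzag C S X Y w"
  shows "zz_arrow C S X Y v = zz_arrow C S X Y w \<longleftrightarrow> zz_eq C S X Y v w"
proof
  assume "zz_arrow C S X Y v = zz_arrow C S X Y w"
  then show "zz_eq C S X Y v w" using zz_refl[OF assms] by (auto simp: zz_arrow_def)
next
  assume "zz_eq C S X Y v w"
  then show "zz_arrow C S X Y v = zz_arrow C S X Y w"
    unfolding zz_arrow_def by (auto intro: zz_trans zz_sym)
qed

lemma loc_cmp:
  assumes "zigzag C S X Y v" "zigzag C S Y Z w"
  shows "Cmp (localization C S) (zz_arrow C S Y Z w) (zz_arrow C S X Y v) = zz_arrow C S X Z (v @ w)"
  using zz_refl[OF assms(1)] zz_refl[OF assms(2)]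
  by (auto simp: localization_def zz_arrow_def intro: zz_trans zz_append)

end

text \<open>The data of a full reflective embedding \<open>R\<close> of \<open>E\<close> into
  \<open>M\<close>, with reflection \<open>L0\<close> on objects and unit \<open>\<eta>\<close>; the
  action of the reflection on arrows is derived. \<open>L_conf\<close> is exactness of the
  reflection. The embedding \<open>R\<close> is in general not exact, and \<open>conf_lift\<close>
  says that it becomes so up to an arrow of \<open>quot_arrows M A\<close>.\<close>

locale reflective_quotient = M: exact_category M + E: exact_category E
  for M :: "('o, 'm) excat" and E :: "('p, 'q) excat" +
  fixes A :: "'o set" and RO :: "'p \<Rightarrow> 'o" and R :: "'q \<Rightarrow> 'm" and L0 :: "'o \<Rightarrow> 'p" and \<eta> :: "'o \<Rightarrow> 'm"
  assumes RO_obj [simp]: "Z \<in> Obj E \<Longrightarrow> RO Z \<in> Obj M"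
    and R_arr [simp]: "f \<in> Arr E \<Longrightarrow> R f \<in> Arr M" "f \<in> Arr E \<Longrightarrow> Dom M (R f) = RO (Dom E f)"
      "f \<in> Arr E \<Longrightarrow> Cod M (R f) = RO (Cod E f)"
    and R_idn: "Z \<in> Obj E \<Longrightarrow> R (Idn E Z) = Idn M (RO Z)"
    and R_cmp: "f \<in> Arr E \<Longrightarrow> g \<in> Arr E \<Longrightarrow> Cod E f = Dom E g \<Longrightarrow> R (g \<star>\<^bsub>E\<^esub> f) = R g \<star>\<^bsub>M\<^esub> R f"
    and R_plus: "f \<in> Arr E \<Longrightarrow> g \<in> Arr E \<Longrightarrow> Dom E f = Dom E g \<Longrightarrow> Cod E f = Cod E g \<Longrightarrow> R (f \<boxplus>\<^bsub>E\<^esub> g) = R f \<boxplus>\<^bsub>M\<^esub> R g"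
    and R_full: "h \<in> Arr M \<Longrightarrow> W \<in> Obj E \<Longrightarrow> Z \<in> Obj E \<Longrightarrow> Dom M h = RO W \<Longrightarrow> Cod M h = RO Z \<Longrightarrow>
      \<exists>f \<in> Arr E. Dom E f = W \<and> Cod E f = Z \<and> R f = h"
    and R_faithful: "f \<in> Arr E \<Longrightarrow> g \<in> Arr E \<Longrightarrow> Dom E f = Dom E g \<Longrightarrow> Cod E f = Cod E g \<Longrightarrow> R f = R g \<Longrightarrow> f = g"
    and L0_obj [simp]: "X \<in> Obj M \<Longrightarrow> L0 X \<in> Obj E"
    and \<eta>_arr [simp]: "X \<in> Obj M \<Longrightarrow> \<eta> X \<in> Arr M" "X \<in> Obj M \<Longrightarrow> Dom M (\<eta> X) = X" "X \<in> Obj M \<Longrightarrow> Cod M (\<eta> X) = RO (L0 X)"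
    and \<eta>_univ: "h \<in> Arr M \<Longrightarrow> Z \<in> Obj E \<Longrightarrow> Cod M h = RO Z \<Longrightarrow>
      \<exists>f \<in> Arr E. Dom E f = L0 (Dom M h) \<and> Cod E f = Z \<and> R f \<star>\<^bsub>M\<^esub> \<eta> (Dom M h) = h"
    and \<eta>_epi: "X \<in> Obj M \<Longrightarrow> f \<in> Arr E \<Longrightarrow> g \<in> Arr E \<Longrightarrow> Dom E f = L0 X \<Longrightarrow> Dom E g = L0 X \<Longrightarrow> Cod E f = Cod E g \<Longrightarrow>
      R f \<star>\<^bsub>M\<^esub> \<eta> X = R g \<star>\<^bsub>M\<^esub> \<eta> X \<Longrightarrow> f = g"
    and \<eta>_quot: "X \<in> Obj M \<Longrightarrow> \<eta> X \<in> quot_arrows M A"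
    and A_obj: "A \<subseteq> Obj M"
    and A_zero: "X \<in> A \<Longrightarrow> is_zero_obj E (L0 X)"
    and L_conf: "(i, p) \<in> Conf M \<Longrightarrow> \<exists>a b. (a, b) \<in> Conf E \<and> Dom E a = L0 (Dom M i) \<and> Cod E a = L0 (Cod M i) \<and> Cod E b = L0 (Cod M p) \<and>
      R a \<star>\<^bsub>M\<^esub> \<eta> (Dom M i) = \<eta> (Cod M i) \<star>\<^bsub>M\<^esub> i \<and> R b \<star>\<^bsub>M\<^esub> \<eta> (Cod M i) = \<eta> (Cod M p) \<star>\<^bsub>M\<^esub> p"
    and conf_lift: "(a, b) \<in> Conf E \<Longrightarrow> \<exists>q w. (R a, q) \<in> Conf M \<and> w \<in> quot_arrows M A \<and> Dom M w = Cod M q \<and> Cod M w = RO (Cod E b) \<and> w \<star>\<^bsub>M\<^esub> q = R b"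
begin

abbreviation "\<Sigma> \<equiv> quot_arrows M A"
abbreviation "K \<equiv> exact_quot M A"

lemma \<Sigma>_arr: "\<Sigma> \<subseteq> Arr M"
  by (auto simp: quot_arrows_def)

lemma \<Sigma>_arrD [simp]: "s \<in> \<Sigma> \<Longrightarrow> s \<in> Arr M"
  using \<Sigma>_arr by auto

definition L :: "'m \<Rightarrow> 'q" where
  "L f = (THE g. g \<in> Arr E \<and> Dom E g = L0 (Dom M f) \<and> Cod E g = L0 (Cod M f) \<and>
     R g \<star>\<^bsub>M\<^esub> \<eta> (Dom M f) = \<eta> (Cod M f) \<star>\<^bsub>M\<^esub> f)"

lemma L_unique:
  assumes "f \<in> Arr M" "g \<in> Arr E" "Dom E g = L0 (Dom M f)" "Cod E g = L0 (Cod M f)"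
     "R g \<star>\<^bsub>M\<^esub> \<eta> (Dom M f) = \<eta> (Cod M f) \<star>\<^bsub>M\<^esub> f"
  shows "L f = g"
  unfolding L_def by (rule the_equality) (use assms in \<open>auto intro: \<eta>_epi[of "Dom M f"]\<close>)

lemma L_arr [simp]:
  assumes "f \<in> Arr M"
  shows "L f \<in> Arr E" "Dom E (L f) = L0 (Dom M f)" "Cod E (L f) = L0 (Cod M f)"
    and L_nat: "R (L f) \<star>\<^bsub>M\<^esub> \<eta> (Dom M f) = \<eta> (Cod M f) \<star>\<^bsub>M\<^esub> f"
proof -
  obtain g where g: "g \<in> Arr E" "Dom E g = L0 (Dom M f)" "Cod E g = L0 (Cod M f)"
     "R g \<star>\<^bsub>M\<^esub> \<eta> (Dom M f) = \<eta> (Cod M f) \<star>\<^bsub>M\<^esub> f"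
    using \<eta>_univ[of "\<eta> (Cod M f) \<star>\<^bsub>M\<^esub> f" "L0 (Cod M f)"] assms by auto
  moreover have "L f = g" using assms g by (rule L_unique)
  ultimately show "L f \<in> Arr E" "Dom E (L f) = L0 (Dom M f)" "Cod E (L f) = L0 (Cod M f)"
    "R (L f) \<star>\<^bsub>M\<^esub> \<eta> (Dom M f) = \<eta> (Cod M f) \<star>\<^bsub>M\<^esub> f" by simp_all
qed

lemma L_idn: "X \<in> Obj M \<Longrightarrow> L (Idn M X) = Idn E (L0 X)"
  by (rule L_unique) (auto simp: R_idn)

lemma L_nat': "f \<in> Arr M \<Longrightarrow> x \<in> Arr M \<Longrightarrow> Cod M x = Dom M f \<Longrightarrow>
    R (L f) \<star>\<^bsub>M\<^esub> \<eta> (Dom M f) \<star>\<^bsub>M\<^esub> x = \<eta> (Cod M f) \<star>\<^bsub>M\<^esub> f \<star>\<^bsub>M\<^esub> x"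
  using M.cmp_reduce[OF L_nat, of f x] by simp

lemma L_cmp:
  assumes "f \<in> Arr M" "g \<in> Arr M" "Cod M f = Dom M g"
  shows "L (g \<star>\<^bsub>M\<^esub> f) = L g \<star>\<^bsub>E\<^esub> L f"
proof (rule L_unique)
  have "R (L g \<star>\<^bsub>E\<^esub> L f) \<star>\<^bsub>M\<^esub> \<eta> (Dom M f) = R (L g) \<star>\<^bsub>M\<^esub> \<eta> (Cod M f) \<star>\<^bsub>M\<^esub> f"
    using assms by (simp add: R_cmp L_nat)
  then show "R (L g \<star>\<^bsub>E\<^esub> L f) \<star>\<^bsub>M\<^esub> \<eta> (Dom M (g \<star>\<^bsub>M\<^esub> f)) = \<eta> (Cod M (g \<star>\<^bsub>M\<^esub> f)) \<star>\<^bsub>M\<^esub> g \<star>\<^bsub>M\<^esub> f"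
    using assms by (simp add: L_nat')
qed (use assms in auto)

lemma L_plus:
  assumes "f \<in> Arr M" "g \<in> Arr M" "Dom M f = Dom M g" "Cod M f = Cod M g"
  shows "L (f \<boxplus>\<^bsub>M\<^esub> g) = L f \<boxplus>\<^bsub>E\<^esub> L g"
proof (rule L_unique)
  show "R (L f \<boxplus>\<^bsub>E\<^esub> L g) \<star>\<^bsub>M\<^esub> \<eta> (Dom M (f \<boxplus>\<^bsub>M\<^esub> g)) = \<eta> (Cod M (f \<boxplus>\<^bsub>M\<^esub> g)) \<star>\<^bsub>M\<^esub> (f \<boxplus>\<^bsub>M\<^esub> g)"
    using assms L_nat[of f] L_nat[of g] by (simp add: R_plus)
qed (use assms in auto)

definition LF :: "('o, 'm, 'p, 'q) ftor" where
  "LF = \<lparr>FObj = L0, FArr = L\<rparr>"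

sublocale L: exact_functor M E LF
  rewrites "FObj LF = L0" and "FArr LF = L"
proof -
  show "exact_functor M E LF"
  proof (intro exact_functor.intro exact_functor_axioms.intro M.exact_category_axioms E.exact_category_axioms)
    fix i p assume ip: "(i, p) \<in> Conf M"
    note D = M.confD[OF ip]
    obtain a b where ab: "(a, b) \<in> Conf E" "Dom E a = L0 (Dom M i)" "Cod E a = L0 (Cod M i)" "Cod E b = L0 (Cod M p)"
      "R a \<star>\<^bsub>M\<^esub> \<eta> (Dom M i) = \<eta> (Cod M i) \<star>\<^bsub>M\<^esub> i" "R b \<star>\<^bsub>M\<^esub> \<eta> (Cod M i) = \<eta> (Cod M p) \<star>\<^bsub>M\<^esub> p"
      using L_conf[OF ip] by blast
    note abD = E.confD[OF ab(1)]
    \<comment> \<open>\<open>L_conf\<close> provides some conflation for which both squares commute;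
      uniqueness in the universal property identifies its arrows with \<open>L i\<close> and
      \<open>L p\<close>.\<close>
    have "L i = a" by (rule L_unique) (use ab abD D in auto)
    moreover have "L p = b" by (rule L_unique) (use ab abD D in auto)
    ultimately show "(FArr LF i, FArr LF p) \<in> Conf E" using ab by (simp add: LF_def)
  qed (auto simp: LF_def hom_iff L_idn L_cmp L_plus)
  show "FObj LF = L0" "FArr LF = L" by (simp_all add: LF_def)
qed

lemma L_quot: "s \<in> \<Sigma> \<Longrightarrow> is_iso_arr E (L s)"
  by (rule L.F_quot_arrow) (auto simp: A_zero)

section \<open>The counit of the reflection\<close>

lemma counit_ex:
  assumes "Z \<in> Obj E"
  shows "\<exists>f \<in> Arr E. Dom E f = L0 (RO Z) \<and> Cod E f = Z \<and> R f \<star>\<^bsub>M\<^esub> \<eta> (RO Z) = Idn M (RO Z)"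
  using \<eta>_univ[of "Idn M (RO Z)" Z] assms by simp

definition \<epsilon> :: "'p \<Rightarrow> 'q" where
  "\<epsilon> Z = (SOME f. f \<in> Arr E \<and> Dom E f = L0 (RO Z) \<and> Cod E f = Z \<and> R f \<star>\<^bsub>M\<^esub> \<eta> (RO Z) = Idn M (RO Z))"

lemma \<epsilon>_arr [simp]:
  assumes "Z \<in> Obj E"
  shows "\<epsilon> Z \<in> Arr E" "Dom E (\<epsilon> Z) = L0 (RO Z)" "Cod E (\<epsilon> Z) = Z"
    and \<epsilon>_\<eta>: "R (\<epsilon> Z) \<star>\<^bsub>M\<^esub> \<eta> (RO Z) = Idn M (RO Z)"
  using someI_ex[OF counit_ex[OF assms, unfolded Bex_def], folded \<epsilon>_def] by auto

text \<open>Fullness of \<open>R\<close> makes the unit at \<open>RO Z\<close> equal to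
  \<open>R g\<close> for some \<open>g\<close>, and this \<open>g\<close> inverts the
  counit.\<close>

lemma \<epsilon>_iso:
  assumes Z: "Z \<in> Obj E"
  shows "is_iso_arr E (\<epsilon> Z)"
proof -
  obtain g where g: "g \<in> Arr E" "Dom E g = Z" "Cod E g = L0 (RO Z)" "R g = \<eta> (RO Z)"
    using R_full[of "\<eta> (RO Z)" Z "L0 (RO Z)"] Z by auto
  have "g \<star>\<^bsub>E\<^esub> \<epsilon> Z = Idn E (L0 (RO Z))"
    by (rule \<eta>_epi[of "RO Z"]) (use g Z in \<open>simp_all add: R_cmp R_idn \<epsilon>_\<eta>\<close>)
  moreover have "\<epsilon> Z \<star>\<^bsub>E\<^esub> g = Idn E Z"
    by (rule R_faithful) (use g Z in \<open>simp_all add: R_cmp R_idn \<epsilon>_\<eta>\<close>)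
  ultimately show ?thesis by (intro E.iso_arrI[of _ g]) (use g Z in auto)
qed

lemma \<epsilon>_nat:
  assumes f: "f \<in> Arr E"
  shows "f \<star>\<^bsub>E\<^esub> \<epsilon> (Dom E f) = \<epsilon> (Cod E f) \<star>\<^bsub>E\<^esub> L (R f)"
proof (rule \<eta>_epi[of "RO (Dom E f)"])
  have "R (L (R f)) \<star>\<^bsub>M\<^esub> \<eta> (RO (Dom E f)) = \<eta> (RO (Cod E f)) \<star>\<^bsub>M\<^esub> R f"
    using L_nat[of "R f"] f by simp
  then show "R (f \<star>\<^bsub>E\<^esub> \<epsilon> (Dom E f)) \<star>\<^bsub>M\<^esub> \<eta> (RO (Dom E f)) = R (\<epsilon> (Cod E f) \<star>\<^bsub>E\<^esub> L (R f)) \<star>\<^bsub>M\<^esub> \<eta> (RO (Dom E f))"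
    using f by (simp add: R_cmp \<epsilon>_\<eta> \<epsilon>_\<eta>[THEN M.cmp_reduce])
qed (use f in auto)

lemma \<epsilon>_L\<eta>:
  assumes X: "X \<in> Obj M"
  shows "\<epsilon> (L0 X) \<star>\<^bsub>E\<^esub> L (\<eta> X) = Idn E (L0 X)"
proof (rule \<eta>_epi[of X])
  have "R (L (\<eta> X)) \<star>\<^bsub>M\<^esub> \<eta> X = \<eta> (RO (L0 X)) \<star>\<^bsub>M\<^esub> \<eta> X"
    using L_nat[of "\<eta> X"] X by simp
  then show "R (\<epsilon> (L0 X) \<star>\<^bsub>E\<^esub> L (\<eta> X)) \<star>\<^bsub>M\<^esub> \<eta> X = R (Idn E (L0 X)) \<star>\<^bsub>M\<^esub> \<eta> X"
    using X by (simp add: R_cmp R_idn \<epsilon>_\<eta>[THEN M.cmp_reduce])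
qed (use X in auto)

text \<open>After composing with the invertible counit both sides become \<open>f\<close>, by
  naturality of the counit and the triangle identity \<open>\<epsilon>_L\<eta>\<close>.\<close>

lemma L\<eta>_nat:
  assumes f: "f \<in> Arr E" "Dom E f = L0 X" "Cod E f = L0 Y" and XY: "X \<in> Obj M" "Y \<in> Obj M"
  shows "L (R f) \<star>\<^bsub>E\<^esub> L (\<eta> X) = L (\<eta> Y) \<star>\<^bsub>E\<^esub> f"
proof (rule E.iso_mono[OF \<epsilon>_iso[of "L0 Y"]])
  have e: "f \<star>\<^bsub>E\<^esub> \<epsilon> (L0 X) = \<epsilon> (L0 Y) \<star>\<^bsub>E\<^esub> L (R f)"
    using \<epsilon>_nat[OF f(1)] f by simp
  have "\<epsilon> (L0 Y) \<star>\<^bsub>E\<^esub> L (R f) \<star>\<^bsub>E\<^esub> L (\<eta> X) = f"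
    using e[symmetric, THEN E.cmp_reduce, of "L (\<eta> X)"] f XY by (simp add: \<epsilon>_L\<eta>)
  moreover have "\<epsilon> (L0 Y) \<star>\<^bsub>E\<^esub> L (\<eta> Y) \<star>\<^bsub>E\<^esub> f = f"
    using \<epsilon>_L\<eta>[OF XY(2), THEN E.cmp_reduce, of f] f XY by simp
  ultimately show "\<epsilon> (L0 Y) \<star>\<^bsub>E\<^esub> L (R f) \<star>\<^bsub>E\<^esub> L (\<eta> X) = \<epsilon> (L0 Y) \<star>\<^bsub>E\<^esub> L (\<eta> Y) \<star>\<^bsub>E\<^esub> f" by simp
qed (use f XY in auto)

section \<open>Zigzags and their values in \<open>E\<close>\<close>

fun ev :: "'o \<Rightarrow> 'm step list \<Rightarrow> 'q" where
  "ev Y [] = Idn E (L0 Y)"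
| "ev Y (Fwd f # w) = ev Y w \<star>\<^bsub>E\<^esub> L f"
| "ev Y (Bwd s # w) = ev Y w \<star>\<^bsub>E\<^esub> inv_arr E (L s)"

lemma inv_L [simp]:
  assumes "s \<in> \<Sigma>"
  shows "inv_arr E (L s) \<in> Arr E" "Dom E (inv_arr E (L s)) = L0 (Cod M s)" "Cod E (inv_arr E (L s)) = L0 (Dom M s)"
    "inv_arr E (L s) \<star>\<^bsub>E\<^esub> L s = Idn E (L0 (Dom M s))" "L s \<star>\<^bsub>E\<^esub> inv_arr E (L s) = Idn E (L0 (Cod M s))"
  using E.inv_arr[OF L_quot[OF assms]] assms by auto

lemma ev_arr:
  "zigzag M \<Sigma> X Y w \<Longrightarrow> ev Y w \<in> Arr E \<and> Dom E (ev Y w) = L0 X \<and> Cod E (ev Y w) = L0 Y"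
proof (induction w arbitrary: X)
  case (Cons a w)
  then show ?case by (cases a) (fastforce)+
qed auto

lemma ev_append:
  assumes "zigzag M \<Sigma> Y Z w"
  shows "zigzag M \<Sigma> X Y v \<Longrightarrow> ev Z (v @ w) = ev Z w \<star>\<^bsub>E\<^esub> ev Y v"
proof (induction v arbitrary: X)
  case Nil
  then show ?case using ev_arr[OF assms] by auto
next
  case (Cons a v)
  show ?case
  proof (cases a)
    case (Fwd f)
    with Cons.prems have z: "zigzag M \<Sigma> (Cod M f) Y v" and f: "f \<in> Arr M" by auto
    show ?thesis using Cons.IH[OF z] ev_arr[OF z] ev_arr[OF assms] f Fwd by simp
  next
    case (Bwd f)
    with Cons.prems have z: "zigzag M \<Sigma> (Dom M f) Y v" and f: "f \<in> \<Sigma>" by auto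
    show ?thesis using Cons.IH[OF z] ev_arr[OF z] ev_arr[OF assms] f Bwd by simp
  qed
qed

text \<open>Each generator of the congruence is respected because \<open>L\<close> is a functor that
  inverts \<open>\<Sigma>\<close>.\<close>

lemma ev_zz_eq: "zz_eq M \<Sigma> X Y v w \<Longrightarrow> ev Y v = ev Y w"
proof (induction rule: zz_eq.induct)
  case (zz_append X Y v w Z v' w')
  then show ?case
    using M.zz_eq_zigzag[OF \<Sigma>_arr zz_append(1)] M.zz_eq_zigzag[OF \<Sigma>_arr zz_append(2)]
    by (metis ev_append)
qed (auto simp: hom_iff L_idn L_cmp)

lemma zigzag_\<Sigma>_obj: "zigzag M \<Sigma> X Y w \<Longrightarrow> X \<in> Obj M \<and> Y \<in> Obj M"
  by (rule M.zigzag_obj[OF \<Sigma>_arr])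

text \<open>A zigzag is determined by its value \<^term>\<open>ev\<close> in \<^term>\<open>E\<close>, since it is congruent to the normal
  form below.\<close>

abbreviation normal :: "'o \<Rightarrow> 'o \<Rightarrow> 'q \<Rightarrow> 'm step list" where
  "normal X Y g \<equiv> [Fwd (\<eta> X), Fwd (R g), Bwd (\<eta> Y)]"

abbreviation zz :: "'o \<Rightarrow> 'o \<Rightarrow> 'm step list \<Rightarrow> 'm step list \<Rightarrow> bool" where
  "zz \<equiv> zz_eq M \<Sigma>"

lemma zigzag_normal:
  "X \<in> Obj M \<Longrightarrow> Y \<in> Obj M \<Longrightarrow> g \<in> Arr E \<Longrightarrow> Dom E g = L0 X \<Longrightarrow> Cod E g = L0 Y \<Longrightarrow> zigzag M \<Sigma> X Y (normal X Y g)"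
  by (simp add: \<eta>_quot)

lemma ev_normal:
  assumes "X \<in> Obj M" "Y \<in> Obj M" "g \<in> Arr E" "Dom E g = L0 X" "Cod E g = L0 Y"
  shows "ev Y (normal X Y g) = g"
proof -
  have "ev Y (normal X Y g) = inv_arr E (L (\<eta> Y)) \<star>\<^bsub>E\<^esub> (L (R g) \<star>\<^bsub>E\<^esub> L (\<eta> X))"
    using assms by (simp add: \<eta>_quot)
  also have "\<dots> = g"
    unfolding L\<eta>_nat[OF assms(3-5) assms(1,2)]
    using assms inv_L(4)[OF \<eta>_quot[OF assms(2)], THEN E.cmp_reduce, of g] by (simp add: \<eta>_quot)
  finally show ?thesis .
qed

lemma zz_ctx: "zz X Y u v \<Longrightarrow> zigzag M \<Sigma> W X a \<Longrightarrow> zigzag M \<Sigma> Y Z b \<Longrightarrow> zz W Z (a @ u @ b) (a @ v @ b)"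
  by (intro zz_append zz_refl)

lemma zz_Fwd2:
  assumes "f \<in> Arr M" "g \<in> Arr M" "h \<in> Arr M" "k \<in> Arr M" "Cod M f = Dom M g" "Cod M h = Dom M k"
    "Dom M f = Dom M h" "Cod M g = Cod M k" "g \<star>\<^bsub>M\<^esub> f = k \<star>\<^bsub>M\<^esub> h"
  shows "zz (Dom M f) (Cod M g) [Fwd f, Fwd g] [Fwd h, Fwd k]"
proof -
  have "zz (Dom M f) (Cod M g) [Fwd f, Fwd g] [Fwd (k \<star>\<^bsub>M\<^esub> h)]"
    using zz_cmp[of f M "Dom M f" "Cod M f" g "Cod M g" \<Sigma>] assms by (simp add: hom_iff)
  moreover have "zz (Dom M f) (Cod M g) [Fwd h, Fwd k] [Fwd (k \<star>\<^bsub>M\<^esub> h)]"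
    using zz_cmp[of h M "Dom M f" "Cod M h" k "Cod M g" \<Sigma>] assms by (simp add: hom_iff)
  ultimately show ?thesis by (blast intro: zz_trans zz_sym)
qed

lemma R_Fwd: 
  assumes "f \<in> Arr E" "g \<in> Arr E" "Cod E f = Dom E g"
  shows "zz (RO (Dom E f)) (RO (Cod E g)) [Fwd (R f), Fwd (R g)] [Fwd (R (g \<star>\<^bsub>E\<^esub> f))]"
  unfolding R_cmp[OF assms] by (rule zz_cmp) (use assms in \<open>auto simp: hom_iff\<close>)

text \<open>Induction on the zigzag, pushing its first step through the normal form of the rest.
  Naturality of the unit turns a forward \<open>f\<close> into \<open>R (L f)\<close>, which merges
  with the representable arrow; a backward \<open>s\<close> becomes \<open>R\<close> of the inverse
  of \<open>L s\<close>.\<close>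

lemma zz_normal: "zigzag M \<Sigma> X Y w \<Longrightarrow> zz X Y w (normal X Y (ev Y w))"
proof (induction w arbitrary: X)
  case Nil
  then have X: "X \<in> Obj M" "Y = X" by auto
  have "zz X X ([Fwd (\<eta> X)] @ [Fwd (R (Idn E (L0 X)))] @ [Bwd (\<eta> X)]) ([Fwd (\<eta> X)] @ [] @ [Bwd (\<eta> X)])"
    unfolding R_idn[OF L0_obj[OF X(1)]]
    by (rule zz_ctx[OF zz_idn]) (use X in \<open>auto simp: \<eta>_quot\<close>)
  moreover have "zz X X [Fwd (\<eta> X), Bwd (\<eta> X)] []"
    by (rule zz_fwd_bwd) (use X in \<open>auto simp: \<eta>_quot hom_iff\<close>)
  ultimately show ?case using X by (auto intro: zz_sym zz_trans)
next
  case (Cons a w)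
  show ?case
  proof (cases a)
    case (Fwd f)
    with Cons.prems have f: "f \<in> Arr M" "Dom M f = X" and w: "zigzag M \<Sigma> (Cod M f) Y w" by auto
    let ?g = "ev Y w" and ?X = "Cod M f"
    note g = ev_arr[OF w] and Y = zigzag_\<Sigma>_obj[OF w]
    have "zz X Y ([Fwd f] @ w @ []) ([Fwd f] @ normal ?X Y ?g @ [])"
      by (rule zz_ctx[OF Cons.IH[OF w]]) (use f Y in auto)
    moreover have "zz X Y ([] @ [Fwd f, Fwd (\<eta> ?X)] @ [Fwd (R ?g), Bwd (\<eta> Y)]) ([] @ [Fwd (\<eta> X), Fwd (R (L f))] @ [Fwd (R ?g), Bwd (\<eta> Y)])"
      by (rule zz_ctx[of X "RO (L0 ?X)"])
        (use zz_Fwd2[of f "\<eta> ?X" "\<eta> X" "R (L f)"] L_nat[OF f(1)] f g Y in \<open>auto simp: \<eta>_quot\<close>)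
    moreover have "zz X Y ([Fwd (\<eta> X)] @ [Fwd (R (L f)), Fwd (R ?g)] @ [Bwd (\<eta> Y)]) ([Fwd (\<eta> X)] @ [Fwd (R (?g \<star>\<^bsub>E\<^esub> L f))] @ [Bwd (\<eta> Y)])"
      by (rule zz_ctx[of "RO (L0 X)" "RO (L0 Y)"])
        (use R_Fwd[of "L f" ?g] f g Y in \<open>auto simp: \<eta>_quot\<close>)
    ultimately show ?thesis using Fwd by (auto intro: zz_trans)
  next
    case (Bwd s)
    with Cons.prems have s: "s \<in> \<Sigma>" "Cod M s = X" and w: "zigzag M \<Sigma> (Dom M s) Y w" by auto
    let ?g = "ev Y w" and ?X = "Dom M s" and ?i = "inv_arr E (L s)"
    note g = ev_arr[OF w] and Y = zigzag_\<Sigma>_obj[OF w]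
    have sA: "s \<in> Arr M" using s by simp
    have X: "X \<in> Obj M" using s sA by auto
    have "zz X Y ([Bwd s] @ w @ []) ([Bwd s] @ normal ?X Y ?g @ [])"
      by (rule zz_ctx[OF Cons.IH[OF w]]) (use s Y in auto)
    \<comment> \<open>It suffices to compare both sides after a forward step along \<open>s\<close>,
      which \<open>Bwd s\<close> cancels. There naturality of the unit trades the unit after
      \<open>s\<close> for \<open>R (L s)\<close> after the unit, and \<open>R ?i\<close> cancels
      \<open>R (L s)\<close>.\<close>
    moreover have "zz X Y ([Bwd s] @ [Fwd (\<eta> ?X)] @ [Fwd (R ?g), Bwd (\<eta> Y)]) ([] @ [Fwd (\<eta> X), Fwd (R ?i)] @ [Fwd (R ?g), Bwd (\<eta> Y)])"
    proof -
      have "R (L s) \<star>\<^bsub>M\<^esub> \<eta> ?X = \<eta> X \<star>\<^bsub>M\<^esub> s" using L_nat[OF sA] s by simp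
      then have 1: "zz ?X (RO (L0 X)) [Fwd s, Fwd (\<eta> X)] [Fwd (\<eta> ?X), Fwd (R (L s))]"
        using zz_Fwd2[of s "\<eta> X" "\<eta> ?X" "R (L s)"] s sA X by auto
      have "zz (RO (L0 ?X)) (RO (L0 ?X)) [Fwd (R (L s)), Fwd (R ?i)] [Fwd (R (Idn E (L0 ?X)))]"
        using R_Fwd[of "L s" ?i] s sA by simp
      moreover have "zz (RO (L0 ?X)) (RO (L0 ?X)) [Fwd (R (Idn E (L0 ?X)))] []"
        unfolding R_idn[OF L0_obj[OF conjunct1[OF Y]]] using Y by (intro zz_idn) auto
      ultimately have "zz (RO (L0 ?X)) (RO (L0 ?X)) [Fwd (R (L s)), Fwd (R ?i)] []" by (rule zz_trans)
      then have "zz ?X (RO (L0 ?X)) ([Fwd (\<eta> ?X)] @ [Fwd (R (L s)), Fwd (R ?i)] @ []) ([Fwd (\<eta> ?X)] @ [] @ [])"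
        by (rule zz_ctx) (use Y in auto)
      moreover have "zz ?X (RO (L0 ?X)) ([] @ [Fwd s, Fwd (\<eta> X)] @ [Fwd (R ?i)]) ([] @ [Fwd (\<eta> ?X), Fwd (R (L s))] @ [Fwd (R ?i)])"
        by (rule zz_ctx[OF 1]) (use s Y X in auto)
      ultimately have 2: "zz ?X (RO (L0 ?X)) [Fwd s, Fwd (\<eta> X), Fwd (R ?i)] [Fwd (\<eta> ?X)]"
        by (auto intro: zz_trans)
      have "zz X (RO (L0 ?X)) ([Bwd s] @ [Fwd s, Fwd (\<eta> X), Fwd (R ?i)] @ []) ([Bwd s] @ [Fwd (\<eta> ?X)] @ [])"
        by (rule zz_ctx[OF 2]) (use s Y in auto)
      moreover have "zz X (RO (L0 ?X)) ([] @ [Bwd s, Fwd s] @ [Fwd (\<eta> X), Fwd (R ?i)]) ([] @ [] @ [Fwd (\<eta> X), Fwd (R ?i)])"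
        by (rule zz_ctx[OF zz_bwd_fwd[OF s(1)]]) (use s sA X Y in \<open>auto simp: hom_iff\<close>)
      ultimately have "zz X (RO (L0 ?X)) ([Bwd s] @ [Fwd (\<eta> ?X)]) [Fwd (\<eta> X), Fwd (R ?i)]"
        by (auto intro: zz_trans zz_sym)
      from zz_ctx[OF this, of X "[]" Y "[Fwd (R ?g), Bwd (\<eta> Y)]"] show ?thesis
        using X Y g by (simp add: \<eta>_quot)
    qed
    moreover have "zz X Y ([Fwd (\<eta> X)] @ [Fwd (R ?i), Fwd (R ?g)] @ [Bwd (\<eta> Y)]) ([Fwd (\<eta> X)] @ [Fwd (R (?g \<star>\<^bsub>E\<^esub> ?i))] @ [Bwd (\<eta> Y)])"
      by (rule zz_ctx[of "RO (L0 X)" "RO (L0 Y)"])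
        (use R_Fwd[of ?i ?g] s g Y X in \<open>auto simp: \<eta>_quot\<close>)
    ultimately show ?thesis using Bwd by (auto intro: zz_trans)
  qed
qed

text \<open>Equality of arrows of the localization is thereby decided in \<open>E\<close>; this
  takes the place of a calculus of fractions.\<close>

lemma zz_iff_ev:
  assumes "zigzag M \<Sigma> X Y v" "zigzag M \<Sigma> X Y w"
  shows "zz X Y v w \<longleftrightarrow> ev Y v = ev Y w"
  using ev_zz_eq zz_normal[OF assms(1)] zz_normal[OF assms(2)] by (metis zz_trans zz_sym)

section \<open>The quotient category and its comparison with \<open>E\<close>\<close>

abbreviation cl :: "'o \<Rightarrow> 'o \<Rightarrow> 'm step list \<Rightarrow> 'o \<times> 'o \<times> 'm step list set" where
  "cl \<equiv> zz_arrow M \<Sigma>"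

abbreviation Q :: "'m \<Rightarrow> 'o \<times> 'o \<times> 'm step list set" where
  "Q f \<equiv> cl (Dom M f) (Cod M f) [Fwd f]"

text \<open>The functor on the localization induced by \<open>L\<close>, computed on a chosen
  representative; by \<open>ev_zz_eq\<close> the choice does not matter.\<close>

definition \<Phi> :: "'o \<times> 'o \<times> 'm step list set \<Rightarrow> 'q" where
  "\<Phi> = (\<lambda>(X, Y, W). ev Y (SOME w. w \<in> W))"

lemma \<Phi>_cl:
  assumes "zigzag M \<Sigma> X Y w"
  shows "\<Phi> (cl X Y w) = ev Y w"
proof -
  have "zz X Y w (SOME v. zz X Y w v)" by (rule someI[of "zz X Y w", OF zz_refl[OF assms]])
  then show ?thesis unfolding \<Phi>_def zz_arrow_def using ev_zz_eq by simp
qed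

lemma K_simps [simp]:
  "Obj K = Obj M" "Dom K (cl X Y w) = X" "Cod K (cl X Y w) = Y" "Idn K X = cl X X []"
  "Zero K X Y = Q (Zero M X Y)"
  by (simp_all add: exact_quot_def Let_def localization_def zz_arrow_def loc_ftor_def)

lemma K_Arr: "Arr K = {cl X Y w |X Y w. zigzag M \<Sigma> X Y w}"
  by (simp add: exact_quot_def Let_def localization_def)

lemma K_cmp: "zigzag M \<Sigma> X Y v \<Longrightarrow> zigzag M \<Sigma> Y Z w \<Longrightarrow> cl Y Z w \<star>\<^bsub>K\<^esub> cl X Y v = cl X Z (v @ w)"
  using M.loc_cmp[of \<Sigma> X Y v Z w] by (simp add: exact_quot_def Let_def)

lemma K_arrE:
  assumes "x \<in> Arr K"
  obtains w where "zigzag M \<Sigma> (Dom K x) (Cod K x) w" "x = cl (Dom K x) (Cod K x) w" "\<Phi> x = ev (Cod K x) w"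
  using assms unfolding K_Arr by (auto simp: \<Phi>_cl)

lemma cl_arr [simp]: "zigzag M \<Sigma> X Y w \<Longrightarrow> cl X Y w \<in> Arr K"
  unfolding K_Arr by auto

lemma \<Phi>_arr:
  assumes "x \<in> Arr K"
  shows "Dom K x \<in> Obj M" "Cod K x \<in> Obj M" "\<Phi> x \<in> Arr E" "Dom E (\<Phi> x) = L0 (Dom K x)" "Cod E (\<Phi> x) = L0 (Cod K x)"
  using K_arrE[OF assms] ev_arr zigzag_\<Sigma>_obj by metis+

lemma \<Phi>_faithful:
  assumes "x \<in> Arr K" "y \<in> Arr K" "Dom K x = Dom K y" "Cod K x = Cod K y" "\<Phi> x = \<Phi> y"
  shows "x = y"
proof -
  obtain v where v: "zigzag M \<Sigma> (Dom K x) (Cod K x) v" "x = cl (Dom K x) (Cod K x) v" "\<Phi> x = ev (Cod K x) v"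
    using assms(1) by (rule K_arrE)
  obtain w where w: "zigzag M \<Sigma> (Dom K y) (Cod K y) w" "y = cl (Dom K y) (Cod K y) w" "\<Phi> y = ev (Cod K y) w"
    using assms(2) by (rule K_arrE)
  have "zz (Dom K y) (Cod K y) v w" using v w assms(3-5) zz_iff_ev by metis
  then show ?thesis using M.zz_arrow_eq_iff[OF w(1)] v(2) w(2) assms(3,4) by metis
qed

lemma Q_arr [simp]:
  assumes "f \<in> Arr M"
  shows "Q f \<in> Arr K" "\<Phi> (Q f) = L f"
  using assms \<Phi>_cl[of "Dom M f" "Cod M f" "[Fwd f]"] by auto

lemma \<Phi>_Fwd [simp]: "f \<in> Arr M \<Longrightarrow> Dom M f = X \<Longrightarrow> Cod M f = Y \<Longrightarrow> \<Phi> (cl X Y [Fwd f]) = L f"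
  using Q_arr(2)[of f] by simp

lemma L_zero: "X \<in> Obj M \<Longrightarrow> Y \<in> Obj M \<Longrightarrow> L (Zero M X Y) = Zero E (L0 X) (L0 Y)"
  using L_plus[of "Zero M X Y" "Zero M X Y"] E.plus_eq_self[of "L (Zero M X Y)"] by simp

lemma frac:
  assumes "s \<in> \<Sigma>" "f \<in> Arr M" "Cod M f = Cod M s"
  shows "loc_frac M \<Sigma> s f \<in> Arr K" "Dom K (loc_frac M \<Sigma> s f) = Dom M f" "Cod K (loc_frac M \<Sigma> s f) = Dom M s"
    "\<Phi> (loc_frac M \<Sigma> s f) = inv_arr E (L s) \<star>\<^bsub>E\<^esub> L f"
proof -
  have z: "zigzag M \<Sigma> (Dom M f) (Dom M s) [Fwd f, Bwd s]" using assms by simp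
  show "loc_frac M \<Sigma> s f \<in> Arr K" "Dom K (loc_frac M \<Sigma> s f) = Dom M f" "Cod K (loc_frac M \<Sigma> s f) = Dom M s"
    "\<Phi> (loc_frac M \<Sigma> s f) = inv_arr E (L s) \<star>\<^bsub>E\<^esub> L f"
    unfolding loc_frac_def using \<Phi>_cl[OF z] z assms by auto
qed

text \<open>Every arrow is a fraction whose denominator is the unit at its target, so parallel
  arrows always share this denominator.\<close>

lemma frac_normal:
  assumes "x \<in> Arr K"
  shows "x = loc_frac M \<Sigma> (\<eta> (Cod K x)) (R (\<Phi> x) \<star>\<^bsub>M\<^esub> \<eta> (Dom K x))"
proof (rule \<Phi>_faithful)
  note X = \<Phi>_arr[OF assms]
  note F = frac[OF \<eta>_quot[OF X(2)], of "R (\<Phi> x) \<star>\<^bsub>M\<^esub> \<eta> (Dom K x)"]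
  have "inv_arr E (L (\<eta> (Cod K x))) \<star>\<^bsub>E\<^esub> L (R (\<Phi> x)) \<star>\<^bsub>E\<^esub> L (\<eta> (Dom K x)) = \<Phi> x"
    unfolding L\<eta>_nat[OF X(3-5,1,2)]
    using X inv_L(4)[OF \<eta>_quot[OF X(2)], THEN E.cmp_reduce, of "\<Phi> x"] by (simp add: \<eta>_quot)
  with F X show "\<Phi> x = \<Phi> (loc_frac M \<Sigma> (\<eta> (Cod K x)) (R (\<Phi> x) \<star>\<^bsub>M\<^esub> \<eta> (Dom K x)))"
    by (simp add: L_cmp)
qed (use \<Phi>_arr[OF assms] frac[OF \<eta>_quot[OF \<Phi>_arr(2)[OF assms]], of "R (\<Phi> x) \<star>\<^bsub>M\<^esub> \<eta> (Dom K x)"] assms in auto)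

text \<open>The definite description in \<open>Plus\<close> is met by the sum over the common
  denominator of \<open>frac_normal\<close>. It is met only once, since every candidate has the
  value \<open>\<Phi> x \<boxplus> \<Phi> y\<close> in \<open>E\<close> and \<open>\<Phi>\<close> is
  faithful.\<close>

lemma K_plus:
  assumes x: "x \<in> Arr K" and y: "y \<in> Arr K" and xy: "Dom K x = Dom K y" "Cod K x = Cod K y"
  shows "x \<boxplus>\<^bsub>K\<^esub> y \<in> Arr K \<and> Dom K (x \<boxplus>\<^bsub>K\<^esub> y) = Dom K y \<and> Cod K (x \<boxplus>\<^bsub>K\<^esub> y) = Cod K y \<and> \<Phi> (x \<boxplus>\<^bsub>K\<^esub> y) = \<Phi> x \<boxplus>\<^bsub>E\<^esub> \<Phi> y"
proof -
  define P where "P z \<longleftrightarrow> (\<exists>s \<in> \<Sigma>. \<exists>f \<in> Arr M. \<exists>g \<in> Arr M.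
         Dom M f = Dom M g \<and> Cod M f = Cod M s \<and> Cod M g = Cod M s \<and>
         x = loc_frac M \<Sigma> s f \<and> y = loc_frac M \<Sigma> s g \<and> z = loc_frac M \<Sigma> s (f \<boxplus>\<^bsub>M\<^esub> g))" for z
  have e: "x \<boxplus>\<^bsub>K\<^esub> y = (THE z. P z)"
    by (simp add: exact_quot_def Let_def P_def)
  have P: "z \<in> Arr K \<and> Dom K z = Dom K y \<and> Cod K z = Cod K y \<and> \<Phi> z = \<Phi> x \<boxplus>\<^bsub>E\<^esub> \<Phi> y" if Pz: "P z" for z
  proof -
    obtain s f g where s: "s \<in> \<Sigma>" and f: "f \<in> Arr M" and g: "g \<in> Arr M" and t: "Dom M f = Dom M g" "Cod M f = Cod M s" "Cod M g = Cod M s"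
      and eq: "x = loc_frac M \<Sigma> s f" "y = loc_frac M \<Sigma> s g" "z = loc_frac M \<Sigma> s (f \<boxplus>\<^bsub>M\<^esub> g)"
      using Pz unfolding P_def by blast
    have h: "f \<boxplus>\<^bsub>M\<^esub> g \<in> Arr M" "Dom M (f \<boxplus>\<^bsub>M\<^esub> g) = Dom M g" "Cod M (f \<boxplus>\<^bsub>M\<^esub> g) = Cod M s" using f g t by auto
    show ?thesis unfolding eq using frac[OF s f t(2)] frac[OF s g t(3)] frac[OF s h(1,3)] f g t h(2) s
      by (simp add: L_plus)
  qed
  note X = \<Phi>_arr[OF x] and Y = \<Phi>_arr[OF y]
  have Pw: "P (loc_frac M \<Sigma> (\<eta> (Cod K x)) (R (\<Phi> x) \<star>\<^bsub>M\<^esub> \<eta> (Dom K x) \<boxplus>\<^bsub>M\<^esub> R (\<Phi> y) \<star>\<^bsub>M\<^esub> \<eta> (Dom K y)))"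
    unfolding P_def
  proof (intro bexI conjI)
    show "x = loc_frac M \<Sigma> (\<eta> (Cod K x)) (R (\<Phi> x) \<star>\<^bsub>M\<^esub> \<eta> (Dom K x))" by (rule frac_normal[OF x])
    show "y = loc_frac M \<Sigma> (\<eta> (Cod K x)) (R (\<Phi> y) \<star>\<^bsub>M\<^esub> \<eta> (Dom K y))" unfolding xy(2) by (rule frac_normal[OF y])
  qed (use X Y xy \<eta>_quot in auto)
  from Pw have "P (x \<boxplus>\<^bsub>K\<^esub> y)" unfolding e
  proof (rule theI)
    fix z assume z: "P z"
    show "z = loc_frac M \<Sigma> (\<eta> (Cod K x)) (R (\<Phi> x) \<star>\<^bsub>M\<^esub> \<eta> (Dom K x) \<boxplus>\<^bsub>M\<^esub> R (\<Phi> y) \<star>\<^bsub>M\<^esub> \<eta> (Dom K y))"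
      using P[OF z] P[OF Pw] by (intro \<Phi>_faithful) simp_all
  qed
  then show ?thesis by (rule P)
qed

text \<open>Fullness is the normal form with a prescribed middle arrow, and essential surjectivity
  is the counit.\<close>

lemma \<Phi>_fully_faithful: "fully_faithful K E L0 \<Phi>"
proof (intro fully_faithful.intro fully_faithful_axioms.intro E.additive_category_axioms)
  fix f g assume fg: "f \<in> Arr K" "g \<in> Arr K" "Cod K f = Dom K g"
  obtain v where v: "zigzag M \<Sigma> (Dom K f) (Cod K f) v" "f = cl (Dom K f) (Cod K f) v" "\<Phi> f = ev (Cod K f) v"
    using fg(1) by (rule K_arrE)
  obtain w where w: "zigzag M \<Sigma> (Dom K g) (Cod K g) w" "g = cl (Dom K g) (Cod K g) w" "\<Phi> g = ev (Cod K g) w"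
    using fg(2) by (rule K_arrE)
  have z: "zigzag M \<Sigma> (Dom K f) (Cod K g) (v @ w)" using v(1) w(1) fg(3) by (auto intro: zigzag_append)
  have e: "g \<star>\<^bsub>K\<^esub> f = cl (Dom K f) (Cod K g) (v @ w)"
    using K_cmp[OF v(1), of "Cod K g" w] v(2) w(1,2) fg(3) by metis
  show "g \<star>\<^bsub>K\<^esub> f \<in> Arr K" "Dom K (g \<star>\<^bsub>K\<^esub> f) = Dom K f" "Cod K (g \<star>\<^bsub>K\<^esub> f) = Cod K g"
    unfolding e using z by simp_all
  show "\<Phi> (g \<star>\<^bsub>K\<^esub> f) = \<Phi> g \<star>\<^bsub>E\<^esub> \<Phi> f"
    unfolding e \<Phi>_cl[OF z] using ev_append[OF w(1), of "Dom K f" v] v(1,3) w(3) fg(3) by simp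
next
  fix h X Y assume h: "h \<in> Arr E" "X \<in> Obj K" "Y \<in> Obj K" "Dom E h = L0 X" "Cod E h = L0 Y"
  then have XY: "X \<in> Obj M" "Y \<in> Obj M" by auto
  note z = zigzag_normal[OF XY h(1,4,5)]
  show "\<exists>f\<in>Arr K. Dom K f = X \<and> Cod K f = Y \<and> \<Phi> f = h"
    using \<Phi>_cl[OF z, unfolded ev_normal[OF XY h(1,4,5)]] z by (intro bexI[of _ "cl X Y (normal X Y h)"]) auto
next
  fix Z assume Z: "Z \<in> Obj E"
  show "\<exists>X\<in>Obj K. \<exists>u. is_iso_arr E u \<and> Dom E u = Z \<and> Cod E u = L0 X"
    using Z E.iso_inv[OF \<epsilon>_iso[OF Z]] E.inv_arr[OF \<epsilon>_iso[OF Z]]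
    by (intro bexI[of _ "RO Z"] exI[of _ "inv_arr E (\<epsilon> Z)"]) auto
qed (use \<Phi>_arr \<Phi>_faithful K_plus in \<open>auto simp: \<Phi>_cl L_zero\<close>)

sublocale F: fully_faithful K E L0 \<Phi> by (rule \<Phi>_fully_faithful)

lemma isomorphic_seqs_loc: "isomorphic_seqs (localization M \<Sigma>) = isomorphic_seqs K"
  unfolding isomorphic_seqs_def is_iso_arr_def Hom_def by (simp add: exact_quot_def Let_def)

lemma K_Conf: "(i, p) \<in> Conf K \<longleftrightarrow> (\<exists>j q. (j, q) \<in> Conf M \<and> isomorphic_seqs K (Q j, Q q) (i, p))"
  unfolding isomorphic_seqs_loc[symmetric] by (auto simp: exact_quot_def Let_def loc_ftor_def)

text \<open>Exactness of \<open>L\<close> gives one direction. For the other,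
  \<open>conf_lift\<close> makes \<open>R (\<Phi> i)\<close> the inflation of a conflation of
  \<open>M\<close> whose deflation agrees with \<open>R (\<Phi> p)\<close> up to an inverted
  arrow.\<close>

lemma K_conf_iff: "(i, p) \<in> Conf K \<longleftrightarrow> i \<in> Arr K \<and> p \<in> Arr K \<and> Cod K i = Dom K p \<and> (\<Phi> i, \<Phi> p) \<in> Conf E"
proof
  assume "(i, p) \<in> Conf K"
  then obtain j q where jq: "(j, q) \<in> Conf M" and jqs: "isomorphic_seqs K (Q j, Q q) (i, p)"
    unfolding K_Conf by blast
  note jqD = M.confD[OF jq]
  obtain a b c where S: "Q j \<in> Arr K" "Q q \<in> Arr K" "i \<in> Arr K" "p \<in> Arr K" "Cod K (Q j) = Dom K (Q q)" "Cod K i = Dom K p"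
      and abc: "is_iso_arr K a" "is_iso_arr K b" "is_iso_arr K c" "Dom K a = Dom K (Q j)" "Cod K a = Dom K i"
        "Dom K b = Cod K (Q j)" "Cod K b = Cod K i" "Dom K c = Cod K (Q q)" "Cod K c = Cod K p"
      and eqs: "i \<star>\<^bsub>K\<^esub> a = b \<star>\<^bsub>K\<^esub> Q j" "p \<star>\<^bsub>K\<^esub> b = c \<star>\<^bsub>K\<^esub> Q q"
    using jqs by (rule isomorphic_seqsE)
  have abcE: "a \<in> Arr K" "b \<in> Arr K" "c \<in> Arr K" "is_iso_arr E (\<Phi> a)" "is_iso_arr E (\<Phi> b)" "is_iso_arr E (\<Phi> c)"
    using abc(1-3) unfolding F.iso_iff by auto
  have "\<Phi> (i \<star>\<^bsub>K\<^esub> a) = \<Phi> (b \<star>\<^bsub>K\<^esub> Q j)" "\<Phi> (p \<star>\<^bsub>K\<^esub> b) = \<Phi> (c \<star>\<^bsub>K\<^esub> Q q)" by (simp_all only: eqs)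
  then have e: "\<Phi> i \<star>\<^bsub>E\<^esub> \<Phi> a = \<Phi> b \<star>\<^bsub>E\<^esub> L j" "\<Phi> p \<star>\<^bsub>E\<^esub> \<Phi> b = \<Phi> c \<star>\<^bsub>E\<^esub> L q"
    using S(1-6) abc(4-9) abcE(1-3) jqD(1,2) by simp_all
  have "(\<Phi> i, \<Phi> p) \<in> Conf E"
    by (rule E.conf_transfer[OF L.farr_conf[OF jq] abcE(4-6)]) (use S(1-6) abc(4-9) abcE(1-3) jqD(1,2) e in simp_all)
  with S show "i \<in> Arr K \<and> p \<in> Arr K \<and> Cod K i = Dom K p \<and> (\<Phi> i, \<Phi> p) \<in> Conf E" by simp
next
  assume a: "i \<in> Arr K \<and> p \<in> Arr K \<and> Cod K i = Dom K p \<and> (\<Phi> i, \<Phi> p) \<in> Conf E"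
  then have i: "i \<in> Arr K" and p: "p \<in> Arr K" and ip: "Cod K i = Dom K p" and cE: "(\<Phi> i, \<Phi> p) \<in> Conf E" by auto
  note I = \<Phi>_arr[OF i] and P = \<Phi>_arr[OF p]
  obtain q w where q: "(R (\<Phi> i), q) \<in> Conf M" "w \<in> \<Sigma>" "Dom M w = Cod M q" "Cod M w = RO (L0 (Cod K p))" "w \<star>\<^bsub>M\<^esub> q = R (\<Phi> p)"
    using conf_lift[OF cE] P by auto
  note qD = M.confD[OF q(1)]
  have wA: "w \<in> Arr M" using q by simp
  have Dq: "Dom M q = RO (L0 (Dom K p))" using qD I ip by simp
  \<comment> \<open>The comparison isomorphisms are counits; at the third term the counit is
    preceded by \<open>L w\<close>, the inverted arrow that measures the inexactness of
    \<open>R\<close>.\<close>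
  let ?\<alpha> = "\<epsilon> (L0 (Dom K i))" and ?\<beta> = "\<epsilon> (L0 (Dom K p))" and ?\<gamma> = "\<epsilon> (L0 (Cod K p)) \<star>\<^bsub>E\<^esub> L w"
  obtain a where a: "a \<in> Arr K" "Dom K a = RO (L0 (Dom K i))" "Cod K a = Dom K i" "\<Phi> a = ?\<alpha>"
    by (rule F.full[of ?\<alpha> "RO (L0 (Dom K i))" "Dom K i"]) (use I in auto)
  obtain b where b: "b \<in> Arr K" "Dom K b = RO (L0 (Dom K p))" "Cod K b = Dom K p" "\<Phi> b = ?\<beta>"
    by (rule F.full[of ?\<beta> "RO (L0 (Dom K p))" "Dom K p"]) (use P in auto)
  have isoc: "is_iso_arr E ?\<gamma>"
    by (rule E.iso_cmp[OF L_quot \<epsilon>_iso]) (use q P wA in auto)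
  obtain c where c: "c \<in> Arr K" "Dom K c = Cod M q" "Cod K c = Cod K p" "\<Phi> c = ?\<gamma>"
    by (rule F.full[of ?\<gamma> "Cod M q" "Cod K p"]) (use P q wA qD in auto)
  have 1: "\<Phi> i \<star>\<^bsub>E\<^esub> ?\<alpha> = ?\<beta> \<star>\<^bsub>E\<^esub> L (R (\<Phi> i))" using \<epsilon>_nat[OF I(3)] I ip by simp
  have "L (R (\<Phi> p)) = L w \<star>\<^bsub>E\<^esub> L q" unfolding q(5)[symmetric] by (rule L_cmp) (use qD wA q in auto)
  then have 2: "\<Phi> p \<star>\<^bsub>E\<^esub> ?\<beta> = ?\<gamma> \<star>\<^bsub>E\<^esub> L q" using \<epsilon>_nat[OF P(3)] P wA q(3,4) qD by simp
  have Qt: "Q (R (\<Phi> i)) \<in> Arr K" "Q q \<in> Arr K" using qD by simp_all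
  have "isomorphic_seqs K (Q (R (\<Phi> i)), Q q) (i, p)"
    unfolding isomorphic_seqs_def prod.case
  proof (intro conjI bexI)
    show "is_iso_arr K a" "is_iso_arr K b" "is_iso_arr K c"
      unfolding F.iso_iff using a b c I P \<epsilon>_iso isoc by simp_all
    show "i \<star>\<^bsub>K\<^esub> a = b \<star>\<^bsub>K\<^esub> Q (R (\<Phi> i))"
      by (rule \<Phi>_faithful) (use a b c I P ip 1 i Qt qD in simp_all)
    show "p \<star>\<^bsub>K\<^esub> b = c \<star>\<^bsub>K\<^esub> Q q"
      by (rule \<Phi>_faithful) (use a b c I P ip 2 p Qt qD Dq in simp_all)
  qed (use a b c I P i p ip Qt qD Dq in \<open>simp_all add: hom_iff\<close>)
  with q show "(i, p) \<in> Conf K" unfolding K_Conf by blast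
qed

sublocale T: exact_transport K E L0 \<Phi>
  by (intro exact_transport.intro \<Phi>_fully_faithful E.exact_category_axioms exact_transport_axioms.intro K_conf_iff)

section \<open>The quotient functor and its universal property\<close>

lemma quot_ftor_simps [simp]: "FObj (quot_ftor M A) = (\<lambda>X. X)" "FArr (quot_ftor M A) = Q"
  by (simp_all add: quot_ftor_def loc_ftor_def fun_eq_iff)

lemma Q_exact: "exact_functor M K (quot_ftor M A)"
proof (intro exact_functor.intro exact_functor_axioms.intro M.exact_category_axioms T.K.exact_category_axioms)
  fix f g X Y Z assume "f \<in> Hom M X Y" "g \<in> Hom M Y Z"
  then show "FArr (quot_ftor M A) (g \<star>\<^bsub>M\<^esub> f) = FArr (quot_ftor M A) g \<star>\<^bsub>K\<^esub> FArr (quot_ftor M A) f"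
    by (auto simp: hom_iff L_cmp intro!: \<Phi>_faithful)
next
  fix f g X Y assume "f \<in> Hom M X Y" "g \<in> Hom M X Y"
  then show "FArr (quot_ftor M A) (f \<boxplus>\<^bsub>M\<^esub> g) = FArr (quot_ftor M A) f \<boxplus>\<^bsub>K\<^esub> FArr (quot_ftor M A) g"
    by (auto simp: hom_iff L_plus intro!: \<Phi>_faithful)
next
  fix i p assume "(i, p) \<in> Conf M"
  then show "(FArr (quot_ftor M A) i, FArr (quot_ftor M A) p) \<in> Conf K"
    using M.confD L.farr_conf by (simp add: K_conf_iff)
next
  fix X assume "X \<in> Obj M"
  then show "FArr (quot_ftor M A) (Idn M X) = Idn K (FObj (quot_ftor M A) X)"
    by (auto simp: L_idn \<Phi>_cl intro!: \<Phi>_faithful)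
qed (auto simp: hom_iff)

lemma Q_kills:
  assumes "X \<in> A"
  shows "is_zero_obj K X"
proof (rule F.K.zero_objI)
  have X: "X \<in> Obj M" using assms A_obj by auto
  then show "X \<in> Obj K" by simp
  have "\<Phi> (Idn K X) = \<Phi> (Zero K X X)"
    using E.zero_objD(4)[OF A_zero[OF assms]] X F.K_idn(4)[of X] F.K_zero(4)[of X X] by simp
  then show "Idn K X = Zero K X X"
    by (intro \<Phi>_faithful) (use X in auto)
qed

text \<open>In the quotient the units are natural for all arrows, not only for those coming from
  \<open>M\<close>. As they are invertible there, functors and transformations on the quotient are
  determined by their behaviour on arrows from \<open>M\<close>.\<close>

lemma K_square:
  assumes x: "x \<in> Arr K"
  shows "Q (\<eta> (Cod K x)) \<star>\<^bsub>K\<^esub> x = Q (R (\<Phi> x)) \<star>\<^bsub>K\<^esub> Q (\<eta> (Dom K x))"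
proof -
  note X = \<Phi>_arr[OF x]
  show ?thesis
    by (rule \<Phi>_faithful) (use x X L\<eta>_nat[OF X(3-5,1,2)] in simp_all)
qed

lemma Q_\<eta>_iso: "X \<in> Obj M \<Longrightarrow> is_iso_arr K (Q (\<eta> X))"
  using L_quot[OF \<eta>_quot] by (simp add: F.iso_iff)

lemma lift_along_Q:
  assumes F: "exact_functor M D F" and z: "\<And>X. X \<in> A \<Longrightarrow> is_zero_obj D (FObj F X)"
  shows "\<exists>G. exact_functor K D G \<and> isomorphic_ftors M D (comp_ftor G (quot_ftor M A)) F"
proof -
  interpret F': exact_functor M D F by (rule F)
  note inv = F'.B.inv_arr[OF F'.F_quot_arrow[OF z \<eta>_quot]] F'.B.inv_arr_cmp[OF F'.F_quot_arrow[OF z \<eta>_quot]]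
  \<comment> \<open>\<open>K_square\<close> forces this formula: \<open>x\<close> is the unit, then
    \<open>R (\<Phi> x)\<close>, then an inverse unit, and \<open>F\<close> inverts the units
    because they lie in \<open>\<Sigma>\<close>.\<close>
  define g where "g x = inv_arr D (FArr F (\<eta> (Cod K x))) \<star>\<^bsub>D\<^esub> FArr F (R (\<Phi> x)) \<star>\<^bsub>D\<^esub> FArr F (\<eta> (Dom K x))" for x
  define G where "G = \<lparr>FObj = FObj F, FArr = g\<rparr>"
  have g: "g x \<in> Arr D" "Dom D (g x) = FObj F (Dom K x)" "Cod D (g x) = FObj F (Cod K x)" if "x \<in> Arr K" for x
    unfolding g_def using \<Phi>_arr[OF that] by (simp_all add: inv)
  have g_idn: "g (Idn K X) = Idn D (FObj F X)" if "X \<in> Obj M" for X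
    unfolding g_def using that F.K_idn(4)[of X] by (simp add: inv R_idn F'.farr_idn F'.fobj_in)
  have g_cmp: "g (y \<star>\<^bsub>K\<^esub> x) = g y \<star>\<^bsub>D\<^esub> g x" if "x \<in> Arr K" "y \<in> Arr K" "Cod K x = Dom K y" for x y
    unfolding g_def using that \<Phi>_arr[OF that(1)] \<Phi>_arr[OF that(2)] by (simp add: inv R_cmp F'.F_cmp)
  have g_plus: "g (x \<boxplus>\<^bsub>K\<^esub> y) = g x \<boxplus>\<^bsub>D\<^esub> g y" if "x \<in> Arr K" "y \<in> Arr K" "Dom K x = Dom K y" "Cod K x = Cod K y" for x y
    unfolding g_def using that \<Phi>_arr[OF that(1)] \<Phi>_arr[OF that(2)] by (simp add: inv R_plus F'.F_plus)
  have g_Q: "g (Q f) = FArr F f" if f: "f \<in> Arr M" for f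
  proof -
    have "FArr F (R (L f)) \<star>\<^bsub>D\<^esub> FArr F (\<eta> (Dom M f)) = FArr F (\<eta> (Cod M f)) \<star>\<^bsub>D\<^esub> FArr F f"
      using f L_nat[OF f] by (simp add: F'.F_cmp[symmetric])
    then show ?thesis unfolding g_def using f by (simp add: inv)
  qed
  have g_iso: "is_iso_arr D (g x)" if "is_iso_arr K x" for x
  proof -
    note x = F.K.inv_arr[OF that]
    show ?thesis
      by (rule F'.B.iso_arrI[of _ "g (inv_arr K x)"])
        (use x \<Phi>_arr[OF x(1)] in \<open>simp_all add: g g_cmp[symmetric] g_idn del: K_simps(4)\<close>)
  qed
  have "exact_functor K D G"
  proof (intro exact_functor.intro exact_functor_axioms.intro T.K.exact_category_axioms F'.B.exact_category_axioms)
    fix i p assume "(i, p) \<in> Conf K"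
    then obtain j q where jq: "(j, q) \<in> Conf M" and jqs: "isomorphic_seqs K (Q j, Q q) (i, p)"
      unfolding K_Conf by blast
    note jqD = M.confD[OF jq]
    obtain a b c where S: "Q j \<in> Arr K" "Q q \<in> Arr K" "i \<in> Arr K" "p \<in> Arr K" "Cod K (Q j) = Dom K (Q q)" "Cod K i = Dom K p"
        and abc: "is_iso_arr K a" "is_iso_arr K b" "is_iso_arr K c" "Dom K a = Dom K (Q j)" "Cod K a = Dom K i"
          "Dom K b = Cod K (Q j)" "Cod K b = Cod K i" "Dom K c = Cod K (Q q)" "Cod K c = Cod K p"
        and eqs: "i \<star>\<^bsub>K\<^esub> a = b \<star>\<^bsub>K\<^esub> Q j" "p \<star>\<^bsub>K\<^esub> b = c \<star>\<^bsub>K\<^esub> Q q"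
      using jqs by (rule isomorphic_seqsE)
    note abcA = F.K.inv_arr(1)[OF abc(1)] F.K.inv_arr(1)[OF abc(2)] F.K.inv_arr(1)[OF abc(3)]
    have "g (i \<star>\<^bsub>K\<^esub> a) = g (b \<star>\<^bsub>K\<^esub> Q j)" "g (p \<star>\<^bsub>K\<^esub> b) = g (c \<star>\<^bsub>K\<^esub> Q q)" by (simp_all only: eqs)
    then have e: "g i \<star>\<^bsub>D\<^esub> g a = g b \<star>\<^bsub>D\<^esub> FArr F j" "g p \<star>\<^bsub>D\<^esub> g b = g c \<star>\<^bsub>D\<^esub> FArr F q"
      using S(1-6) abc(4-9) abcA jqD(1,2) by (simp_all add: g_cmp g_Q)
    have "(g i, g p) \<in> Conf D"
      by (rule F'.B.conf_transfer[OF F'.farr_conf[OF jq] g_iso[OF abc(1)] g_iso[OF abc(2)] g_iso[OF abc(3)]])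
        (use S(1-6) abc(4-9) abcA jqD(1,2) e in \<open>simp_all add: g\<close>)
    then show "(FArr G i, FArr G p) \<in> Conf D" by (simp add: G_def)
  qed (use g g_idn g_cmp g_plus F'.fobj_in in \<open>auto simp: G_def hom_iff\<close>)
  \<comment> \<open>By \<open>g_Q\<close> the lift restricts to \<open>F\<close> on the nose, so
    identities serve as the isomorphism.\<close>
  moreover have "isomorphic_ftors M D (comp_ftor G (quot_ftor M A)) F"
    unfolding isomorphic_ftors_def nat_trans_def comp_ftor_def G_def
    by (intro exI[of _ "\<lambda>X. Idn D (FObj F X)"]) (auto simp: hom_iff g_Q F'.fobj_in)
  ultimately show ?thesis by blast
qed

text \<open>The quotient functor is the identity on objects, so the components stay the same and
  only naturality for the new arrows is at stake. It is checked after composing with the invertible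
  image of a unit under \<open>H\<close>, where \<open>K_square\<close> reduces it to arrows from
  \<open>M\<close>.\<close>

lemma nat_trans_along_Q:
  assumes G: "exact_functor K D G" and H: "exact_functor K D H"
    and n: "nat_trans M D (comp_ftor G (quot_ftor M A)) (comp_ftor H (quot_ftor M A)) \<tau>"
  shows "nat_trans K D G H \<tau>"
proof -
  interpret G: exact_functor K D G by (rule G)
  interpret H: exact_functor K D H by (rule H)
  have \<tau>: "\<tau> X \<in> Arr D" "Dom D (\<tau> X) = FObj G X" "Cod D (\<tau> X) = FObj H X" if "X \<in> Obj M" for X
    using n that by (auto simp: nat_trans_def comp_ftor_def hom_iff)
  have nat: "\<tau> (Cod M f) \<star>\<^bsub>D\<^esub> FArr G (Q f) = FArr H (Q f) \<star>\<^bsub>D\<^esub> \<tau> (Dom M f)" if "f \<in> Arr M" for f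
    using n that by (auto simp: nat_trans_def comp_ftor_def)
  have "\<tau> (Cod K x) \<star>\<^bsub>D\<^esub> FArr G x = FArr H x \<star>\<^bsub>D\<^esub> \<tau> (Dom K x)" if x: "x \<in> Arr K" for x
  proof -
    note X = \<Phi>_arr[OF x]
    let ?e = "Q (\<eta> (Cod K x))" and ?d = "Q (\<eta> (Dom K x))" and ?r = "Q (R (\<Phi> x))"
    have t: "?e \<in> Arr K" "?d \<in> Arr K" "?r \<in> Arr K" using X by simp_all
    have sG: "FArr G ?e \<star>\<^bsub>D\<^esub> FArr G x = FArr G ?r \<star>\<^bsub>D\<^esub> FArr G ?d"
      using arg_cong[OF K_square[OF x], of "FArr G"] x X t by (simp add: G.F_cmp)
    have sH: "FArr H ?e \<star>\<^bsub>D\<^esub> FArr H x = FArr H ?r \<star>\<^bsub>D\<^esub> FArr H ?d"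
      using arg_cong[OF K_square[OF x], of "FArr H"] x X t by (simp add: H.F_cmp)
    have ne: "\<tau> (RO (L0 (Cod K x))) \<star>\<^bsub>D\<^esub> FArr G ?e = FArr H ?e \<star>\<^bsub>D\<^esub> \<tau> (Cod K x)" using nat[of "\<eta> (Cod K x)"] X by simp
    have nd: "\<tau> (RO (L0 (Dom K x))) \<star>\<^bsub>D\<^esub> FArr G ?d = FArr H ?d \<star>\<^bsub>D\<^esub> \<tau> (Dom K x)" using nat[of "\<eta> (Dom K x)"] X by simp
    have nr: "\<tau> (RO (L0 (Cod K x))) \<star>\<^bsub>D\<^esub> FArr G ?r = FArr H ?r \<star>\<^bsub>D\<^esub> \<tau> (RO (L0 (Dom K x)))" using nat[of "R (\<Phi> x)"] X by simp
    note ty = \<tau>[OF X(1)] \<tau>[OF X(2)] \<tau>[of "RO (L0 (Cod K x))"] \<tau>[of "RO (L0 (Dom K x))"]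
    show ?thesis
    proof (rule G.B.iso_mono[OF H.F_iso[OF Q_\<eta>_iso[OF X(2)]]])
      have "FArr H ?e \<star>\<^bsub>D\<^esub> \<tau> (Cod K x) \<star>\<^bsub>D\<^esub> FArr G x = \<tau> (RO (L0 (Cod K x))) \<star>\<^bsub>D\<^esub> FArr G ?e \<star>\<^bsub>D\<^esub> FArr G x"
        using ne[symmetric, THEN G.B.cmp_reduce, of "FArr G x"] ty X t x by simp
      also have "\<dots> = FArr H ?r \<star>\<^bsub>D\<^esub> \<tau> (RO (L0 (Dom K x))) \<star>\<^bsub>D\<^esub> FArr G ?d"
        unfolding sG using nr[THEN G.B.cmp_reduce, of "FArr G ?d"] ty X t x by simp
      also have "\<dots> = FArr H ?e \<star>\<^bsub>D\<^esub> FArr H x \<star>\<^bsub>D\<^esub> \<tau> (Dom K x)"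
        unfolding nd using sH[THEN G.B.cmp_reduce, of "\<tau> (Dom K x)"] ty X t x by simp
      finally show "FArr H ?e \<star>\<^bsub>D\<^esub> (\<tau> (Cod K x) \<star>\<^bsub>D\<^esub> FArr G x) = FArr H ?e \<star>\<^bsub>D\<^esub> (FArr H x \<star>\<^bsub>D\<^esub> \<tau> (Dom K x))" .
    qed (use ty X x in simp_all)
  qed
  then show ?thesis unfolding nat_trans_def using \<tau> by (auto simp: hom_iff)
qed

theorem exact_quotient: "is_exact_quotient TYPE('r \<times> 's) M A K (quot_ftor M A)"
  unfolding is_exact_quotient_def
proof (intro conjI allI impI ballI Q_exact)
  fix D :: "('r, 's) excat" and G H \<tau>
  assume *: "exact_functor K D G" "exact_functor K D H"
    "nat_trans M D (comp_ftor G (quot_ftor M A)) (comp_ftor H (quot_ftor M A)) \<tau>"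
  show "\<exists>\<theta>. (nat_trans K D G H \<theta> \<and> (\<forall>X\<in>Obj M. \<theta> (FObj (quot_ftor M A) X) = \<tau> X)) \<and>
      (\<forall>\<theta>'. nat_trans K D G H \<theta>' \<and> (\<forall>X\<in>Obj M. \<theta>' (FObj (quot_ftor M A) X) = \<tau> X) \<longrightarrow> (\<forall>Y\<in>Obj K. \<theta>' Y = \<theta> Y))"
    using nat_trans_along_Q[OF *] by (intro exI[of _ \<tau>]) auto
next
  fix D :: "('r, 's) excat" and F
  assume "exact_functor M D F" "\<forall>X\<in>A. is_zero_obj D (FObj F X)"
  then show "\<exists>G. exact_functor K D G \<and> isomorphic_ftors M D (comp_ftor G (quot_ftor M A)) F"
    using lift_along_Q by blast
qed (use Q_kills in auto)

text \<open>The inverse functor sends \<open>f\<close> to the class of \<open>R f\<close>. It is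
  exact although \<open>R\<close> may fail to be: conflations of the quotient are recognized by
  their values in \<open>E\<close>, and \<open>L\<close> after \<open>R\<close> is conjugate to the
  identity by counits.\<close>

theorem exact_equivalence: "exact_equivalent K E"
proof -
  define F where "F = \<lparr>FObj = L0, FArr = \<Phi>\<rparr>"
  define G where "G = \<lparr>FObj = RO, FArr = \<lambda>f. Q (R f)\<rparr>"
  have F: "exact_functor K E F"
    by (intro exact_functor.intro exact_functor_axioms.intro T.K.exact_category_axioms E.exact_category_axioms)
      (use F.K_idn(4) in \<open>auto simp: F_def hom_iff K_conf_iff\<close>)
  have G: "exact_functor E K G"
  proof (intro exact_functor.intro exact_functor_axioms.intro T.K.exact_category_axioms E.exact_category_axioms)
    fix i p assume ip: "(i, p) \<in> Conf E"
    note D = E.confD[OF ip]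
    have "(L (R i), L (R p)) \<in> Conf E"
    proof (rule E.conf_transfer[OF ip E.iso_inv E.iso_inv E.iso_inv])
      note inv = E.inv_arr[OF \<epsilon>_iso] E.inv_arr_cmp[OF \<epsilon>_iso]
      show "is_iso_arr E (\<epsilon> (Dom E i))" "is_iso_arr E (\<epsilon> (Cod E i))" "is_iso_arr E (\<epsilon> (Cod E p))" using D \<epsilon>_iso by auto
      have nat: "L (R f) \<star>\<^bsub>E\<^esub> inv_arr E (\<epsilon> (Dom E f)) = inv_arr E (\<epsilon> (Cod E f)) \<star>\<^bsub>E\<^esub> f" if f: "f \<in> Arr E" for f
      proof -
        have "(\<epsilon> (Cod E f) \<star>\<^bsub>E\<^esub> L (R f)) \<star>\<^bsub>E\<^esub> inv_arr E (\<epsilon> (Dom E f)) = (f \<star>\<^bsub>E\<^esub> \<epsilon> (Dom E f)) \<star>\<^bsub>E\<^esub> inv_arr E (\<epsilon> (Dom E f))"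
          by (simp only: \<epsilon>_nat[OF f])
        then have "inv_arr E (\<epsilon> (Cod E f)) \<star>\<^bsub>E\<^esub> \<epsilon> (Cod E f) \<star>\<^bsub>E\<^esub> L (R f) \<star>\<^bsub>E\<^esub> inv_arr E (\<epsilon> (Dom E f)) = inv_arr E (\<epsilon> (Cod E f)) \<star>\<^bsub>E\<^esub> f"
          using f by (simp add: inv)
        then show ?thesis using f by (simp add: inv)
      qed
      show "L (R i) \<star>\<^bsub>E\<^esub> inv_arr E (\<epsilon> (Dom E i)) = inv_arr E (\<epsilon> (Cod E i)) \<star>\<^bsub>E\<^esub> i" by (rule nat[OF D(1)])
      show "L (R p) \<star>\<^bsub>E\<^esub> inv_arr E (\<epsilon> (Cod E i)) = inv_arr E (\<epsilon> (Cod E p)) \<star>\<^bsub>E\<^esub> p" using nat[OF D(2)] D(3) by simp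
    qed (use D E.inv_arr[OF \<epsilon>_iso] in auto)
    with D show "(FArr G i, FArr G p) \<in> Conf K" by (simp add: G_def K_conf_iff)
  next
    fix f g X Y Z assume "f \<in> Hom E X Y" "g \<in> Hom E Y Z"
    then show "FArr G (g \<star>\<^bsub>E\<^esub> f) = FArr G g \<star>\<^bsub>K\<^esub> FArr G f"
      by (auto simp: G_def hom_iff L_cmp R_cmp intro!: \<Phi>_faithful)
  next
    fix f g X Y assume "f \<in> Hom E X Y" "g \<in> Hom E X Y"
    then show "FArr G (f \<boxplus>\<^bsub>E\<^esub> g) = FArr G f \<boxplus>\<^bsub>K\<^esub> FArr G g"
      by (auto simp: G_def hom_iff L_plus R_plus intro!: \<Phi>_faithful)
  next
    fix X assume "X \<in> Obj E"
    then show "FArr G (Idn E X) = Idn K (FObj G X)"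
      by (auto simp: G_def L_idn R_idn \<Phi>_cl intro!: \<Phi>_faithful)
  qed (auto simp: G_def hom_iff)
  have 1: "isomorphic_ftors E E (comp_ftor F G) id_ftor"
    unfolding isomorphic_ftors_def nat_trans_def comp_ftor_def id_ftor_def F_def G_def
    by (intro exI[of _ \<epsilon>]) (auto simp: hom_iff \<epsilon>_iso \<epsilon>_nat)
  \<comment> \<open>The isomorphism is the inverse of the unit, and its naturality is
    \<open>K_square\<close>.\<close>
  have 2: "isomorphic_ftors K K (comp_ftor G F) id_ftor"
    unfolding isomorphic_ftors_def nat_trans_def comp_ftor_def id_ftor_def F_def G_def
  proof (intro exI[of _ "\<lambda>X. inv_arr K (Q (\<eta> X))"] conjI ballI)
    note inv = F.K.inv_arr[OF Q_\<eta>_iso] F.K.inv_arr_cmp[OF Q_\<eta>_iso]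
    fix x assume x: "x \<in> Arr K"
    note X = \<Phi>_arr[OF x]
    let ?e = "Q (\<eta> (Cod K x))" and ?d = "Q (\<eta> (Dom K x))"
    have t: "?e \<in> Arr K" "?d \<in> Arr K" "Q (R (\<Phi> x)) \<in> Arr K" using X by simp_all
    have "(Q (R (\<Phi> x)) \<star>\<^bsub>K\<^esub> ?d) \<star>\<^bsub>K\<^esub> inv_arr K ?d = (?e \<star>\<^bsub>K\<^esub> x) \<star>\<^bsub>K\<^esub> inv_arr K ?d"
      by (simp only: K_square[OF x])
    then have "Q (R (\<Phi> x)) = ?e \<star>\<^bsub>K\<^esub> x \<star>\<^bsub>K\<^esub> inv_arr K ?d"
      using X x t inv[OF X(1)] by (simp del: K_simps(4))
    then show "inv_arr K ?e \<star>\<^bsub>K\<^esub> FArr \<lparr>FObj = FObj \<lparr>FObj = RO, FArr = \<lambda>f. Q (R f)\<rparr> \<circ> FObj \<lparr>FObj = L0, FArr = \<Phi>\<rparr>,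
         FArr = FArr \<lparr>FObj = RO, FArr = \<lambda>f. Q (R f)\<rparr> \<circ> FArr \<lparr>FObj = L0, FArr = \<Phi>\<rparr>\<rparr> x =
        FArr \<lparr>FObj = \<lambda>X. X, FArr = \<lambda>f. f\<rparr> x \<star>\<^bsub>K\<^esub> inv_arr K ?d"
      using X x t inv[OF X(2)] inv[OF X(1)] by simp
  qed (use F.K.inv_arr[OF Q_\<eta>_iso] F.K.iso_inv[OF Q_\<eta>_iso] in \<open>simp_all add: hom_iff\<close>)
  from F G 1 2 show ?thesis unfolding exact_equivalent_def by blast
qed

end

section \<open>Finitely presented modules, abstractly\<close>

context exact_category
begin

text \<open>The deflation \<open>p\<close> is epic, so \<open>m \<star> p\<close> and
  \<open>m\<close> have the same cokernels.\<close>

lemma admissible_cokernel_conf: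
  assumes p: "deflation C p" and m: "inflation C m" and pm: "Cod C p = Dom C m" and c: "is_cokernel C c (m \<star> p)"
  shows "(m, c) \<in> Conf C"
proof -
  obtain d where d: "(m, d) \<in> Conf C" using m by (rule inflationE)
  note D = confD[OF d] and A = deflation_arr[OF p]
  obtain u where u: "is_iso_arr C u" "Dom C u = Cod C d" "Cod C u = Cod C c" "u \<star> d = c"
    by (rule cokernel_iso[OF cokernel_pre_deflation[OF conf_cokernel[OF d] p pm] c])
  show ?thesis
    by (rule conf_transfer[OF d, of "Idn C (Dom C m)" "Idn C (Cod C m)" u])
      (use u D A pm cokernelD[OF c] in auto)
qed

lemma admissible_cokernel:
  assumes "admissible C f"
  obtains c where "is_cokernel C c f"
proof -
  obtain p m where pm: "deflation C p" "inflation C m" "Cod C p = Dom C m" "f = m \<star> p"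
    using assms by (rule admissibleE)
  obtain d where d: "(m, d) \<in> Conf C" using pm(2) by (rule inflationE)
  show thesis
    using cokernel_pre_deflation[OF conf_cokernel[OF d] pm(1,3)] that pm(4) by simp
qed

end

text \<open>By the Yoneda lemma an element of a module \<open>F\<close> over \<open>W\<close> is an arrow \<open>RO W \<rightarrow> F\<close>; \<^term>\<open>T x F\<close> below
  means that \<^term>\<open>x\<close> is such an arrow. All arguments about modules are phrased through these elements.\<close>

locale presheaf_base = E: exact_category E + M: preadditive_category M
  for E :: "('p, 'q) excat" and M :: "('o, 'm) pcat" +
  fixes RO :: "'p \<Rightarrow> 'o" and R :: "'q \<Rightarrow> 'm"
  assumes RO_obj [simp]: "Z \<in> Obj E \<Longrightarrow> RO Z \<in> Obj M"
    and R_arr [simp]: "f \<in> Arr E \<Longrightarrow> R f \<in> Arr M" "f \<in> Arr E \<Longrightarrow> Dom M (R f) = RO (Dom E f)"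
      "f \<in> Arr E \<Longrightarrow> Cod M (R f) = RO (Cod E f)"
    and R_idn: "Z \<in> Obj E \<Longrightarrow> R (Idn E Z) = Idn M (RO Z)"
    and R_cmp: "f \<in> Arr E \<Longrightarrow> g \<in> Arr E \<Longrightarrow> Cod E f = Dom E g \<Longrightarrow> R (g \<star>\<^bsub>E\<^esub> f) = R g \<star>\<^bsub>M\<^esub> R f"
    and R_plus: "f \<in> Arr E \<Longrightarrow> g \<in> Arr E \<Longrightarrow> Dom E f = Dom E g \<Longrightarrow> Cod E f = Cod E g \<Longrightarrow> R (f \<boxplus>\<^bsub>E\<^esub> g) = R f \<boxplus>\<^bsub>M\<^esub> R g"
    and R_full: "h \<in> Arr M \<Longrightarrow> W \<in> Obj E \<Longrightarrow> Z \<in> Obj E \<Longrightarrow> Dom M h = RO W \<Longrightarrow> Cod M h = RO Z \<Longrightarrow>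
      \<exists>f \<in> Arr E. Dom E f = W \<and> Cod E f = Z \<and> R f = h"
    and R_faithful: "f \<in> Arr E \<Longrightarrow> g \<in> Arr E \<Longrightarrow> Dom E f = Dom E g \<Longrightarrow> Cod E f = Cod E g \<Longrightarrow> R f = R g \<Longrightarrow> f = g"
begin

abbreviation mcmp (infixr "\<bullet>" 75) where "g \<bullet> f \<equiv> g \<star>\<^bsub>M\<^esub> f"
abbreviation mplus (infixl "\<oplus>" 65) where "g \<oplus> f \<equiv> g \<boxplus>\<^bsub>M\<^esub> f"
abbreviation ecmp (infixr "\<cdot>" 75) where "g \<cdot> f \<equiv> g \<star>\<^bsub>E\<^esub> f"
abbreviation eplus (infixl "\<dotplus>" 65) where "g \<dotplus> f \<equiv> g \<boxplus>\<^bsub>E\<^esub> f"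

definition T :: "'m \<Rightarrow> 'o \<Rightarrow> bool" where
  "T x F \<longleftrightarrow> x \<in> Arr M \<and> Cod M x = F \<and> (\<exists>W \<in> Obj E. Dom M x = RO W)"

text \<open>\<open>inj\<close>, \<open>sur\<close> and \<open>ex\<close> are objectwise injectivity,
  surjectivity and exactness, tested on generalized elements; requiring equal domains keeps each
  test at one object. \<open>inj_iff\<close>, \<open>sur_iff\<close> and \<open>ex_iff\<close>
  translate them back.\<close>

definition inj :: "'m \<Rightarrow> bool" where
  "inj \<phi> \<longleftrightarrow> \<phi> \<in> Arr M \<and> (\<forall>x. T x (Dom M \<phi>) \<longrightarrow> \<phi> \<bullet> x = Zero M (Dom M x) (Cod M \<phi>) \<longrightarrow> x = Zero M (Dom M x) (Dom M \<phi>))"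

definition sur :: "'m \<Rightarrow> bool" where
  "sur \<phi> \<longleftrightarrow> \<phi> \<in> Arr M \<and> (\<forall>y. T y (Cod M \<phi>) \<longrightarrow> (\<exists>x. T x (Dom M \<phi>) \<and> Dom M x = Dom M y \<and> \<phi> \<bullet> x = y))"

definition ex :: "'m \<Rightarrow> 'm \<Rightarrow> bool" where
  "ex \<phi> \<psi> \<longleftrightarrow> \<phi> \<in> Arr M \<and> \<psi> \<in> Arr M \<and> Cod M \<phi> = Dom M \<psi> \<and> \<psi> \<bullet> \<phi> = Zero M (Dom M \<phi>) (Cod M \<psi>) \<and>
     (\<forall>y. T y (Dom M \<psi>) \<longrightarrow> \<psi> \<bullet> y = Zero M (Dom M y) (Cod M \<psi>) \<longrightarrow> (\<exists>x. T x (Dom M \<phi>) \<and> Dom M x = Dom M y \<and> \<phi> \<bullet> x = y))"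

definition ses :: "'m \<Rightarrow> 'm \<Rightarrow> bool" where
  "ses i p \<longleftrightarrow> inj i \<and> ex i p \<and> sur p"

definition pres :: "'q \<Rightarrow> 'm \<Rightarrow> 'o \<Rightarrow> bool" where
  "pres f \<pi> F \<longleftrightarrow> f \<in> Arr E \<and> ex (R f) \<pi> \<and> sur \<pi> \<and> Cod M \<pi> = F"

definition P :: "'o set" where
  "P = {F \<in> Obj M. \<exists>f \<pi>. admissible E f \<and> pres f \<pi> F}"

lemma TD:
  assumes "T x F"
  shows "x \<in> Arr M" "Cod M x = F"
  using assms by (auto simp: T_def)

lemma T_dom: "T x F \<Longrightarrow> \<exists>W \<in> Obj E. Dom M x = RO W"
  by (auto simp: T_def)

lemma T_cmp: "T x F \<Longrightarrow> f \<in> Arr M \<Longrightarrow> Dom M f = F \<Longrightarrow> Cod M f = G \<Longrightarrow> T (f \<bullet> x) G"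
  by (auto simp: T_def)

lemma T_plus: "T x F \<Longrightarrow> T y F \<Longrightarrow> Dom M x = Dom M y \<Longrightarrow> T (x \<oplus> y) F"
  by (auto simp: T_def)

lemma T_R: "f \<in> Arr E \<Longrightarrow> Cod E f = Y \<Longrightarrow> T (R f) (RO Y)"
  by (auto simp: T_def)

lemma injD: "inj \<phi> \<Longrightarrow> \<phi> \<in> Arr M"
  "inj \<phi> \<Longrightarrow> T x (Dom M \<phi>) \<Longrightarrow> \<phi> \<bullet> x = Zero M (Dom M x) (Cod M \<phi>) \<Longrightarrow> x = Zero M (Dom M x) (Dom M \<phi>)"
  by (auto simp: inj_def)

lemma surE:
  assumes "sur \<phi>" "T y (Cod M \<phi>)"
  obtains x where "T x (Dom M \<phi>)" "Dom M x = Dom M y" "\<phi> \<bullet> x = y"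
  using assms by (auto simp: sur_def)

lemma sur_arr: "sur \<phi> \<Longrightarrow> \<phi> \<in> Arr M"
  by (auto simp: sur_def)

lemma exD:
  assumes "ex \<phi> \<psi>"
  shows "\<phi> \<in> Arr M" "\<psi> \<in> Arr M" "Cod M \<phi> = Dom M \<psi>" "\<psi> \<bullet> \<phi> = Zero M (Dom M \<phi>) (Cod M \<psi>)"
  using assms by (auto simp: ex_def)

lemma exE:
  assumes "ex \<phi> \<psi>" "T y (Dom M \<psi>)" "\<psi> \<bullet> y = Zero M (Dom M y) (Cod M \<psi>)"
  obtains x where "T x (Dom M \<phi>)" "Dom M x = Dom M y" "\<phi> \<bullet> x = y"
  using assms by (auto simp: ex_def)

lemma ex_cmp: "ex \<phi> \<psi> \<Longrightarrow> x \<in> Arr M \<Longrightarrow> Cod M x = Dom M \<phi> \<Longrightarrow> \<psi> \<bullet> \<phi> \<bullet> x = Zero M (Dom M x) (Cod M \<psi>)"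
  using exD[of \<phi> \<psi>] M.cmp_reduce[OF exD(4), of \<phi> \<psi> x] by auto

lemma presD:
  assumes "pres f \<pi> F"
  shows "f \<in> Arr E" "ex (R f) \<pi>" "sur \<pi>" "Cod M \<pi> = F" "\<pi> \<in> Arr M" "Dom M \<pi> = RO (Cod E f)" "F \<in> Obj M"
    "\<pi> \<bullet> R f = Zero M (RO (Dom E f)) F"
  using assms exD[of "R f" \<pi>] by (auto simp: pres_def)

lemma R_zero [simp]: "X \<in> Obj E \<Longrightarrow> Y \<in> Obj E \<Longrightarrow> R (Zero E X Y) = Zero M (RO X) (RO Y)"
  using R_plus[of "Zero E X Y" "Zero E X Y"] M.plus_eq_self[of "R (Zero E X Y)"] by simp

lemma R_neg [simp]: "f \<in> Arr E \<Longrightarrow> R (neg E f) = neg M (R f)"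
  using R_plus[of f "neg E f"] M.neg_unique[of "R f" "R (neg E f)"] by simp

text \<open>Representables are projective, by the very definition of \<open>sur\<close>, and
  fullness of \<open>R\<close> realizes the lift in \<open>E\<close>.\<close>

lemma sur_lift:
  assumes "sur \<pi>" "Dom M \<pi> = RO Y" "Y \<in> Obj E" "y \<in> Arr M" "Dom M y = RO W" "W \<in> Obj E" "Cod M y = Cod M \<pi>"
  obtains h where "h \<in> Arr E" "Dom E h = W" "Cod E h = Y" "\<pi> \<bullet> R h = y"
proof -
  have "T y (Cod M \<pi>)" using assms by (auto simp: T_def)
  then obtain x where x: "T x (Dom M \<pi>)" "Dom M x = Dom M y" "\<pi> \<bullet> x = y" by (rule surE[OF assms(1)])
  with R_full[of x W Y] assms TD[OF x(1)] that show thesis by auto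
qed

lemma pres_lift:
  assumes "pres f \<pi> F" "y \<in> Arr M" "Dom M y = RO W" "W \<in> Obj E" "Cod M y = F"
  obtains h where "h \<in> Arr E" "Dom E h = W" "Cod E h = Cod E f" "\<pi> \<bullet> R h = y"
  by (rule sur_lift[of \<pi> "Cod E f" y W]) (use assms presD[OF assms(1)] in auto)

text \<open>Exactness of the presentation reads the vanishing of an element back into
  \<open>E\<close>, as a factorization through the presenting arrow.\<close>

lemma pres_zero:
  assumes p: "pres f \<pi> F" and h: "h \<in> Arr E" "Cod E h = Cod E f" "\<pi> \<bullet> R h = Zero M (RO (Dom E h)) F"
  obtains u where "u \<in> Arr E" "Dom E u = Dom E h" "Cod E u = Dom E f" "f \<cdot> u = h"
proof -
  note D = presD[OF p]
  have "T (R h) (Dom M \<pi>)" using T_R h D by simp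
  then obtain x where x: "T x (RO (Dom E f))" "Dom M x = RO (Dom E h)" "R f \<bullet> x = R h"
    by (rule exE[OF D(2)]) (use D h in auto)
  obtain u where u: "u \<in> Arr E" "Dom E u = Dom E h" "Cod E u = Dom E f" "R u = x"
    using R_full[of x "Dom E h" "Dom E f"] TD[OF x(1)] x h D by auto
  then have "f \<cdot> u = h" by (intro R_faithful) (use x h D in \<open>auto simp: R_cmp\<close>)
  with u that show thesis by blast
qed

end

text \<open>Properties of module categories, stated over \<open>presheaf_base\<close> because they
  use its notions of element, \<open>inj\<close>, \<open>sur\<close> and \<open>ex\<close>.
  \<open>cok_fac\<close> and \<open>ker_fac\<close> construct arrows from their effect on
  elements.\<close>

locale presheaf_setting = presheaf_base E M RO R
  for E :: "('p, 'q) excat" and M :: "('o, 'm) pcat" and RO R +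
  assumes sep: "\<phi> \<in> Arr M \<Longrightarrow> (\<And>x. T x (Dom M \<phi>) \<Longrightarrow> \<phi> \<bullet> x = Zero M (Dom M x) (Cod M \<phi>)) \<Longrightarrow> \<phi> = Zero M (Dom M \<phi>) (Cod M \<phi>)"
    and ker_ex: "\<phi> \<in> Arr M \<Longrightarrow> \<exists>\<kappa>. inj \<kappa> \<and> ex \<kappa> \<phi>"
    and cok_ex: "\<phi> \<in> Arr M \<Longrightarrow> \<exists>\<pi>. sur \<pi> \<and> ex \<phi> \<pi>"
    and cok_fac: "sur \<pi> \<Longrightarrow> h \<in> Arr M \<Longrightarrow> Dom M h = Dom M \<pi> \<Longrightarrow>
      (\<And>x. T x (Dom M \<pi>) \<Longrightarrow> \<pi> \<bullet> x = Zero M (Dom M x) (Cod M \<pi>) \<Longrightarrow> h \<bullet> x = Zero M (Dom M x) (Cod M h)) \<Longrightarrow>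
      \<exists>u \<in> Arr M. Dom M u = Cod M \<pi> \<and> Cod M u = Cod M h \<and> u \<bullet> \<pi> = h"
    and ker_fac: "inj i \<Longrightarrow> h \<in> Arr M \<Longrightarrow> Cod M h = Cod M i \<Longrightarrow>
      (\<And>x. T x (Dom M h) \<Longrightarrow> \<exists>y. T y (Dom M i) \<and> Dom M y = Dom M x \<and> i \<bullet> y = h \<bullet> x) \<Longrightarrow>
      \<exists>u \<in> Arr M. Dom M u = Dom M h \<and> Cod M u = Dom M i \<and> i \<bullet> u = h"
begin

section \<open>Epimorphisms, monomorphisms and short exact sequences by elements\<close>

lemma sur_epi:
  assumes s: "sur p" and e: "x \<bullet> p = y \<bullet> p" and xy: "x \<in> Arr M" "y \<in> Arr M" "Cod M x = Cod M y" "Dom M x = Cod M p" "Dom M y = Cod M p"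
  shows "x = y"
proof (rule M.eq_if_diff_zero)
  let ?d = "x \<oplus> neg M y"
  have "?d = Zero M (Dom M ?d) (Cod M ?d)"
  proof (rule sep)
    fix t assume "T t (Dom M ?d)"
    then have t: "T t (Cod M p)" using xy by simp
    obtain u where u: "T u (Dom M p)" "Dom M u = Dom M t" "p \<bullet> u = t" by (rule surE[OF s t])
    have "x \<bullet> t = (x \<bullet> p) \<bullet> u" "y \<bullet> t = (y \<bullet> p) \<bullet> u" unfolding u(3)[symmetric] using xy sur_arr[OF s] TD[OF u(1)] by auto
    then have "x \<bullet> t = y \<bullet> t" using e by simp
    then show "?d \<bullet> t = Zero M (Dom M t) (Cod M ?d)" using xy TD[OF t] by simp
  qed (use xy in auto)
  then show "x \<oplus> neg M y = Zero M (Dom M x) (Cod M x)" using xy by simp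
qed (use xy in auto)

lemma inj_mono:
  assumes s: "inj i" and e: "i \<bullet> x = i \<bullet> y" and xy: "x \<in> Arr M" "y \<in> Arr M" "Dom M x = Dom M y" "Cod M x = Dom M i" "Cod M y = Dom M i"
  shows "x = y"
proof (rule M.eq_if_diff_zero)
  let ?d = "x \<oplus> neg M y"
  note iA = injD(1)[OF s]
  have "?d = Zero M (Dom M ?d) (Cod M ?d)"
  proof (rule sep)
    fix t assume t: "T t (Dom M ?d)"
    have tt: "T (?d \<bullet> t) (Dom M i)" by (rule T_cmp[OF t]) (use xy in auto)
    have "i \<bullet> ?d = Zero M (Dom M y) (Cod M i)" using xy iA e by simp
    then have "i \<bullet> ?d \<bullet> t = Zero M (Dom M (?d \<bullet> t)) (Cod M i)"
      using M.cmp_reduce[of i ?d "Zero M (Dom M y) (Cod M i)" t] xy iA TD[OF t] by (simp del: M.cmp_plus_l M.cmp_plus_r)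
    from injD(2)[OF s tt this] show "?d \<bullet> t = Zero M (Dom M t) (Cod M ?d)" using xy TD[OF t] by simp
  qed (use xy in auto)
  then show "x \<oplus> neg M y = Zero M (Dom M x) (Cod M x)" using xy by simp
qed (use xy in auto)

lemma sesD: "ses i p \<Longrightarrow> inj i" "ses i p \<Longrightarrow> ex i p" "ses i p \<Longrightarrow> sur p"
  by (auto simp: ses_def)

lemma ses_arr:
  assumes "ses i p"
  shows "i \<in> Arr M" "p \<in> Arr M" "Cod M i = Dom M p" "p \<bullet> i = Zero M (Dom M i) (Cod M p)"
  using exD[OF sesD(2)[OF assms]] by auto

lemma ses_fac_out:
  assumes "ses i p" "h \<in> Arr M" "Dom M h = Cod M i" "h \<bullet> i = Zero M (Dom M i) (Cod M h)"
  obtains u where "u \<in> Arr M" "Dom M u = Cod M p" "Cod M u = Cod M h" "u \<bullet> p = h"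
proof -
  note D = ses_arr[OF assms(1)]
  have "h \<bullet> x = Zero M (Dom M x) (Cod M h)" if x: "T x (Dom M p)" "p \<bullet> x = Zero M (Dom M x) (Cod M p)" for x
  proof -
    obtain y where y: "T y (Dom M i)" "Dom M y = Dom M x" "i \<bullet> y = x" by (rule exE[OF sesD(2)[OF assms(1)] x])
    show ?thesis unfolding y(3)[symmetric] using M.cmp_reduce[OF assms(4), of y] TD[OF y(1)] D assms(2,3) y(2) by simp
  qed
  with cok_fac[OF sesD(3)[OF assms(1)] assms(2)] D assms(3) that show thesis by auto
qed

lemma inj_fac:
  assumes "inj i" "ex i p" "h \<in> Arr M" "Cod M h = Cod M i" "p \<bullet> h = Zero M (Dom M h) (Cod M p)"
  obtains u where "u \<in> Arr M" "Dom M u = Dom M h" "Cod M u = Dom M i" "i \<bullet> u = h"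
proof -
  note D = exD[OF assms(2)]
  have "\<exists>y. T y (Dom M i) \<and> Dom M y = Dom M x \<and> i \<bullet> y = h \<bullet> x" if x: "T x (Dom M h)" for x
  proof -
    have t: "T (h \<bullet> x) (Dom M p)" by (rule T_cmp[OF x]) (use assms D in auto)
    have z: "p \<bullet> h \<bullet> x = Zero M (Dom M (h \<bullet> x)) (Cod M p)"
      using M.cmp_reduce[OF assms(5), of x] TD[OF x] D assms(3,4) by simp
    show ?thesis by (rule exE[OF assms(2) t z]) (use TD[OF x] assms(3) in auto)
  qed
  with ker_fac[OF assms(1,3,4)] that show thesis by auto
qed

lemma ses_kernel:
  assumes s: "ses i p"
  shows "is_kernel M i p"
proof (rule M.kernelI)
  fix h assume h: "h \<in> Arr M" "Cod M h = Dom M p" "p \<bullet> h = Zero M (Dom M h) (Cod M p)"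
  obtain u where "u \<in> Arr M" "Dom M u = Dom M h" "Cod M u = Dom M i" "i \<bullet> u = h"
    by (rule inj_fac[OF sesD(1,2)[OF s]]) (use h ses_arr[OF s] in auto)
  then show "\<exists>u\<in>Arr M. Dom M u = Dom M h \<and> Cod M u = Dom M i \<and> i \<bullet> u = h" by blast
qed (use ses_arr[OF s] inj_mono[OF sesD(1)[OF s]] in blast)+

lemma ses_cokernel:
  assumes s: "ses i p"
  shows "is_cokernel M p i"
proof (rule M.cokernelI)
  fix h assume h: "h \<in> Arr M" "Dom M h = Cod M i" "h \<bullet> i = Zero M (Dom M i) (Cod M h)"
  obtain u where "u \<in> Arr M" "Dom M u = Cod M p" "Cod M u = Cod M h" "u \<bullet> p = h"
    by (rule ses_fac_out[OF s]) (use h ses_arr[OF s] in auto)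
  then show "\<exists>u\<in>Arr M. Dom M u = Cod M p \<and> Cod M u = Cod M h \<and> u \<bullet> p = h" by blast
next
  show "Dom M p = Cod M i" using ses_arr[OF s] by simp
qed (use ses_arr[OF s] sur_epi[OF sesD(3)[OF s]] in blast)+

section \<open>Presentations and the horseshoe lemma for modules\<close>

lemma pres_map:
  assumes p: "pres f \<pi> F" and q: "pres g \<rho> G"
    and a: "a \<in> Arr E" "Dom E a = Cod E f" "Cod E a = Cod E g" and b: "b \<in> Arr E" "Dom E b = Dom E f" "Cod E b = Dom E g"
    and c: "a \<cdot> f = g \<cdot> b"
  obtains \<phi> where "\<phi> \<in> Arr M" "Dom M \<phi> = F" "Cod M \<phi> = G" "\<phi> \<bullet> \<pi> = \<rho> \<bullet> R a"
proof -
  note D = presD[OF p] and D' = presD[OF q]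
  have "R (a \<cdot> f) = R (g \<cdot> b)" by (simp add: c)
  then have e: "R a \<bullet> R f = R g \<bullet> R b" using a b D(1) D'(1) by (simp add: R_cmp)
  have "(\<rho> \<bullet> R a) \<bullet> x = Zero M (Dom M x) (Cod M (\<rho> \<bullet> R a))" if x: "T x (Dom M \<pi>)" "\<pi> \<bullet> x = Zero M (Dom M x) (Cod M \<pi>)" for x
  proof -
    obtain y where y: "T y (Dom M (R f))" "Dom M y = Dom M x" "R f \<bullet> y = x" by (rule exE[OF D(2) x])
    have "(\<rho> \<bullet> R a) \<bullet> x = \<rho> \<bullet> R a \<bullet> R f \<bullet> y" unfolding y(3)[symmetric] using TD[OF y(1)] a b D D' by simp
    also have "R a \<bullet> R f \<bullet> y = R g \<bullet> R b \<bullet> y" using M.cmp_reduce[OF e, of y] TD[OF y(1)] a b D D' by simp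
    also have "\<rho> \<bullet> R g \<bullet> R b \<bullet> y = Zero M (Dom M x) G" using ex_cmp[OF D'(2), of "R b \<bullet> y"] TD[OF y(1)] y(2) b D(1) D' by simp
    finally show ?thesis using a D' by simp
  qed
  with cok_fac[OF D(3), of "\<rho> \<bullet> R a"] that a D D' show thesis by auto
qed

lemma pres_ex: "f \<in> Arr E \<Longrightarrow> \<exists>\<pi> F. pres f \<pi> F \<and> F \<in> Obj M"
  using cok_ex[of "R f"] M.cod_obj[OF sur_arr] by (auto simp: pres_def)

lemma P_I: "pres f \<pi> F \<Longrightarrow> admissible E f \<Longrightarrow> F \<in> P"
  using presD(7) by (auto simp: P_def)

lemma P_E:
  assumes "F \<in> P"
  obtains f \<pi> c where "admissible E f" "pres f \<pi> F" "is_cokernel E c f"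
proof -
  from assms obtain f \<pi> where f: "admissible E f" "pres f \<pi> F" by (auto simp: P_def)
  show thesis by (rule E.admissible_cokernel[OF f(1)]) (rule that[OF f])
qed

lemma P_obj: "F \<in> P \<Longrightarrow> F \<in> Obj M"
  by (simp add: P_def)

text \<open>The middle term is presented by the triangular matrix with diagonal \<open>f1\<close>,
  \<open>f2\<close>. Its corner \<open>a\<close> corrects a lift \<open>\<rho>\<close> of
  \<open>\<pi>2\<close> along \<open>p\<close>, which in general does not kill \<open>R f2\<close>.
  The conflation of cokernels comes along because it later yields exactness of the
  reflection.\<close>

lemma ses_horseshoe:
  assumes s: "ses i p" and pr1: "pres f1 \<pi>1 (Dom M i)" and pr2: "pres f2 \<pi>2 (Cod M p)"
    and ad: "admissible E f1" "admissible E f2" and c1: "is_cokernel E c1 f1" and c2: "is_cokernel E c2 f2"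
  obtains f \<pi> c \<alpha> \<beta> u v where "admissible E f" "pres f \<pi> (Cod M i)" "is_cokernel E c f" "(\<alpha>, \<beta>) \<in> Conf E"
    "Dom E \<alpha> = Cod E c1" "Cod E \<alpha> = Cod E c" "Cod E \<beta> = Cod E c2"
    "u \<in> Arr E" "Dom E u = Cod E f1" "Cod E u = Cod E f" "v \<in> Arr E" "Dom E v = Cod E f" "Cod E v = Cod E f2"
    "\<alpha> \<cdot> c1 = c \<cdot> u" "\<beta> \<cdot> c = c2 \<cdot> v" "\<pi> \<bullet> R u = i \<bullet> \<pi>1" "p \<bullet> \<pi> = \<pi>2 \<bullet> R v"
proof -
  obtain p1 m1 where pm1: "deflation E p1" "inflation E m1" "Cod E p1 = Dom E m1" "f1 = m1 \<cdot> p1"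
    using ad(1) by (rule E.admissibleE)
  obtain p2 m2 where pm2: "deflation E p2" "inflation E m2" "Cod E p2 = Dom E m2" "f2 = m2 \<cdot> p2"
    using ad(2) by (rule E.admissibleE)
  have mc1: "(m1, c1) \<in> Conf E" by (rule E.admissible_cokernel_conf[OF pm1(1-3)]) (use c1 pm1 in simp)
  have mc2: "(m2, c2) \<in> Conf E" by (rule E.admissible_cokernel_conf[OF pm2(1-3)]) (use c2 pm2 in simp)
  obtain k2 where k2: "(k2, p2) \<in> Conf E" using pm2(1) by (rule E.deflationE)
  note A = E.confD[OF mc1] E.confD[OF mc2] E.confD[OF k2] E.deflation_arr[OF pm1(1)] pm1(3) pm2(3)
  note D1 = presD[OF pr1] and D2 = presD[OF pr2] and S = ses_arr[OF s] and si = sesD[OF s]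
  have ft: "Dom E f1 = Dom E p1" "Cod E f1 = Cod E m1" "Dom E f2 = Dom E p2" "Cod E f2 = Cod E m2"
    using pm1(4) pm2(4) A by auto
  obtain SX iX jX pX qX where bX: "E.biprod (Dom E p1) (Dom E p2) SX iX jX pX qX"
    by (rule E.biprodE[of "Dom E p1" "Dom E p2"]) (use A in auto)
  obtain SY iY jY pY qY where bY: "E.biprod (Cod E m1) (Cod E m2) SY iY jY pY qY"
    by (rule E.biprodE[of "Cod E m1" "Cod E m2"]) (use A in auto)
  note DX = E.biprodD[OF bX] E.biprod_cmp(1-4)[OF bX]
  note DY = E.biprodD[OF bY] E.biprod_cmp(1-4)[OF bY]
  obtain \<rho> where "T \<rho> (Dom M p)" "Dom M \<rho> = Dom M \<pi>2" "p \<bullet> \<rho> = \<pi>2"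
    by (rule surE[OF si(3), of \<pi>2]) (use D2 in \<open>auto simp: T_def\<close>)
  then have \<rho>: "\<rho> \<in> Arr M" "Dom M \<rho> = RO (Cod E f2)" "Cod M \<rho> = Dom M p" "p \<bullet> \<rho> = \<pi>2"
    using TD D2 by auto
  \<comment> \<open>On \<open>R f2\<close> the lift lands in the kernel of \<open>p\<close>; the
    resulting element of \<open>Dom M i\<close> is represented by \<open>a\<close>. The sign makes
    \<open>\<pi>\<close> kill the matrix.\<close>
  have "p \<bullet> neg M (\<rho> \<bullet> R f2) = Zero M (Dom M (neg M (\<rho> \<bullet> R f2))) (Cod M p)"
    using \<rho> D2 S M.cmp_reduce[OF \<rho>(4), of "R f2"] by simp
  then obtain x where x: "x \<in> Arr M" "Dom M x = RO (Dom E f2)" "Cod M x = Dom M i" "i \<bullet> x = neg M (\<rho> \<bullet> R f2)"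
    using inj_fac[OF si(1,2), of "neg M (\<rho> \<bullet> R f2)"] \<rho> D2 S by auto
  obtain a where a: "a \<in> Arr E" "Dom E a = Dom E f2" "Cod E a = Cod E f1" "\<pi>1 \<bullet> R a = x"
    by (rule pres_lift[OF pr1 x(1,2) _ x(3)]) (use D2 in auto)
  have \<rho>f: "\<rho> \<bullet> R f2 \<bullet> y = neg M (i \<bullet> \<pi>1 \<bullet> R a \<bullet> y)" if y: "y \<in> Arr M" "Cod M y = RO (Dom E f2)" for y
  proof -
    have "\<rho> \<bullet> R f2 = neg M (i \<bullet> \<pi>1 \<bullet> R a)" using x \<rho> D2 a(4) by simp
    from M.cmp_reduce[OF this, of y] show ?thesis using y a(1-3) \<rho> D1 D2 S by simp
  qed
  \<comment> \<open>Since \<open>f2\<close> vanishes on \<open>k2\<close>, the arrow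
    \<open>a \<cdot> k2\<close> dies in \<open>Dom M i\<close> and so factors through
    \<open>f1\<close>. This yields the corestriction \<open>p1 \<cdot> w\<close> that
    \<open>E.horseshoe\<close> asks for.\<close>
  have "i \<bullet> \<pi>1 \<bullet> R (a \<cdot> k2) = neg M (\<rho> \<bullet> R f2 \<bullet> R k2)"
    using \<rho>f[of "R k2"] a A ft D1 S by (simp add: R_cmp)
  also have "R f2 \<bullet> R k2 = Zero M (RO (Dom E k2)) (RO (Cod E f2))"
  proof -
    have "f2 \<cdot> k2 = Zero E (Dom E k2) (Cod E f2)" unfolding pm2(4) using A by simp
    from arg_cong[OF this, of R] show ?thesis using A ft D2 by (simp add: R_cmp)
  qed
  finally have "i \<bullet> \<pi>1 \<bullet> R (a \<cdot> k2) = i \<bullet> Zero M (RO (Dom E k2)) (Dom M i)"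
    using \<rho> D2 A S by simp
  then have "\<pi>1 \<bullet> R (a \<cdot> k2) = Zero M (RO (Dom E k2)) (Dom M i)"
    by (rule inj_mono[OF si(1)]) (use D1 a A ft S in auto)
  then obtain w where w: "w \<in> Arr E" "Dom E w = Dom E k2" "Cod E w = Dom E f1" "f1 \<cdot> w = a \<cdot> k2"
    using pres_zero[OF pr1, of "a \<cdot> k2"] a A ft by auto
  define f where "f = iY \<cdot> m1 \<cdot> p1 \<cdot> pX \<dotplus> (iY \<cdot> a \<cdot> qX \<dotplus> jY \<cdot> m2 \<cdot> p2 \<cdot> qX)"
  obtain c \<alpha> \<beta> where H: "admissible E f" "is_cokernel E c f" "(\<alpha>, \<beta>) \<in> Conf E" "Dom E \<alpha> = Cod E c1" "Cod E \<alpha> = Cod E c"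
    "Cod E \<beta> = Cod E c2" "\<alpha> \<cdot> c1 = c \<cdot> iY" "\<beta> \<cdot> c = c2 \<cdot> qY"
    by (rule E.horseshoe[OF pm1(1) mc1 pm1(3) k2 mc2 pm2(3), of a "p1 \<cdot> w", OF _ _ _ _ _ _ _ bX bY f_def])
      (use a w ft A pm1(4) in auto)
  have f12: "m1 \<cdot> p1 \<cdot> y = f1 \<cdot> y" if "y \<in> Arr E" "Cod E y = Dom E f1" for y using that pm1(4) A ft by simp
  have f22: "m2 \<cdot> p2 \<cdot> y = f2 \<cdot> y" if "y \<in> Arr E" "Cod E y = Dom E f2" for y using that pm2(4) A ft by simp
  have f: "f = iY \<cdot> f1 \<cdot> pX \<dotplus> (iY \<cdot> a \<cdot> qX \<dotplus> jY \<cdot> f2 \<cdot> qX)"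
    unfolding f_def using DX ft by (simp add: f12 f22)
  have fA: "f \<in> Arr E" "Dom E f = SX" "Cod E f = SY" unfolding f using DX DY a D1 D2 ft by auto
  define \<pi> where "\<pi> = i \<bullet> \<pi>1 \<bullet> R pY \<oplus> \<rho> \<bullet> R qY"
  have \<pi>t: "\<pi> \<in> Arr M" "Dom M \<pi> = RO SY" "Cod M \<pi> = Cod M i" unfolding \<pi>_def using DY S D1 \<rho> ft by auto
  have \<pi>h: "\<pi> \<bullet> R h = i \<bullet> \<pi>1 \<bullet> R (pY \<cdot> h) \<oplus> \<rho> \<bullet> R (qY \<cdot> h)" if "h \<in> Arr E" "Cod E h = SY" for h
    unfolding \<pi>_def using that DY S D1 \<rho> ft by (simp add: R_cmp)
  have p\<pi>: "p \<bullet> \<pi> = \<pi>2 \<bullet> R qY"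
    unfolding \<pi>_def using DY S D1 D2 \<rho> ft by (simp add: S(4)[THEN M.cmp_reduce] \<rho>(4)[THEN M.cmp_reduce])
  have \<pi>u: "\<pi> \<bullet> R iY = i \<bullet> \<pi>1" using \<pi>h[of iY] DY D1 S \<rho> ft by (simp add: R_idn)
  have pres: "pres f \<pi> (Cod M i)"
    unfolding pres_def
  proof (intro conjI)
    show "sur \<pi>" unfolding sur_def
    proof (intro conjI allI impI)
      fix y assume y: "T y (Cod M \<pi>)"
      obtain W where W: "W \<in> Obj E" "Dom M y = RO W" using T_dom[OF y] by blast
      note yD = TD[OF y]
      obtain h2 where h2: "h2 \<in> Arr E" "Dom E h2 = W" "Cod E h2 = Cod E f2" "\<pi>2 \<bullet> R h2 = p \<bullet> y"
        by (rule pres_lift[OF pr2, of "p \<bullet> y"]) (use yD W \<pi>t S in auto)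
      \<comment> \<open>Subtracting a lift of its image under \<open>p\<close> leaves an element
        that comes from \<open>Dom M i\<close>.\<close>
      have "p \<bullet> (y \<oplus> neg M (\<rho> \<bullet> R h2)) = Zero M (Dom M (y \<oplus> neg M (\<rho> \<bullet> R h2))) (Cod M p)"
        using yD W \<pi>t S \<rho> h2 M.cmp_reduce[OF \<rho>(4), of "R h2"] by simp
      then obtain z where z: "z \<in> Arr M" "Dom M z = RO W" "Cod M z = Dom M i" "i \<bullet> z = y \<oplus> neg M (\<rho> \<bullet> R h2)"
        using inj_fac[OF si(1,2), of "y \<oplus> neg M (\<rho> \<bullet> R h2)"] yD W \<pi>t S \<rho> h2 by auto
      obtain h1 where h1: "h1 \<in> Arr E" "Dom E h1 = W" "Cod E h1 = Cod E f1" "\<pi>1 \<bullet> R h1 = z"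
        by (rule pres_lift[OF pr1 z(1,2) W(1) z(3)])
      let ?h = "iY \<cdot> h1 \<dotplus> jY \<cdot> h2"
      have "\<pi> \<bullet> R ?h = i \<bullet> \<pi>1 \<bullet> R h1 \<oplus> \<rho> \<bullet> R h2"
        using \<pi>h[of ?h] h1 h2 DY ft by simp
      also have "\<dots> = y" unfolding h1(4) z(4) using yD W \<pi>t S \<rho> h2 by (simp add: M.plus_ac)
      finally show "\<exists>x. T x (Dom M \<pi>) \<and> Dom M x = Dom M y \<and> \<pi> \<bullet> x = y"
        using h1 h2 DY ft \<pi>t W by (intro exI[of _ "R ?h"]) (auto simp: T_R)
    qed (rule \<pi>t)
    show "ex (R f) \<pi>" unfolding ex_def
    proof (intro conjI allI impI)
      have "pY \<cdot> f = f1 \<cdot> pX \<dotplus> a \<cdot> qX" "qY \<cdot> f = f2 \<cdot> qX" unfolding f using DX DY a D1 D2 ft by simp_all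
      then have "\<pi> \<bullet> R f = i \<bullet> \<pi>1 \<bullet> R f1 \<bullet> R pX \<oplus> i \<bullet> \<pi>1 \<bullet> R a \<bullet> R qX \<oplus> \<rho> \<bullet> R f2 \<bullet> R qX"
        using \<pi>h[OF fA(1,3)] DX a D1 D2 S ft by (simp add: R_plus R_cmp)
      also have "\<dots> = Zero M (RO SX) (Cod M i)"
        using \<rho>f[of "R qX"] ex_cmp[OF D1(2), of "R pX"] DX a D1 D2 S \<rho> ft by simp
      finally show "\<pi> \<bullet> R f = Zero M (Dom M (R f)) (Cod M \<pi>)" using fA \<pi>t by simp
    next
      fix y assume y: "T y (Dom M \<pi>)" "\<pi> \<bullet> y = Zero M (Dom M y) (Cod M \<pi>)"
      obtain W where W: "W \<in> Obj E" "Dom M y = RO W" using T_dom[OF y(1)] by blast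
      note yD = TD[OF y(1)]
      obtain h where h: "h \<in> Arr E" "Dom E h = W" "Cod E h = SY" "R h = y"
        using R_full[of y W SY] yD W \<pi>t DY by auto
      have "\<pi>2 \<bullet> R (qY \<cdot> h) = (p \<bullet> \<pi>) \<bullet> R h" unfolding p\<pi> using h(1-3) DY D2 ft by (simp add: R_cmp)
      also have "\<dots> = Zero M (RO W) (Cod M p)" using h \<pi>t S y yD W by simp
      finally have "\<pi>2 \<bullet> R (qY \<cdot> h) = Zero M (RO (Dom E (qY \<cdot> h))) (Cod M p)" using h DY by simp
      then obtain u2 where u2: "u2 \<in> Arr E" "Dom E u2 = W" "Cod E u2 = Dom E f2" "f2 \<cdot> u2 = qY \<cdot> h"
        using pres_zero[OF pr2, of "qY \<cdot> h"] h DY ft by auto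
      \<comment> \<open>The second component of \<open>h\<close> is \<open>f2 \<cdot> u2\<close>;
        the contribution of the corner to the first one is removed before that is factored through
        \<open>f1\<close>.\<close>
      let ?g = "pY \<cdot> h \<dotplus> neg E (a \<cdot> u2)"
      have gt: "?g \<in> Arr E" "Dom E ?g = W" "Cod E ?g = Cod E f1" using h DY u2 a ft by auto
      have "\<rho> \<bullet> R (qY \<cdot> h) = neg M (i \<bullet> \<pi>1 \<bullet> R (a \<cdot> u2))"
        unfolding u2(4)[symmetric] using \<rho>f[of "R u2"] u2(1-3) a(1-3) D2 by (simp add: R_cmp)
      then have "i \<bullet> \<pi>1 \<bullet> R ?g = \<pi> \<bullet> R h" using \<pi>h[OF h(1,3)] gt h DY u2 a ft D1 S by (simp add: R_plus)
      also have "\<dots> = i \<bullet> Zero M (RO W) (Dom M i)" using h y \<pi>t S W by simp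
      finally have "\<pi>1 \<bullet> R ?g = Zero M (RO W) (Dom M i)"
        by (rule inj_mono[OF si(1)]) (use gt D1 S W in auto)
      then obtain u1 where u1: "u1 \<in> Arr E" "Dom E u1 = W" "Cod E u1 = Dom E f1" "f1 \<cdot> u1 = ?g"
        using pres_zero[OF pr1 gt(1,3)] gt(2) by auto
      let ?u = "iX \<cdot> u1 \<dotplus> jX \<cdot> u2"
      have ut: "?u \<in> Arr E" "Dom E ?u = W" "Cod E ?u = SX" using u1 u2 DX ft by auto
      have "f \<cdot> ?u = iY \<cdot> (f1 \<cdot> u1 \<dotplus> a \<cdot> u2) \<dotplus> jY \<cdot> f2 \<cdot> u2"
        unfolding f using u1(1-3) u2(1-3) DX DY a D1 D2 ft W(1) by (simp add: E.plus_ac)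
      also have "f1 \<cdot> u1 \<dotplus> a \<cdot> u2 = pY \<cdot> h" unfolding u1(4) using h DY u2(1-3) a ft by (simp add: E.plus_ac)
      also have "iY \<cdot> pY \<cdot> h \<dotplus> jY \<cdot> f2 \<cdot> u2 = h" unfolding u2(4) by (rule E.biprod_cmp(5)[OF bY h(1,3)])
      finally have "R f \<bullet> R ?u = y" using R_cmp[of ?u f] ut fA h by simp
      then show "\<exists>x. T x (Dom M (R f)) \<and> Dom M x = Dom M y \<and> R f \<bullet> x = y"
        using ut fA W by (intro exI[of _ "R ?u"]) (auto simp: T_R)
    qed (use fA \<pi>t in auto)
  qed (use fA \<pi>t in auto)
  show thesis
    by (rule that[OF H(1) pres H(2-6), of iY qY]) (use DY fA ft H \<pi>u p\<pi> in auto)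
qed

lemma P_ext:
  assumes s: "ses i p" and F: "Dom M i \<in> P" and H: "Cod M p \<in> P"
  shows "Cod M i \<in> P"
proof -
  obtain f1 \<pi>1 c1 where 1: "admissible E f1" "pres f1 \<pi>1 (Dom M i)" "is_cokernel E c1 f1" using F by (rule P_E)
  obtain f2 \<pi>2 c2 where 2: "admissible E f2" "pres f2 \<pi>2 (Cod M p)" "is_cokernel E c2 f2" using H by (rule P_E)
  obtain f \<pi> where "admissible E f" "pres f \<pi> (Cod M i)"
    by (rule ses_horseshoe[OF s 1(2) 2(2) 1(1) 2(1) 1(3) 2(3)])
  then show ?thesis by (intro P_I)
qed

section \<open>The exact category of admissibly presented objects\<close>

text \<open>The abstract copy of \<open>mod_adm\<close>, built by the same record operations;
  \<open>N_eq\<close> identifies the two.\<close>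

definition N :: "('o, 'm) excat" where
  "N = (let L = full_sub M P in pcat.extend L (excat.fields {(i, p). i \<in> Arr L \<and> p \<in> Arr L \<and> ses i p}))"

lemma N_simps [simp]:
  "Obj N = P" "Arr N = {f \<in> Arr M. Dom M f \<in> P \<and> Cod M f \<in> P}" "Dom N = Dom M" "Cod N = Cod M"
  "Idn N = Idn M" "Cmp N = Cmp M" "Plus N = Plus M" "Zero N = Zero M"
  "Conf N = {(i, p). i \<in> Arr M \<and> Dom M i \<in> P \<and> Cod M i \<in> P \<and> p \<in> Arr M \<and> Dom M p \<in> P \<and> Cod M p \<in> P \<and> ses i p}"
  using P_obj by (auto simp: N_def Let_def full_sub_def pcat.extend_def excat.fields_def)

lemma Hom_N: "X \<in> P \<Longrightarrow> Y \<in> P \<Longrightarrow> Hom N X Y = Hom M X Y"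
  by (auto simp: Hom_def)

section \<open>Composition and isomorphism invariance of exact sequences\<close>

lemma inj_cmp:
  assumes "inj i" "inj j" "Cod M i = Dom M j"
  shows "inj (j \<bullet> i)"
  unfolding inj_def
proof (intro conjI allI impI)
  note D = injD(1)[OF assms(1)] injD(1)[OF assms(2)] assms(3)
  show "j \<bullet> i \<in> Arr M" using D by simp
  fix x assume x: "T x (Dom M (j \<bullet> i))" "(j \<bullet> i) \<bullet> x = Zero M (Dom M x) (Cod M (j \<bullet> i))"
  have x': "T x (Dom M i)" using x D by simp
  note xD = TD[OF x']
  have t: "T (i \<bullet> x) (Dom M j)" by (rule T_cmp[OF x']) (use D in auto)
  have "i \<bullet> x = Zero M (Dom M x) (Cod M i)"
    using injD(2)[OF assms(2) t] x D xD by simp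
  from injD(2)[OF assms(1) x' this] show "x = Zero M (Dom M x) (Dom M (j \<bullet> i))" using D by simp
qed

lemma sur_cmp:
  assumes "sur p" "sur q" "Cod M p = Dom M q"
  shows "sur (q \<bullet> p)"
  unfolding sur_def
proof (intro conjI allI impI)
  note D = sur_arr[OF assms(1)] sur_arr[OF assms(2)] assms(3)
  show "q \<bullet> p \<in> Arr M" using D by simp
  fix y assume "T y (Cod M (q \<bullet> p))"
  then have "T y (Cod M q)" using D by simp
  then obtain z where z: "T z (Dom M q)" "Dom M z = Dom M y" "q \<bullet> z = y" by (rule surE[OF assms(2)])
  have "T z (Cod M p)" using z D by simp
  then obtain x where x: "T x (Dom M p)" "Dom M x = Dom M z" "p \<bullet> x = z" by (rule surE[OF assms(1)])
  then show "\<exists>x. T x (Dom M (q \<bullet> p)) \<and> Dom M x = Dom M y \<and> (q \<bullet> p) \<bullet> x = y"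
    using z TD[OF x(1)] D by (intro exI[of _ x]) auto
qed

lemma iso_inj: "is_iso_arr M u \<Longrightarrow> inj u"
  unfolding inj_def
proof (intro conjI allI impI)
  assume u: "is_iso_arr M u"
  note D = M.inv_arr[OF u]
  show "u \<in> Arr M" by (rule D)
  fix x assume x: "T x (Dom M u)" "u \<bullet> x = Zero M (Dom M x) (Cod M u)"
  show "x = Zero M (Dom M x) (Dom M u)" by (rule M.iso_mono[OF u]) (use x TD[OF x(1)] D in auto)
qed

lemma iso_sur: "is_iso_arr M u \<Longrightarrow> sur u"
  unfolding sur_def
proof (intro conjI allI impI)
  assume u: "is_iso_arr M u"
  note D = M.inv_arr[OF u]
  show "u \<in> Arr M" by (rule D)
  fix y assume y: "T y (Cod M u)"
  then show "\<exists>x. T x (Dom M u) \<and> Dom M x = Dom M y \<and> u \<bullet> x = y"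
    using D TD[OF y] T_cmp[OF y, of "inv_arr M u"] M.inv_arr_cmp[OF u] by (intro exI[of _ "inv_arr M u \<bullet> y"]) auto
qed

lemma ex_pre_sur:
  assumes e: "ex i p" and s: "sur s" "Cod M s = Dom M i"
  shows "ex (i \<bullet> s) p"
  unfolding ex_def
proof (intro conjI allI impI)
  note D = exD[OF e] sur_arr[OF s(1)] s(2)
  show "i \<bullet> s \<in> Arr M" "p \<in> Arr M" "Cod M (i \<bullet> s) = Dom M p" using D by auto
  show "p \<bullet> i \<bullet> s = Zero M (Dom M (i \<bullet> s)) (Cod M p)" using ex_cmp[OF e, of s] D by simp
  fix y assume y: "T y (Dom M p)" "p \<bullet> y = Zero M (Dom M y) (Cod M p)"
  obtain x where x: "T x (Dom M i)" "Dom M x = Dom M y" "i \<bullet> x = y" by (rule exE[OF e y])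
  have "T x (Cod M s)" using x D by simp
  then obtain z where z: "T z (Dom M s)" "Dom M z = Dom M x" "s \<bullet> z = x" by (rule surE[OF s(1)])
  then show "\<exists>x. T x (Dom M (i \<bullet> s)) \<and> Dom M x = Dom M y \<and> (i \<bullet> s) \<bullet> x = y"
    using x TD[OF z(1)] D by (intro exI[of _ z]) auto
qed

lemma ex_post_inj:
  assumes e: "ex i p" and j: "inj j" "Dom M j = Cod M p"
  shows "ex i (j \<bullet> p)"
  unfolding ex_def
proof (intro conjI allI impI)
  note D = exD[OF e] injD(1)[OF j(1)] j(2)
  show "i \<in> Arr M" "j \<bullet> p \<in> Arr M" "Cod M i = Dom M (j \<bullet> p)" using D by auto
  show "(j \<bullet> p) \<bullet> i = Zero M (Dom M i) (Cod M (j \<bullet> p))" using D by simp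
  fix y assume y: "T y (Dom M (j \<bullet> p))" "(j \<bullet> p) \<bullet> y = Zero M (Dom M y) (Cod M (j \<bullet> p))"
  have y': "T y (Dom M p)" using y D by simp
  have t: "T (p \<bullet> y) (Dom M j)" by (rule T_cmp[OF y']) (use D in auto)
  have "p \<bullet> y = Zero M (Dom M y) (Cod M p)" using injD(2)[OF j(1) t] y TD[OF y'] D by simp
  then show "\<exists>x. T x (Dom M i) \<and> Dom M x = Dom M y \<and> i \<bullet> x = y"
    using e y' unfolding ex_def by blast
qed

lemma ex_iso:
  assumes e: "ex i p" and u: "is_iso_arr M u" "Dom M u = Cod M i"
  shows "ex (u \<bullet> i) (p \<bullet> inv_arr M u)"
  unfolding ex_def
proof (intro conjI allI impI)
  note D = exD[OF e] M.inv_arr[OF u(1)] M.inv_arr_cmp[OF u(1)] u(2)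
  show "u \<bullet> i \<in> Arr M" "p \<bullet> inv_arr M u \<in> Arr M" "Cod M (u \<bullet> i) = Dom M (p \<bullet> inv_arr M u)"
    "(p \<bullet> inv_arr M u) \<bullet> u \<bullet> i = Zero M (Dom M (u \<bullet> i)) (Cod M (p \<bullet> inv_arr M u))" using D by auto
  fix y assume y: "T y (Dom M (p \<bullet> inv_arr M u))" "(p \<bullet> inv_arr M u) \<bullet> y = Zero M (Dom M y) (Cod M (p \<bullet> inv_arr M u))"
  have y': "T y (Cod M u)" using y D by simp
  have t: "T (inv_arr M u \<bullet> y) (Dom M p)" by (rule T_cmp[OF y']) (use D in auto)
  obtain x where x: "T x (Dom M i)" "Dom M x = Dom M (inv_arr M u \<bullet> y)" "i \<bullet> x = inv_arr M u \<bullet> y"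
    by (rule exE[OF e t]) (use y TD[OF y'] D in auto)
  then show "\<exists>x. T x (Dom M (u \<bullet> i)) \<and> Dom M x = Dom M y \<and> (u \<bullet> i) \<bullet> x = y"
    using TD[OF y'] TD[OF x(1)] D by (intro exI[of _ x]) auto
qed

lemma ses_iso:
  assumes s: "ses i p" and iso: "is_iso_arr M a" "is_iso_arr M b" "is_iso_arr M c"
    and t: "j \<in> Arr M" "q \<in> Arr M" "Cod M j = Dom M q" "Dom M a = Dom M i" "Cod M a = Dom M j" "Dom M b = Cod M i" "Cod M b = Cod M j"
      "Dom M c = Cod M p" "Cod M c = Cod M q" and e: "j \<bullet> a = b \<bullet> i" "q \<bullet> b = c \<bullet> p"
  shows "ses j q"
proof -
  note D = ses_arr[OF s] M.inv_arr[OF iso(1)] M.inv_arr[OF iso(2)] M.inv_arr[OF iso(3)]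
  have "j = (j \<bullet> a) \<bullet> inv_arr M a" using t D by simp
  also have "\<dots> = (b \<bullet> i) \<bullet> inv_arr M a" by (simp only: e)
  finally have j: "j = (b \<bullet> i) \<bullet> inv_arr M a" .
  have "q = (q \<bullet> b) \<bullet> inv_arr M b" using t D by simp
  also have "\<dots> = c \<bullet> p \<bullet> inv_arr M b" unfolding e using t D by simp
  finally have q: "q = c \<bullet> p \<bullet> inv_arr M b" .
  have "inj j" unfolding j
    by (intro inj_cmp iso_inj M.iso_inv iso sesD[OF s]) (use t D in auto)
  moreover have "sur q" unfolding q
    by (intro sur_cmp iso_sur M.iso_inv iso sesD[OF s]) (use t D in auto)
  moreover have "ex j q" unfolding j q
    by (intro ex_pre_sur ex_post_inj ex_iso iso_sur iso_inj M.iso_inv iso sesD[OF s]) (use t D in auto)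
  ultimately show ?thesis by (simp add: ses_def)
qed

lemma P_iso:
  assumes F: "F \<in> P" and u: "is_iso_arr M u" "Dom M u = F"
  shows "Cod M u \<in> P"
proof -
  obtain f \<pi> where f: "admissible E f" "pres f \<pi> F" using F by (auto simp: P_def)
  note D = presD[OF f(2)] M.inv_arr[OF u(1)]
  have "pres f (u \<bullet> \<pi>) (Cod M u)" unfolding pres_def
    using D u ex_post_inj[OF D(2) iso_inj[OF u(1)]] sur_cmp[OF D(3) iso_sur[OF u(1)]] by simp
  then show ?thesis using f(1) by (rule P_I)
qed

text \<open>A zero arrow has zero image whatever its source. The source is left free:
  \<open>RO_P\<close> takes a zero object, which makes the arrow an inflation, and
  \<open>conf_ses\<close> takes \<open>Z = Y\<close>.\<close>

lemma RO_pres: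
  assumes "Y \<in> Obj E" "Z \<in> Obj E"
  shows "pres (Zero E Z Y) (Idn M (RO Y)) (RO Y)"
  unfolding pres_def
proof (intro conjI)
  show "ex (R (Zero E Z Y)) (Idn M (RO Y))" unfolding ex_def
  proof (intro conjI allI impI)
    fix y assume y: "T y (Dom M (Idn M (RO Y)))" "Idn M (RO Y) \<bullet> y = Zero M (Dom M y) (Cod M (Idn M (RO Y)))"
    note yD = TD[OF y(1)]
    have "T (Zero M (Dom M y) (RO Z)) (RO Z)" using T_dom[OF y(1)] yD assms by (auto simp: T_def)
    then show "\<exists>x. T x (Dom M (R (Zero E Z Y))) \<and> Dom M x = Dom M y \<and> R (Zero E Z Y) \<bullet> x = y"
      using y yD assms by (intro exI[of _ "Zero M (Dom M y) (RO Z)"]) auto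
  qed (use assms in auto)
qed (use assms in \<open>auto intro: iso_sur\<close>)

lemma RO_P:
  assumes "Y \<in> Obj E"
  shows "RO Y \<in> P"
proof -
  obtain Z where Z: "is_zero_obj E Z" using E.ex_zero_obj by blast
  have "admissible E (Zero E Z Y)"
    by (rule E.inflation_admissible, rule E.zero_inflation) (use Z E.zero_objD(1)[OF Z] assms in auto)
  then show ?thesis using RO_pres[OF assms E.zero_objD(1)[OF Z]] by (intro P_I)
qed

lemma RO_zero: "is_zero_obj E Z \<Longrightarrow> is_zero_obj M (RO Z)"
  using E.zero_objD(1,4)[of Z] R_idn[of Z] by (intro M.zero_objI) auto

text \<open>\<open>M\<close> is only preadditive, so the biproduct is built from presentations: the
  diagonal matrix is admissible by \<open>E.horseshoe\<close> with zero corner, and inclusions and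
  projections descend by \<open>pres_map\<close>.\<close>

lemma P_biprod:
  assumes F: "F \<in> P" and H: "H \<in> P"
  obtains S i j p q where "S \<in> P" "M.biprod F H S i j p q"
proof -
  obtain f1 \<pi>1 where 1: "admissible E f1" "pres f1 \<pi>1 F" using F by (auto simp: P_def)
  obtain f2 \<pi>2 where 2: "admissible E f2" "pres f2 \<pi>2 H" using H by (auto simp: P_def)
  note D1 = presD[OF 1(2)] and D2 = presD[OF 2(2)]
  obtain p1 m1 where pm1: "deflation E p1" "inflation E m1" "Cod E p1 = Dom E m1" "f1 = m1 \<cdot> p1"
    using 1(1) by (rule E.admissibleE)
  obtain p2 m2 where pm2: "deflation E p2" "inflation E m2" "Cod E p2 = Dom E m2" "f2 = m2 \<cdot> p2"
    using 2(1) by (rule E.admissibleE)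
  obtain c1 where c1: "(m1, c1) \<in> Conf E" using pm1(2) by (rule E.inflationE)
  obtain c2 where c2: "(m2, c2) \<in> Conf E" using pm2(2) by (rule E.inflationE)
  obtain k2 where k2: "(k2, p2) \<in> Conf E" using pm2(1) by (rule E.deflationE)
  note A = E.confD[OF c1] E.confD[OF c2] E.confD[OF k2] E.deflation_arr[OF pm1(1)] pm1(3) pm2(3)
  have ft: "Dom E f1 = Dom E p1" "Cod E f1 = Cod E m1" "Dom E f2 = Dom E p2" "Cod E f2 = Cod E m2"
    using pm1(4) pm2(4) A by auto
  obtain SX iX jX pX qX where bX: "E.biprod (Dom E p1) (Dom E p2) SX iX jX pX qX"
    by (rule E.biprodE[of "Dom E p1" "Dom E p2"]) (use A in auto)
  obtain SY iY jY pY qY where bY: "E.biprod (Cod E m1) (Cod E m2) SY iY jY pY qY"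
    by (rule E.biprodE[of "Cod E m1" "Cod E m2"]) (use A in auto)
  note DX = E.biprodD[OF bX] E.biprod_cmp(1-4)[OF bX]
  note DY = E.biprodD[OF bY] E.biprod_cmp(1-4)[OF bY]
  define f where "f = iY \<cdot> m1 \<cdot> p1 \<cdot> pX \<dotplus> (iY \<cdot> Zero E (Dom E p2) (Cod E m1) \<cdot> qX \<dotplus> jY \<cdot> m2 \<cdot> p2 \<cdot> qX)"
  have "admissible E f"
    by (rule E.horseshoe[OF pm1(1) c1 pm1(3) k2 c2 pm2(3), of "Zero E (Dom E p2) (Cod E m1)" "Zero E (Dom E k2) (Dom E m1)",
        OF _ _ _ _ _ _ _ bX bY f_def]) (use A in auto)
  moreover have f: "f = iY \<cdot> f1 \<cdot> pX \<dotplus> jY \<cdot> f2 \<cdot> qX"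
    unfolding f_def pm1(4) pm2(4) using A DX DY by simp
  have ft': "f \<in> Arr E" "Dom E f = SX" "Cod E f = SY" unfolding f using D1 D2 DX DY ft by auto
  obtain \<pi> G where \<pi>: "pres f \<pi> G" using pres_ex[OF ft'(1)] by blast
  note D = presD[OF \<pi>]
  have G: "G \<in> P" using \<pi> calculation by (rule P_I)
  obtain i where i: "i \<in> Arr M" "Dom M i = F" "Cod M i = G" "i \<bullet> \<pi>1 = \<pi> \<bullet> R iY"
    by (rule pres_map[OF 1(2) \<pi>, of iY iX]) (use f ft ft' D1 D2 DX DY in auto)
  obtain j where j: "j \<in> Arr M" "Dom M j = H" "Cod M j = G" "j \<bullet> \<pi>2 = \<pi> \<bullet> R jY"
    by (rule pres_map[OF 2(2) \<pi>, of jY jX]) (use f ft ft' D1 D2 DX DY in auto)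
  obtain p where p: "p \<in> Arr M" "Dom M p = G" "Cod M p = F" "p \<bullet> \<pi> = \<pi>1 \<bullet> R pY"
    by (rule pres_map[OF \<pi> 1(2), of pY pX]) (use f ft ft' D1 D2 DX DY in auto)
  obtain q where q: "q \<in> Arr M" "Dom M q = G" "Cod M q = H" "q \<bullet> \<pi> = \<pi>2 \<bullet> R qY"
    by (rule pres_map[OF \<pi> 2(2), of qY qX]) (use f ft ft' D1 D2 DX DY in auto)
  note red = i(4)[THEN M.cmp_reduce] j(4)[THEN M.cmp_reduce] p(4)[THEN M.cmp_reduce] q(4)[THEN M.cmp_reduce]
  have Rb: "R pY \<bullet> R iY = Idn M (RO (Cod E m1))" "R qY \<bullet> R jY = Idn M (RO (Cod E m2))"
    "R pY \<bullet> R jY = Zero M (RO (Cod E m2)) (RO (Cod E m1))" "R qY \<bullet> R iY = Zero M (RO (Cod E m1)) (RO (Cod E m2))"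
    using DY by (simp_all add: R_cmp[symmetric] R_idn)
  have "R (iY \<cdot> pY \<dotplus> jY \<cdot> qY) = Idn M (RO SY)" using DY R_idn by simp
  then have Rs: "R iY \<bullet> R pY \<oplus> R jY \<bullet> R qY = Idn M (RO SY)" using DY(1-19) by (simp add: R_plus R_cmp)
  have "\<pi> \<bullet> (R iY \<bullet> R pY \<oplus> R jY \<bullet> R qY) = \<pi>" unfolding Rs using D ft' by simp
  then have Rs': "\<pi> \<bullet> R iY \<bullet> R pY \<oplus> \<pi> \<bullet> R jY \<bullet> R qY = \<pi>" using D ft' DY(1-19) by simp
  have "p \<bullet> i = Idn M F" "q \<bullet> i = Zero M F H"
    by (rule sur_epi[OF D1(3)]; use i p q D D1 D2 DY ft ft' Rb in \<open>simp add: red\<close>)+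
  moreover have "q \<bullet> j = Idn M H" "p \<bullet> j = Zero M H F"
    by (rule sur_epi[OF D2(3)]; use j p q D D1 D2 DY ft ft' Rb in \<open>simp add: red\<close>)+
  moreover have "i \<bullet> p \<oplus> j \<bullet> q = Idn M G"
    by (rule sur_epi[OF D(3)]; use i j p q D D1 D2 DY(1-19) ft ft' Rs' in \<open>simp add: red\<close>)
  ultimately have "M.biprod F H G i j p q"
    unfolding M.biprod_def using i j p q D D1 D2 by simp
  with G that show thesis by blast
qed

text \<open>The corner is the cokernel of the difference of \<open>i\<close> and
  \<open>\<phi>\<close> into the biproduct, as in an abelian category. It is not known to lie in
  \<open>P\<close> at this point; \<open>P_ext\<close> puts it there once the sequence is
  exact.\<close>

lemma ses_pushout:
  assumes s: "ses i p" and \<phi>: "\<phi> \<in> Arr M" "Dom M \<phi> = Dom M i" and P: "Dom M i \<in> P" "Cod M i \<in> P" "Cod M p \<in> P" "Cod M \<phi> \<in> P"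
  obtains i' f' p' where "ses i' p'" "is_pushout M i \<phi> i' f'" "Cod M p' = Cod M p"
proof -
  note S = ses_arr[OF s]
  obtain B u v r t where "B \<in> P" and b: "M.biprod (Cod M i) (Cod M \<phi>) B u v r t"
    by (rule P_biprod[OF P(2,4)])
  note D = M.biprodD[OF b] M.biprod_cmp(1-4)[OF b]
  define \<psi> where "\<psi> = u \<bullet> i \<oplus> neg M (v \<bullet> \<phi>)"
  have \<psi>: "\<psi> \<in> Arr M" "Dom M \<psi> = Dom M i" "Cod M \<psi> = B" unfolding \<psi>_def using D S \<phi> by auto
  obtain \<pi> where \<pi>: "sur \<pi>" "ex \<psi> \<pi>" using cok_ex[OF \<psi>(1)] by blast
  note \<pi>D = exD[OF \<pi>(2), unfolded \<psi>]
  have eq: "\<pi> \<bullet> v \<bullet> \<phi> = \<pi> \<bullet> u \<bullet> i"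
  proof (rule M.eq_if_diff_zero[symmetric])
    show "\<pi> \<bullet> u \<bullet> i \<oplus> neg M (\<pi> \<bullet> v \<bullet> \<phi>) = Zero M (Dom M (\<pi> \<bullet> u \<bullet> i)) (Cod M (\<pi> \<bullet> u \<bullet> i))"
      using \<pi>D D S \<phi> unfolding \<psi>_def by simp
  qed (use \<pi>D D S \<phi> in auto)
  have po: "is_pushout M i \<phi> (\<pi> \<bullet> v) (\<pi> \<bullet> u)"
  proof (rule M.pushoutI)
    fix a c assume ac: "a \<in> Arr M" "c \<in> Arr M" "Dom M a = Cod M \<phi>" "Dom M c = Cod M i" "Cod M a = Cod M c" "a \<bullet> \<phi> = c \<bullet> i"
    let ?h = "c \<bullet> r \<oplus> a \<bullet> t"
    have ht: "?h \<in> Arr M" "Dom M ?h = B" "Cod M ?h = Cod M c" using ac D by auto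
    have h\<psi>: "?h \<bullet> \<psi> = Zero M (Dom M i) (Cod M c)" unfolding \<psi>_def using ac D S \<phi> by simp
    have "?h \<bullet> x = Zero M (Dom M x) (Cod M ?h)" if x: "T x (Dom M \<pi>)" "\<pi> \<bullet> x = Zero M (Dom M x) (Cod M \<pi>)" for x
    proof -
      obtain y where y: "T y (Dom M \<psi>)" "Dom M y = Dom M x" "\<psi> \<bullet> y = x" by (rule exE[OF \<pi>(2) x])
      have "?h \<bullet> \<psi> \<bullet> y = Zero M (Dom M x) (Cod M ?h)"
        using M.cmp_reduce[OF h\<psi>, of y] TD[OF y(1)] \<psi> ht ac S y(2) by (simp del: M.cmp_plus_l)
      then show ?thesis unfolding y(3) .
    qed
    then obtain w where w: "w \<in> Arr M" "Dom M w = Cod M \<pi>" "Cod M w = Cod M c" "w \<bullet> \<pi> = ?h"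
      using cok_fac[OF \<pi>(1) ht(1)] ht \<pi>D by metis
    have "w \<bullet> \<pi> \<bullet> v = a" "w \<bullet> \<pi> \<bullet> u = c" using w ac D \<pi>D by (simp_all add: w(4)[THEN M.cmp_reduce])
    with w show "\<exists>u'\<in>Arr M. Dom M u' = Cod M (\<pi> \<bullet> v) \<and> Cod M u' = Cod M a \<and> u' \<bullet> \<pi> \<bullet> v = a \<and> u' \<bullet> \<pi> \<bullet> u = c"
      using D \<pi>D ac by (intro bexI[of _ w]) auto
  next
    fix x y assume xy: "x \<in> Arr M" "y \<in> Arr M" "Cod M x = Cod M y" "Dom M x = Cod M (\<pi> \<bullet> v)" "Dom M y = Cod M (\<pi> \<bullet> v)"
      "x \<bullet> \<pi> \<bullet> v = y \<bullet> \<pi> \<bullet> v" "x \<bullet> \<pi> \<bullet> u = y \<bullet> \<pi> \<bullet> u"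
    have "x \<bullet> \<pi> = y \<bullet> \<pi>" by (rule M.biprod_eq_from[OF b]) (use xy D \<pi>D in auto)
    then show "x = y" by (rule sur_epi[OF \<pi>(1)]) (use xy D \<pi>D in auto)
  qed (use eq D S \<phi> \<pi>D in auto)
  obtain p' where p': "p' \<in> Arr M" "Dom M p' = Cod M \<pi>" "Cod M p' = Cod M p" "p' \<bullet> \<pi> \<bullet> v = Zero M (Cod M \<phi>) (Cod M p)" "p' \<bullet> \<pi> \<bullet> u = p"
    by (rule M.pushout_fac[OF po, of "Zero M (Cod M \<phi>) (Cod M p)" p]) (use S \<phi> D \<pi>D in auto)
  have p'\<pi>: "p' \<bullet> \<pi> = p \<bullet> r"
    by (rule M.biprod_eq_from[OF b]) (use p' S D \<pi>D in auto)
  have "ses (\<pi> \<bullet> v) p'" unfolding ses_def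
  proof (intro conjI)
    show "inj (\<pi> \<bullet> v)" unfolding inj_def
    proof (intro conjI allI impI)
      fix x assume x: "T x (Dom M (\<pi> \<bullet> v))" "(\<pi> \<bullet> v) \<bullet> x = Zero M (Dom M x) (Cod M (\<pi> \<bullet> v))"
      have xT: "T x (Cod M \<phi>)" using x D \<pi>D by simp
      note xD = TD[OF xT]
      have t1: "T (v \<bullet> x) (Dom M \<pi>)" by (rule T_cmp[OF xT]) (use D \<pi>D in auto)
      \<comment> \<open>If \<open>v \<bullet> x\<close> dies in the cokernel, it is
        \<open>\<psi> \<bullet> y\<close>. Its first component shows that \<open>i\<close> kills
        \<open>y\<close>, so \<open>y\<close> vanishes, and with it the second component
        \<open>x\<close>.\<close>
      obtain y where y: "T y (Dom M \<psi>)" "Dom M y = Dom M (v \<bullet> x)" "\<psi> \<bullet> y = v \<bullet> x"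
        by (rule exE[OF \<pi>(2) t1]) (use x xD D \<pi>D in auto)
      have yT: "T y (Dom M i)" using y \<psi> by simp
      note yD = TD[OF yT]
      have "r \<bullet> \<psi> \<bullet> y = r \<bullet> v \<bullet> x" by (simp only: y(3))
      then have "i \<bullet> y = Zero M (Dom M y) (Cod M i)"
        using yD xD D S \<phi> y(2) unfolding \<psi>_def by simp
      from injD(2)[OF sesD(1)[OF s] yT this] have y0: "y = Zero M (Dom M y) (Dom M i)" .
      have "t \<bullet> v \<bullet> x = t \<bullet> \<psi> \<bullet> y" by (simp only: y(3))
      also have "\<dots> = Zero M (Dom M y) (Cod M \<phi>)" by (subst y0) (use yD D \<psi> in auto)
      finally show "x = Zero M (Dom M x) (Dom M (\<pi> \<bullet> v))" using xD D \<pi>D y(2) by simp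
    qed (use D \<pi>D in auto)
    show "ex (\<pi> \<bullet> v) p'" unfolding ex_def
    proof (intro conjI allI impI)
      fix y assume y: "T y (Dom M p')" "p' \<bullet> y = Zero M (Dom M y) (Cod M p')"
      have "T y (Cod M \<pi>)" using y p' by simp
      then obtain z where z: "T z (Dom M \<pi>)" "Dom M z = Dom M y" "\<pi> \<bullet> z = y" by (rule surE[OF \<pi>(1)])
      have zT: "T z B" using z \<pi>D by simp
      note zD = TD[OF zT]
      have rT: "T (r \<bullet> z) (Dom M p)" by (rule T_cmp[OF zT]) (use D S in auto)
      have "p \<bullet> r \<bullet> z = p' \<bullet> \<pi> \<bullet> z" using M.cmp_reduce[OF p'\<pi>, of z] zD p' \<pi>D S D by simp
      then have "p \<bullet> r \<bullet> z = Zero M (Dom M (r \<bullet> z)) (Cod M p)" unfolding z(3) using y p' z zD D by simp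
      from exE[OF sesD(2)[OF s] rT this] obtain w where w: "T w (Dom M i)" "Dom M w = Dom M (r \<bullet> z)" "i \<bullet> w = r \<bullet> z" .
      note wD = TD[OF w(1)]
      have wz: "Dom M w = Dom M z" using w zD D by simp
      let ?x = "\<phi> \<bullet> w \<oplus> t \<bullet> z"
      have "T (\<phi> \<bullet> w) (Cod M \<phi>)" "T (t \<bullet> z) (Cod M \<phi>)" using T_cmp[OF w(1)] T_cmp[OF zT] \<phi> D by auto
      then have xT: "T ?x (Cod M \<phi>)" by (rule T_plus) (use wD zD wz \<phi> D in auto)
      have "\<pi> \<bullet> v \<bullet> ?x = \<pi> \<bullet> v \<bullet> \<phi> \<bullet> w \<oplus> \<pi> \<bullet> v \<bullet> t \<bullet> z" using wD zD wz \<phi> D \<pi>D by simp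
      also have "\<pi> \<bullet> v \<bullet> \<phi> \<bullet> w = \<pi> \<bullet> u \<bullet> r \<bullet> z"
        using M.cmp_reduce[OF eq, of w] wD \<phi> D \<pi>D S w(3) by simp
      also have "\<pi> \<bullet> u \<bullet> r \<bullet> z \<oplus> \<pi> \<bullet> v \<bullet> t \<bullet> z = \<pi> \<bullet> (u \<bullet> r \<bullet> z \<oplus> v \<bullet> t \<bullet> z)" using zD D(1-19) \<pi>D by simp
      also have "u \<bullet> r \<bullet> z \<oplus> v \<bullet> t \<bullet> z = z" by (rule M.biprod_cmp(5)[OF b]) (use zD in auto)
      finally have "(\<pi> \<bullet> v) \<bullet> ?x = y" unfolding z(3) using wD zD wz \<phi> D \<pi>D by simp
      then show "\<exists>x. T x (Dom M (\<pi> \<bullet> v)) \<and> Dom M x = Dom M y \<and> (\<pi> \<bullet> v) \<bullet> x = y"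
        using xT wD zD wz z \<phi> D \<pi>D by (intro exI[of _ ?x]) auto
    qed (use D \<pi>D p' in auto)
    show "sur p'" unfolding sur_def
    proof (intro conjI allI impI)
      fix y assume "T y (Cod M p')"
      then have "T y (Cod M p)" using p' by simp
      then obtain z where z: "T z (Dom M p)" "Dom M z = Dom M y" "p \<bullet> z = y" by (rule surE[OF sesD(3)[OF s]])
      have "T ((\<pi> \<bullet> u) \<bullet> z) (Cod M \<pi>)" by (rule T_cmp[OF z(1)]) (use D \<pi>D S in auto)
      moreover have "p' \<bullet> \<pi> \<bullet> u \<bullet> z = y" using M.cmp_reduce[OF p'(5), of z] TD[OF z(1)] z D \<pi>D S p' by simp
      ultimately show "\<exists>x. T x (Dom M p') \<and> Dom M x = Dom M y \<and> p' \<bullet> x = y"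
        using TD[OF z(1)] z D \<pi>D S p' by (intro exI[of _ "(\<pi> \<bullet> u) \<bullet> z"]) auto
    qed (use p' in auto)
  qed
  with po p' that show thesis by blast
qed

text \<open>Dually, the corner is the kernel of the difference of \<open>p\<close> and
  \<open>\<phi>\<close> on the biproduct, and \<open>i'\<close> is induced by \<open>i\<close> and
  zero.\<close>

lemma ses_pullback:
  assumes s: "ses i p" and \<phi>: "\<phi> \<in> Arr M" "Cod M \<phi> = Cod M p" and P: "Dom M i \<in> P" "Cod M i \<in> P" "Cod M p \<in> P" "Dom M \<phi> \<in> P"
  obtains i' f' p' where "ses i' p'" "is_pullback M p \<phi> p' f'" "Dom M i' = Dom M i"
proof -
  note S = ses_arr[OF s]
  obtain B u v r t where "B \<in> P" and b: "M.biprod (Cod M i) (Dom M \<phi>) B u v r t"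
    by (rule P_biprod[OF P(2,4)])
  note D = M.biprodD[OF b] M.biprod_cmp(1-4)[OF b]
  define \<psi> where "\<psi> = p \<bullet> r \<oplus> neg M (\<phi> \<bullet> t)"
  have \<psi>: "\<psi> \<in> Arr M" "Dom M \<psi> = B" "Cod M \<psi> = Cod M p" unfolding \<psi>_def using D S \<phi> by auto
  obtain \<kappa> where \<kappa>: "inj \<kappa>" "ex \<kappa> \<psi>" using ker_ex[OF \<psi>(1)] by blast
  note \<kappa>D = exD[OF \<kappa>(2), unfolded \<psi>]
  have eq: "\<phi> \<bullet> t \<bullet> \<kappa> = p \<bullet> r \<bullet> \<kappa>"
  proof (rule M.eq_if_diff_zero[symmetric])
    show "p \<bullet> r \<bullet> \<kappa> \<oplus> neg M (\<phi> \<bullet> t \<bullet> \<kappa>) = Zero M (Dom M (p \<bullet> r \<bullet> \<kappa>)) (Cod M (p \<bullet> r \<bullet> \<kappa>))"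
      using \<kappa>D D S \<phi> unfolding \<psi>_def by simp
  qed (use \<kappa>D D S \<phi> in auto)
  have pb: "is_pullback M p \<phi> (t \<bullet> \<kappa>) (r \<bullet> \<kappa>)"
  proof (rule M.pullbackI)
    fix a c assume ac: "a \<in> Arr M" "c \<in> Arr M" "Cod M a = Dom M \<phi>" "Cod M c = Dom M p" "Dom M a = Dom M c" "\<phi> \<bullet> a = p \<bullet> c"
    let ?h = "u \<bullet> c \<oplus> v \<bullet> a"
    have "\<psi> \<bullet> ?h = Zero M (Dom M ?h) (Cod M \<psi>)" unfolding \<psi>_def using ac D S \<phi> by simp
    then obtain w where w: "w \<in> Arr M" "Dom M w = Dom M ?h" "Cod M w = Dom M \<kappa>" "\<kappa> \<bullet> w = ?h"
      using inj_fac[OF \<kappa>, of ?h] ac D S \<kappa>D by auto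
    have "t \<bullet> \<kappa> \<bullet> w = a" "r \<bullet> \<kappa> \<bullet> w = c" unfolding w(4) using ac D S by simp_all
    with w show "\<exists>u'\<in>Arr M. Dom M u' = Dom M a \<and> Cod M u' = Dom M (t \<bullet> \<kappa>) \<and> (t \<bullet> \<kappa>) \<bullet> u' = a \<and> (r \<bullet> \<kappa>) \<bullet> u' = c"
      using D \<kappa>D ac S by (intro bexI[of _ w]) auto
  next
    fix x y assume xy: "x \<in> Arr M" "y \<in> Arr M" "Dom M x = Dom M y" "Cod M x = Dom M (t \<bullet> \<kappa>)" "Cod M y = Dom M (t \<bullet> \<kappa>)"
      "(t \<bullet> \<kappa>) \<bullet> x = (t \<bullet> \<kappa>) \<bullet> y" "(r \<bullet> \<kappa>) \<bullet> x = (r \<bullet> \<kappa>) \<bullet> y"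
    have "\<kappa> \<bullet> x = \<kappa> \<bullet> y" by (rule M.biprod_eq_into[OF b]) (use xy D \<kappa>D in auto)
    then show "x = y" by (rule inj_mono[OF \<kappa>(1)]) (use xy D \<kappa>D in auto)
  qed (use eq D S \<phi> \<kappa>D in auto)
  obtain i' where i': "i' \<in> Arr M" "Dom M i' = Dom M i" "Cod M i' = Dom M \<kappa>" "(t \<bullet> \<kappa>) \<bullet> i' = Zero M (Dom M i) (Dom M \<phi>)" "(r \<bullet> \<kappa>) \<bullet> i' = i"
    by (rule M.pullback_fac[OF pb, of "Zero M (Dom M i) (Dom M \<phi>)" i]) (use S \<phi> D \<kappa>D in auto)
  have "ses i' (t \<bullet> \<kappa>)" unfolding ses_def
  proof (intro conjI)
    show "inj i'" unfolding inj_def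
    proof (intro conjI allI impI)
      fix x assume x: "T x (Dom M i')" "i' \<bullet> x = Zero M (Dom M x) (Cod M i')"
      have xT: "T x (Dom M i)" using x i' by simp
      note xD = TD[OF xT]
      have "((r \<bullet> \<kappa>) \<bullet> i') \<bullet> x = (r \<bullet> \<kappa>) \<bullet> i' \<bullet> x" using xD i'(1-3) D \<kappa>D by simp
      then have "i \<bullet> x = Zero M (Dom M x) (Cod M i)" unfolding i'(5) x(2) using xD i' D \<kappa>D S by simp
      from injD(2)[OF sesD(1)[OF s] xT this] show "x = Zero M (Dom M x) (Dom M i')" using i' by simp
    qed (use i' in auto)
    show "ex i' (t \<bullet> \<kappa>)" unfolding ex_def
    proof (intro conjI allI impI)
      fix y assume y: "T y (Dom M (t \<bullet> \<kappa>))" "(t \<bullet> \<kappa>) \<bullet> y = Zero M (Dom M y) (Cod M (t \<bullet> \<kappa>))"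
      have yT: "T y (Dom M \<kappa>)" using y D \<kappa>D by simp
      note yD = TD[OF yT]
      have rT: "T ((r \<bullet> \<kappa>) \<bullet> y) (Dom M p)" by (rule T_cmp[OF yT]) (use D S \<kappa>D in auto)
      have "p \<bullet> (r \<bullet> \<kappa>) \<bullet> y = \<phi> \<bullet> (t \<bullet> \<kappa>) \<bullet> y" using M.cmp_reduce[OF M.pullbackD(9)[OF pb], of y] yD D \<kappa>D S \<phi> by simp
      then have "p \<bullet> (r \<bullet> \<kappa>) \<bullet> y = Zero M (Dom M ((r \<bullet> \<kappa>) \<bullet> y)) (Cod M p)" unfolding y(2) using yD D \<kappa>D S \<phi> by simp
      from exE[OF sesD(2)[OF s] rT this] obtain w where w: "T w (Dom M i)" "Dom M w = Dom M ((r \<bullet> \<kappa>) \<bullet> y)" "i \<bullet> w = (r \<bullet> \<kappa>) \<bullet> y" .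
      note wD = TD[OF w(1)]
      have "i' \<bullet> w = y"
      proof (rule M.pullback_eq[OF pb])
        have "(t \<bullet> \<kappa>) \<bullet> i' \<bullet> w = Zero M (Dom M w) (Dom M \<phi>)" using M.cmp_reduce[OF i'(4), of w] wD i' D \<kappa>D \<phi> by simp
        then show "(t \<bullet> \<kappa>) \<bullet> i' \<bullet> w = (t \<bullet> \<kappa>) \<bullet> y" using y(2) w(2) yD D \<kappa>D by simp
        show "(r \<bullet> \<kappa>) \<bullet> i' \<bullet> w = (r \<bullet> \<kappa>) \<bullet> y" using M.cmp_reduce[OF i'(5), of w] w wD i' D \<kappa>D by simp
      qed (use w wD yD i' D \<kappa>D in auto)
      then show "\<exists>x. T x (Dom M i') \<and> Dom M x = Dom M y \<and> i' \<bullet> x = y"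
        using w yD D \<kappa>D i' by (intro exI[of _ w]) auto
    qed (use D \<kappa>D i' in auto)
    show "sur (t \<bullet> \<kappa>)" unfolding sur_def
    proof (intro conjI allI impI)
      fix y assume "T y (Cod M (t \<bullet> \<kappa>))"
      then have yT: "T y (Dom M \<phi>)" using D \<kappa>D by simp
      note yD = TD[OF yT]
      have "T (\<phi> \<bullet> y) (Cod M p)" by (rule T_cmp[OF yT]) (use \<phi> in auto)
      then obtain z where z: "T z (Dom M p)" "Dom M z = Dom M (\<phi> \<bullet> y)" "p \<bullet> z = \<phi> \<bullet> y" by (rule surE[OF sesD(3)[OF s]])
      obtain w where w: "w \<in> Arr M" "Dom M w = Dom M y" "Cod M w = Dom M (t \<bullet> \<kappa>)" "(t \<bullet> \<kappa>) \<bullet> w = y" "(r \<bullet> \<kappa>) \<bullet> w = z"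
        by (rule M.pullback_fac[OF pb, of y z]) (use yD z TD[OF z(1)] \<phi> S in auto)
      have "T w (Dom M (t \<bullet> \<kappa>))" using w T_dom[OF yT] by (auto simp: T_def)
      with w show "\<exists>x. T x (Dom M (t \<bullet> \<kappa>)) \<and> Dom M x = Dom M y \<and> (t \<bullet> \<kappa>) \<bullet> x = y" by blast
    qed (use D \<kappa>D in auto)
  qed
  with pb i' that show thesis by blast
qed

text \<open>By the third isomorphism theorem the cokernel of the composite is an extension of the
  cokernel of \<open>j\<close> by that of \<open>i\<close>, so \<open>P_ext\<close> keeps it in
  \<open>P\<close>.\<close>

lemma ses_inflation_cmp:
  assumes s1: "ses i p" and s2: "ses j q" and ij: "Cod M i = Dom M j" and P: "Cod M p \<in> P" "Cod M q \<in> P"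
  obtains \<pi> where "ses (j \<bullet> i) \<pi>" "Cod M \<pi> \<in> P"
proof -
  note S1 = ses_arr[OF s1] and S2 = ses_arr[OF s2]
  have ji: "inj (j \<bullet> i)" by (rule inj_cmp) (use sesD[OF s1] sesD[OF s2] ij in auto)
  obtain \<pi> where \<pi>: "sur \<pi>" "ex (j \<bullet> i) \<pi>" using cok_ex[OF injD(1)[OF ji]] by blast
  have s: "ses (j \<bullet> i) \<pi>" using ji \<pi> by (simp add: ses_def)
  note S = ses_arr[OF s]
  have St: "Dom M \<pi> = Cod M j" "\<pi> \<bullet> j \<bullet> i = Zero M (Dom M i) (Cod M \<pi>)" using S S1 S2 ij by auto
  note S = S(1,2)
  obtain \<alpha> where \<alpha>: "\<alpha> \<in> Arr M" "Dom M \<alpha> = Cod M p" "Cod M \<alpha> = Cod M \<pi>" "\<alpha> \<bullet> p = \<pi> \<bullet> j"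
    by (rule ses_fac_out[OF s1, of "\<pi> \<bullet> j"]) (use S S1 S2 St ij in auto)
  obtain \<beta> where \<beta>: "\<beta> \<in> Arr M" "Dom M \<beta> = Cod M \<pi>" "Cod M \<beta> = Cod M q" "\<beta> \<bullet> \<pi> = q"
    by (rule ses_fac_out[OF s, of q]) (use S1(1-3) S2(1-3) ij ex_cmp[OF sesD(2)[OF s2], of i] in simp_all)
  have "ses \<alpha> \<beta>" unfolding ses_def
  proof (intro conjI)
    show "inj \<alpha>" unfolding inj_def
    proof (intro conjI allI impI)
      fix x assume x: "T x (Dom M \<alpha>)" "\<alpha> \<bullet> x = Zero M (Dom M x) (Cod M \<alpha>)"
      have "T x (Cod M p)" using x \<alpha> by simp
      then obtain y where y: "T y (Dom M p)" "Dom M y = Dom M x" "p \<bullet> y = x" by (rule surE[OF sesD(3)[OF s1]])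
      note yD = TD[OF y(1)]
      have t: "T (j \<bullet> y) (Dom M \<pi>)" by (rule T_cmp[OF y(1)]) (use S1 S2 St ij in auto)
      have "\<pi> \<bullet> j \<bullet> y = \<alpha> \<bullet> p \<bullet> y" using M.cmp_reduce[OF \<alpha>(4), of y] yD \<alpha>(1-3) S S1 S2 St ij by simp
      then have "\<pi> \<bullet> j \<bullet> y = Zero M (Dom M (j \<bullet> y)) (Cod M \<pi>)" unfolding y(3) x(2) using yD y \<alpha> S2 S1 ij by simp
      from exE[OF \<pi>(2) t this] obtain z where z: "T z (Dom M (j \<bullet> i))" "Dom M z = Dom M (j \<bullet> y)" "(j \<bullet> i) \<bullet> z = j \<bullet> y" .
      note zD = TD[OF z(1)]
      have "i \<bullet> z = y" by (rule inj_mono[OF sesD(1)[OF s2]]) (use z zD yD S1 S2 ij in auto)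
      then show "x = Zero M (Dom M x) (Dom M \<alpha>)"
        using y ex_cmp[OF sesD(2)[OF s1], of z] z zD yD S1 S2 ij \<alpha> by auto
    qed (rule \<alpha>)
    show "ex \<alpha> \<beta>" unfolding ex_def
    proof (intro conjI allI impI)
      show "\<beta> \<bullet> \<alpha> = Zero M (Dom M \<alpha>) (Cod M \<beta>)"
      proof (rule sur_epi[OF sesD(3)[OF s1]])
        have "(\<beta> \<bullet> \<alpha>) \<bullet> p = (\<beta> \<bullet> \<pi>) \<bullet> j" using \<alpha> \<beta>(1-3) S S1 S2 St ij by simp
        then show "(\<beta> \<bullet> \<alpha>) \<bullet> p = Zero M (Dom M \<alpha>) (Cod M \<beta>) \<bullet> p" unfolding \<beta>(4) using \<alpha> \<beta> S1 S2 ij by simp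
      qed (use \<alpha> \<beta> S1 S2 S in auto)
      fix y assume y: "T y (Dom M \<beta>)" "\<beta> \<bullet> y = Zero M (Dom M y) (Cod M \<beta>)"
      have "T y (Cod M \<pi>)" using y \<beta> by simp
      then obtain x where x: "T x (Dom M \<pi>)" "Dom M x = Dom M y" "\<pi> \<bullet> x = y" by (rule surE[OF \<pi>(1)])
      note xD = TD[OF x(1)]
      have xq: "T x (Dom M q)" using x St S2 by simp
      have "q \<bullet> x = \<beta> \<bullet> \<pi> \<bullet> x" using M.cmp_reduce[OF \<beta>(4), of x] xD \<beta>(1-3) S by simp
      then have "q \<bullet> x = Zero M (Dom M x) (Cod M q)" unfolding x(3) y(2) using x \<beta> by simp
      from exE[OF sesD(2)[OF s2] xq this] obtain z where z: "T z (Dom M j)" "Dom M z = Dom M x" "j \<bullet> z = x" .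
      note zD = TD[OF z(1)]
      have "T (p \<bullet> z) (Dom M \<alpha>)" by (rule T_cmp[OF z(1)]) (use S1 ij \<alpha> in auto)
      moreover have "\<alpha> \<bullet> p \<bullet> z = y" using M.cmp_reduce[OF \<alpha>(4), of z] zD z x \<alpha>(1-3) S S1 S2 St ij by simp
      ultimately show "\<exists>x. T x (Dom M \<alpha>) \<and> Dom M x = Dom M y \<and> \<alpha> \<bullet> x = y"
        using z zD x S1 ij by (intro exI[of _ "p \<bullet> z"]) auto
    qed (use \<alpha> \<beta> in auto)
    show "sur \<beta>" unfolding sur_def
    proof (intro conjI allI impI)
      fix y assume "T y (Cod M \<beta>)"
      then have "T y (Cod M q)" using \<beta> by simp
      then obtain x where x: "T x (Dom M q)" "Dom M x = Dom M y" "q \<bullet> x = y" by (rule surE[OF sesD(3)[OF s2]])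
      note xD = TD[OF x(1)]
      have "T x (Dom M \<pi>)" using x St S2 by simp
      then have "T (\<pi> \<bullet> x) (Dom M \<beta>)" by (rule T_cmp) (use \<beta> S in auto)
      moreover have "\<beta> \<bullet> \<pi> \<bullet> x = y" using M.cmp_reduce[OF \<beta>(4), of x] xD \<beta>(1-3) S St S2 x by simp
      ultimately show "\<exists>x. T x (Dom M \<beta>) \<and> Dom M x = Dom M y \<and> \<beta> \<bullet> x = y"
        using x xD S St S2 by (intro exI[of _ "\<pi> \<bullet> x"]) auto
    qed (use \<beta> in auto)
  qed
  from P_ext[OF this] have "Cod M \<pi> \<in> P" using \<alpha> \<beta> P by simp
  with s that show thesis by blast
qed

text \<open>Dually, the kernel of the composite is an extension of the kernel of \<open>q\<close> by
  that of \<open>p\<close>.\<close>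

lemma ses_deflation_cmp:
  assumes s1: "ses i p" and s2: "ses j q" and pq: "Cod M p = Dom M q" and P: "Dom M i \<in> P" "Dom M j \<in> P"
  obtains \<kappa> where "ses \<kappa> (q \<bullet> p)" "Dom M \<kappa> \<in> P"
proof -
  note S1 = ses_arr[OF s1] and S2 = ses_arr[OF s2]
  have qp: "sur (q \<bullet> p)" by (rule sur_cmp) (use sesD[OF s1] sesD[OF s2] pq in auto)
  obtain \<kappa> where \<kappa>: "inj \<kappa>" "ex \<kappa> (q \<bullet> p)" using ker_ex[OF sur_arr[OF qp]] by blast
  have s: "ses \<kappa> (q \<bullet> p)" using qp \<kappa> by (simp add: ses_def)
  note S = ses_arr[OF s]
  have St: "Cod M \<kappa> = Dom M p" "q \<bullet> p \<bullet> \<kappa> = Zero M (Dom M \<kappa>) (Cod M q)" using S S1 S2 pq by auto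
  note S = S(1,2)
  obtain \<alpha> where \<alpha>: "\<alpha> \<in> Arr M" "Dom M \<alpha> = Dom M i" "Cod M \<alpha> = Dom M \<kappa>" "\<kappa> \<bullet> \<alpha> = i"
    by (rule inj_fac[OF \<kappa>, of i]) (use S S1 S2 St pq in auto)
  obtain \<beta> where \<beta>: "\<beta> \<in> Arr M" "Dom M \<beta> = Dom M \<kappa>" "Cod M \<beta> = Dom M j" "j \<bullet> \<beta> = p \<bullet> \<kappa>"
    by (rule inj_fac[OF sesD(1,2)[OF s2], of "p \<bullet> \<kappa>"]) (use S S1 S2 St pq in auto)
  have "ses \<alpha> \<beta>" unfolding ses_def
  proof (intro conjI)
    show "inj \<alpha>" unfolding inj_def
    proof (intro conjI allI impI)
      fix x assume x: "T x (Dom M \<alpha>)" "\<alpha> \<bullet> x = Zero M (Dom M x) (Cod M \<alpha>)"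
      have xi: "T x (Dom M i)" using x \<alpha> by simp
      note xD = TD[OF xi]
      have "i \<bullet> x = \<kappa> \<bullet> \<alpha> \<bullet> x" using M.cmp_reduce[OF \<alpha>(4), of x] xD \<alpha>(1-3) S by simp
      then have "i \<bullet> x = Zero M (Dom M x) (Cod M i)" unfolding x(2) using xD \<alpha> S St S1 by simp
      from injD(2)[OF sesD(1)[OF s1] xi this] show "x = Zero M (Dom M x) (Dom M \<alpha>)" using \<alpha> by simp
    qed (rule \<alpha>)
    show "ex \<alpha> \<beta>" unfolding ex_def
    proof (intro conjI allI impI)
      show "\<beta> \<bullet> \<alpha> = Zero M (Dom M \<alpha>) (Cod M \<beta>)"
      proof (rule inj_mono[OF sesD(1)[OF s2]])
        have "j \<bullet> \<beta> \<bullet> \<alpha> = p \<bullet> \<kappa> \<bullet> \<alpha>" using M.cmp_reduce[OF \<beta>(4), of \<alpha>] \<alpha>(1-3) \<beta>(1-3) S(1) St(1) S1(1-3) S2(1-3) by simp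
        then show "j \<bullet> \<beta> \<bullet> \<alpha> = j \<bullet> Zero M (Dom M \<alpha>) (Cod M \<beta>)" unfolding \<alpha>(4) using \<alpha> \<beta> S1 S2 pq by simp
      qed (use \<alpha> \<beta> S1 S2 S in auto)
      fix y assume y: "T y (Dom M \<beta>)" "\<beta> \<bullet> y = Zero M (Dom M y) (Cod M \<beta>)"
      have yk: "T y (Dom M \<kappa>)" using y \<beta> by simp
      note yD = TD[OF yk]
      have t: "T (\<kappa> \<bullet> y) (Dom M p)" by (rule T_cmp[OF yk]) (use S St in auto)
      have "p \<bullet> \<kappa> \<bullet> y = j \<bullet> \<beta> \<bullet> y" using M.cmp_reduce[OF \<beta>(4), of y] yD \<beta>(1-3) S St S1 S2 by simp
      then have "p \<bullet> \<kappa> \<bullet> y = Zero M (Dom M (\<kappa> \<bullet> y)) (Cod M p)" unfolding y(2) using yD \<beta> S S2 pq by simp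
      from exE[OF sesD(2)[OF s1] t this] obtain z where z: "T z (Dom M i)" "Dom M z = Dom M (\<kappa> \<bullet> y)" "i \<bullet> z = \<kappa> \<bullet> y" .
      note zD = TD[OF z(1)]
      have "\<alpha> \<bullet> z = y"
        by (rule inj_mono[OF \<kappa>(1)]) (use z zD yD \<alpha> S M.cmp_reduce[OF \<alpha>(4), of z] in auto)
      then show "\<exists>x. T x (Dom M \<alpha>) \<and> Dom M x = Dom M y \<and> \<alpha> \<bullet> x = y"
        using z zD yD S \<alpha> by (intro exI[of _ z]) auto
    qed (use \<alpha> \<beta> in auto)
    show "sur \<beta>" unfolding sur_def
    proof (intro conjI allI impI)
      fix y assume "T y (Cod M \<beta>)"
      then have yj: "T y (Dom M j)" using \<beta> by simp
      note yD = TD[OF yj]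
      have "T (j \<bullet> y) (Cod M p)" by (rule T_cmp[OF yj]) (use S2 pq in auto)
      then obtain g where g: "T g (Dom M p)" "Dom M g = Dom M (j \<bullet> y)" "p \<bullet> g = j \<bullet> y" by (rule surE[OF sesD(3)[OF s1]])
      note gD = TD[OF g(1)]
      have gT: "T g (Dom M (q \<bullet> p))" using g S1 S2 pq by simp
      have "(q \<bullet> p) \<bullet> g = Zero M (Dom M g) (Cod M (q \<bullet> p))"
        using gD g yD S1 S2 pq ex_cmp[OF sesD(2)[OF s2], of y] by simp
      from exE[OF \<kappa>(2) gT this] obtain k where k: "T k (Dom M \<kappa>)" "Dom M k = Dom M g" "\<kappa> \<bullet> k = g" .
      note kD = TD[OF k(1)]
      have "\<beta> \<bullet> k = y"
        by (rule inj_mono[OF sesD(1)[OF s2]])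
          (use k kD g gD yD \<beta> S St S1 S2 pq M.cmp_reduce[OF \<beta>(4), of k] in auto)
      then show "\<exists>x. T x (Dom M \<beta>) \<and> Dom M x = Dom M y \<and> \<beta> \<bullet> x = y"
        using k kD g yD S2 \<beta> by (intro exI[of _ k]) auto
    qed (use \<beta> in auto)
  qed
  from P_ext[OF this] have "Dom M \<kappa> \<in> P" using \<alpha> \<beta> P by simp
  with s that show thesis by blast
qed

lemma ses_idn:
  assumes X: "X \<in> Obj M" and Z: "Z \<in> Obj E" "is_zero_obj M (RO Z)"
  shows "ses (Idn M X) (Zero M X (RO Z))" "ses (Zero M (RO Z) X) (Idn M X)"
proof -
  note z = M.zero_objD[OF Z(2)]
  have T0: "T (Zero M (Dom M y) F) F" if "T y G" "F \<in> Obj M" for y F G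
    using T_dom[OF that(1)] that by (auto simp: T_def)
  have "ex (Idn M X) (Zero M X (RO Z))" unfolding ex_def
  proof (intro conjI allI impI)
    fix y assume "T y (Dom M (Zero M X (RO Z)))"
    then show "\<exists>x. T x (Dom M (Idn M X)) \<and> Dom M x = Dom M y \<and> Idn M X \<bullet> x = y"
      using X z TD[of y X] by (intro exI[of _ y]) auto
  qed (use X z in auto)
  moreover have "sur (Zero M X (RO Z))" unfolding sur_def
  proof (intro conjI allI impI)
    fix y assume y: "T y (Cod M (Zero M X (RO Z)))"
    then show "\<exists>x. T x (Dom M (Zero M X (RO Z))) \<and> Dom M x = Dom M y \<and> Zero M X (RO Z) \<bullet> x = y"
      using X z T0[OF y X] TD[of y "RO Z"] z(2)[of y] by (intro exI[of _ "Zero M (Dom M y) X"]) auto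
  qed (use X z in auto)
  ultimately show "ses (Idn M X) (Zero M X (RO Z))"
    using X by (simp add: ses_def iso_inj)
  have "inj (Zero M (RO Z) X)" unfolding inj_def
    using X z TD by auto
  moreover have "ex (Zero M (RO Z) X) (Idn M X)" unfolding ex_def
  proof (intro conjI allI impI)
    fix y assume y: "T y (Dom M (Idn M X))" "Idn M X \<bullet> y = Zero M (Dom M y) (Cod M (Idn M X))"
    then show "\<exists>x. T x (Dom M (Zero M (RO Z) X)) \<and> Dom M x = Dom M y \<and> Zero M (RO Z) X \<bullet> x = y"
      using X z T0[OF y(1) z(1)] TD[of y X] by (intro exI[of _ "Zero M (Dom M y) (RO Z)"]) auto
  qed (use X z in auto)
  ultimately show "ses (Zero M (RO Z) X) (Idn M X)"
    using X by (simp add: ses_def iso_sur)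
qed

section \<open>Quillen's axioms for the admissibly presented objects\<close>

lemma conf_N: "(i, p) \<in> Conf N \<longleftrightarrow> ses i p \<and> Dom M i \<in> P \<and> Cod M i \<in> P \<and> Cod M p \<in> P"
  using ses_arr by auto

lemma inflation_N: "inflation N i \<longleftrightarrow> (\<exists>p. ses i p \<and> Dom M i \<in> P \<and> Cod M i \<in> P \<and> Cod M p \<in> P)"
  by (simp only: inflation_def conf_N)

lemma deflation_N: "deflation N p \<longleftrightarrow> (\<exists>i. ses i p \<and> Dom M i \<in> P \<and> Cod M i \<in> P \<and> Cod M p \<in> P)"
  by (simp only: deflation_def conf_N)

lemma ex_zero_E: "\<exists>Z. is_zero_obj E Z \<and> Z \<in> Obj E \<and> is_zero_obj M (RO Z) \<and> RO Z \<in> P"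
  using E.ex_zero_obj E.zero_objD(1) RO_zero RO_P by blast

lemma iso_N: "is_iso_arr N u \<longleftrightarrow> is_iso_arr M u \<and> Dom M u \<in> P \<and> Cod M u \<in> P"
  unfolding is_iso_arr_def by (auto simp: Hom_def)

lemma N_preadditive: "preadditive_category N"
proof (intro preadditive_category.intro category.intro preadditive_category_axioms.intro)
  fix X Y assume "X \<in> Obj N" "Y \<in> Obj N"
  then have "X \<in> P" "Y \<in> P" by auto
  moreover from this have "hom_group N X Y = hom_group M X Y" by (simp add: hom_group_def Hom_N)
  ultimately show "comm_group (hom_group N X Y)" using M.hom_comm_group P_obj by simp
qed (use P_obj in \<open>auto simp: hom_iff\<close>)

lemma kernel_N:
  assumes "is_kernel M k f" "Dom M k \<in> P" "Dom M f \<in> P" "Cod M f \<in> P"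
  shows "is_kernel N k f"
  using assms unfolding is_kernel_def by (auto simp: Hom_N)

lemma cokernel_N:
  assumes "is_cokernel M c f" "Cod M c \<in> P" "Dom M f \<in> P" "Cod M f \<in> P"
  shows "is_cokernel N c f"
  using assms unfolding is_cokernel_def by (auto simp: Hom_N)

lemma pushout_N:
  assumes po: "is_pushout M f g f' g'" and P: "Dom M f \<in> P" "Cod M f \<in> P" "Cod M g \<in> P" "Cod M f' \<in> P"
  shows "is_pushout N f g f' g'"
proof -
  interpret N: preadditive_category N by (rule N_preadditive)
  note D = M.pushoutD[OF po]
  show ?thesis
  proof (rule N.pushoutI)
    fix a b assume *: "a \<in> Arr N" "b \<in> Arr N" "Dom N a = Cod N g" "Dom N b = Cod N f" "Cod N a = Cod N b" "a \<star>\<^bsub>N\<^esub> g = b \<star>\<^bsub>N\<^esub> f"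
    obtain u where "u \<in> Arr M" "Dom M u = Cod M f'" "Cod M u = Cod M a" "u \<bullet> f' = a" "u \<bullet> g' = b"
      by (rule M.pushout_fac[OF po, of a b]) (use * in auto)
    with * P show "\<exists>u\<in>Arr N. Dom N u = Cod N f' \<and> Cod N u = Cod N a \<and> u \<star>\<^bsub>N\<^esub> f' = a \<and> u \<star>\<^bsub>N\<^esub> g' = b"
      by (intro bexI[of _ u]) auto
  next
    fix x y assume *: "x \<in> Arr N" "y \<in> Arr N" "Cod N x = Cod N y" "Dom N x = Cod N f'" "Dom N y = Cod N f'"
      "x \<star>\<^bsub>N\<^esub> f' = y \<star>\<^bsub>N\<^esub> f'" "x \<star>\<^bsub>N\<^esub> g' = y \<star>\<^bsub>N\<^esub> g'"
    show "x = y" by (rule M.pushout_eq[OF po]) (use * in simp_all)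
  qed (use D P in auto)
qed

lemma pullback_N:
  assumes pb: "is_pullback M f g f' g'" and P: "Cod M f \<in> P" "Dom M f \<in> P" "Dom M g \<in> P" "Dom M f' \<in> P"
  shows "is_pullback N f g f' g'"
proof -
  interpret N: preadditive_category N by (rule N_preadditive)
  note D = M.pullbackD[OF pb]
  show ?thesis
  proof (rule N.pullbackI)
    fix a b assume *: "a \<in> Arr N" "b \<in> Arr N" "Cod N a = Dom N g" "Cod N b = Dom N f" "Dom N a = Dom N b" "g \<star>\<^bsub>N\<^esub> a = f \<star>\<^bsub>N\<^esub> b"
    obtain u where "u \<in> Arr M" "Dom M u = Dom M a" "Cod M u = Dom M f'" "f' \<bullet> u = a" "g' \<bullet> u = b"
      by (rule M.pullback_fac[OF pb, of a b]) (use * in auto)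
    with * P show "\<exists>u\<in>Arr N. Dom N u = Dom N a \<and> Cod N u = Dom N f' \<and> f' \<star>\<^bsub>N\<^esub> u = a \<and> g' \<star>\<^bsub>N\<^esub> u = b"
      by (intro bexI[of _ u]) auto
  next
    fix x y assume *: "x \<in> Arr N" "y \<in> Arr N" "Dom N x = Dom N y" "Cod N x = Dom N f'" "Cod N y = Dom N f'"
      "f' \<star>\<^bsub>N\<^esub> x = f' \<star>\<^bsub>N\<^esub> y" "g' \<star>\<^bsub>N\<^esub> x = g' \<star>\<^bsub>N\<^esub> y"
    show "x = y" by (rule M.pullback_eq[OF pb]) (use * in simp_all)
  qed (use D P in auto)
qed

sublocale N: exact_category N
proof (intro exact_category.intro additive_category.intro N_preadditive additive_category_axioms.intro exact_category_axioms.intro)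
  interpret N: preadditive_category N by (rule N_preadditive)
  obtain Z where Z: "is_zero_obj E Z" "Z \<in> Obj E" "is_zero_obj M (RO Z)" "RO Z \<in> P" using ex_zero_E by blast
  have "is_zero_obj N (RO Z)" using M.zero_objD(4)[OF Z(3)] Z(4) by (intro N.zero_objI) auto
  then show "\<exists>Z. is_zero_obj N Z" by blast
  fix X assume X: "X \<in> Obj N"
  show "inflation N (Idn N X)"
    unfolding inflation_N using X P_obj[of X] ses_idn(1)[of X Z] Z by (intro exI[of _ "Zero M X (RO Z)"]) auto
  show "deflation N (Idn N X)"
    unfolding deflation_N using X P_obj[of X] ses_idn(2)[of X Z] Z by (intro exI[of _ "Zero M (RO Z) X"]) auto
next
  fix X Y assume "X \<in> Obj N" "Y \<in> Obj N"
  then have XY: "X \<in> P" "Y \<in> P" by auto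
  obtain S i j p q where S: "S \<in> P" and b: "M.biprod X Y S i j p q" by (rule P_biprod[OF XY])
  note D = M.biprodD[OF b]
  show "\<exists>S\<in>Obj N. \<exists>i\<in>Hom N X S. \<exists>j\<in>Hom N Y S. \<exists>p\<in>Hom N S X. \<exists>q\<in>Hom N S Y.
          p \<star>\<^bsub>N\<^esub> i = Idn N X \<and> q \<star>\<^bsub>N\<^esub> j = Idn N Y \<and> p \<star>\<^bsub>N\<^esub> j = Zero N Y X \<and> q \<star>\<^bsub>N\<^esub> i = Zero N X Y \<and> i \<star>\<^bsub>N\<^esub> p \<boxplus>\<^bsub>N\<^esub> j \<star>\<^bsub>N\<^esub> q = Idn N S"
    using D S XY by (intro bexI[of _ S] bexI[of _ i] bexI[of _ j] bexI[of _ p] bexI[of _ q]) (auto simp: hom_iff)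
next
  show "is_kernel N i p" if "(i, p) \<in> Conf N" for i p
    using that unfolding conf_N by (intro kernel_N ses_kernel) (auto simp: ses_arr)
  show "is_cokernel N p i" if "(i, p) \<in> Conf N" for i p
    using that unfolding conf_N by (intro cokernel_N ses_cokernel) auto
  show "(j, q) \<in> Conf N" if h: "(i, p) \<in> Conf N" "isomorphic_seqs N (i, p) (j, q)" for i p j q
  proof -
    have s: "ses i p" using h(1) conf_N by blast
    show ?thesis using h(2)
    proof (rule isomorphic_seqsE)
      fix a b c
      assume A: "i \<in> Arr N" "p \<in> Arr N" "j \<in> Arr N" "q \<in> Arr N" "Cod N i = Dom N p" "Cod N j = Dom N q"
        "is_iso_arr N a" "is_iso_arr N b" "is_iso_arr N c" "Dom N a = Dom N i" "Cod N a = Dom N j"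
        "Dom N b = Cod N i" "Cod N b = Cod N j" "Dom N c = Cod N p" "Cod N c = Cod N q"
        "j \<star>\<^bsub>N\<^esub> a = b \<star>\<^bsub>N\<^esub> i" "q \<star>\<^bsub>N\<^esub> b = c \<star>\<^bsub>N\<^esub> p"
      have "ses j q" by (rule ses_iso[OF s, of a b c]) (use A in \<open>simp_all add: iso_N\<close>)
      then show ?thesis unfolding conf_N using A(3,4,6) by simp
    qed
  qed
  show "inflation N (j \<star>\<^bsub>N\<^esub> i)" if h: "inflation N i" "inflation N j" "Cod N i = Dom N j" for i j
  proof -
    obtain p where p: "ses i p" "Dom M i \<in> P" "Cod M i \<in> P" "Cod M p \<in> P" using h(1) unfolding inflation_N by blast
    obtain q where q: "ses j q" "Dom M j \<in> P" "Cod M j \<in> P" "Cod M q \<in> P" using h(2) unfolding inflation_N by blast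
    have ij: "Cod M i = Dom M j" using h(3) by simp
    obtain \<pi> where "ses (j \<bullet> i) \<pi>" "Cod M \<pi> \<in> P" by (rule ses_inflation_cmp[OF p(1) q(1) ij p(4) q(4)])
    then show ?thesis unfolding inflation_N using p q ij ses_arr[OF p(1)] ses_arr[OF q(1)] by auto
  qed
  show "deflation N (q \<star>\<^bsub>N\<^esub> p)" if h: "deflation N p" "deflation N q" "Cod N p = Dom N q" for p q
  proof -
    obtain i where i: "ses i p" "Dom M i \<in> P" "Cod M i \<in> P" "Cod M p \<in> P" using h(1) unfolding deflation_N by blast
    obtain j where j: "ses j q" "Dom M j \<in> P" "Cod M j \<in> P" "Cod M q \<in> P" using h(2) unfolding deflation_N by blast
    have pq: "Cod M p = Dom M q" using h(3) by simp
    obtain \<kappa> where \<kappa>: "ses \<kappa> (q \<bullet> p)" "Dom M \<kappa> \<in> P" by (rule ses_deflation_cmp[OF i(1) j(1) pq i(2) j(2)])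
    then show ?thesis unfolding deflation_N using i j pq ses_arr[OF i(1)] ses_arr[OF j(1)] ses_arr[OF \<kappa>(1)] by auto
  qed
  show "\<exists>i' f'. is_pushout N i f i' f' \<and> inflation N i'" if h: "inflation N i" "f \<in> Arr N" "Dom N f = Dom N i" for i f
  proof -
    obtain p where p: "ses i p" "Dom M i \<in> P" "Cod M i \<in> P" "Cod M p \<in> P" using h(1) unfolding inflation_N by blast
    have f: "f \<in> Arr M" "Dom M f = Dom M i" "Cod M f \<in> P" using h(2,3) by auto
    obtain i' f' p' where *: "ses i' p'" "is_pushout M i f i' f'" "Cod M p' = Cod M p"
      by (rule ses_pushout[OF p(1) f(1,2) p(2-4) f(3)])
    note D = M.pushoutD[OF *(2)]
    have i'1: "Dom M i' \<in> P" using D(6) f(3) by simp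
    \<comment> \<open>The pushed out sequence has ends \<open>Cod M f\<close> and
      \<open>Cod M p\<close>, so extension closure places its middle term in
      \<open>P\<close>.\<close>
    have i': "Dom M i' \<in> P" "Cod M i' \<in> P" using P_ext[OF *(1) i'1] *(3) p(4) i'1 by simp_all
    have "is_pushout N i f i' f'" by (rule pushout_N[OF *(2)]) (use p(2,3) f(3) i'(2) in simp_all)
    moreover have "inflation N i'" unfolding inflation_N using *(1,3) p(4) i' by (intro exI[of _ p']) simp
    ultimately show ?thesis by blast
  qed
  show "\<exists>p' f'. is_pullback N p f p' f' \<and> deflation N p'" if h: "deflation N p" "f \<in> Arr N" "Cod N f = Cod N p" for p f
  proof -
    obtain i where i: "ses i p" "Dom M i \<in> P" "Cod M i \<in> P" "Cod M p \<in> P" using h(1) unfolding deflation_N by blast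
    have f: "f \<in> Arr M" "Cod M f = Cod M p" "Dom M f \<in> P" using h(2,3) by auto
    obtain i' f' p' where *: "ses i' p'" "is_pullback M p f p' f'" "Dom M i' = Dom M i"
      by (rule ses_pullback[OF i(1) f(1,2) i(2-4) f(3)])
    note D = M.pullbackD[OF *(2)]
    have i'1: "Dom M i' \<in> P" "Cod M p' \<in> P" using D(6) f(3) *(3) i(2) by simp_all
    have i': "Dom M i' \<in> P" "Cod M i' \<in> P" "Cod M p' \<in> P" using P_ext[OF *(1) i'1] i'1 by simp_all
    have "is_pullback N p f p' f'" by (rule pullback_N[OF *(2)]) (use i(3,4) f(3) i'(2) ses_arr(3)[OF i(1)] ses_arr(3)[OF *(1)] in simp_all)
    moreover have "deflation N p'" unfolding deflation_N using *(1) i' by (intro exI[of _ i']) simp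
    ultimately show ?thesis by blast
  qed
qed

section \<open>Effaceable objects\<close>

definition Eff :: "'o set" where
  "Eff = {F \<in> P. \<forall>Z \<in> Obj E. \<forall>h \<in> Arr M. Dom M h = F \<longrightarrow> Cod M h = RO Z \<longrightarrow> h = Zero M F (RO Z)}"

lemma EffD: "F \<in> Eff \<Longrightarrow> F \<in> P"
  "F \<in> Eff \<Longrightarrow> Z \<in> Obj E \<Longrightarrow> h \<in> Arr M \<Longrightarrow> Dom M h = F \<Longrightarrow> Cod M h = RO Z \<Longrightarrow> h = Zero M F (RO Z)"
  by (auto simp: Eff_def)

section \<open>Reading exactness off presentations\<close>

lemma sur_cancel:
  assumes "sur (a \<bullet> b)" "a \<in> Arr M" "b \<in> Arr M" "Cod M b = Dom M a"
  shows "sur a"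
  unfolding sur_def
proof (intro conjI allI impI)
  fix y assume "T y (Cod M a)"
  then have "T y (Cod M (a \<bullet> b))" using assms by simp
  then obtain x where x: "T x (Dom M (a \<bullet> b))" "Dom M x = Dom M y" "(a \<bullet> b) \<bullet> x = y" by (rule surE[OF assms(1)])
  have xb: "T x (Dom M b)" using x assms by simp
  then show "\<exists>x. T x (Dom M a) \<and> Dom M x = Dom M y \<and> a \<bullet> x = y"
    using x TD[OF xb] assms T_cmp[OF xb, of b] by (intro exI[of _ "b \<bullet> x"]) auto
qed (rule assms)

lemma pres_T:
  assumes p: "pres f \<pi> F" and x: "T x F"
  obtains h where "h \<in> Arr E" "Cod E h = Cod E f" "Dom M x = RO (Dom E h)" "\<pi> \<bullet> R h = x"
proof -
  obtain W where W: "W \<in> Obj E" "Dom M x = RO W" using T_dom[OF x] by blast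
  show thesis by (rule pres_lift[OF p TD(1)[OF x] W(2,1) TD(2)[OF x]]) (use that W in auto)
qed

lemma pres_zero_iff:
  assumes p: "pres f \<pi> F" and h: "h \<in> Arr E" "Cod E h = Cod E f"
  shows "\<pi> \<bullet> R h = Zero M (RO (Dom E h)) F \<longleftrightarrow> (\<exists>u \<in> Arr E. Dom E u = Dom E h \<and> Cod E u = Dom E f \<and> f \<cdot> u = h)"
proof
  assume "\<pi> \<bullet> R h = Zero M (RO (Dom E h)) F"
  from pres_zero[OF p h this] show "\<exists>u \<in> Arr E. Dom E u = Dom E h \<and> Cod E u = Dom E f \<and> f \<cdot> u = h" by metis
next
  note D = presD[OF p]
  assume "\<exists>u \<in> Arr E. Dom E u = Dom E h \<and> Cod E u = Dom E f \<and> f \<cdot> u = h"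
  then obtain u where u: "u \<in> Arr E" "Dom E u = Dom E h" "Cod E u = Dom E f" "f \<cdot> u = h" by blast
  then have "\<pi> \<bullet> R h = \<pi> \<bullet> R f \<bullet> R u" using D by (auto simp: R_cmp)
  then show "\<pi> \<bullet> R h = Zero M (RO (Dom E h)) F" using u ex_cmp[OF D(2), of "R u"] D by simp
qed

text \<open>An element of \<open>F\<close> is \<open>\<pi> \<bullet> R h\<close>, and it vanishes
  exactly when \<open>h\<close> factors through \<open>f\<close>. Injectivity becomes a
  factorization property in \<open>E\<close>; \<open>ex_presI\<close> does the same for
  exactness.\<close>

lemma inj_presI:
  assumes p: "pres f \<pi> F" and a: "a \<in> Arr M" "Dom M a = F"
    and z: "\<And>h. h \<in> Arr E \<Longrightarrow> Cod E h = Cod E f \<Longrightarrow> (a \<bullet> \<pi>) \<bullet> R h = Zero M (RO (Dom E h)) (Cod M a) \<Longrightarrow>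
      \<exists>u \<in> Arr E. Dom E u = Dom E h \<and> Cod E u = Dom E f \<and> f \<cdot> u = h"
  shows "inj a"
  unfolding inj_def
proof (intro conjI allI impI)
  fix x assume x: "T x (Dom M a)" "a \<bullet> x = Zero M (Dom M x) (Cod M a)"
  obtain h where h: "h \<in> Arr E" "Cod E h = Cod E f" "Dom M x = RO (Dom E h)" "\<pi> \<bullet> R h = x"
    by (rule pres_T[OF p, of x]) (use x a in auto)
  have "(a \<bullet> \<pi>) \<bullet> R h = Zero M (RO (Dom E h)) (Cod M a)" using x h a presD[OF p] by simp
  from z[OF h(1,2) this] show "x = Zero M (Dom M x) (Dom M a)"
    using pres_zero_iff[OF p h(1,2)] h(3,4) a by simp
qed (rule a)

lemma ex_presI:
  assumes p: "pres f \<pi> F" and b: "b \<in> Arr M" "Dom M b = F"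
    and q: "pres g \<tau> G" and a: "a \<in> Arr M" "Dom M a = G" "Cod M a = F"
    and ba: "b \<bullet> a \<bullet> \<tau> = Zero M (Dom M \<tau>) (Cod M b)"
    and z: "\<And>h. h \<in> Arr E \<Longrightarrow> Cod E h = Cod E f \<Longrightarrow> (b \<bullet> \<pi>) \<bullet> R h = Zero M (RO (Dom E h)) (Cod M b) \<Longrightarrow>
      \<exists>u \<in> Arr E. Dom E u = Dom E h \<and> Cod E u = Cod E g \<and> a \<bullet> \<tau> \<bullet> R u = \<pi> \<bullet> R h"
  shows "ex a b"
  unfolding ex_def
proof (intro conjI allI impI)
  note D = presD[OF p] presD[OF q]
  show "b \<bullet> a = Zero M (Dom M a) (Cod M b)"
    by (rule sur_epi[OF presD(3)[OF q]]) (use D a b ba in simp_all)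
  fix y assume y: "T y (Dom M b)" "b \<bullet> y = Zero M (Dom M y) (Cod M b)"
  obtain h where h: "h \<in> Arr E" "Cod E h = Cod E f" "Dom M y = RO (Dom E h)" "\<pi> \<bullet> R h = y"
    by (rule pres_T[OF p, of y]) (use y b in auto)
  have "(b \<bullet> \<pi>) \<bullet> R h = Zero M (RO (Dom E h)) (Cod M b)" using y h b D by simp
  from z[OF h(1,2) this] obtain u where u: "u \<in> Arr E" "Dom E u = Dom E h" "Cod E u = Cod E g" "a \<bullet> \<tau> \<bullet> R u = \<pi> \<bullet> R h" by blast
  have "T (\<tau> \<bullet> R u) (Dom M a)" by (rule T_cmp[OF T_R[OF u(1,3)]]) (use D a in auto)
  then show "\<exists>x. T x (Dom M a) \<and> Dom M x = Dom M y \<and> a \<bullet> x = y"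
    using u h D by (intro exI[of _ "\<tau> \<bullet> R u"]) auto
qed (use a b in auto)

lemma sur_presI:
  assumes "pres g \<rho> G" "a \<in> Arr M" "\<pi> \<in> Arr M" "Cod M \<pi> = Dom M a" "a \<bullet> \<pi> = \<rho>"
  shows "sur a"
  by (rule sur_cancel[of a \<pi>]) (use assms presD in auto)

text \<open>A map from \<open>G\<close> to a representable is, along \<open>\<gamma>\<close>, an
  arrow \<open>z\<close> of \<open>E\<close> with \<open>z \<cdot> g = 0\<close>, and deflations are
  epic.\<close>

lemma Eff_deflation:
  assumes g: "deflation E g" and p: "pres g \<gamma> G"
  shows "G \<in> Eff"
  unfolding Eff_def
proof (intro CollectI conjI ballI impI)
  note D = presD[OF p]
  show "G \<in> P" by (rule P_I[OF p E.deflation_admissible[OF g]])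
  fix Z h assume h: "Z \<in> Obj E" "h \<in> Arr M" "Dom M h = G" "Cod M h = RO Z"
  obtain z where z: "z \<in> Arr E" "Dom E z = Cod E g" "Cod E z = Z" "R z = h \<bullet> \<gamma>"
    using R_full[of "h \<bullet> \<gamma>" "Cod E g" Z] h D by auto
  have "z \<cdot> g = Zero E (Cod E g) Z \<cdot> g"
  proof (rule R_faithful)
    have "R (z \<cdot> g) = h \<bullet> \<gamma> \<bullet> R g" using z D h by (simp add: R_cmp)
    then show "R (z \<cdot> g) = R (Zero E (Cod E g) Z \<cdot> g)" using D h z by simp
  qed (use z h D in auto)
  then have "z = Zero E (Cod E g) Z" by (rule E.deflation_epi[OF g]) (use z h D in auto)
  then have e: "h \<bullet> \<gamma> = Zero M (RO (Cod E g)) (RO Z)" using z h D by simp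
  show "h = Zero M G (RO Z)" by (rule sur_epi[OF D(3)]) (use e h D in auto)
qed

section \<open>The reflection onto the representables\<close>

definition reflection :: "'o \<Rightarrow> 'p \<Rightarrow> 'm \<Rightarrow> bool" where
  "reflection F D e \<longleftrightarrow> D \<in> Obj E \<and> e \<in> Arr M \<and> Dom M e = F \<and> Cod M e = RO D \<and>
     (\<forall>Z \<in> Obj E. \<forall>h \<in> Arr M. Dom M h = F \<longrightarrow> Cod M h = RO Z \<longrightarrow> (\<exists>g \<in> Arr E. Dom E g = D \<and> Cod E g = Z \<and> R g \<bullet> e = h)) \<and>
     (\<forall>g \<in> Arr E. \<forall>g' \<in> Arr E. Dom E g = D \<longrightarrow> Dom E g' = D \<longrightarrow> Cod E g = Cod E g' \<longrightarrow> R g \<bullet> e = R g' \<bullet> e \<longrightarrow> g = g')"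

lemma reflectionD:
  assumes "reflection F D e"
  shows "D \<in> Obj E" "e \<in> Arr M" "Dom M e = F" "Cod M e = RO D"
  using assms by (auto simp: reflection_def)

lemma reflection_fac:
  assumes "reflection F D e" "h \<in> Arr M" "Z \<in> Obj E" "Dom M h = F" "Cod M h = RO Z"
  obtains g where "g \<in> Arr E" "Dom E g = D" "Cod E g = Z" "R g \<bullet> e = h"
  using assms unfolding reflection_def by blast

lemma reflection_eq:
  assumes "reflection F D e" "g \<in> Arr E" "g' \<in> Arr E" "Dom E g = D" "Dom E g' = D" "Cod E g = Cod E g'" "R g \<bullet> e = R g' \<bullet> e"
  shows "g = g'"
  using assms unfolding reflection_def by blast

lemma reflection_iso:
  assumes r: "reflection F D e" and r': "reflection F D' e'"
  obtains u where "is_iso_arr E u" "Dom E u = D" "Cod E u = D'" "R u \<bullet> e = e'"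
proof -
  note A = reflectionD[OF r] reflectionD[OF r']
  obtain u where u: "u \<in> Arr E" "Dom E u = D" "Cod E u = D'" "R u \<bullet> e = e'" by (rule reflection_fac[OF r, of e' D']) (use A in auto)
  obtain v where v: "v \<in> Arr E" "Dom E v = D'" "Cod E v = D" "R v \<bullet> e' = e" by (rule reflection_fac[OF r', of e D]) (use A in auto)
  have "v \<cdot> u = Idn E D" by (rule reflection_eq[OF r]) (use A u v in \<open>simp_all add: R_cmp R_idn\<close>)
  moreover have "u \<cdot> v = Idn E D'" by (rule reflection_eq[OF r']) (use A u v in \<open>simp_all add: R_cmp R_idn\<close>)
  ultimately have "is_iso_arr E u" by (intro E.iso_arrI[of _ v]) (use u v in auto)
  with u that show thesis by blast
qed

text \<open>Maps from \<open>F\<close> to \<open>RO Z\<close> are the arrows \<open>z\<close> of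
  \<open>E\<close> with \<open>z \<cdot> f = 0\<close>, and these are the arrows out of the cokernel
  of \<open>f\<close>.\<close>

lemma reflection_pres:
  assumes p: "pres f \<pi> F" and c: "is_cokernel E c f"
  obtains e where "reflection F (Cod E c) e" "e \<bullet> \<pi> = R c"
proof -
  note D = presD[OF p] and C = E.cokernelD[OF c]
  have "R c \<bullet> x = Zero M (Dom M x) (Cod M (R c))" if x: "T x (Dom M \<pi>)" "\<pi> \<bullet> x = Zero M (Dom M x) (Cod M \<pi>)" for x
  proof -
    obtain y where y: "T y (Dom M (R f))" "Dom M y = Dom M x" "R f \<bullet> y = x" by (rule exE[OF D(2) x])
    have "R (c \<cdot> f) = Zero M (RO (Dom E f)) (RO (Cod E c))" using C by simp
    then have z: "R c \<bullet> R f = Zero M (RO (Dom E f)) (RO (Cod E c))" using C(1-3) by (simp add: R_cmp)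
    show ?thesis using M.cmp_reduce[OF z, of y] TD[OF y(1)] y(2) C(1-3) unfolding y(3) by simp
  qed
  then obtain e where e: "e \<in> Arr M" "Dom M e = F" "Cod M e = RO (Cod E c)" "e \<bullet> \<pi> = R c"
    using cok_fac[OF D(3), of "R c"] D C(1-3) by auto
  have "reflection F (Cod E c) e" unfolding reflection_def
  proof (intro conjI ballI impI)
    fix Z h assume h: "Z \<in> Obj E" "h \<in> Arr M" "Dom M h = F" "Cod M h = RO Z"
    obtain z where z: "z \<in> Arr E" "Dom E z = Cod E f" "Cod E z = Z" "R z = h \<bullet> \<pi>"
      using R_full[of "h \<bullet> \<pi>" "Cod E f" Z] h D by auto
    have "z \<cdot> f = Zero E (Dom E f) (Cod E z)"
    proof (rule R_faithful)
      have "R (z \<cdot> f) = h \<bullet> \<pi> \<bullet> R f" using z D h by (simp add: R_cmp)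
      then show "R (z \<cdot> f) = R (Zero E (Dom E f) (Cod E z))" using D h z by simp
    qed (use z h D in auto)
    then obtain g where g: "g \<in> Arr E" "Dom E g = Cod E c" "Cod E g = Cod E z" "g \<cdot> c = z"
      using E.cokernel_fac[OF c z(1)] z C by auto
    have "R g \<bullet> e = h"
    proof (rule sur_epi[OF D(3)])
      have "(R g \<bullet> e) \<bullet> \<pi> = R (g \<cdot> c)" using g(1-3) e D C(1-3) by (simp add: R_cmp)
      then show "(R g \<bullet> e) \<bullet> \<pi> = h \<bullet> \<pi>" unfolding g(4) z(4) .
    qed (use g z e D h in auto)
    with g z show "\<exists>g\<in>Arr E. Dom E g = Cod E c \<and> Cod E g = Z \<and> R g \<bullet> e = h" by auto
  next
    fix g g' assume g: "g \<in> Arr E" "g' \<in> Arr E" "Dom E g = Cod E c" "Dom E g' = Cod E c" "Cod E g = Cod E g'" "R g \<bullet> e = R g' \<bullet> e"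
    have "(R g \<bullet> e) \<bullet> \<pi> = (R g' \<bullet> e) \<bullet> \<pi>" by (simp only: g(6))
    then have "R g \<bullet> R c = R g' \<bullet> R c" using g(1-5) e D by simp
    then have "R (g \<cdot> c) = R (g' \<cdot> c)" using g(1-5) C(1-3) by (simp add: R_cmp)
    then have "g \<cdot> c = g' \<cdot> c" by (intro R_faithful) (use g(1-5) C(1-3) in auto)
    then show "g = g'" by (rule E.cokernel_epi[OF c]) (use g in auto)
  qed (use e C in auto)
  with e that show thesis by blast
qed

text \<open>All maps from \<open>F\<close> to representables factor through the unit, which by
  universality vanishes only when its target is zero.\<close>

lemma reflection_Eff:
  assumes r: "reflection F D e" and F: "F \<in> P"
  shows "F \<in> Eff \<longleftrightarrow> is_zero_obj E D"
proof
  note A = reflectionD[OF r]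
  assume "F \<in> Eff"
  then have "e = Zero M F (RO D)" using EffD(2) A by simp
  then have "Idn E D = Zero E D D" by (intro reflection_eq[OF r]) (use A in \<open>auto simp: R_idn\<close>)
  then show "is_zero_obj E D" using A by (intro E.zero_objI)
next
  note A = reflectionD[OF r]
  assume z: "is_zero_obj E D"
  show "F \<in> Eff" unfolding Eff_def
  proof (intro CollectI conjI ballI impI F)
    fix Z h assume h: "Z \<in> Obj E" "h \<in> Arr M" "Dom M h = F" "Cod M h = RO Z"
    obtain g where g: "g \<in> Arr E" "Dom E g = D" "Cod E g = Z" "R g \<bullet> e = h" by (rule reflection_fac[OF r h(2,1,3,4)])
    have "g = Zero E D Z" using E.zero_objD(3)[OF z g(1,2)] g(3) by simp
    then show "h = Zero M F (RO Z)" using g(4) A h by auto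
  qed
qed

text \<open>\<open>R\<close> is left exact: \<open>R m\<close> is a kernel of \<open>R c\<close>, so
  the cokernel of \<open>R m\<close> embeds into the representable of \<open>Cod E c\<close>. What
  is left over is presented by \<open>c\<close>, because \<open>\<mu>\<close> and \<open>R c\<close>
  have the same image.\<close>

lemma conf_ses:
  assumes mc: "(m, c) \<in> Conf E" and s: "pres m \<sigma> J" and r: "pres c \<rho> D"
  obtains \<mu> where "ses \<mu> \<rho>" "Dom M \<mu> = J" "\<mu> \<bullet> \<sigma> = R c"
proof -
  note A = E.confD[OF mc] and S = presD[OF s] and D = presD[OF r]
  obtain \<mu> where \<mu>: "\<mu> \<in> Arr M" "Dom M \<mu> = J" "Cod M \<mu> = RO (Cod E c)" "\<mu> \<bullet> \<sigma> = R c"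
  proof (rule pres_map[OF s RO_pres[of "Cod E c" "Cod E c"], of c "Zero E (Dom E m) (Cod E c)"])
  qed (use A in auto)
  have "inj \<mu>"
  proof (rule inj_presI[OF s \<mu>(1,2)])
    fix h assume h: "h \<in> Arr E" "Cod E h = Cod E m" "(\<mu> \<bullet> \<sigma>) \<bullet> R h = Zero M (RO (Dom E h)) (Cod M \<mu>)"
    have "c \<cdot> h = Zero E (Dom E h) (Cod E c)"
      by (rule R_faithful) (use h A \<mu> in \<open>auto simp: R_cmp\<close>)
    then obtain u where "u \<in> Arr E" "Dom E u = Dom E h" "Cod E u = Dom E m" "m \<cdot> u = h"
      using E.kernel_fac[OF E.conf_kernel[OF mc] h(1)] h A by auto
    then show "\<exists>u \<in> Arr E. Dom E u = Dom E h \<and> Cod E u = Dom E m \<and> m \<cdot> u = h" by blast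
  qed
  moreover have "ex \<mu> \<rho>"
  proof (rule ex_presI[OF RO_pres[of "Cod E c" "Cod E c"] _ _ s \<mu>(1-3)])
    show "\<rho> \<bullet> \<mu> \<bullet> \<sigma> = Zero M (Dom M \<sigma>) (Cod M \<rho>)" unfolding \<mu>(4) using D S A by simp
    fix h assume h: "h \<in> Arr E" "Cod E h = Cod E (Zero E (Cod E c) (Cod E c))"
      "(\<rho> \<bullet> Idn M (RO (Cod E c))) \<bullet> R h = Zero M (RO (Dom E h)) (Cod M \<rho>)"
    then have "\<rho> \<bullet> R h = Zero M (RO (Dom E h)) D" using D A by simp
    then obtain u where u: "u \<in> Arr E" "Dom E u = Dom E h" "Cod E u = Dom E c" "c \<cdot> u = h"
      using pres_zero[OF r h(1)] h A by auto
    have "\<mu> \<bullet> \<sigma> \<bullet> R u = R c \<bullet> R u" using M.cmp_reduce[OF \<mu>(4), of "R u"] u \<mu> S A by simp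
    then have "\<mu> \<bullet> \<sigma> \<bullet> R u = Idn M (RO (Cod E c)) \<bullet> R h" using u A h by (auto simp: R_cmp)
    with u A show "\<exists>u\<in>Arr E. Dom E u = Dom E h \<and> Cod E u = Cod E m \<and> \<mu> \<bullet> \<sigma> \<bullet> R u = Idn M (RO (Cod E c)) \<bullet> R h" by auto
  qed (use D A in auto)
  ultimately have "ses \<mu> \<rho>" using presD(3)[OF r] by (simp add: ses_def)
  with \<mu> that show thesis by blast
qed

text \<open>The arrows \<open>q\<close>, \<open>m\<close> and \<open>c\<close> present the kernel,
  the image and the cokernel of the unit. As \<open>q\<close> and \<open>c\<close> are deflations,
  the outer two objects are effaceable.\<close>

lemma unit_factorization:
  assumes q: "deflation E q" and mc: "(m, c) \<in> Conf E" and qm: "Cod E q = Dom E m" and p: "pres (m \<cdot> q) \<pi> F"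
    and e: "reflection F (Cod E c) e" "e \<bullet> \<pi> = R c"
  obtains \<iota> \<nu> \<mu> \<rho> where "ses \<iota> \<nu>" "ses \<mu> \<rho>" "Cod M \<nu> = Dom M \<mu>" "e = \<mu> \<bullet> \<nu>" "Dom M \<iota> \<in> Eff" "Dom M \<mu> \<in> P" "Cod M \<rho> \<in> Eff"
proof -
  note A = E.confD[OF mc] E.deflation_arr[OF q] qm and D = presD[OF p] and e' = reflectionD[OF e(1)] e(2)
  have im: "inflation E m" and dc: "deflation E c" using mc by (auto simp: inflation_def deflation_def)
  obtain \<tau> K where \<tau>: "pres q \<tau> K" using pres_ex A by blast
  obtain \<sigma> J where \<sigma>: "pres m \<sigma> J" using pres_ex A by blast
  obtain \<rho> D where \<rho>: "pres c \<rho> D" using pres_ex A by blast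
  note Tau = presD[OF \<tau>] and Sig = presD[OF \<sigma>] and Rho = presD[OF \<rho>]
  obtain \<mu> where \<mu>: "ses \<mu> \<rho>" "Dom M \<mu> = J" "\<mu> \<bullet> \<sigma> = R c" by (rule conf_ses[OF mc \<sigma> \<rho>])
  note Mu = ses_arr[OF \<mu>(1)]
  \<comment> \<open>\<open>\<iota>\<close> is induced by \<open>m\<close> on targets over the
    identity on sources, and \<open>\<nu>\<close> by the identity on targets over \<open>q\<close>
    on sources.\<close>
  obtain \<iota> where \<iota>: "\<iota> \<in> Arr M" "Dom M \<iota> = K" "Cod M \<iota> = F" "\<iota> \<bullet> \<tau> = \<pi> \<bullet> R m"
    by (rule pres_map[OF \<tau> p, of m "Idn E (Dom E q)"]) (use A in auto)
  obtain \<nu> where \<nu>: "\<nu> \<in> Arr M" "Dom M \<nu> = F" "Cod M \<nu> = J" "\<nu> \<bullet> \<pi> = \<sigma> \<bullet> R (Idn E (Cod E m))"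
    by (rule pres_map[OF p \<sigma>, of "Idn E (Cod E m)" q]) (use A in auto)
  have \<nu>\<pi>: "\<nu> \<bullet> \<pi> = \<sigma>" using \<nu>(4) Sig A by (simp add: R_idn)
  have fac: "e = \<mu> \<bullet> \<nu>"
    by (rule sur_epi[OF D(3)]) (use e' D \<mu>(2,3) Mu(1) \<nu>(1-3) \<nu>\<pi> A Rho Mu in simp_all)
  have "inj \<iota>"
  proof (rule inj_presI[OF \<tau> \<iota>(1,2)])
    fix h assume h: "h \<in> Arr E" "Cod E h = Cod E q" "(\<iota> \<bullet> \<tau>) \<bullet> R h = Zero M (RO (Dom E h)) (Cod M \<iota>)"
    have "\<pi> \<bullet> R (m \<cdot> h) = Zero M (RO (Dom E (m \<cdot> h))) F" using h \<iota> A D by (simp add: R_cmp)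
    then obtain u where u: "u \<in> Arr E" "Dom E u = Dom E h" "Cod E u = Dom E q" "(m \<cdot> q) \<cdot> u = m \<cdot> h"
      using pres_zero[OF p, of "m \<cdot> h"] h A by auto
    have "q \<cdot> u = h" by (rule E.inflation_mono[OF im]) (use u h A in auto)
    with u show "\<exists>u\<in>Arr E. Dom E u = Dom E h \<and> Cod E u = Dom E q \<and> q \<cdot> u = h" by blast
  qed
  moreover have "ex \<iota> \<nu>"
  proof (rule ex_presI[OF p \<nu>(1,2) \<tau> \<iota>(1-3)])
    have "\<nu> \<bullet> \<iota> \<bullet> \<tau> = \<sigma> \<bullet> R m" unfolding \<iota>(4) using M.cmp_reduce[OF \<nu>\<pi>, of "R m"] \<nu> D A by simp
    then show "\<nu> \<bullet> \<iota> \<bullet> \<tau> = Zero M (Dom M \<tau>) (Cod M \<nu>)" using Sig Tau \<nu> A by simp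
    fix h assume h: "h \<in> Arr E" "Cod E h = Cod E (m \<cdot> q)" "(\<nu> \<bullet> \<pi>) \<bullet> R h = Zero M (RO (Dom E h)) (Cod M \<nu>)"
    then have "\<sigma> \<bullet> R h = Zero M (RO (Dom E h)) J" using \<nu>(3) by (simp add: \<nu>\<pi>)
    then obtain u where u: "u \<in> Arr E" "Dom E u = Dom E h" "Cod E u = Dom E m" "m \<cdot> u = h"
      using pres_zero[OF \<sigma>, of h] h A by auto
    have "\<iota> \<bullet> \<tau> \<bullet> R u = \<pi> \<bullet> R m \<bullet> R u" using M.cmp_reduce[OF \<iota>(4), of "R u"] u \<iota>(1-3) Tau D A by simp
    then have "\<iota> \<bullet> \<tau> \<bullet> R u = \<pi> \<bullet> R h" using u A by (auto simp: R_cmp)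
    with u A show "\<exists>u\<in>Arr E. Dom E u = Dom E h \<and> Cod E u = Cod E q \<and> \<iota> \<bullet> \<tau> \<bullet> R u = \<pi> \<bullet> R h" by auto
  qed
  moreover have "sur \<nu>" by (rule sur_presI[OF \<sigma> \<nu>(1) _ _ \<nu>\<pi>]) (use D \<nu> in auto)
  ultimately have "ses \<iota> \<nu>" by (simp add: ses_def)
  moreover have "J \<in> P" by (rule P_I[OF \<sigma> E.inflation_admissible[OF im]])
  moreover have "K \<in> Eff" "D \<in> Eff" using Eff_deflation[OF q \<tau>] Eff_deflation[OF dc \<rho>] by auto
  ultimately show thesis using that[of \<iota> \<nu> \<mu> \<rho>] \<mu> \<nu>(3) \<iota>(2) Rho(4) fac by simp
qed

lemma P_unit:
  assumes F: "F \<in> P"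
  obtains D e \<iota> \<nu> \<mu> \<rho> where "reflection F D e" "ses \<iota> \<nu>" "ses \<mu> \<rho>" "Cod M \<nu> = Dom M \<mu>" "e = \<mu> \<bullet> \<nu>"
    "Dom M \<iota> \<in> Eff" "Dom M \<mu> \<in> P" "Cod M \<rho> \<in> Eff"
proof -
  obtain f \<pi> c where f: "admissible E f" "pres f \<pi> F" "is_cokernel E c f" using F by (rule P_E)
  obtain q m where qm: "deflation E q" "inflation E m" "Cod E q = Dom E m" "f = m \<cdot> q" using f(1) by (rule E.admissibleE)
  have mc: "(m, c) \<in> Conf E" by (rule E.admissible_cokernel_conf[OF qm(1-3)]) (use f qm in simp)
  obtain e where e: "reflection F (Cod E c) e" "e \<bullet> \<pi> = R c" by (rule reflection_pres[OF f(2,3)])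
  show thesis
    by (rule unit_factorization[OF qm(1) mc qm(3) f(2)[unfolded qm(4)] e]) (rule that[OF e(1)])
qed

lemma Eff_sub: "Eff \<subseteq> P"
  by (auto simp: Eff_def)

lemma unit_quot:
  assumes F: "F \<in> P"
  obtains D e where "reflection F D e" "e \<in> quot_arrows N Eff"
proof -
  obtain D e \<iota> \<nu> \<mu> \<rho> where U: "reflection F D e" "ses \<iota> \<nu>" "ses \<mu> \<rho>" "Cod M \<nu> = Dom M \<mu>" "e = \<mu> \<bullet> \<nu>"
    "Dom M \<iota> \<in> Eff" "Dom M \<mu> \<in> P" "Cod M \<rho> \<in> Eff" using F by (rule P_unit)
  note R = reflectionD[OF U(1)] and S1 = ses_arr[OF U(2)] and S2 = ses_arr[OF U(3)]
  have t: "Dom M \<nu> = F" "Cod M \<mu> = RO D" using R U(4,5) S1 S2 by auto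
  have c1: "(\<iota>, \<nu>) \<in> Conf N" unfolding conf_N using U Eff_sub S1(3) t F by auto
  have c2: "(\<mu>, \<rho>) \<in> Conf N" unfolding conf_N using U Eff_sub RO_P[OF R(1)] t by auto
  have d: "deflation N \<nu>" and i: "inflation N \<mu>" using c1 c2 unfolding deflation_def inflation_def by blast+
  have "is_kernel N \<iota> (\<mu> \<star>\<^bsub>N\<^esub> \<nu>)"
    by (rule N.kernel_post_inflation[OF N.conf_kernel[OF c1] i]) (use U(4) in simp)
  moreover have "is_cokernel N \<rho> (\<mu> \<star>\<^bsub>N\<^esub> \<nu>)"
    by (rule N.cokernel_pre_deflation[OF N.conf_cokernel[OF c2] d]) (use U(4) in simp)
  moreover have "admissible N (\<mu> \<star>\<^bsub>N\<^esub> \<nu>)"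
    by (rule N.admissibleI[OF d i]) (use U(4) in simp)
  ultimately have "e \<in> quot_arrows N Eff"
    unfolding quot_arrows_def using U R F RO_P[OF R(1)] by auto
  with U(1) that show thesis by blast
qed

text \<open>For an effaceable object the reflection, which is the cokernel of \<open>m\<close>, is
  zero. Then \<open>m\<close> is invertible and the presenting arrow itself is a deflation.\<close>

lemma Eff_presented:
  assumes "G \<in> Eff"
  obtains g \<gamma> where "deflation E g" "pres g \<gamma> G"
proof -
  obtain f \<pi> c where f: "admissible E f" "pres f \<pi> G" "is_cokernel E c f" using EffD(1)[OF assms] by (rule P_E)
  obtain q m where qm: "deflation E q" "inflation E m" "Cod E q = Dom E m" "f = m \<cdot> q" using f(1) by (rule E.admissibleE)
  have mc: "(m, c) \<in> Conf E" by (rule E.admissible_cokernel_conf[OF qm(1-3)]) (use f qm in simp)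
  obtain e where e: "reflection G (Cod E c) e" by (rule reflection_pres[OF f(2,3)])
  have "is_zero_obj E (Cod E c)" using reflection_Eff[OF e] assms EffD(1) by blast
  then have "is_iso_arr E m" using E.conf_zero_right[OF mc] by simp
  then have "deflation E f" unfolding qm(4) using E.deflation_post_iso[OF qm(1)] qm(3) by simp
  with f(2) that show thesis by blast
qed

text \<open>The horseshoe gives a conflation of the three reflections, and the middle term of a
  conflation is zero exactly when both ends are.\<close>

lemma Eff_ses:
  assumes s: "ses i p" and P: "Dom M i \<in> P" "Cod M i \<in> P" "Cod M p \<in> P"
  shows "Cod M i \<in> Eff \<longleftrightarrow> Dom M i \<in> Eff \<and> Cod M p \<in> Eff"
proof -
  obtain f1 \<pi>1 c1 where 1: "admissible E f1" "pres f1 \<pi>1 (Dom M i)" "is_cokernel E c1 f1" using P(1) by (rule P_E)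
  obtain f2 \<pi>2 c2 where 2: "admissible E f2" "pres f2 \<pi>2 (Cod M p)" "is_cokernel E c2 f2" using P(3) by (rule P_E)
  obtain f \<pi> c \<alpha> \<beta> where H: "pres f \<pi> (Cod M i)" "is_cokernel E c f" "(\<alpha>, \<beta>) \<in> Conf E"
    "Dom E \<alpha> = Cod E c1" "Cod E \<alpha> = Cod E c" "Cod E \<beta> = Cod E c2"
    by (rule ses_horseshoe[OF s 1(2) 2(2) 1(1) 2(1) 1(3) 2(3)])
  obtain e1 where e1: "reflection (Dom M i) (Cod E c1) e1" by (rule reflection_pres[OF 1(2,3)])
  obtain e2 where e2: "reflection (Cod M p) (Cod E c2) e2" by (rule reflection_pres[OF 2(2,3)])
  obtain e where e: "reflection (Cod M i) (Cod E c) e" by (rule reflection_pres[OF H(1,2)])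
  show ?thesis using E.conf_zero_mid[OF H(3)] H(4-6) reflection_Eff[OF e1 P(1)] reflection_Eff[OF e2 P(3)] reflection_Eff[OF e P(2)] by simp
qed

section \<open>Admissibility of maps to and from effaceable objects\<close>

lemma ses_admissible:
  assumes "ses \<kappa> \<nu>" "ses \<mu> \<xi>" "Cod M \<nu> = Dom M \<mu>" "Dom M \<kappa> \<in> P" "Cod M \<kappa> \<in> P" "Dom M \<mu> \<in> P" "Cod M \<mu> \<in> P" "Cod M \<xi> \<in> P"
  shows "admissible N (\<mu> \<bullet> \<nu>)"
proof -
  have "deflation N \<nu>" unfolding deflation_N using assms by metis
  moreover have "inflation N \<mu>" unfolding inflation_N using assms by metis
  ultimately show ?thesis using N.admissibleI[of \<nu> \<mu>] assms(3) by simp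
qed

text \<open>The map lifts to an arrow \<open>y\<close> between presentations. If the deflation
  \<open>g\<close> presents the target, then the pullback \<open>g'\<close> of \<open>g\<close>
  along \<open>y\<close> presents the image, the row \<open>d\<close> with entries \<open>y\<close>
  and \<open>g\<close> presents the cokernel, and the row \<open>t\<close> of
  \<open>admissible_pullback_resolution\<close> presents the kernel. The first two are deflations
  and \<open>t\<close> is admissible, so all three objects lie in \<open>P\<close>.\<close>

lemma admissible_into_Eff:
  assumes \<phi>: "\<phi> \<in> Arr M" "Dom M \<phi> \<in> P" "Cod M \<phi> \<in> Eff"
  shows "admissible N \<phi>"
proof -
  obtain f \<pi> where f: "admissible E f" "pres f \<pi> (Dom M \<phi>)" using \<phi>(2) by (auto simp: P_def)
  obtain q m where qm: "deflation E q" "inflation E m" "Cod E q = Dom E m" "f = m \<cdot> q" using f(1) by (rule E.admissibleE)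
  obtain g \<gamma> where g: "deflation E g" "pres g \<gamma> (Cod M \<phi>)" using \<phi>(3) by (rule Eff_presented)
  note D = presD[OF f(2)] and G = presD[OF g(2)] and Q = E.deflation_arr[OF qm(1)] E.inflation_arr[OF qm(2)] qm(3)
  have ft: "Dom E f = Dom E q" "Cod E f = Cod E m" unfolding qm(4) using Q by auto
  obtain y where y: "y \<in> Arr E" "Dom E y = Cod E f" "Cod E y = Cod E g" "\<gamma> \<bullet> R y = \<phi> \<bullet> \<pi>"
    by (rule pres_lift[OF g(2), of "\<phi> \<bullet> \<pi>" "Cod E f"]) (use \<phi> D in auto)
  have "\<gamma> \<bullet> R (y \<cdot> f) = (\<gamma> \<bullet> R y) \<bullet> R f" using y(1-3) D G by (simp add: R_cmp)
  then have "\<gamma> \<bullet> R (y \<cdot> f) = Zero M (RO (Dom E (y \<cdot> f))) (Cod M \<phi>)" unfolding y(4) using y(1-3) D \<phi> by simp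
  then obtain x where x: "x \<in> Arr E" "Dom E x = Dom E f" "Cod E x = Dom E g" "g \<cdot> x = y \<cdot> f"
    using pres_zero[OF g(2), of "y \<cdot> f"] y D by auto
  obtain g' y' where pb: "is_pullback E g y g' y'" "deflation E g'"
    using E.deflation_pullback[OF g(1), of y] y by auto
  note B = E.pullbackD[OF pb(1)]
  obtain k where k: "(k, g') \<in> Conf E" using pb(2) by (rule E.deflationE)
  note K = E.confD[OF k]
  \<comment> \<open>\<open>f'\<close> is the arrow into the pullback with components
    \<open>f\<close> and \<open>x\<close>, where \<open>x\<close> lifts \<open>y \<cdot> f\<close>
    along \<open>g\<close>.\<close>
  obtain f' where f': "f' \<in> Arr E" "Dom E f' = Dom E f" "Cod E f' = Dom E g'" "g' \<cdot> f' = f" "y' \<cdot> f' = x"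
    by (rule E.pullback_fac[OF pb(1), of f x]) (use x y D in auto)
  obtain S u v r s where b: "E.biprod (Dom E q) (Dom E k) S u v r s"
    by (rule E.biprodE[of "Dom E q" "Dom E k"]) (use Q K in auto)
  note Bi = E.biprodD[OF b] E.biprod_cmp(1-4)[OF b]
  \<comment> \<open>A generator over \<open>Dom E g'\<close> vanishes in the source module exactly
    when it differs from some \<open>f' \<cdot> w\<close> by an element of the kernel
    \<open>k\<close> of \<open>g'\<close>; hence the two entries of \<open>t\<close>.\<close>
  define t where "t = f' \<cdot> r \<dotplus> k \<cdot> s"
  have ad: "admissible E t" unfolding t_def
    by (rule E.admissible_pullback_resolution[OF qm(1-3) k _ f'(1) _ _ _ b]) (use f' ft B y qm(4) in auto)
  have t: "t \<in> Arr E" "Dom E t = S" "Cod E t = Dom E g'" unfolding t_def using f' Bi ft K by auto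
  have g't: "g' \<cdot> t = f \<cdot> r" unfolding t_def using f' Bi ft K B(3,6) y(1,2) D(1) Q
    by (simp add: f'(4)[THEN E.cmp_reduce] K(4)[THEN E.cmp_reduce])
  obtain S2 u2 v2 r2 s2 where b2: "E.biprod (Cod E f) (Dom E g) S2 u2 v2 r2 s2"
    by (rule E.biprodE[of "Cod E f" "Dom E g"]) (use D G in auto)
  note B2 = E.biprodD[OF b2] E.biprod_cmp(1-4)[OF b2]
  define d where "d = y \<cdot> r2 \<dotplus> g \<cdot> s2"
  have dd: "deflation E d" unfolding d_def by (rule E.deflation_from_biprod[OF b2 g(1)]) (use y in auto)
  have dt: "d \<in> Arr E" "Dom E d = S2" "Cod E d = Cod E g" unfolding d_def using y B2 G by auto
  have du: "d \<cdot> u2 = y" "d \<cdot> v2 = g" unfolding d_def using y B2 G by auto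
  obtain \<tau> K' where \<tau>: "pres t \<tau> K'" using pres_ex[OF t(1)] by blast
  obtain \<sigma> J where \<sigma>: "pres g' \<sigma> J" using pres_ex[OF B(3)] by blast
  obtain \<rho> C where \<rho>: "pres d \<rho> C" using pres_ex[OF dt(1)] by blast
  note Tau = presD[OF \<tau>] and Sig = presD[OF \<sigma>] and Rho = presD[OF \<rho>]
  obtain \<kappa> where \<kappa>: "\<kappa> \<in> Arr M" "Dom M \<kappa> = K'" "Cod M \<kappa> = Dom M \<phi>" "\<kappa> \<bullet> \<tau> = \<pi> \<bullet> R g'"
    by (rule pres_map[OF \<tau> f(2), of g' r]) (use t g't Bi ft B y in auto)
  obtain \<nu> where \<nu>: "\<nu> \<in> Arr M" "Dom M \<nu> = Dom M \<phi>" "Cod M \<nu> = J" "\<nu> \<bullet> \<pi> = \<sigma> \<bullet> R (Idn E (Cod E f))"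
    by (rule pres_map[OF f(2) \<sigma>, of "Idn E (Cod E f)" f']) (use f' D B y in auto)
  have \<nu>\<pi>: "\<nu> \<bullet> \<pi> = \<sigma>" using \<nu>(4) Sig D B(6) y by (simp add: R_idn)
  obtain \<mu> where \<mu>: "\<mu> \<in> Arr M" "Dom M \<mu> = J" "Cod M \<mu> = Cod M \<phi>" "\<mu> \<bullet> \<sigma> = \<gamma> \<bullet> R y"
    by (rule pres_map[OF \<sigma> g(2), of y y']) (use y B in auto)
  obtain \<xi> where \<xi>: "\<xi> \<in> Arr M" "Dom M \<xi> = Cod M \<phi>" "Cod M \<xi> = C" "\<xi> \<bullet> \<gamma> = \<rho> \<bullet> R (Idn E (Cod E g))"
    by (rule pres_map[OF g(2) \<rho>, of "Idn E (Cod E g)" v2]) (use G B2 dt du in auto)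
  have \<xi>\<gamma>: "\<xi> \<bullet> \<gamma> = \<rho>" using \<xi>(4) Rho G dt by (simp add: R_idn)
  have fac: "\<phi> = \<mu> \<bullet> \<nu>"
    by (rule sur_epi[OF D(3)]) (use \<mu> \<nu>(1-3) \<nu>\<pi> D \<phi> y(4) in simp_all)
  have Jt: "Cod E g' = Cod E f" using B y by simp
  have "inj \<kappa>"
  proof (rule inj_presI[OF \<tau> \<kappa>(1,2)])
    fix h assume h: "h \<in> Arr E" "Cod E h = Cod E t" "(\<kappa> \<bullet> \<tau>) \<bullet> R h = Zero M (RO (Dom E h)) (Cod M \<kappa>)"
    have ht: "Cod E h = Dom E g'" using h t by simp
    have "\<pi> \<bullet> R (g' \<cdot> h) = Zero M (RO (Dom E (g' \<cdot> h))) (Dom M \<phi>)" using h(1,3) ht \<kappa> D B(3) Jt by (simp add: R_cmp)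
    then obtain w where w: "w \<in> Arr E" "Dom E w = Dom E h" "Cod E w = Dom E f" "f \<cdot> w = g' \<cdot> h"
      using pres_zero[OF f(2), of "g' \<cdot> h"] h(1) ht B(3) Jt by auto
    let ?z = "h \<dotplus> neg E (f' \<cdot> w)"
    have zt: "?z \<in> Arr E" "Dom E ?z = Dom E h" "Cod E ?z = Dom E g'" using h(1) ht w f' by auto
    have "g' \<cdot> ?z = Zero E (Dom E ?z) (Cod E g')"
      using h(1) ht w f'(1-3) B(3) Jt M.cmp_reduce E.cmp_reduce[OF f'(4), of w] by simp
    then obtain a where a: "a \<in> Arr E" "Dom E a = Dom E h" "Cod E a = Dom E k" "k \<cdot> a = ?z"
      using E.kernel_fac[OF E.conf_kernel[OF k] zt(1)] zt by auto
    have "t \<cdot> (u \<cdot> w \<dotplus> v \<cdot> a) = f' \<cdot> w \<dotplus> k \<cdot> a"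
      unfolding t_def using w a(1-3) Bi f'(1-3) ft K h(1) by simp
    also have "\<dots> = h" unfolding a(4) using h(1) ht w f'(1-3) by simp
    finally show "\<exists>u\<in>Arr E. Dom E u = Dom E h \<and> Cod E u = Dom E t \<and> t \<cdot> u = h"
      using w a Bi ft t by (intro bexI[of _ "u \<cdot> w \<dotplus> v \<cdot> a"]) auto
  qed
  moreover have "ex \<kappa> \<nu>"
  proof (rule ex_presI[OF f(2) \<nu>(1,2) \<tau> \<kappa>(1-3)])
    have "\<nu> \<bullet> \<kappa> \<bullet> \<tau> = \<sigma> \<bullet> R g'" unfolding \<kappa>(4) using M.cmp_reduce[OF \<nu>\<pi>, of "R g'"] \<nu> D B(3) Jt by simp
    then show "\<nu> \<bullet> \<kappa> \<bullet> \<tau> = Zero M (Dom M \<tau>) (Cod M \<nu>)" using Sig Tau \<nu> t by simp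
    fix h assume h: "h \<in> Arr E" "Cod E h = Cod E f" "(\<nu> \<bullet> \<pi>) \<bullet> R h = Zero M (RO (Dom E h)) (Cod M \<nu>)"
    then have "\<sigma> \<bullet> R h = Zero M (RO (Dom E h)) J" using \<nu>(3) by (simp add: \<nu>\<pi>)
    then obtain w where w: "w \<in> Arr E" "Dom E w = Dom E h" "Cod E w = Dom E g'" "g' \<cdot> w = h"
      using pres_zero[OF \<sigma>, of h] h Jt by auto
    have "\<kappa> \<bullet> \<tau> \<bullet> R w = \<pi> \<bullet> R g' \<bullet> R w" using M.cmp_reduce[OF \<kappa>(4), of "R w"] w \<kappa>(1-3) Tau D B(3) Jt t by simp
    then have "\<kappa> \<bullet> \<tau> \<bullet> R w = \<pi> \<bullet> R h" using w B(3) by (auto simp: R_cmp)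
    with w t show "\<exists>u\<in>Arr E. Dom E u = Dom E h \<and> Cod E u = Cod E t \<and> \<kappa> \<bullet> \<tau> \<bullet> R u = \<pi> \<bullet> R h" by auto
  qed
  moreover have "sur \<nu>" by (rule sur_presI[OF \<sigma> \<nu>(1) _ _ \<nu>\<pi>]) (use D \<nu> in auto)
  ultimately have s1: "ses \<kappa> \<nu>" by (simp add: ses_def)
  have "inj \<mu>"
  proof (rule inj_presI[OF \<sigma> \<mu>(1,2)])
    fix h assume h: "h \<in> Arr E" "Cod E h = Cod E g'" "(\<mu> \<bullet> \<sigma>) \<bullet> R h = Zero M (RO (Dom E h)) (Cod M \<mu>)"
    have ht: "Cod E h = Dom E y" using h(2) Jt y by simp
    have "\<gamma> \<bullet> R (y \<cdot> h) = Zero M (RO (Dom E (y \<cdot> h))) (Cod M \<phi>)" using h(1,3) ht \<mu>(3) y(1-3) G unfolding \<mu>(4) by (simp add: R_cmp)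
    then obtain w where w: "w \<in> Arr E" "Dom E w = Dom E h" "Cod E w = Dom E g" "g \<cdot> w = y \<cdot> h"
      using pres_zero[OF g(2), of "y \<cdot> h"] h(1) ht y by auto
    \<comment> \<open>Injectivity of \<open>\<mu>\<close> is the pullback property: \<open>h\<close>
      dies in the target when \<open>y \<cdot> h\<close> factors through \<open>g\<close>.\<close>
    obtain z where "z \<in> Arr E" "Dom E z = Dom E h" "Cod E z = Dom E g'" "g' \<cdot> z = h"
      by (rule E.pullback_fac[OF pb(1), of h w]) (use h(1) ht w in auto)
    then show "\<exists>u\<in>Arr E. Dom E u = Dom E h \<and> Cod E u = Dom E g' \<and> g' \<cdot> u = h" by blast
  qed
  moreover have "ex \<mu> \<xi>"
  proof (rule ex_presI[OF g(2) \<xi>(1,2) \<sigma> \<mu>(1-3)])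
    have "\<xi> \<bullet> \<mu> \<bullet> \<sigma> = \<rho> \<bullet> R y" unfolding \<mu>(4) using M.cmp_reduce[OF \<xi>\<gamma>, of "R y"] \<xi> G y by simp
    also have "\<dots> = Zero M (RO (Cod E f)) C"
      using pres_zero_iff[OF \<rho> y(1)] y(2,3) dt B2 du(1) by auto
    finally show "\<xi> \<bullet> \<mu> \<bullet> \<sigma> = Zero M (Dom M \<sigma>) (Cod M \<xi>)" using Sig Jt \<xi> by simp
    fix h assume h: "h \<in> Arr E" "Cod E h = Cod E g" "(\<xi> \<bullet> \<gamma>) \<bullet> R h = Zero M (RO (Dom E h)) (Cod M \<xi>)"
    then have "\<rho> \<bullet> R h = Zero M (RO (Dom E h)) C" using \<xi>(3) by (simp add: \<xi>\<gamma>)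
    then obtain w where w: "w \<in> Arr E" "Dom E w = Dom E h" "Cod E w = S2" "d \<cdot> w = h"
      using pres_zero[OF \<rho>, of h] h dt by auto
    \<comment> \<open>The first component of \<open>w\<close> supplies the preimage; the second
      contributes \<open>g \<cdot> s2 \<cdot> w\<close>, which vanishes in the target.\<close>
    have hw: "h = y \<cdot> r2 \<cdot> w \<dotplus> g \<cdot> s2 \<cdot> w" unfolding w(4)[symmetric] d_def using w(1-3) B2 y G by simp
    have "\<gamma> \<bullet> R (g \<cdot> s2 \<cdot> w) = Zero M (RO (Dom E (g \<cdot> s2 \<cdot> w))) (Cod M \<phi>)"
    proof (rule iffD2[OF pres_zero_iff[OF g(2)]])
      show "\<exists>z\<in>Arr E. Dom E z = Dom E (g \<cdot> s2 \<cdot> w) \<and> Cod E z = Dom E g \<and> g \<cdot> z = g \<cdot> s2 \<cdot> w"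
        using w(1-3) B2 G(1) by (intro bexI[of _ "s2 \<cdot> w"]) simp_all
    qed (use w(1-3) B2 G(1) in simp_all)
    then have "\<gamma> \<bullet> R h = \<gamma> \<bullet> R y \<bullet> R (r2 \<cdot> w)"
      unfolding hw using w(1-3) B2 y G by (simp add: R_plus R_cmp)
    also have "\<dots> = \<mu> \<bullet> \<sigma> \<bullet> R (r2 \<cdot> w)"
      using M.cmp_reduce[OF \<mu>(4), of "R (r2 \<cdot> w)"] w(1-3) B2 y(1-3) G \<mu>(1-3) Sig Jt by simp
    finally show "\<exists>u\<in>Arr E. Dom E u = Dom E h \<and> Cod E u = Cod E g' \<and> \<mu> \<bullet> \<sigma> \<bullet> R u = \<gamma> \<bullet> R h"
      using w(1-3) B2 Jt by (intro bexI[of _ "r2 \<cdot> w"]) auto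
  qed
  moreover have "sur \<xi>" by (rule sur_presI[OF \<rho> \<xi>(1) _ _ \<xi>\<gamma>]) (use G \<xi> in auto)
  ultimately have s2: "ses \<mu> \<xi>" by (simp add: ses_def)
  have "K' \<in> P" "J \<in> P" "C \<in> P"
    using P_I[OF \<tau> ad] Eff_deflation[OF pb(2) \<sigma>] Eff_deflation[OF dd \<rho>] Eff_sub by auto
  then show ?thesis unfolding fac
    by (intro ses_admissible[OF s1 s2]) (use \<kappa> \<nu> \<mu> \<xi> \<phi> Eff_sub in auto)
qed

text \<open>Effaceability of the source makes the composite with the unit of the target zero, so the
  map lands in the kernel \<open>\<iota>\<close> of that unit. This kernel is effaceable,
  \<open>admissible_into_Eff\<close> applies to the corestriction, and composing with the inflation
  \<open>\<iota>\<close> preserves admissibility.\<close>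

lemma admissible_from_Eff:
  assumes \<phi>: "\<phi> \<in> Arr M" "Dom M \<phi> \<in> Eff" "Cod M \<phi> \<in> P"
  shows "admissible N \<phi>"
proof -
  obtain D e \<iota> \<nu> \<mu> \<rho> where U: "reflection (Cod M \<phi>) D e" "ses \<iota> \<nu>" "ses \<mu> \<rho>" "Cod M \<nu> = Dom M \<mu>" "e = \<mu> \<bullet> \<nu>"
    "Dom M \<iota> \<in> Eff" "Dom M \<mu> \<in> P" using \<phi>(3) by (rule P_unit)
  note R = reflectionD[OF U(1)] and S1 = ses_arr[OF U(2)] and S2 = ses_arr[OF U(3)]
  have t: "Dom M \<nu> = Cod M \<phi>" "Cod M \<mu> = RO D" using R U(4,5) S1 S2 by auto
  have "e \<bullet> \<phi> = Zero M (Dom M \<phi>) (RO D)" using EffD(2)[OF \<phi>(2) R(1)] \<phi> R by simp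
  then have "\<mu> \<bullet> \<nu> \<bullet> \<phi> = \<mu> \<bullet> Zero M (Dom M \<phi>) (Cod M \<nu>)" unfolding U(5) using \<phi> S1 S2 U(4) t by simp
  then have "\<nu> \<bullet> \<phi> = Zero M (Dom M \<phi>) (Cod M \<nu>)" by (rule inj_mono[OF sesD(1)[OF U(3)]]) (use \<phi> S1 S2 U(4) t in auto)
  then obtain \<psi> where \<psi>: "\<psi> \<in> Arr M" "Dom M \<psi> = Dom M \<phi>" "Cod M \<psi> = Dom M \<iota>" "\<iota> \<bullet> \<psi> = \<phi>"
    using inj_fac[OF sesD(1,2)[OF U(2)], of \<phi>] \<phi> S1 t by auto
  have "admissible N \<psi>" by (rule admissible_into_Eff) (use \<psi> \<phi> U Eff_sub in auto)
  then obtain p m where pm: "deflation N p" "inflation N m" "Cod N p = Dom N m" "\<psi> = m \<star>\<^bsub>N\<^esub> p" by (rule N.admissibleE)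
  have "inflation N \<iota>" unfolding inflation_N using U Eff_sub S1 t \<phi>(3) by (intro exI[of _ \<nu>]) auto
  note a = N.deflation_arr[OF pm(1)] N.inflation_arr[OF pm(2)] pm(3)
  have cm: "Cod M m = Dom M \<iota>" using \<psi>(3) pm(4) a by auto
  have "inflation N (\<iota> \<star>\<^bsub>N\<^esub> m)" by (rule N.inflation_cmp[OF pm(2) \<open>inflation N \<iota>\<close>]) (use cm in simp)
  then have "admissible N ((\<iota> \<star>\<^bsub>N\<^esub> m) \<star>\<^bsub>N\<^esub> p)"
    by (rule N.admissibleI[OF pm(1)]) (use a cm S1 in auto)
  moreover have "(\<iota> \<star>\<^bsub>N\<^esub> m) \<star>\<^bsub>N\<^esub> p = \<phi>" using \<psi>(4) pm(4) a cm S1 by auto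
  ultimately show ?thesis by simp
qed

text \<open>An image is a quotient of the source and a subobject of the target, so
  \<open>Eff_ses\<close> settles either case.\<close>

lemma image_Eff:
  assumes i: "is_image N f I" and f: "Dom N f \<in> Eff \<or> Cod N f \<in> Eff"
  shows "I \<in> Eff"
proof -
  obtain p m where pm: "deflation N p" "inflation N m" "Cod N p = I" "Dom N m = I" "f = m \<star>\<^bsub>N\<^esub> p"
    using i unfolding is_image_def by blast
  obtain k where k: "ses k p" "Dom M k \<in> P" "Cod M k \<in> P" "Cod M p \<in> P" using pm(1) unfolding deflation_N by blast
  obtain c where c: "ses m c" "Dom M m \<in> P" "Cod M m \<in> P" "Cod M c \<in> P" using pm(2) unfolding inflation_N by blast
  note K = ses_arr[OF k(1)] and C = ses_arr[OF c(1)]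
  have "Dom N f = Cod M k" "Cod N f = Cod M m" using pm K C by auto
  then show ?thesis using Eff_ses[OF k] Eff_ses[OF c] f pm(3,4) by auto
qed

theorem percolating: "percolating_subcategory N Eff"
proof (intro percolating_subcategory.intro percolating_subcategory_axioms.intro N.exact_category_axioms)
  show "Eff \<subseteq> Obj N" using Eff_sub by simp
  obtain Z where Z: "is_zero_obj E Z" "Z \<in> Obj E" "is_zero_obj M (RO Z)" "RO Z \<in> P" using ex_zero_E by blast
  have "RO Z \<in> Eff" unfolding Eff_def using Z M.zero_objD(3)[OF Z(3)] by force
  then show "Eff \<noteq> {}" by blast
next
  fix X Y assume X: "X \<in> Eff" and "isomorphic_objs N X Y"
  then obtain u where u: "is_iso_arr M u" "Dom M u = X" "Cod M u = Y"
    unfolding isomorphic_objs_def by (auto simp: hom_iff iso_N)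
  note D = M.inv_arr[OF u(1)]
  show "Y \<in> Eff" unfolding Eff_def
  proof (intro CollectI conjI ballI impI)
    show "Y \<in> P" using P_iso[OF EffD(1)[OF X] u(1,2)] u(3) by simp
    fix Z h assume h: "Z \<in> Obj E" "h \<in> Arr M" "Dom M h = Y" "Cod M h = RO Z"
    have "h \<bullet> u = Zero M Y (RO Z) \<bullet> u" using EffD(2)[OF X h(1), of "h \<bullet> u"] h D u by auto
    then show "h = Zero M Y (RO Z)" by (rule M.iso_epi[OF u(1)]) (use h u D in auto)
  qed
next
  fix i p assume "(i, p) \<in> Conf N"
  then show "Cod N i \<in> Eff \<longleftrightarrow> Dom N i \<in> Eff \<and> Cod N p \<in> Eff" unfolding conf_N using Eff_ses by simp
next
  fix f assume f: "f \<in> Arr N" "Cod N f \<in> Eff"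
  then show "admissible N f \<and> (\<forall>I. is_image N f I \<longrightarrow> I \<in> Eff)"
    using admissible_into_Eff image_Eff by auto
next
  fix f assume f: "f \<in> Arr N" "Dom N f \<in> Eff"
  then show "admissible N f \<and> (\<forall>I. is_image N f I \<longrightarrow> I \<in> Eff)"
    using admissible_from_Eff image_Eff by auto
qed

section \<open>The admissibly presented objects as a reflective quotient\<close>

definition L0 :: "'o \<Rightarrow> 'p" where
  "L0 F = (SOME D. \<exists>e. reflection F D e \<and> e \<in> quot_arrows N Eff)"

definition \<eta> :: "'o \<Rightarrow> 'm" where
  "\<eta> F = (SOME e. reflection F (L0 F) e \<and> e \<in> quot_arrows N Eff)"

text \<open>The object is chosen first and the arrow after it, each time for both properties
  together, so that one and the same unit is universal and inverted in the quotient.\<close>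

lemma reflection_\<eta>:
  assumes "F \<in> P"
  shows "reflection F (L0 F) (\<eta> F)" "\<eta> F \<in> quot_arrows N Eff"
proof -
  have "\<exists>D e. reflection F D e \<and> e \<in> quot_arrows N Eff" using unit_quot[OF assms] by metis
  from someI_ex[OF this] have "\<exists>e. reflection F (L0 F) e \<and> e \<in> quot_arrows N Eff" unfolding L0_def .
  from someI_ex[OF this] show "reflection F (L0 F) (\<eta> F)" "\<eta> F \<in> quot_arrows N Eff" unfolding \<eta>_def by auto
qed

text \<open>The horseshoe produces the conflation for reflections computed from presentations; the
  isomorphisms of \<open>reflection_iso\<close> move it to the chosen reflections
  \<open>L0\<close>.\<close>

lemma L_ses:
  assumes s: "ses i p" and P: "Dom M i \<in> P" "Cod M i \<in> P" "Cod M p \<in> P"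
  shows "\<exists>a b. (a, b) \<in> Conf E \<and> Dom E a = L0 (Dom M i) \<and> Cod E a = L0 (Cod M i) \<and> Cod E b = L0 (Cod M p) \<and>
      R a \<bullet> \<eta> (Dom M i) = \<eta> (Cod M i) \<bullet> i \<and> R b \<bullet> \<eta> (Cod M i) = \<eta> (Cod M p) \<bullet> p"
proof -
  note S = ses_arr[OF s]
  obtain f1 \<pi>1 c1 where 1: "admissible E f1" "pres f1 \<pi>1 (Dom M i)" "is_cokernel E c1 f1" using P(1) by (rule P_E)
  obtain f2 \<pi>2 c2 where 2: "admissible E f2" "pres f2 \<pi>2 (Cod M p)" "is_cokernel E c2 f2" using P(3) by (rule P_E)
  obtain f \<pi> c \<alpha> \<beta> u v where H: "pres f \<pi> (Cod M i)" "is_cokernel E c f" "(\<alpha>, \<beta>) \<in> Conf E"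
    "Dom E \<alpha> = Cod E c1" "Cod E \<alpha> = Cod E c" "Cod E \<beta> = Cod E c2"
    "u \<in> Arr E" "Dom E u = Cod E f1" "Cod E u = Cod E f" "v \<in> Arr E" "Dom E v = Cod E f" "Cod E v = Cod E f2"
    "\<alpha> \<cdot> c1 = c \<cdot> u" "\<beta> \<cdot> c = c2 \<cdot> v" "\<pi> \<bullet> R u = i \<bullet> \<pi>1" "p \<bullet> \<pi> = \<pi>2 \<bullet> R v"
    by (rule ses_horseshoe[OF s 1(2) 2(2) 1(1) 2(1) 1(3) 2(3)])
  obtain e1 where e1: "reflection (Dom M i) (Cod E c1) e1" "e1 \<bullet> \<pi>1 = R c1" by (rule reflection_pres[OF 1(2,3)])
  obtain e2 where e2: "reflection (Cod M p) (Cod E c2) e2" "e2 \<bullet> \<pi>2 = R c2" by (rule reflection_pres[OF 2(2,3)])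
  obtain e where e: "reflection (Cod M i) (Cod E c) e" "e \<bullet> \<pi> = R c" by (rule reflection_pres[OF H(1,2)])
  note D1 = presD[OF 1(2)] and D2 = presD[OF 2(2)] and D = presD[OF H(1)] and ab = E.confD[OF H(3)]
  note C = E.cokernelD(1-3)[OF 1(3)] E.cokernelD(1-3)[OF 2(3)] E.cokernelD(1-3)[OF H(2)]
  note Re1 = reflectionD[OF e1(1)] and Re2 = reflectionD[OF e2(1)] and Re = reflectionD[OF e(1)]
  \<comment> \<open>Both sides are compared after the epic \<open>\<pi>1\<close>, where the units
    turn into the cokernels \<open>c1\<close> and \<open>c\<close> of the presenting arrows.\<close>
  have \<alpha>e: "R \<alpha> \<bullet> e1 = e \<bullet> i"
  proof (rule sur_epi[OF D1(3)])
    have "(R \<alpha> \<bullet> e1) \<bullet> \<pi>1 = R (\<alpha> \<cdot> c1)" using Re1 e1(2) D1 ab H(4) C by (simp add: R_cmp)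
    also have "\<dots> = (e \<bullet> \<pi>) \<bullet> R u" unfolding H(13) e(2) using H(7-9) C by (simp add: R_cmp)
    also have "\<dots> = e \<bullet> \<pi> \<bullet> R u" using Re D H(7-9) by simp
    also have "\<dots> = (e \<bullet> i) \<bullet> \<pi>1" unfolding H(15) using Re D1 S by simp
    finally show "(R \<alpha> \<bullet> e1) \<bullet> \<pi>1 = (e \<bullet> i) \<bullet> \<pi>1" .
  qed (use Re Re1 D1 S ab H(4,5) in auto)
  have \<beta>e: "R \<beta> \<bullet> e = e2 \<bullet> p"
  proof (rule sur_epi[OF D(3)])
    have "(R \<beta> \<bullet> e) \<bullet> \<pi> = R (\<beta> \<cdot> c)" using Re e(2) D ab H(5) C by (simp add: R_cmp)
    also have "\<dots> = (e2 \<bullet> \<pi>2) \<bullet> R v" unfolding H(14) e2(2) using H(10-12) C by (simp add: R_cmp)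
    also have "\<dots> = e2 \<bullet> \<pi>2 \<bullet> R v" using Re2 D2 H(10-12) by simp
    also have "\<dots> = (e2 \<bullet> p) \<bullet> \<pi>" unfolding H(16)[symmetric] using Re2 D S by simp
    finally show "(R \<beta> \<bullet> e) \<bullet> \<pi> = (e2 \<bullet> p) \<bullet> \<pi>" .
  qed (use Re Re2 D S ab H(5,6) in auto)
  obtain w1 where w1: "is_iso_arr E w1" "Dom E w1 = Cod E c1" "Cod E w1 = L0 (Dom M i)" "R w1 \<bullet> e1 = \<eta> (Dom M i)"
    by (rule reflection_iso[OF e1(1) reflection_\<eta>(1)[OF P(1)]])
  obtain w where w: "is_iso_arr E w" "Dom E w = Cod E c" "Cod E w = L0 (Cod M i)" "R w \<bullet> e = \<eta> (Cod M i)"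
    by (rule reflection_iso[OF e(1) reflection_\<eta>(1)[OF P(2)]])
  obtain w2 where w2: "is_iso_arr E w2" "Dom E w2 = Cod E c2" "Cod E w2 = L0 (Cod M p)" "R w2 \<bullet> e2 = \<eta> (Cod M p)"
    by (rule reflection_iso[OF e2(1) reflection_\<eta>(1)[OF P(3)]])
  note W1 = E.inv_arr[OF w1(1)] and W = E.inv_arr[OF w(1)] and W2 = E.inv_arr[OF w2(1)]
  have r: "R (inv_arr E w1) \<bullet> \<eta> (Dom M i) = e1" "R (inv_arr E w) \<bullet> \<eta> (Cod M i) = e"
  proof -
    have "R (inv_arr E w1) \<bullet> R w1 \<bullet> e1 = R (inv_arr E w1 \<cdot> w1) \<bullet> e1" using W1(1-4) w1(2,3) Re1 by (simp add: R_cmp)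
    then show "R (inv_arr E w1) \<bullet> \<eta> (Dom M i) = e1" unfolding w1(4) W1(5) using Re1 w1(2) by (simp add: R_idn)
    have "R (inv_arr E w) \<bullet> R w \<bullet> e = R (inv_arr E w \<cdot> w) \<bullet> e" using W(1-4) w(2,3) Re by (simp add: R_cmp)
    then show "R (inv_arr E w) \<bullet> \<eta> (Cod M i) = e" unfolding w(4) W(5) using Re w(2) by (simp add: R_idn)
  qed
  note Eta = reflectionD[OF reflection_\<eta>(1)[OF P(1)]] reflectionD[OF reflection_\<eta>(1)[OF P(2)]] reflectionD[OF reflection_\<eta>(1)[OF P(3)]]
  let ?a = "w \<cdot> \<alpha> \<cdot> inv_arr E w1" and ?b = "w2 \<cdot> \<beta> \<cdot> inv_arr E w"
  have "(?a, ?b) \<in> Conf E"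
    by (rule E.conf_transfer[OF H(3) w1(1) w(1) w2(1)])
      (use W1 W W2 w1(2,3) w(2,3) w2(2,3) ab H(4-6) in simp_all)
  moreover have "R ?a \<bullet> \<eta> (Dom M i) = \<eta> (Cod M i) \<bullet> i"
  proof -
    have "R ?a \<bullet> \<eta> (Dom M i) = R w \<bullet> R \<alpha> \<bullet> R (inv_arr E w1) \<bullet> \<eta> (Dom M i)"
      using W1(1-4) W(1-4) w1(2,3) w(2,3) ab H(4,5) Eta by (simp add: R_cmp)
    also have "\<dots> = (R w \<bullet> e) \<bullet> i" unfolding r \<alpha>e using W(1) w(2) Re S by simp
    finally show ?thesis unfolding w(4) .
  qed
  moreover have "R ?b \<bullet> \<eta> (Cod M i) = \<eta> (Cod M p) \<bullet> p"
  proof -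
    have "R ?b \<bullet> \<eta> (Cod M i) = R w2 \<bullet> R \<beta> \<bullet> R (inv_arr E w) \<bullet> \<eta> (Cod M i)"
      using W(1-4) W2(1-4) w(2,3) w2(2,3) ab H(5,6) Eta by (simp add: R_cmp)
    also have "\<dots> = (R w2 \<bullet> e2) \<bullet> p" unfolding r \<beta>e using W2(1) w2(2) Re2 S by simp
    finally show ?thesis unfolding w2(4) .
  qed
  ultimately show ?thesis
    using W1 W W2 w1(2,3) w(2,3) w2(2,3) ab H(4-6) by (intro exI[of _ ?a] exI[of _ ?b]) simp
qed

text \<open>Let \<open>\<sigma>\<close> be the cokernel of \<open>R a\<close>. By left exactness
  \<open>R b\<close> is \<open>\<mu>\<close> after \<open>\<sigma>\<close> with \<open>\<mu>\<close>
  injective, and the cokernel of \<open>\<mu>\<close> is presented by the deflation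
  \<open>b\<close>, hence effaceable. So \<open>q\<close> is \<open>\<sigma>\<close> and
  \<open>w\<close> is \<open>\<mu>\<close>.\<close>

lemma conf_lift:
  assumes ab: "(a, b) \<in> Conf E"
  shows "\<exists>q w. ses (R a) q \<and> Cod M q \<in> P \<and> w \<in> quot_arrows N Eff \<and> Dom M w = Cod M q \<and> Cod M w = RO (Cod E b) \<and> w \<bullet> q = R b"
proof -
  note A = E.confD[OF ab]
  have ia: "inflation E a" and db: "deflation E b" using ab by (auto simp: inflation_def deflation_def)
  obtain \<sigma> J where \<sigma>: "pres a \<sigma> J" using pres_ex A by blast
  obtain \<rho> D where \<rho>: "pres b \<rho> D" using pres_ex A by blast
  obtain \<mu> where \<mu>: "ses \<mu> \<rho>" "Dom M \<mu> = J" "\<mu> \<bullet> \<sigma> = R b" by (rule conf_ses[OF ab \<sigma> \<rho>])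
  note Sig = presD[OF \<sigma>] and Rho = presD[OF \<rho>] and Mu = ses_arr[OF \<mu>(1)]
  have J: "J \<in> P" by (rule P_I[OF \<sigma> E.inflation_admissible[OF ia]])
  have D: "D \<in> Eff" by (rule Eff_deflation[OF db \<rho>])
  have "inj (R a)" unfolding inj_def
  proof (intro conjI allI impI)
    fix x assume x: "T x (Dom M (R a))" "R a \<bullet> x = Zero M (Dom M x) (Cod M (R a))"
    obtain W where W: "W \<in> Obj E" "Dom M x = RO W" using T_dom[OF x(1)] by blast
    obtain h where h: "h \<in> Arr E" "Dom E h = W" "Cod E h = Dom E a" "R h = x"
      using R_full[of x W "Dom E a"] TD[OF x(1)] W A by auto
    have "a \<cdot> h = a \<cdot> Zero E W (Dom E a)"
      by (rule R_faithful) (use h x A W in \<open>simp_all add: R_cmp\<close>)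
    then have "h = Zero E W (Dom E a)" by (rule E.inflation_mono[OF ia]) (use h A W in auto)
    then show "x = Zero M (Dom M x) (Dom M (R a))" using h W A by auto
  qed (use A in auto)
  then have "ses (R a) \<sigma>" using Sig by (simp add: ses_def)
  moreover have "\<mu> \<in> quot_arrows N Eff"
  proof -
    obtain Z where Z: "is_zero_obj E Z" "Z \<in> Obj E" "is_zero_obj M (RO Z)" "RO Z \<in> P" using ex_zero_E by blast
    have RZ: "RO Z \<in> Eff" unfolding Eff_def using Z M.zero_objD(3)[OF Z(3)] by force
    have c: "(\<mu>, \<rho>) \<in> Conf N" unfolding conf_N using \<mu> J D Eff_sub Mu(3) Rho RO_P A by auto
    then have i: "inflation N \<mu>" by (auto simp only: inflation_def)
    \<comment> \<open>\<open>quot_arrows\<close> asks for an effaceable kernel of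
      \<open>\<mu>\<close>. It is the zero representable \<open>RO Z\<close>, obtained by reading
      the inflation \<open>\<mu>\<close> as \<open>\<mu>\<close> after an identity.\<close>
    have "ses (Zero M (RO Z) J) (Idn M J)" by (rule ses_idn(2)) (use P_obj[OF J] Z in auto)
    then have c0: "(Zero M (RO Z) J, Idn M J) \<in> Conf N" unfolding conf_N using Z J P_obj[OF J] by auto
    have "is_kernel N (Zero M (RO Z) J) (\<mu> \<star>\<^bsub>N\<^esub> Idn M J)"
      by (rule N.kernel_post_inflation[OF N.conf_kernel[OF c0] i]) (use \<mu>(2) P_obj[OF J] in simp)
    then have "is_kernel N (Zero M (RO Z) J) \<mu>" using \<mu>(2) Mu by simp
    moreover have "is_cokernel N \<rho> \<mu>" by (rule N.conf_cokernel[OF c])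
    moreover have "admissible N \<mu>" by (rule N.inflation_admissible[OF i])
    ultimately show ?thesis
      unfolding quot_arrows_def using RZ D Rho P_obj[OF J] Z N.inflation_arr[OF i]
      by (intro CollectI conjI exI[of _ "Zero M (RO Z) J"] exI[of _ \<rho>]) auto
  qed
  ultimately show ?thesis
    using \<mu> J Sig Mu Rho by (intro exI[of _ \<sigma>] exI[of _ \<mu>]) simp
qed

sublocale Q: reflective_quotient N E Eff RO R L0 \<eta>
proof (intro reflective_quotient.intro reflective_quotient_axioms.intro N.exact_category_axioms E.exact_category_axioms)
  fix X assume "X \<in> Obj N"
  then have X: "X \<in> P" by simp
  note Re = reflectionD[OF reflection_\<eta>(1)[OF X]]
  show "L0 X \<in> Obj E" "\<eta> X \<in> Arr N" "Dom N (\<eta> X) = X" "Cod N (\<eta> X) = RO (L0 X)" "\<eta> X \<in> quot_arrows N Eff"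
    using Re X RO_P reflection_\<eta>(2)[OF X] by auto
  fix f g assume "f \<in> Arr E" "g \<in> Arr E" "Dom E f = L0 X" "Dom E g = L0 X" "Cod E f = Cod E g" "R f \<star>\<^bsub>N\<^esub> \<eta> X = R g \<star>\<^bsub>N\<^esub> \<eta> X"
  then show "f = g" by (intro reflection_eq[OF reflection_\<eta>(1)[OF X]]) simp_all
next
  fix h Z assume h: "h \<in> Arr N" "Z \<in> Obj E" "Cod N h = RO Z"
  have X: "Dom M h \<in> P" using h by simp
  show "\<exists>f\<in>Arr E. Dom E f = L0 (Dom N h) \<and> Cod E f = Z \<and> R f \<star>\<^bsub>N\<^esub> \<eta> (Dom N h) = h"
    using reflection_fac[OF reflection_\<eta>(1)[OF X], of h Z] h by auto
next
  fix i p assume "(i, p) \<in> Conf N"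
  then have "ses i p" "Dom M i \<in> P" "Cod M i \<in> P" "Cod M p \<in> P" unfolding conf_N by auto
  from L_ses[OF this] show "\<exists>a b. (a, b) \<in> Conf E \<and> Dom E a = L0 (Dom N i) \<and> Cod E a = L0 (Cod N i) \<and> Cod E b = L0 (Cod N p) \<and>
      R a \<star>\<^bsub>N\<^esub> \<eta> (Dom N i) = \<eta> (Cod N i) \<star>\<^bsub>N\<^esub> i \<and> R b \<star>\<^bsub>N\<^esub> \<eta> (Cod N i) = \<eta> (Cod N p) \<star>\<^bsub>N\<^esub> p" by simp
next
  fix a b assume ab: "(a, b) \<in> Conf E"
  note A = E.confD[OF ab]
  from conf_lift[OF ab] obtain q w where "ses (R a) q" "Cod M q \<in> P" "w \<in> quot_arrows N Eff" "Dom M w = Cod M q"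
     "Cod M w = RO (Cod E b)" "w \<bullet> q = R b" by blast
  then show "\<exists>q w. (R a, q) \<in> Conf N \<and> w \<in> quot_arrows N Eff \<and> Dom N w = Cod N q \<and> Cod N w = RO (Cod E b) \<and> w \<star>\<^bsub>N\<^esub> q = R b"
    unfolding conf_N using A RO_P by (intro exI[of _ q] exI[of _ w]) simp
next
  fix X assume X: "X \<in> Eff"
  show "is_zero_obj E (L0 X)" using reflection_Eff[OF reflection_\<eta>(1)[OF EffD(1)[OF X]] EffD(1)[OF X]] X by simp
next
  show "Eff \<subseteq> Obj N" using Eff_sub by simp
qed (use RO_P R_full R_faithful in \<open>auto simp: R_idn R_cmp R_plus\<close>)

end

section \<open>The category of modules\<close>

text \<open>The quotient is carried by coset representatives, in order to stay in the type of the given group.\<close>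

lemma comm_group_quotient_ex:
  fixes G :: "'v monoid" (structure)
  assumes G: "comm_group G" and S: "subgroup S G"
  shows "\<exists>(T :: 'v monoid) r. comm_group T \<and> r \<in> hom G T \<and> r ` carrier G = carrier T \<and> kernel G T r = S"
proof -
  interpret comm_group G by (rule G)
  interpret normal S G by (rule subgroup_imp_normal[OF S])
  define r where "r u = (SOME v. v \<in> S #> u)" for u
  have r: "r u \<in> S #> u" if "u \<in> carrier G" for u
    unfolding r_def by (rule someI[of _ u]) (rule rcos_self[OF that S])
  have rG: "r u \<in> carrier G" if "u \<in> carrier G" for u
    using r[OF that] r_coset_subset_G[OF subset that] by blast
  have rS: "S #> r u = S #> u" if "u \<in> carrier G" for u
    by (rule repr_independence[symmetric, OF r[OF that] that S])
  have rr: "r u = r v" if "S #> u = S #> v" for u v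
    using that by (simp add: r_def)
  have mult: "r (r u \<otimes> r v) = r (u \<otimes> v)" if "u \<in> carrier G" "v \<in> carrier G" for u v
  proof (rule rr)
    have "S #> (r u \<otimes> r v) = (S #> r u) <#> (S #> r v)" using rcos_sum[OF rG rG] that by simp
    then show "S #> (r u \<otimes> r v) = S #> (u \<otimes> v)" using rcos_sum that by (simp add: rS)
  qed
  \<comment> \<open>Only the multiplication of \<open>?H\<close> matters: \<open>?T\<close> replaces
    carrier and unit, in the form of \<open>hom_imp_img_comm_group\<close>.\<close>
  let ?H = "\<lparr>carrier = UNIV, mult = \<lambda>u v. r (u \<otimes> v), one = undefined\<rparr>"
  let ?T = "?H\<lparr>carrier := r ` carrier G, one := r \<one>\<rparr>"
  have h: "r \<in> hom G ?H" by (rule homI) (auto simp: mult)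
  have "comm_group ?T" by (rule hom_imp_img_comm_group[OF h])
  moreover have "r \<in> hom G ?T" using h by (auto simp: hom_def)
  moreover have "kernel G ?T r = S"
  proof (rule Set.set_eqI)
    fix u
    have "u \<in> S \<longleftrightarrow> S #> u = S" if "u \<in> carrier G"
      using coset_join1[OF _ that S] coset_join2[OF that S] by blast
    moreover have "S #> u = S" if "u \<in> carrier G" "r u = r \<one>"
      using rS[OF that(1)] rS[of \<one>] that(2) coset_mult_one[OF subset] by simp
    moreover have "r u = r \<one>" if "S #> u = S"
      by (rule rr) (use that coset_mult_one[OF subset] in simp)
    ultimately show "u \<in> kernel G ?T r \<longleftrightarrow> u \<in> S" using subset by (auto simp: kernel_def)
  qed
  ultimately show ?thesis by (intro exI[of _ ?T] exI[of _ r]) simp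
qed

text \<open>Well-definedness of maps on quotients: once \<open>h\<close> kills the kernel of
  \<open>r\<close>, its value depends only on the class \<open>r u\<close>.\<close>

lemma hom_eq_if_ker:
  assumes G: "comm_group G" and K: "comm_group K" "comm_group L" and r: "r \<in> hom G K" and h: "h \<in> hom G L"
    and ker: "\<And>x. x \<in> carrier G \<Longrightarrow> r x = \<one>\<^bsub>K\<^esub> \<Longrightarrow> h x = \<one>\<^bsub>L\<^esub>"
    and uv: "u \<in> carrier G" "v \<in> carrier G" "r u = r v"
  shows "h u = h v"
proof -
  interpret G: comm_group G by (rule G)
  interpret K: comm_group K by (rule K)
  interpret L: comm_group L by (rule K)
  interpret r: group_hom G K r by unfold_locales (rule r)
  interpret h: group_hom G L h by unfold_locales (rule h)
  have "h (u \<otimes>\<^bsub>G\<^esub> inv\<^bsub>G\<^esub> v) = \<one>\<^bsub>L\<^esub>" by (rule ker) (use uv in simp_all)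
  then have "h u \<otimes>\<^bsub>L\<^esub> inv\<^bsub>L\<^esub> h v = \<one>\<^bsub>L\<^esub>" using uv by simp
  then show ?thesis using uv by (metis L.inv_unique' L.inv_inv h.hom_closed L.inv_closed L.r_inv L.inv_equality)
qed

section \<open>Arrows and operations of the module category\<close>

definition component :: "('o, 'm, 'v) presheaf_map \<Rightarrow> 'o \<Rightarrow> 'v \<Rightarrow> 'v" where
  "component \<phi> = snd (snd \<phi>)"

text \<open>The restrictions are the ones that extensionality in \<open>is_module_map\<close>
  demands, so any family of maps can be fed in. Identities, composites, sums and zeros of
  \<open>mod_cat\<close> all have this form, see \<open>MC_simps\<close>.\<close>

definition nat_map :: "('o, 'm, 'x) pcat_scheme \<Rightarrow> ('o, 'm, 'v) presheaf \<Rightarrow> ('o, 'm, 'v) presheaf \<Rightarrow> ('o \<Rightarrow> 'v \<Rightarrow> 'v) \<Rightarrow>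
    ('o, 'm, 'v) presheaf_map" where
  "nat_map C F G h = (F, G, \<lambda>X \<in> Obj C. \<lambda>u \<in> carrier (PObj F X). h X u)"

context preadditive_category
begin

abbreviation "MC \<equiv> mod_cat C"

lemma MC_simps [simp]:
  "Obj MC = {F. is_module C F}" "Dom MC = fst" "Cod MC = (\<lambda>\<phi>. fst (snd \<phi>))"
  "Idn MC F = nat_map C F F (\<lambda>X u. u)"
  "Cmp MC \<psi> \<phi> = nat_map C (fst \<phi>) (fst (snd \<psi>)) (\<lambda>X u. component \<psi> X (component \<phi> X u))"
  "Plus MC \<psi> \<phi> = nat_map C (fst \<phi>) (fst (snd \<phi>)) (\<lambda>X u. component \<psi> X u \<otimes>\<^bsub>PObj (fst (snd \<phi>)) X\<^esub> component \<phi> X u)"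
  "Zero MC F G = nat_map C F G (\<lambda>X u. \<one>\<^bsub>PObj G X\<^esub>)"
  by (simp_all add: mod_cat_def nat_map_def component_def fun_eq_iff split: prod.splits)

lemma nat_map_simps [simp]:
  "fst (nat_map C F G h) = F" "fst (snd (nat_map C F G h)) = G"
  "X \<in> Obj C \<Longrightarrow> u \<in> carrier (PObj F X) \<Longrightarrow> component (nat_map C F G h) X u = h X u"
  by (simp_all add: nat_map_def component_def)

lemma MC_Arr: "\<phi> \<in> Arr MC \<longleftrightarrow> is_module C (fst \<phi>) \<and> is_module C (fst (snd \<phi>)) \<and> is_module_map C (fst \<phi>) (fst (snd \<phi>)) (component \<phi>)"
  by (cases \<phi>) (auto simp: mod_cat_def component_def)

lemma moduleD:
  assumes "is_module C F"
  shows "X \<in> Obj C \<Longrightarrow> comm_group (PObj F X)"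
    and "f \<in> Arr C \<Longrightarrow> PArr F f \<in> hom (PObj F (Cod C f)) (PObj F (Dom C f))"
    and "X \<in> Obj C \<Longrightarrow> u \<in> carrier (PObj F X) \<Longrightarrow> PArr F (Idn C X) u = u"
    and "f \<in> Arr C \<Longrightarrow> g \<in> Arr C \<Longrightarrow> Cod C f = Dom C g \<Longrightarrow> v \<in> carrier (PObj F (Cod C g)) \<Longrightarrow>
      PArr F (g \<star> f) v = PArr F f (PArr F g v)"
    and "f \<in> Arr C \<Longrightarrow> g \<in> Arr C \<Longrightarrow> Dom C f = Dom C g \<Longrightarrow> Cod C f = Cod C g \<Longrightarrow> v \<in> carrier (PObj F (Cod C g)) \<Longrightarrow>
      PArr F (f \<boxplus> g) v = PArr F f v \<otimes>\<^bsub>PObj F (Dom C g)\<^esub> PArr F g v"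
proof -
  show "X \<in> Obj C \<Longrightarrow> comm_group (PObj F X)"
    "f \<in> Arr C \<Longrightarrow> PArr F f \<in> hom (PObj F (Cod C f)) (PObj F (Dom C f))"
    "X \<in> Obj C \<Longrightarrow> u \<in> carrier (PObj F X) \<Longrightarrow> PArr F (Idn C X) u = u"
    using assms unfolding is_module_def by simp_all
  have *: "PArr F (g \<star> f) v = PArr F f (PArr F g v)" if "f \<in> Hom C X Y" "g \<in> Hom C Y Z" "v \<in> carrier (PObj F Z)" for X Y Z
    using assms that unfolding is_module_def by blast
  show "f \<in> Arr C \<Longrightarrow> g \<in> Arr C \<Longrightarrow> Cod C f = Dom C g \<Longrightarrow> v \<in> carrier (PObj F (Cod C g)) \<Longrightarrow>
      PArr F (g \<star> f) v = PArr F f (PArr F g v)"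
    by (rule *) (simp_all add: hom_iff)
  have **: "PArr F (f \<boxplus> g) v = PArr F f v \<otimes>\<^bsub>PObj F X\<^esub> PArr F g v"
    if "f \<in> Hom C X Y" "g \<in> Hom C X Y" "v \<in> carrier (PObj F Y)" for X Y
    using assms that unfolding is_module_def by blast
  show "f \<in> Arr C \<Longrightarrow> g \<in> Arr C \<Longrightarrow> Dom C f = Dom C g \<Longrightarrow> Cod C f = Cod C g \<Longrightarrow> v \<in> carrier (PObj F (Cod C g)) \<Longrightarrow>
      PArr F (f \<boxplus> g) v = PArr F f v \<otimes>\<^bsub>PObj F (Dom C g)\<^esub> PArr F g v"
    by (rule **) (simp_all add: hom_iff)
qed

lemma PArr_in:
  assumes "is_module C F" "f \<in> Arr C" "u \<in> carrier (PObj F (Cod C f))" "Dom C f = X"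
  shows "PArr F f u \<in> carrier (PObj F X)"
  using hom_in_carrier[OF moduleD(2)[OF assms(1,2)] assms(3)] assms(4) by simp

lemma arrD:
  assumes "\<phi> \<in> Arr MC"
  shows "is_module C (fst \<phi>)" "is_module C (fst (snd \<phi>))"
    and "X \<in> Obj C \<Longrightarrow> component \<phi> X \<in> hom (PObj (fst \<phi>) X) (PObj (fst (snd \<phi>)) X)"
    and "X \<in> Obj C \<Longrightarrow> u \<in> carrier (PObj (fst \<phi>) X) \<Longrightarrow> component \<phi> X u \<in> carrier (PObj (fst (snd \<phi>)) X)"
    and "f \<in> Arr C \<Longrightarrow> v \<in> carrier (PObj (fst \<phi>) (Cod C f)) \<Longrightarrow>
      component \<phi> (Dom C f) (PArr (fst \<phi>) f v) = PArr (fst (snd \<phi>)) f (component \<phi> (Cod C f) v)"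
    and "X \<in> Obj C \<Longrightarrow> component \<phi> X \<one>\<^bsub>PObj (fst \<phi>) X\<^esub> = \<one>\<^bsub>PObj (fst (snd \<phi>)) X\<^esub>"
proof -
  have *: "is_module_map C (fst \<phi>) (fst (snd \<phi>)) (component \<phi>)" using assms by (simp add: MC_Arr)
  show m: "is_module C (fst \<phi>)" "is_module C (fst (snd \<phi>))" using assms by (auto simp: MC_Arr)
  show h: "component \<phi> X \<in> hom (PObj (fst \<phi>) X) (PObj (fst (snd \<phi>)) X)" if "X \<in> Obj C" for X
    using * that unfolding is_module_map_def by blast
  show "X \<in> Obj C \<Longrightarrow> u \<in> carrier (PObj (fst \<phi>) X) \<Longrightarrow> component \<phi> X u \<in> carrier (PObj (fst (snd \<phi>)) X)"
    using hom_in_carrier[OF h] .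
  show "f \<in> Arr C \<Longrightarrow> v \<in> carrier (PObj (fst \<phi>) (Cod C f)) \<Longrightarrow>
      component \<phi> (Dom C f) (PArr (fst \<phi>) f v) = PArr (fst (snd \<phi>)) f (component \<phi> (Cod C f) v)"
    using * unfolding is_module_map_def by blast
  show "X \<in> Obj C \<Longrightarrow> component \<phi> X \<one>\<^bsub>PObj (fst \<phi>) X\<^esub> = \<one>\<^bsub>PObj (fst (snd \<phi>)) X\<^esub>"
    using hom_one[OF h] moduleD(1)[OF m(1)] moduleD(1)[OF m(2)] by (simp add: comm_group_def)
qed

lemma arr_ext:
  assumes "\<phi> \<in> Arr MC" "\<psi> \<in> Arr MC" "fst \<phi> = fst \<psi>" "fst (snd \<phi>) = fst (snd \<psi>)"
    and e: "\<And>X u. X \<in> Obj C \<Longrightarrow> u \<in> carrier (PObj (fst \<psi>) X) \<Longrightarrow> component \<phi> X u = component \<psi> X u"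
  shows "\<phi> = \<psi>"
proof -
  have *: "is_module_map C (fst \<psi>) (fst (snd \<psi>)) (component \<phi>)" "is_module_map C (fst \<psi>) (fst (snd \<psi>)) (component \<psi>)"
    using assms(1-4) by (auto simp: MC_Arr)
  have "component \<phi> X = component \<psi> X" if X: "X \<in> Obj C" for X
  proof (rule extensionalityI)
    show "component \<phi> X \<in> extensional (carrier (PObj (fst \<psi>) X))" "component \<psi> X \<in> extensional (carrier (PObj (fst \<psi>) X))"
      using * X unfolding is_module_map_def by blast+
  qed (rule e[OF X])
  then have "component \<phi> = component \<psi>"
    using * unfolding is_module_map_def by (elim conjE) (rule extensionalityI)
  with assms(3,4) show ?thesis by (simp add: component_def prod_eq_iff)
qed

lemma nat_map_arr:
  assumes "is_module C F" "is_module C G"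
    and "\<And>X. X \<in> Obj C \<Longrightarrow> h X \<in> hom (PObj F X) (PObj G X)"
    and "\<And>f u. f \<in> Arr C \<Longrightarrow> u \<in> carrier (PObj F (Cod C f)) \<Longrightarrow> h (Dom C f) (PArr F f u) = PArr G f (h (Cod C f) u)"
  shows "nat_map C F G h \<in> Arr MC"
  unfolding MC_Arr is_module_map_def
proof (intro conjI ballI)
  fix X assume X: "X \<in> Obj C"
  interpret comm_group "PObj F X" by (rule moduleD(1)[OF assms(1) X])
  show "component (nat_map C F G h) X \<in> hom (PObj (fst (nat_map C F G h)) X) (PObj (fst (snd (nat_map C F G h))) X) \<inter> extensional (carrier (PObj (fst (nat_map C F G h)) X))"
    using assms(3)[OF X] X by (auto simp: hom_def Pi_def component_def nat_map_def)
next
  fix f u assume "f \<in> Arr C" "u \<in> carrier (PObj (fst (nat_map C F G h)) (Cod C f))"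
  then show "component (nat_map C F G h) (Dom C f) (PArr (fst (nat_map C F G h)) f u) = PArr (fst (snd (nat_map C F G h))) f (component (nat_map C F G h) (Cod C f) u)"
    using assms(1,4) by (simp add: PArr_in)
qed (use assms in \<open>auto simp: component_def nat_map_def\<close>)

lemma nat_map_idn: "is_module C F \<Longrightarrow> nat_map C F F (\<lambda>X u. u) \<in> Arr MC"
  by (rule nat_map_arr) (auto simp: hom_def)

lemma nat_map_cmp:
  assumes "\<phi> \<in> Arr MC" "\<psi> \<in> Arr MC" "fst (snd \<phi>) = fst \<psi>"
  shows "nat_map C (fst \<phi>) (fst (snd \<psi>)) (\<lambda>X u. component \<psi> X (component \<phi> X u)) \<in> Arr MC"
proof (rule nat_map_arr)
  note D = arrD[OF assms(1)] arrD[OF assms(2)]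
  fix X assume X: "X \<in> Obj C"
  show "(\<lambda>u. component \<psi> X (component \<phi> X u)) \<in> hom (PObj (fst \<phi>) X) (PObj (fst (snd \<psi>)) X)"
    using hom_compose[OF D(3)[OF X], of "component \<psi> X"] D(9)[OF X] assms(3) by (simp add: comp_def)
next
  note D = arrD[OF assms(1)] arrD[OF assms(2)]
  fix f u assume "f \<in> Arr C" "u \<in> carrier (PObj (fst \<phi>) (Cod C f))"
  then show "component \<psi> (Dom C f) (component \<phi> (Dom C f) (PArr (fst \<phi>) f u)) = PArr (fst (snd \<psi>)) f (component \<psi> (Cod C f) (component \<phi> (Cod C f) u))"
    using D(4)[of "Cod C f" u] D(5)[of f u] D(11)[of f "component \<phi> (Cod C f) u"] assms(3) by simp
qed (use arrD[OF assms(1)] arrD[OF assms(2)] in auto)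

lemma nat_map_zero:
  assumes F: "is_module C F" and G: "is_module C G"
  shows "nat_map C F G (\<lambda>X u. \<one>\<^bsub>PObj G X\<^esub>) \<in> Arr MC"
proof (rule nat_map_arr[OF F G])
  fix X assume "X \<in> Obj C"
  then interpret comm_group "PObj G X" by (rule moduleD(1)[OF G])
  show "(\<lambda>u. \<one>\<^bsub>PObj G X\<^esub>) \<in> hom (PObj F X) (PObj G X)" by (auto simp: hom_def)
next
  fix f u assume f: "f \<in> Arr C"
  show "\<one>\<^bsub>PObj G (Dom C f)\<^esub> = PArr G f \<one>\<^bsub>PObj G (Cod C f)\<^esub>"
    using hom_one[OF moduleD(2)[OF G f]] moduleD(1)[OF G] f by (simp add: comm_group_def)
qed

lemma nat_map_plus:
  assumes \<phi>: "\<phi> \<in> Arr MC" and \<psi>: "\<psi> \<in> Arr MC" and e: "fst \<phi> = fst \<psi>" "fst (snd \<phi>) = fst (snd \<psi>)"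
  shows "nat_map C (fst \<psi>) (fst (snd \<psi>)) (\<lambda>X u. component \<phi> X u \<otimes>\<^bsub>PObj (fst (snd \<psi>)) X\<^esub> component \<psi> X u) \<in> Arr MC"
proof (rule nat_map_arr)
  note D = arrD[OF \<phi>] arrD[OF \<psi>]
  fix X assume X: "X \<in> Obj C"
  interpret comm_group "PObj (fst (snd \<psi>)) X" by (rule moduleD(1)[OF D(8) X])
  interpret F: comm_group "PObj (fst \<psi>) X" by (rule moduleD(1)[OF D(7) X])
  show "(\<lambda>u. component \<phi> X u \<otimes>\<^bsub>PObj (fst (snd \<psi>)) X\<^esub> component \<psi> X u) \<in> hom (PObj (fst \<psi>) X) (PObj (fst (snd \<psi>)) X)"
    using D(3,4,9,10)[OF X] e by (auto simp: hom_def Pi_def m_ac)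
next
  note D = arrD[OF \<phi>] arrD[OF \<psi>]
  fix f u assume f: "f \<in> Arr C" "u \<in> carrier (PObj (fst \<psi>) (Cod C f))"
  then show "component \<phi> (Dom C f) (PArr (fst \<psi>) f u) \<otimes>\<^bsub>PObj (fst (snd \<psi>)) (Dom C f)\<^esub> component \<psi> (Dom C f) (PArr (fst \<psi>) f u) =
      PArr (fst (snd \<psi>)) f (component \<phi> (Cod C f) u \<otimes>\<^bsub>PObj (fst (snd \<psi>)) (Cod C f)\<^esub> component \<psi> (Cod C f) u)"
    using D(4,5,10,11) e hom_mult[OF moduleD(2)[OF D(8) f(1)]] by simp
qed (use arrD[OF \<psi>] in auto)

lemma mod_cat_preadditive: "preadditive_category (mod_cat C :: (('o, 'm, 'v) presheaf, ('o, 'm, 'v) presheaf_map) pcat)"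
proof (intro preadditive_category.intro category.intro preadditive_category_axioms.intro)
  fix f g h :: "('o, 'm, 'v) presheaf_map" and W X Y Z assume "f \<in> Hom MC W X" "g \<in> Hom MC X Y" "h \<in> Hom MC Y Z"
  then have f: "f \<in> Arr MC" and g: "g \<in> Arr MC" and h: "h \<in> Arr MC" and t: "fst (snd f) = fst g" "fst (snd g) = fst h"
    by (auto simp: hom_iff)
  note gf = nat_map_cmp[OF f g t(1)] and hg = nat_map_cmp[OF g h t(2)]
  show "(h \<star>\<^bsub>MC\<^esub> g) \<star>\<^bsub>MC\<^esub> f = h \<star>\<^bsub>MC\<^esub> (g \<star>\<^bsub>MC\<^esub> f)"
    by (rule arr_ext) (use nat_map_cmp[OF f hg] nat_map_cmp[OF gf h] t arrD(4)[OF f] in simp_all)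
next
  fix F G :: "('o, 'm, 'v) presheaf" assume "F \<in> Obj MC" "G \<in> Obj MC"
  then have F: "is_module C F" and G: "is_module C G" by auto
  have gG: "comm_group (PObj G X)" if "X \<in> Obj C" for X by (rule moduleD(1)[OF G that])
  show "comm_group (hom_group MC F G)"
  proof (rule comm_groupI)
    fix x y assume "x \<in> carrier (hom_group MC F G)" "y \<in> carrier (hom_group MC F G)"
    then have x: "x \<in> Arr MC" "fst x = F" "fst (snd x) = G" and y: "y \<in> Arr MC" "fst y = F" "fst (snd y) = G"
      by (auto simp: hom_group_def hom_iff)
    show "x \<otimes>\<^bsub>hom_group MC F G\<^esub> y \<in> carrier (hom_group MC F G)"
      using x y nat_map_plus[OF x(1) y(1)] by (simp add: hom_group_def hom_iff)
    show "x \<otimes>\<^bsub>hom_group MC F G\<^esub> y = y \<otimes>\<^bsub>hom_group MC F G\<^esub> x"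
      using x y by (simp add: hom_group_def) (rule arr_ext;
        use x y nat_map_plus[OF x(1) y(1)] nat_map_plus[OF y(1) x(1)] arrD(4)[OF x(1)] arrD(4)[OF y(1)] in
          \<open>simp add: comm_monoid.m_comm[OF comm_group.axioms(1)[OF gG]]\<close>)
    fix z assume "z \<in> carrier (hom_group MC F G)"
    then have z: "z \<in> Arr MC" "fst z = F" "fst (snd z) = G" by (auto simp: hom_group_def hom_iff)
    have xy: "nat_map C F G (\<lambda>X u. component x X u \<otimes>\<^bsub>PObj G X\<^esub> component y X u) \<in> Arr MC"
      and yz: "nat_map C F G (\<lambda>X u. component y X u \<otimes>\<^bsub>PObj G X\<^esub> component z X u) \<in> Arr MC"
      using nat_map_plus[OF x(1) y(1)] nat_map_plus[OF y(1) z(1)] x y z by auto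
    show "x \<otimes>\<^bsub>hom_group MC F G\<^esub> y \<otimes>\<^bsub>hom_group MC F G\<^esub> z = x \<otimes>\<^bsub>hom_group MC F G\<^esub> (y \<otimes>\<^bsub>hom_group MC F G\<^esub> z)"
      using x y z by (simp add: hom_group_def) (rule arr_ext;
        use x y z xy yz nat_map_plus[OF xy z(1)] nat_map_plus[OF x(1) yz] arrD(4)[OF x(1)] arrD(4)[OF y(1)] arrD(4)[OF z(1)] in
          \<open>simp add: monoid.m_assoc[OF comm_monoid.axioms(1)[OF comm_group.axioms(1)[OF gG]]]\<close>)
  next
    show "\<one>\<^bsub>hom_group MC F G\<^esub> \<in> carrier (hom_group MC F G)"
      using nat_map_zero[OF F G] by (simp add: hom_group_def hom_iff)
  next
    fix x assume "x \<in> carrier (hom_group MC F G)"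
    then have x: "x \<in> Arr MC" "fst x = F" "fst (snd x) = G" by (auto simp: hom_group_def hom_iff)
    have z: "nat_map C F G (\<lambda>X u. \<one>\<^bsub>PObj G X\<^esub>) \<in> Arr MC" by (rule nat_map_zero[OF F G])
    show "\<one>\<^bsub>hom_group MC F G\<^esub> \<otimes>\<^bsub>hom_group MC F G\<^esub> x = x"
      using x by (simp add: hom_group_def) (rule arr_ext;
        use x nat_map_plus[OF z x(1)] arrD(4)[OF x(1)] in
          \<open>simp add: monoid.l_one[OF comm_monoid.axioms(1)[OF comm_group.axioms(1)[OF gG]]]\<close>)
    let ?y = "nat_map C F G (\<lambda>X u. inv\<^bsub>PObj G X\<^esub> (component x X u))"
    have y: "?y \<in> Arr MC"
    proof (rule nat_map_arr[OF F G])
      fix X assume X: "X \<in> Obj C"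
      interpret comm_group "PObj G X" by (rule gG[OF X])
      interpret F: comm_group "PObj F X" by (rule moduleD(1)[OF F X])
      show "(\<lambda>u. inv\<^bsub>PObj G X\<^esub> component x X u) \<in> hom (PObj F X) (PObj G X)"
        using arrD(3,4)[OF x(1) X] x(2,3) by (auto simp: hom_def Pi_def inv_mult)
    next
      fix f u assume f: "f \<in> Arr C" "u \<in> carrier (PObj F (Cod C f))"
      interpret g: group_hom "PObj G (Cod C f)" "PObj G (Dom C f)" "PArr G f"
        using gG[of "Cod C f"] gG[of "Dom C f"] f moduleD(2)[OF G f(1)]
        by (simp add: group_hom_def group_hom_axioms_def comm_group_def)
      show "inv\<^bsub>PObj G (Dom C f)\<^esub> component x (Dom C f) (PArr F f u) = PArr G f (inv\<^bsub>PObj G (Cod C f)\<^esub> component x (Cod C f) u)"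
        using arrD(5)[OF x(1) f(1), of u] arrD(4)[OF x(1), of "Cod C f" u] x f by simp
    qed
    have "?y \<otimes>\<^bsub>hom_group MC F G\<^esub> x = \<one>\<^bsub>hom_group MC F G\<^esub>"
      using x by (simp add: hom_group_def) (rule arr_ext;
        use x z nat_map_plus[OF y x(1)] arrD(4)[OF x(1)] in
          \<open>simp add: group.l_inv[OF comm_group.axioms(2)[OF gG]]\<close>)
    moreover have "?y \<in> carrier (hom_group MC F G)" using y by (simp add: hom_group_def hom_iff)
    ultimately show "\<exists>y\<in>carrier (hom_group MC F G). y \<otimes>\<^bsub>hom_group MC F G\<^esub> x = \<one>\<^bsub>hom_group MC F G\<^esub>" by blast
  qed
next
  fix f g h :: "('o, 'm, 'v) presheaf_map" and X Y Z assume "f \<in> Hom MC X Y" "g \<in> Hom MC Y Z" "h \<in> Hom MC Y Z"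
  then show "(g \<boxplus>\<^bsub>MC\<^esub> h) \<star>\<^bsub>MC\<^esub> f = (g \<star>\<^bsub>MC\<^esub> f) \<boxplus>\<^bsub>MC\<^esub> (h \<star>\<^bsub>MC\<^esub> f)"
    using nat_map_plus[of g h] nat_map_cmp[of f g] nat_map_cmp[of f h] nat_map_cmp[of f "g \<boxplus>\<^bsub>MC\<^esub> h"] nat_map_plus[of "g \<star>\<^bsub>MC\<^esub> f" "h \<star>\<^bsub>MC\<^esub> f"]
    by (auto simp: hom_iff arrD(4) intro!: arr_ext)
next
  fix f g h :: "('o, 'm, 'v) presheaf_map" and X Y Z assume a: "f \<in> Hom MC X Y" "g \<in> Hom MC X Y" "h \<in> Hom MC Y Z"
  have "component h V (u \<otimes>\<^bsub>PObj Y V\<^esub> v) = component h V u \<otimes>\<^bsub>PObj Z V\<^esub> component h V v"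
    if "V \<in> Obj C" "u \<in> carrier (PObj Y V)" "v \<in> carrier (PObj Y V)" for V u v
    using hom_mult[OF arrD(3)[of h V]] a that by (auto simp: hom_iff)
  moreover have "u \<otimes>\<^bsub>PObj Y V\<^esub> v \<in> carrier (PObj Y V)" if "V \<in> Obj C" "u \<in> carrier (PObj Y V)" "v \<in> carrier (PObj Y V)" for V u v
    using moduleD(1)[of Y V] a(1) arrD(2)[of f] that by (auto simp: hom_iff comm_group_def group_def intro: monoid.m_closed)
  ultimately show "h \<star>\<^bsub>MC\<^esub> (f \<boxplus>\<^bsub>MC\<^esub> g) = (h \<star>\<^bsub>MC\<^esub> f) \<boxplus>\<^bsub>MC\<^esub> (h \<star>\<^bsub>MC\<^esub> g)"
    using a nat_map_plus[of f g] nat_map_cmp[of f h] nat_map_cmp[of g h] nat_map_cmp[of "f \<boxplus>\<^bsub>MC\<^esub> g" h] nat_map_plus[of "h \<star>\<^bsub>MC\<^esub> f" "h \<star>\<^bsub>MC\<^esub> g"]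
      arrD(4)[of f] arrD(4)[of g]
    by (intro arr_ext) (simp_all add: hom_iff)
next
  fix f :: "('o, 'm, 'v) presheaf_map" and X Y assume "f \<in> Hom MC X Y"
  then have f: "f \<in> Arr MC" "fst f = X" "fst (snd f) = Y" by (auto simp: hom_iff)
  note D = arrD(1,2)[OF f(1)] arrD(4)[OF f(1)]
  have i: "nat_map C X X (\<lambda>X u. u) \<in> Arr MC" "nat_map C Y Y (\<lambda>X u. u) \<in> Arr MC" using D f by (auto intro: nat_map_idn)
  show "Idn MC Y \<star>\<^bsub>MC\<^esub> f = f" by (rule arr_ext) (use f D nat_map_cmp[OF f(1) i(2)] in simp_all)
  show "f \<star>\<^bsub>MC\<^esub> Idn MC X = f" by (rule arr_ext) (use f D nat_map_cmp[OF i(1) f(1)] in simp_all)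
qed (auto simp: hom_iff arrD nat_map_idn nat_map_cmp)

text \<open>The objectwise quotients inherit restriction maps since \<open>S\<close> is stable under
  restriction, and their carriers stay in the given type by
  \<open>comm_group_quotient_ex\<close>.\<close>

lemma quotient_module_ex:
  fixes G :: "('o, 'm, 'v) presheaf"
  assumes G: "is_module C G" and S: "\<And>X. X \<in> Obj C \<Longrightarrow> subgroup (S X) (PObj G X)"
    and PS: "\<And>f u. f \<in> Arr C \<Longrightarrow> u \<in> S (Cod C f) \<Longrightarrow> PArr G f u \<in> S (Dom C f)"
  shows "\<exists>\<pi> \<in> Arr MC. fst \<pi> = G \<and> (\<forall>X \<in> Obj C. component \<pi> X ` carrier (PObj G X) = carrier (PObj (fst (snd \<pi>)) X) \<and>
    kernel (PObj G X) (PObj (fst (snd \<pi>)) X) (component \<pi> X) = S X)"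
proof -
  note gG = moduleD(1)[OF G]
  \<comment> \<open>Quotients are chosen at all objects at once; outside \<open>Obj C\<close> the
    condition is vacuous.\<close>
  have "\<forall>X. \<exists>Tr :: 'v monoid \<times> ('v \<Rightarrow> 'v). X \<in> Obj C \<longrightarrow> comm_group (fst Tr) \<and> snd Tr \<in> hom (PObj G X) (fst Tr) \<and>
      snd Tr ` carrier (PObj G X) = carrier (fst Tr) \<and> kernel (PObj G X) (fst Tr) (snd Tr) = S X"
  proof
    fix X
    show "\<exists>Tr :: 'v monoid \<times> ('v \<Rightarrow> 'v). X \<in> Obj C \<longrightarrow> comm_group (fst Tr) \<and> snd Tr \<in> hom (PObj G X) (fst Tr) \<and>
      snd Tr ` carrier (PObj G X) = carrier (fst Tr) \<and> kernel (PObj G X) (fst Tr) (snd Tr) = S X"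
    proof (cases "X \<in> Obj C")
      case True
      obtain T r where "comm_group (T :: 'v monoid)" "r \<in> hom (PObj G X) T" "r ` carrier (PObj G X) = carrier T" "kernel (PObj G X) T r = S X"
        using comm_group_quotient_ex[OF gG[OF True] S[OF True]] by blast
      then show ?thesis by (intro exI[of _ "(T, r)"]) simp
    qed simp
  qed
  then obtain Tr :: "'o \<Rightarrow> 'v monoid \<times> ('v \<Rightarrow> 'v)" where Tr: "\<And>X. X \<in> Obj C \<Longrightarrow> comm_group (fst (Tr X)) \<and> snd (Tr X) \<in> hom (PObj G X) (fst (Tr X)) \<and>
      snd (Tr X) ` carrier (PObj G X) = carrier (fst (Tr X)) \<and> kernel (PObj G X) (fst (Tr X)) (snd (Tr X)) = S X"
    by metis
  define T where "T X = fst (Tr X)" for X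
  define r where "r X = snd (Tr X)" for X
  have T: "comm_group (T X)" and r: "r X \<in> hom (PObj G X) (T X)" and im: "r X ` carrier (PObj G X) = carrier (T X)"
    and ker: "kernel (PObj G X) (T X) (r X) = S X" if "X \<in> Obj C" for X
    using Tr[OF that] by (simp_all add: T_def r_def)
  \<comment> \<open>A class is restricted through an arbitrary preimage; \<open>key\<close> shows
    that the choice does not matter.\<close>
  define Q where "Q = \<lparr>PObj = T, PArr = \<lambda>f a. r (Dom C f) (PArr G f (SOME u. u \<in> carrier (PObj G (Cod C f)) \<and> r (Cod C f) u = a))\<rparr>"
  have rE: "\<exists>u \<in> carrier (PObj G X). a = r X u" if "X \<in> Obj C" "a \<in> carrier (T X)" for X a
    using im[OF that(1)] that(2) by blast
  have rin: "r X u \<in> carrier (T X)" if "X \<in> Obj C" "u \<in> carrier (PObj G X)" for X u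
    using im[OF that(1)] that(2) by blast
  have key: "PArr Q f (r (Cod C f) u) = r (Dom C f) (PArr G f u)" if f: "f \<in> Arr C" and u: "u \<in> carrier (PObj G (Cod C f))" for f u
  proof -
    let ?v = "SOME v. v \<in> carrier (PObj G (Cod C f)) \<and> r (Cod C f) v = r (Cod C f) u"
    have v: "?v \<in> carrier (PObj G (Cod C f)) \<and> r (Cod C f) ?v = r (Cod C f) u" by (rule someI[of _ u]) (use u in simp)
    have h: "r (Dom C f) \<circ> PArr G f \<in> hom (PObj G (Cod C f)) (T (Dom C f))"
      by (rule hom_compose[OF moduleD(2)[OF G f] r]) (use f in simp)
    have "(r (Dom C f) \<circ> PArr G f) ?v = (r (Dom C f) \<circ> PArr G f) u"
    proof (rule hom_eq_if_ker[OF gG T T r h])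
      fix x assume "x \<in> carrier (PObj G (Cod C f))" "r (Cod C f) x = \<one>\<^bsub>T (Cod C f)\<^esub>"
      then have "x \<in> S (Cod C f)" using ker[of "Cod C f"] f by (auto simp: kernel_def)
      then have "PArr G f x \<in> S (Dom C f)" by (rule PS[OF f])
      then show "(r (Dom C f) \<circ> PArr G f) x = \<one>\<^bsub>T (Dom C f)\<^esub>" using ker[of "Dom C f"] f by (auto simp: kernel_def)
    qed (use f u v in auto)
    then show ?thesis by (simp add: Q_def)
  qed
  have Qo: "PObj Q = T" by (simp add: Q_def)
  have rm: "r X (u \<otimes>\<^bsub>PObj G X\<^esub> v) = r X u \<otimes>\<^bsub>T X\<^esub> r X v" if "X \<in> Obj C" "u \<in> carrier (PObj G X)" "v \<in> carrier (PObj G X)" for X u v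
    using hom_mult[OF r[OF that(1)] that(2,3)] .
  have Gm: "u \<otimes>\<^bsub>PObj G X\<^esub> v \<in> carrier (PObj G X)" if "X \<in> Obj C" "u \<in> carrier (PObj G X)" "v \<in> carrier (PObj G X)" for X u v
    using gG[OF that(1)] that(2,3) by (simp add: comm_group_def group_def monoid.m_closed)
  have Q: "is_module C Q"
    unfolding is_module_def Qo
  proof (intro conjI ballI allI)
    show "comm_group (T X)" if "X \<in> Obj C" for X using T[OF that] .
    show "PArr Q f \<in> hom (T (Cod C f)) (T (Dom C f))" if f: "f \<in> Arr C" for f
    proof (rule homI)
      fix a assume "a \<in> carrier (T (Cod C f))"
      then obtain u where "u \<in> carrier (PObj G (Cod C f))" "a = r (Cod C f) u" using rE[OF cod_obj[OF f]] by blast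
      then show "PArr Q f a \<in> carrier (T (Dom C f))" using key f PArr_in[OF G f] rin by simp
    next
      fix a b assume "a \<in> carrier (T (Cod C f))" "b \<in> carrier (T (Cod C f))"
      then obtain u v where u: "u \<in> carrier (PObj G (Cod C f))" "a = r (Cod C f) u" and v: "v \<in> carrier (PObj G (Cod C f))" "b = r (Cod C f) v"
        using rE[OF cod_obj[OF f]] by metis
      show "PArr Q f (a \<otimes>\<^bsub>T (Cod C f)\<^esub> b) = PArr Q f a \<otimes>\<^bsub>T (Dom C f)\<^esub> PArr Q f b"
        unfolding u(2) v(2) using key[OF f] rm[of "Cod C f" u v, symmetric] rm[of "Dom C f" "PArr G f u" "PArr G f v"] Gm u(1) v(1) f
          PArr_in[OF G f] hom_mult[OF moduleD(2)[OF G f]] by simp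
    qed
    show "PArr Q (Idn C X) a = a" if X: "X \<in> Obj C" "a \<in> carrier (T X)" for X a
    proof -
      obtain u where "u \<in> carrier (PObj G X)" "a = r X u" using rE X by blast
      then show ?thesis using key[of "Idn C X" u] X moduleD(3)[OF G] by simp
    qed
    fix X Y Z f g a assume "f \<in> Hom C X Y" "g \<in> Hom C Y Z" and a: "a \<in> carrier (T Z)"
    then have fg: "f \<in> Arr C" "Dom C f = X" "Cod C f = Y" "g \<in> Arr C" "Dom C g = Y" "Cod C g = Z" by (auto simp: hom_iff)
    obtain u where u: "u \<in> carrier (PObj G Z)" "a = r Z u" using rE[of Z a] a fg by auto
    show "PArr Q (g \<star> f) a = PArr Q f (PArr Q g a)"
      unfolding u(2) using key[of "g \<star> f" u] key[of g u] key[of f "PArr G g u"] u(1) fg PArr_in[OF G, of g u] moduleD(4)[OF G, of f g u] by simp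
  next
    fix X Y f g a assume "f \<in> Hom C X Y" "g \<in> Hom C X Y" and a: "a \<in> carrier (T Y)"
    then have fg: "f \<in> Arr C" "Dom C f = X" "Cod C f = Y" "g \<in> Arr C" "Dom C g = X" "Cod C g = Y" by (auto simp: hom_iff)
    obtain u where u: "u \<in> carrier (PObj G Y)" "a = r Y u" using rE[of Y a] a fg by auto
    have X: "X \<in> Obj C" using fg by auto
    show "PArr Q (f \<boxplus> g) a = PArr Q f a \<otimes>\<^bsub>T X\<^esub> PArr Q g a"
      unfolding u(2) using key[of "f \<boxplus> g" u] key[of g u] key[of f u] u(1) fg PArr_in[OF G, of g u] PArr_in[OF G, of f u]
        moduleD(5)[OF G, of f g u] rm[OF X, of "PArr G f u" "PArr G g u"] by simp
  qed
  let ?\<pi> = "nat_map C G Q r"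
  have "?\<pi> \<in> Arr MC" by (rule nat_map_arr[OF G Q]) (use r key Qo in auto)
  moreover have "component ?\<pi> X ` carrier (PObj G X) = carrier (PObj Q X) \<and> kernel (PObj G X) (PObj Q X) (component ?\<pi> X) = S X" if X: "X \<in> Obj C" for X
  proof -
    have "component ?\<pi> X ` carrier (PObj G X) = r X ` carrier (PObj G X)" using X by (intro image_cong) auto
    moreover have "kernel (PObj G X) (PObj Q X) (component ?\<pi> X) = kernel (PObj G X) (T X) (r X)" using X Qo by (auto simp: kernel_def)
    ultimately show ?thesis using im[OF X] ker[OF X] Qo by simp
  qed
  ultimately show ?thesis by (intro bexI[of _ ?\<pi>]) auto
qed

text \<open>The kernel keeps the operations of the source and only shrinks the carrier, so that the
  inclusion acts as the identity on elements.\<close>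

lemma kernel_module_ex:
  assumes \<phi>: "\<phi> \<in> Arr MC"
  shows "\<exists>\<kappa> \<in> Arr MC. fst (snd \<kappa>) = fst \<phi> \<and> (\<forall>X \<in> Obj C. carrier (PObj (fst \<kappa>) X) = kernel (PObj (fst \<phi>) X) (PObj (fst (snd \<phi>)) X) (component \<phi> X) \<and>
    one (PObj (fst \<kappa>) X) = one (PObj (fst \<phi>) X) \<and> (\<forall>u \<in> carrier (PObj (fst \<kappa>) X). component \<kappa> X u = u))"
proof -
  note D = arrD[OF \<phi>]
  let ?F = "fst \<phi>" and ?G = "fst (snd \<phi>)"
  define k where "k X = kernel (PObj ?F X) (PObj ?G X) (component \<phi> X)" for X
  define K where "K = \<lparr>PObj = \<lambda>X. (PObj ?F X)\<lparr>carrier := k X\<rparr>, PArr = PArr ?F\<rparr>"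
  have k: "subgroup (k X) (PObj ?F X)" if X: "X \<in> Obj C" for X
    unfolding k_def using D(3)[OF X] moduleD(1)[OF D(1) X] moduleD(1)[OF D(2) X]
    by (intro group_hom.subgroup_kernel) (simp add: group_hom_def group_hom_axioms_def comm_group_def)
  have kF: "u \<in> carrier (PObj ?F X)" if "u \<in> k X" for u X using that by (simp add: k_def kernel_def)
  have kP: "PArr ?F f u \<in> k (Dom C f)" if f: "f \<in> Arr C" "u \<in> k (Cod C f)" for f u
  proof -
    have "PArr ?G f \<one>\<^bsub>PObj ?G (Cod C f)\<^esub> = \<one>\<^bsub>PObj ?G (Dom C f)\<^esub>"
      using hom_one[OF moduleD(2)[OF D(2) f(1)]] moduleD(1)[OF D(2)] f(1) by (simp add: comm_group_def)
    then show ?thesis using f D(5)[OF f(1), of u] PArr_in[OF D(1) f(1)] by (simp add: k_def kernel_def)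
  qed
  have K: "is_module C K" unfolding is_module_def
  proof (intro conjI ballI allI)
    fix X assume X: "X \<in> Obj C"
    interpret comm_group "PObj ?F X" by (rule moduleD(1)[OF D(1) X])
    interpret S: group "(PObj ?F X)\<lparr>carrier := k X\<rparr>" by (rule subgroup.subgroup_is_group[OF k[OF X]]) (rule is_group)
    show "comm_group (PObj K X)" unfolding K_def
      by (simp, rule group.group_comm_groupI[OF S.is_group]) (simp add: m_comm kF)
  next
    fix f assume f: "f \<in> Arr C"
    show "PArr K f \<in> hom (PObj K (Cod C f)) (PObj K (Dom C f))"
      using kP[OF f] hom_mult[OF moduleD(2)[OF D(1) f]] kF by (auto simp: K_def hom_def)
  next
    fix X u assume "X \<in> Obj C" "u \<in> carrier (PObj K X)"
    then show "PArr K (Idn C X) u = u" using moduleD(3)[OF D(1)] kF by (simp add: K_def)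
  next
    fix X Y Z f g u assume "f \<in> Hom C X Y" "g \<in> Hom C Y Z" "u \<in> carrier (PObj K Z)"
    then show "PArr K (g \<star> f) u = PArr K f (PArr K g u)" using moduleD(4)[OF D(1), of f g u] kF by (auto simp: K_def hom_iff)
  next
    fix X Y f g u assume "f \<in> Hom C X Y" "g \<in> Hom C X Y" "u \<in> carrier (PObj K Y)"
    then show "PArr K (f \<boxplus> g) u = PArr K f u \<otimes>\<^bsub>PObj K X\<^esub> PArr K g u" using moduleD(5)[OF D(1), of f g u] kF by (auto simp: K_def hom_iff)
  qed
  let ?\<kappa> = "nat_map C K ?F (\<lambda>X u. u)"
  have "?\<kappa> \<in> Arr MC" by (rule nat_map_arr[OF K D(1)]) (use kF in \<open>auto simp: K_def hom_def\<close>)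
  then show ?thesis by (intro bexI[of _ ?\<kappa>]) (auto simp: K_def k_def)
qed

text \<open>The factorization is defined through arbitrary preimages under \<open>\<pi>\<close>, and
  \<open>hom_eq_if_ker\<close> makes it independent of them.\<close>

lemma module_cok_fac:
  assumes \<pi>: "\<pi> \<in> Arr MC" and h: "h \<in> Arr MC" "fst h = fst \<pi>"
    and sur: "\<And>X. X \<in> Obj C \<Longrightarrow> component \<pi> X ` carrier (PObj (fst \<pi>) X) = carrier (PObj (fst (snd \<pi>)) X)"
    and ker: "\<And>X u. X \<in> Obj C \<Longrightarrow> u \<in> carrier (PObj (fst \<pi>) X) \<Longrightarrow> component \<pi> X u = \<one>\<^bsub>PObj (fst (snd \<pi>)) X\<^esub> \<Longrightarrow> component h X u = \<one>\<^bsub>PObj (fst (snd h)) X\<^esub>"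
  shows "\<exists>w \<in> Arr MC. fst w = fst (snd \<pi>) \<and> fst (snd w) = fst (snd h) \<and> w \<star>\<^bsub>MC\<^esub> \<pi> = h"
proof -
  note P = arrD[OF \<pi>] and H = arrD[OF h(1), unfolded h(2)]
  let ?F = "fst \<pi>" and ?G = "fst (snd \<pi>)" and ?H = "fst (snd h)"
  define w where "w X y = component h X (SOME x. x \<in> carrier (PObj ?F X) \<and> component \<pi> X x = y)" for X y
  have key: "w X (component \<pi> X x) = component h X x" if X: "X \<in> Obj C" "x \<in> carrier (PObj ?F X)" for X x
  proof -
    let ?v = "SOME v. v \<in> carrier (PObj ?F X) \<and> component \<pi> X v = component \<pi> X x"
    have v: "?v \<in> carrier (PObj ?F X) \<and> component \<pi> X ?v = component \<pi> X x" by (rule someI[of _ x]) (use X in simp)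
    have "component h X ?v = component h X x"
      by (rule hom_eq_if_ker[OF moduleD(1)[OF P(1) X(1)] moduleD(1)[OF P(2) X(1)] moduleD(1)[OF H(2) X(1)] P(3)[OF X(1)] H(3)[OF X(1)]])
        (use ker X v in auto)
    then show ?thesis by (simp add: w_def)
  qed
  have E: "\<exists>x \<in> carrier (PObj ?F X). y = component \<pi> X x" if "X \<in> Obj C" "y \<in> carrier (PObj ?G X)" for X y
    using sur[OF that(1)] that(2) by blast
  let ?w = "nat_map C ?G ?H w"
  have w: "?w \<in> Arr MC"
  proof (rule nat_map_arr[OF P(2) H(2)])
    fix X assume X: "X \<in> Obj C"
    show "w X \<in> hom (PObj ?G X) (PObj ?H X)"
    proof (rule homI)
      fix y assume "y \<in> carrier (PObj ?G X)"
      then obtain x where "x \<in> carrier (PObj ?F X)" "y = component \<pi> X x" using E X by blast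
      then show "w X y \<in> carrier (PObj ?H X)" using key X H(4) by simp
    next
      fix y z assume "y \<in> carrier (PObj ?G X)" "z \<in> carrier (PObj ?G X)"
      then obtain a b where a: "a \<in> carrier (PObj ?F X)" "y = component \<pi> X a" and b: "b \<in> carrier (PObj ?F X)" "z = component \<pi> X b" using E X by metis
      have "a \<otimes>\<^bsub>PObj ?F X\<^esub> b \<in> carrier (PObj ?F X)"
        using moduleD(1)[OF P(1) X] a b by (simp add: comm_group_def group_def monoid.m_closed)
      then show "w X (y \<otimes>\<^bsub>PObj ?G X\<^esub> z) = w X y \<otimes>\<^bsub>PObj ?H X\<^esub> w X z"
        unfolding a(2) b(2) using key[OF X] a(1) b(1) hom_mult[OF P(3)[OF X] a(1) b(1), symmetric] hom_mult[OF H(3)[OF X] a(1) b(1)] by simp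
    qed
  next
    fix f y assume f: "f \<in> Arr C" "y \<in> carrier (PObj ?G (Cod C f))"
    then obtain x where x: "x \<in> carrier (PObj ?F (Cod C f))" "y = component \<pi> (Cod C f) x" using E[of "Cod C f" y] by auto
    show "w (Dom C f) (PArr ?G f y) = PArr ?H f (w (Cod C f) y)"
      unfolding x(2) using P(5)[OF f(1) x(1), symmetric] H(5)[OF f(1) x(1)] key[of "Cod C f" x] key[of "Dom C f" "PArr ?F f x"]
        PArr_in[OF P(1) f(1) x(1)] f x(1) by simp
  qed
  moreover have "?w \<star>\<^bsub>MC\<^esub> \<pi> = h"
    by (rule arr_ext) (use nat_map_cmp[OF \<pi> w] h P key in simp_all)
  ultimately show ?thesis by (intro bexI[of _ ?w]) auto
qed

lemma module_ker_fac:
  assumes i: "i \<in> Arr MC" and h: "h \<in> Arr MC" "fst (snd h) = fst (snd i)"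
    and inj: "\<And>X. X \<in> Obj C \<Longrightarrow> inj_on (component i X) (carrier (PObj (fst i) X))"
    and im: "\<And>X u. X \<in> Obj C \<Longrightarrow> u \<in> carrier (PObj (fst h) X) \<Longrightarrow> \<exists>v \<in> carrier (PObj (fst i) X). component i X v = component h X u"
  shows "\<exists>w \<in> Arr MC. fst w = fst h \<and> fst (snd w) = fst i \<and> i \<star>\<^bsub>MC\<^esub> w = h"
proof -
  note I = arrD[OF i] and H = arrD[OF h(1), unfolded h(2)]
  let ?F = "fst i" and ?G = "fst (snd i)" and ?H = "fst h"
  define w where "w X u = (SOME v. v \<in> carrier (PObj ?F X) \<and> component i X v = component h X u)" for X u
  have key: "w X u \<in> carrier (PObj ?F X)" "component i X (w X u) = component h X u" if X: "X \<in> Obj C" "u \<in> carrier (PObj ?H X)" for X u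
    using someI_ex[of "\<lambda>v. v \<in> carrier (PObj ?F X) \<and> component i X v = component h X u"] im[OF X] by (auto simp: w_def)
  have uniq: "w X u = v" if "X \<in> Obj C" "u \<in> carrier (PObj ?H X)" "v \<in> carrier (PObj ?F X)" "component i X v = component h X u" for X u v
    using inj_onD[OF inj[OF that(1)], of "w X u" v] key that by simp
  let ?w = "nat_map C ?H ?F w"
  have w: "?w \<in> Arr MC"
  proof (rule nat_map_arr[OF H(1) I(1)])
    fix X assume X: "X \<in> Obj C"
    interpret F: comm_group "PObj ?F X" by (rule moduleD(1)[OF I(1) X])
    interpret H: comm_group "PObj ?H X" by (rule moduleD(1)[OF H(1) X])
    show "w X \<in> hom (PObj ?H X) (PObj ?F X)"
    proof (rule homI)
      fix u v assume uv: "u \<in> carrier (PObj ?H X)" "v \<in> carrier (PObj ?H X)"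
      show "w X (u \<otimes>\<^bsub>PObj ?H X\<^esub> v) = w X u \<otimes>\<^bsub>PObj ?F X\<^esub> w X v"
        by (rule uniq[OF X]) (use uv key[OF X] hom_mult[OF I(3)[OF X]] hom_mult[OF H(3)[OF X]] in simp_all)
    qed (rule key[OF X])
  next
    fix f u assume f: "f \<in> Arr C" "u \<in> carrier (PObj ?H (Cod C f))"
    show "w (Dom C f) (PArr ?H f u) = PArr ?F f (w (Cod C f) u)"
      by (rule uniq) (use f key[of "Cod C f" u] PArr_in[OF H(1) f] PArr_in[OF I(1) f(1), of "w (Cod C f) u"] I(5)[OF f(1), of "w (Cod C f) u"] H(5)[OF f] in simp_all)
  qed
  moreover have "i \<star>\<^bsub>MC\<^esub> ?w = h"
    by (rule arr_ext) (use nat_map_cmp[OF w i] h I key in simp_all)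
  ultimately show ?thesis by (intro bexI[of _ ?w]) auto
qed

end

section \<open>Representable functors and the Yoneda lemma\<close>

locale representables = exact_category C
  for C :: "('o, 'm) excat" (structure) +
  fixes e :: "'m \<Rightarrow> 'v"
  assumes e_inj: "inj_on e (Arr C)"
begin

abbreviation "y \<equiv> repr C e"
abbreviation "Y \<equiv> repr_map C e"

lemma inv_e [simp]: "f \<in> Arr C \<Longrightarrow> inv_into (Arr C) e (e f) = f"
  by (rule inv_into_f_f[OF e_inj])

lemma e_eq: "f \<in> Arr C \<Longrightarrow> g \<in> Arr C \<Longrightarrow> e f = e g \<longleftrightarrow> f = g"
  using e_inj by (auto simp: inj_on_def)

lemma y_simps [simp]:
  "carrier (PObj (y X) W) = e ` Hom C W X" "one (PObj (y X) W) = e (Zero C W X)"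
  "f \<in> Arr C \<Longrightarrow> g \<in> Arr C \<Longrightarrow> e f \<otimes>\<^bsub>PObj (y X) W\<^esub> e g = e (f \<boxplus> g)"
  "g \<in> Arr C \<Longrightarrow> PArr (y X) f (e g) = e (g \<star> f)"
  by (simp_all add: repr_def Let_def)

lemma y_module:
  assumes X: "X \<in> Obj C"
  shows "is_module C (y X)"
  unfolding is_module_def
proof (intro conjI ballI allI)
  fix W assume W: "W \<in> Obj C"
  show "comm_group (PObj (y X) W)"
  proof (rule comm_groupI)
    fix u assume "u \<in> carrier (PObj (y X) W)"
    then obtain f where "f \<in> Arr C" "Dom C f = W" "Cod C f = X" "u = e f" by (auto simp: hom_iff)
    then show "\<exists>v\<in>carrier (PObj (y X) W). v \<otimes>\<^bsub>PObj (y X) W\<^esub> u = \<one>\<^bsub>PObj (y X) W\<^esub>"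
      by (intro bexI[of _ "e (neg C f)"]) (auto simp: hom_iff)
  qed (use X W in \<open>auto simp: hom_iff plus_ac\<close>)
qed (use X in \<open>auto simp: hom_iff intro!: homI\<close>)

lemma Y_eq: "Y f = nat_map C (y (Dom C f)) (y (Cod C f)) (\<lambda>W u. e (f \<star> inv_into (Arr C) e u))"
  by (simp add: repr_map_def nat_map_def cong: restrict_cong)

lemma Y_arr:
  assumes f: "f \<in> Arr C"
  shows "Y f \<in> Arr MC" "fst (Y f) = y (Dom C f)" "fst (snd (Y f)) = y (Cod C f)"
    "g \<in> Arr C \<Longrightarrow> Cod C g = Dom C f \<Longrightarrow> Dom C g = W \<Longrightarrow> component (Y f) W (e g) = e (f \<star> g)"
proof -
  show "Y f \<in> Arr MC" unfolding Y_eq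
    by (rule nat_map_arr) (use f y_module in \<open>auto simp: hom_iff intro!: homI\<close>)
  show "fst (Y f) = y (Dom C f)" "fst (snd (Y f)) = y (Cod C f)" by (simp_all add: Y_eq)
  show "g \<in> Arr C \<Longrightarrow> Cod C g = Dom C f \<Longrightarrow> Dom C g = W \<Longrightarrow> component (Y f) W (e g) = e (f \<star> g)"
    unfolding Y_eq by (subst nat_map_simps(3)) (auto simp: hom_iff)
qed

text \<open>The map out of the representable of \<open>X\<close> that corresponds to the element
  \<open>u\<close> under the Yoneda lemma.\<close>

definition yel :: "('o, 'm, 'v) presheaf \<Rightarrow> 'o \<Rightarrow> 'v \<Rightarrow> ('o, 'm, 'v) presheaf_map" where
  "yel F X u = nat_map C (y X) F (\<lambda>W v. PArr F (inv_into (Arr C) e v) u)"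

lemma yel_arr:
  assumes F: "is_module C F" and X: "X \<in> Obj C" and u: "u \<in> carrier (PObj F X)"
  shows "yel F X u \<in> Arr MC" "fst (yel F X u) = y X" "fst (snd (yel F X u)) = F"
    "g \<in> Arr C \<Longrightarrow> Cod C g = X \<Longrightarrow> Dom C g = W \<Longrightarrow> component (yel F X u) W (e g) = PArr F g u"
    "component (yel F X u) X (e (Idn C X)) = u"
proof -
  show "yel F X u \<in> Arr MC" unfolding yel_def
  proof (rule nat_map_arr[OF y_module[OF X] F])
    fix W assume "W \<in> Obj C"
    show "(\<lambda>v. PArr F (inv_into (Arr C) e v) u) \<in> hom (PObj (y X) W) (PObj F W)"
      using PArr_in[OF F] moduleD(5)[OF F] u by (auto simp: hom_iff intro!: homI)
  next
    fix f v assume "f \<in> Arr C" "v \<in> carrier (PObj (y X) (Cod C f))"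
    then show "PArr F (inv_into (Arr C) e (PArr (y X) f v)) u = PArr F f (PArr F (inv_into (Arr C) e v) u)"
      using moduleD(4)[OF F, of f] u by (auto simp: hom_iff)
  qed
  show "fst (yel F X u) = y X" "fst (snd (yel F X u)) = F" by (simp_all add: yel_def)
  show *: "g \<in> Arr C \<Longrightarrow> Cod C g = X \<Longrightarrow> Dom C g = W \<Longrightarrow> component (yel F X u) W (e g) = PArr F g u" for g W
    unfolding yel_def by (subst nat_map_simps(3)) (auto simp: hom_iff)
  show "component (yel F X u) X (e (Idn C X)) = u" using * X moduleD(3)[OF F X u] by simp
qed

lemma yoneda:
  assumes x: "x \<in> Arr MC" "fst x = y X" and X: "X \<in> Obj C"
  shows "component x X (e (Idn C X)) \<in> carrier (PObj (fst (snd x)) X)" "x = yel (fst (snd x)) X (component x X (e (Idn C X)))"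
proof -
  note D = arrD[OF x(1), unfolded x(2)]
  show u: "component x X (e (Idn C X)) \<in> carrier (PObj (fst (snd x)) X)" using D(4)[OF X, of "e (Idn C X)"] X by (auto simp: hom_iff)
  note Y = yel_arr[OF D(2) X u]
  show "x = yel (fst (snd x)) X (component x X (e (Idn C X)))"
  proof (rule arr_ext[OF x(1) Y(1)])
    fix W v assume "W \<in> Obj C" "v \<in> carrier (PObj (fst (yel (fst (snd x)) X (component x X (e (Idn C X))))) W)"
    then obtain g where g: "g \<in> Arr C" "Dom C g = W" "Cod C g = X" "v = e g" using Y(2) by (auto simp: hom_iff)
    show "component x W v = component (yel (fst (snd x)) X (component x X (e (Idn C X)))) W v"
      using D(5)[OF g(1), of "e (Idn C X)"] Y(4)[OF g(1,3,2)] g X by (auto simp: hom_iff)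
  qed (use Y x in auto)
qed

text \<open>Naturality in the Yoneda lemma: composing with a generalized element is evaluating a
  component.\<close>

lemma cmp_yel:
  assumes \<phi>: "\<phi> \<in> Arr MC" and X: "X \<in> Obj C" and u: "u \<in> carrier (PObj (fst \<phi>) X)"
  shows "\<phi> \<star>\<^bsub>MC\<^esub> yel (fst \<phi>) X u = yel (fst (snd \<phi>)) X (component \<phi> X u)"
proof (rule arr_ext)
  note D = arrD[OF \<phi>]
  note A = yel_arr[OF D(1) X u] and B = yel_arr[OF D(2) X D(4)[OF X u]]
  show "\<phi> \<star>\<^bsub>MC\<^esub> yel (fst \<phi>) X u \<in> Arr MC" using nat_map_cmp[OF A(1) \<phi>] A by simp
  show "yel (fst (snd \<phi>)) X (component \<phi> X u) \<in> Arr MC" by (rule B)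
  fix W v assume "W \<in> Obj C" "v \<in> carrier (PObj (fst (yel (fst (snd \<phi>)) X (component \<phi> X u))) W)"
  then obtain g where g: "W \<in> Obj C" "g \<in> Arr C" "Dom C g = W" "Cod C g = X" "v = e g" using B(2) by (auto simp: hom_iff)
  show "component (\<phi> \<star>\<^bsub>MC\<^esub> yel (fst \<phi>) X u) W v = component (yel (fst (snd \<phi>)) X (component \<phi> X u)) W v"
    using g A B D(5)[OF g(2), of u] u by (auto simp: hom_iff)
qed (use yel_arr[OF arrD(1)[OF \<phi>] X u] yel_arr[OF arrD(2)[OF \<phi>] X arrD(4)[OF \<phi> X u]] in simp_all)

lemma yel_eq:
  assumes "is_module C F" "X \<in> Obj C" "u \<in> carrier (PObj F X)" "v \<in> carrier (PObj F X)"
  shows "yel F X u = yel F X v \<longleftrightarrow> u = v"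
  using yel_arr(5)[OF assms(1-3)] yel_arr(5)[OF assms(1,2,4)] by metis

lemma yel_one:
  assumes F: "is_module C F" and X: "X \<in> Obj C"
  shows "yel F X \<one>\<^bsub>PObj F X\<^esub> = Zero MC (y X) F"
proof -
  let ?z = "nat_map C (y X) F (\<lambda>W u. \<one>\<^bsub>PObj F W\<^esub>)"
  have z: "?z \<in> Arr MC" by (rule nat_map_zero[OF y_module[OF X] F])
  have "component ?z X (e (Idn C X)) = \<one>\<^bsub>PObj F X\<^esub>" by (subst nat_map_simps(3)) (use X in \<open>auto simp: hom_iff\<close>)
  with yoneda(2)[OF z _ X] show ?thesis by simp
qed

sublocale B: presheaf_base C "mod_cat C :: (('o, 'm, 'v) presheaf, ('o, 'm, 'v) presheaf_map) pcat" "repr C e" "repr_map C e"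
proof (intro presheaf_base.intro presheaf_base_axioms.intro exact_category_axioms mod_cat_preadditive)
  fix Z assume Z: "Z \<in> Obj C"
  have i: "nat_map C (y Z) (y Z) (\<lambda>X u. u) \<in> Arr MC" by (rule nat_map_idn[OF y_module[OF Z]])
  show "Y (Idn C Z) = Idn MC (y Z)"
    by (rule arr_ext) (use i Z Y_arr[of "Idn C Z"] in \<open>auto simp: hom_iff\<close>)
next
  fix f g assume fg: "f \<in> Arr C" "g \<in> Arr C" "Cod C f = Dom C g"
  have c: "nat_map C (y (Dom C f)) (y (Cod C g)) (\<lambda>X u. component (Y g) X (component (Y f) X u)) \<in> Arr MC"
    using nat_map_cmp[OF Y_arr(1)[OF fg(1)] Y_arr(1)[OF fg(2)]] Y_arr[OF fg(1)] Y_arr[OF fg(2)] fg by simp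
  show "Y (g \<star> f) = Y g \<star>\<^bsub>MC\<^esub> Y f"
    by (rule arr_ext) (use c fg Y_arr[OF fg(1)] Y_arr[OF fg(2)] Y_arr[of "g \<star> f"] in \<open>auto simp: hom_iff\<close>)
next
  fix f g assume fg: "f \<in> Arr C" "g \<in> Arr C" "Dom C f = Dom C g" "Cod C f = Cod C g"
  have c: "nat_map C (y (Dom C g)) (y (Cod C g)) (\<lambda>X u. component (Y f) X u \<otimes>\<^bsub>PObj (y (Cod C g)) X\<^esub> component (Y g) X u) \<in> Arr MC"
    using nat_map_plus[OF Y_arr(1)[OF fg(1)] Y_arr(1)[OF fg(2)]] Y_arr[OF fg(1)] Y_arr[OF fg(2)] fg by simp
  show "Y (f \<boxplus> g) = Y f \<boxplus>\<^bsub>MC\<^esub> Y g"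
    by (rule arr_ext) (use c fg Y_arr[OF fg(1)] Y_arr[OF fg(2)] Y_arr[of "f \<boxplus> g"] in \<open>auto simp: hom_iff\<close>)
next
  fix h :: "('o, 'm, 'v) presheaf_map" and W Z
  assume h: "h \<in> Arr MC" "W \<in> Obj C" "Z \<in> Obj C" "Dom MC h = y W" "Cod MC h = y Z"
  have h': "fst h = y W" "fst (snd h) = y Z" using h by simp_all
  \<comment> \<open>The arrow of \<open>C\<close> behind \<open>h\<close> is the value of
    \<open>h\<close> at the identity.\<close>
  obtain f where f: "f \<in> Arr C" "Dom C f = W" "Cod C f = Z" "component h W (e (Idn C W)) = e f"
    using yoneda(1)[OF h(1) h'(1) h(2)] h' by (auto simp: hom_iff)
  have "component (Y f) W (e (Idn C W)) = e f" using Y_arr(4)[OF f(1), of "Idn C W" W] f h by simp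
  then have "Y f = h"
    using yoneda(2)[OF h(1) h'(1) h(2)] yoneda(2)[OF Y_arr(1)[OF f(1)], of W] Y_arr(2,3)[OF f(1)] f h' h(2) by simp
  with f show "\<exists>f\<in>Arr C. Dom C f = W \<and> Cod C f = Z \<and> Y f = h" by blast
next
  fix f g assume fg: "f \<in> Arr C" "g \<in> Arr C" "Dom C f = Dom C g" "Cod C f = Cod C g" "Y f = Y g"
  have "e f = component (Y f) (Dom C f) (e (Idn C (Dom C f)))" using Y_arr(4)[OF fg(1), of "Idn C (Dom C f)"] fg by simp
  also have "\<dots> = e g" unfolding fg(5) using Y_arr(4)[OF fg(2), of "Idn C (Dom C g)"] fg(1-4) by simp
  finally show "f = g" using e_eq fg by simp
qed (use y_module Y_arr in auto)

section \<open>Generalized elements versus elements of groups\<close>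

lemma T_yel:
  assumes "is_module C F" "X \<in> Obj C" "u \<in> carrier (PObj F X)"
  shows "B.T (yel F X u) F"
  unfolding B.T_def using yel_arr[OF assms] assms(2) by auto

lemma T_yelE:
  assumes "B.T x F"
  obtains X u where "X \<in> Obj C" "u \<in> carrier (PObj F X)" "x = yel F X u" "is_module C F"
proof -
  obtain X where X: "X \<in> Obj C" "x \<in> Arr MC" "fst x = y X" and F: "fst (snd x) = F"
    using assms by (auto simp: B.T_def)
  show thesis using that[OF X(1)] yoneda[OF X(2,3,1)] arrD(2)[OF X(2)] F by simp
qed

lemma cmp_yel_zero:
  assumes \<phi>: "\<phi> \<in> Arr MC" and X: "X \<in> Obj C" and u: "u \<in> carrier (PObj (fst \<phi>) X)"
  shows "\<phi> \<star>\<^bsub>MC\<^esub> yel (fst \<phi>) X u = Zero MC (y X) (fst (snd \<phi>)) \<longleftrightarrow> component \<phi> X u = \<one>\<^bsub>PObj (fst (snd \<phi>)) X\<^esub>"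
proof -
  note D = arrD[OF \<phi>]
  have "\<one>\<^bsub>PObj (fst (snd \<phi>)) X\<^esub> \<in> carrier (PObj (fst (snd \<phi>)) X)"
    using moduleD(1)[OF D(2) X] by (simp add: comm_group_def group_def)
  then show ?thesis
    unfolding cmp_yel[OF \<phi> X u] yel_one[OF D(2) X, symmetric] by (rule yel_eq[OF D(2) X D(4)[OF X u]])
qed

lemma all_T:
  assumes F: "is_module C F"
  shows "(\<forall>x. B.T x F \<longrightarrow> Q x) \<longleftrightarrow> (\<forall>X \<in> Obj C. \<forall>u \<in> carrier (PObj F X). Q (yel F X u))"
proof
  show "\<forall>X \<in> Obj C. \<forall>u \<in> carrier (PObj F X). Q (yel F X u)" if "\<forall>x. B.T x F \<longrightarrow> Q x"
    using that T_yel[OF F] by blast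
  show "\<forall>x. B.T x F \<longrightarrow> Q x" if *: "\<forall>X \<in> Obj C. \<forall>u \<in> carrier (PObj F X). Q (yel F X u)"
  proof (intro allI impI)
    fix x assume "B.T x F"
    then show "Q x" by (rule T_yelE) (use * in blast)
  qed
qed

text \<open>By \<open>yoneda\<close> and \<open>cmp_yel\<close>, a lift of the generalized element
  of \<open>v\<close> over the same object is a preimage of \<open>v\<close> in the group.\<close>

lemma lift_iff:
  assumes \<phi>: "\<phi> \<in> Arr MC" and X: "X \<in> Obj C" and v: "v \<in> carrier (PObj (fst (snd \<phi>)) X)"
  shows "(\<exists>x. B.T x (fst \<phi>) \<and> fst x = y X \<and> \<phi> \<star>\<^bsub>MC\<^esub> x = yel (fst (snd \<phi>)) X v) \<longleftrightarrow> v \<in> component \<phi> X ` carrier (PObj (fst \<phi>) X)"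
proof
  note D = arrD[OF \<phi>]
  assume "\<exists>x. B.T x (fst \<phi>) \<and> fst x = y X \<and> \<phi> \<star>\<^bsub>MC\<^esub> x = yel (fst (snd \<phi>)) X v"
  then obtain x where x: "B.T x (fst \<phi>)" "fst x = y X" "\<phi> \<star>\<^bsub>MC\<^esub> x = yel (fst (snd \<phi>)) X v" by blast
  have xa: "x \<in> Arr MC" "fst (snd x) = fst \<phi>" using x(1) by (auto simp: B.T_def)
  let ?u = "component x X (e (Idn C X))"
  have u: "?u \<in> carrier (PObj (fst \<phi>) X)" "x = yel (fst \<phi>) X ?u" using yoneda[OF xa(1) x(2) X] xa(2) by auto
  have "yel (fst (snd \<phi>)) X (component \<phi> X ?u) = yel (fst (snd \<phi>)) X v" using cmp_yel[OF \<phi> X u(1)] x(3) u(2) by metis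
  then show "v \<in> component \<phi> X ` carrier (PObj (fst \<phi>) X)" using yel_eq[OF D(2) X D(4)[OF X u(1)] v] u(1) by blast
next
  note D = arrD[OF \<phi>]
  assume "v \<in> component \<phi> X ` carrier (PObj (fst \<phi>) X)"
  then obtain u where u: "u \<in> carrier (PObj (fst \<phi>) X)" "component \<phi> X u = v" by blast
  show "\<exists>x. B.T x (fst \<phi>) \<and> fst x = y X \<and> \<phi> \<star>\<^bsub>MC\<^esub> x = yel (fst (snd \<phi>)) X v"
    using T_yel[OF D(1) X u(1)] cmp_yel[OF \<phi> X u(1)] yel_arr(2)[OF D(1) X u(1)] unfolding u(2) by metis
qed

lemma inj_iff: "B.inj \<phi> \<longleftrightarrow> \<phi> \<in> Arr MC \<and> pointwise_inj C \<phi>"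
proof (cases "\<phi> \<in> Arr MC")
  case True
  note D = arrD[OF True]
  have 1: "\<one>\<^bsub>PObj (fst \<phi>) X\<^esub> \<in> carrier (PObj (fst \<phi>) X)" if "X \<in> Obj C" for X
    using moduleD(1)[OF D(1) that] by (simp add: comm_group_def group_def)
  have "inj_on (component \<phi> X) (carrier (PObj (fst \<phi>) X)) \<longleftrightarrow> (\<forall>u \<in> carrier (PObj (fst \<phi>) X).
      \<phi> \<star>\<^bsub>MC\<^esub> yel (fst \<phi>) X u = Zero MC (fst (yel (fst \<phi>) X u)) (fst (snd \<phi>)) \<longrightarrow> yel (fst \<phi>) X u = Zero MC (fst (yel (fst \<phi>) X u)) (fst \<phi>))"
    if X: "X \<in> Obj C" for X
  proof -
    interpret group_hom "PObj (fst \<phi>) X" "PObj (fst (snd \<phi>)) X" "component \<phi> X"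
      using D(3)[OF X] moduleD(1)[OF D(1) X] moduleD(1)[OF D(2) X] by (simp add: group_hom_def group_hom_axioms_def comm_group_def)
    have "yel (fst \<phi>) X u = Zero MC (y X) (fst \<phi>) \<longleftrightarrow> u = \<one>\<^bsub>PObj (fst \<phi>) X\<^esub>" if "u \<in> carrier (PObj (fst \<phi>) X)" for u
      using yel_eq[OF D(1) X that 1[OF X]] unfolding yel_one[OF D(1) X] .
    then show ?thesis
      unfolding inj_on_one_iff Ball_def
      by (simp only: yel_arr(2)[OF D(1) X] cmp_yel_zero[OF True X] cong: imp_cong)
  qed
  then show ?thesis
    using True unfolding B.inj_def MC_simps(2,3) all_T[OF D(1)] pointwise_inj_def case_prod_unfold component_def[symmetric] by (simp cong: ball_cong)
qed (simp add: B.inj_def)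

lemma sur_iff: "B.sur \<phi> \<longleftrightarrow> \<phi> \<in> Arr MC \<and> pointwise_surj C \<phi>"
proof (cases "\<phi> \<in> Arr MC")
  case True
  note D = arrD[OF True]
  have "component \<phi> X ` carrier (PObj (fst \<phi>) X) = carrier (PObj (fst (snd \<phi>)) X) \<longleftrightarrow> (\<forall>v \<in> carrier (PObj (fst (snd \<phi>)) X).
      \<exists>x. B.T x (fst \<phi>) \<and> fst x = fst (yel (fst (snd \<phi>)) X v) \<and> \<phi> \<star>\<^bsub>MC\<^esub> x = yel (fst (snd \<phi>)) X v)"
    if X: "X \<in> Obj C" for X
    using D(4)[OF X] lift_iff[OF True X] yel_arr(2)[OF D(2) X] by (auto simp del: MC_simps)
  then show ?thesis
    using True unfolding B.sur_def MC_simps(2,3) all_T[OF D(2)] pointwise_surj_def case_prod_unfold component_def[symmetric] by (simp del: MC_simps cong: ball_cong)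
qed (simp add: B.sur_def)

lemma ex_iff: "B.ex \<phi> \<psi> \<longleftrightarrow> \<phi> \<in> Arr MC \<and> \<psi> \<in> Arr MC \<and> exact_at C \<phi> \<psi>"
proof (cases "\<phi> \<in> Arr MC \<and> \<psi> \<in> Arr MC \<and> fst (snd \<phi>) = fst \<psi>")
  case True
  then have \<phi>: "\<phi> \<in> Arr MC" and \<psi>: "\<psi> \<in> Arr MC" and t: "fst (snd \<phi>) = fst \<psi>" by auto
  note D = arrD[OF \<phi>, unfolded t] and D' = arrD[OF \<psi>]
  have z: "nat_map C (fst \<phi>) (fst (snd \<psi>)) (\<lambda>X u. \<one>\<^bsub>PObj (fst (snd \<psi>)) X\<^esub>) \<in> Arr MC" by (rule nat_map_zero[OF D(1) D'(2)])
  have c: "\<psi> \<star>\<^bsub>MC\<^esub> \<phi> \<in> Arr MC" using nat_map_cmp[OF \<phi> \<psi> t] by simp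
  have "\<psi> \<star>\<^bsub>MC\<^esub> \<phi> = Zero MC (fst \<phi>) (fst (snd \<psi>)) \<longleftrightarrow>
    (\<forall>X \<in> Obj C. \<forall>u \<in> carrier (PObj (fst \<phi>) X). component \<psi> X (component \<phi> X u) = \<one>\<^bsub>PObj (fst (snd \<psi>)) X\<^esub>)" (is "_ \<longleftrightarrow> ?Z")
  proof
    assume "\<psi> \<star>\<^bsub>MC\<^esub> \<phi> = Zero MC (fst \<phi>) (fst (snd \<psi>))"
    then have eq: "component (\<psi> \<star>\<^bsub>MC\<^esub> \<phi>) X u = component (Zero MC (fst \<phi>) (fst (snd \<psi>))) X u" for X u by (rule arg_cong)
    show ?Z
    proof (intro ballI)
      fix X u assume "X \<in> Obj C" "u \<in> carrier (PObj (fst \<phi>) X)"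
      then show "component \<psi> X (component \<phi> X u) = \<one>\<^bsub>PObj (fst (snd \<psi>)) X\<^esub>" using eq[of X u] by simp
    qed
  next
    assume ?Z
    then show "\<psi> \<star>\<^bsub>MC\<^esub> \<phi> = Zero MC (fst \<phi>) (fst (snd \<psi>))" using c z by (intro arr_ext) simp_all
  qed
  moreover have "(\<forall>v \<in> carrier (PObj (fst \<psi>) X).
      \<psi> \<star>\<^bsub>MC\<^esub> yel (fst \<psi>) X v = Zero MC (fst (yel (fst \<psi>) X v)) (fst (snd \<psi>)) \<longrightarrow>
      (\<exists>x. B.T x (fst \<phi>) \<and> fst x = fst (yel (fst \<psi>) X v) \<and> \<phi> \<star>\<^bsub>MC\<^esub> x = yel (fst \<psi>) X v)) \<longleftrightarrow>
    kernel (PObj (fst \<psi>) X) (PObj (fst (snd \<psi>)) X) (component \<psi> X) \<subseteq> component \<phi> X ` carrier (PObj (fst \<phi>) X)" if X: "X \<in> Obj C" for X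
    using lift_iff[OF \<phi> X, unfolded t] yel_arr(2)[OF D'(1) X] cmp_yel_zero[OF \<psi> X] by (auto simp: kernel_def simp del: MC_simps)
  moreover have "(\<forall>u \<in> carrier (PObj (fst \<phi>) X). component \<psi> X (component \<phi> X u) = \<one>\<^bsub>PObj (fst (snd \<psi>)) X\<^esub>) \<longleftrightarrow>
      component \<phi> X ` carrier (PObj (fst \<phi>) X) \<subseteq> kernel (PObj (fst \<psi>) X) (PObj (fst (snd \<psi>)) X) (component \<psi> X)" if X: "X \<in> Obj C" for X
    using D(4)[OF X] by (auto simp: kernel_def)
  ultimately show ?thesis
    using True unfolding B.ex_def MC_simps(2,3) all_T[OF D'(1)] exact_at_def case_prod_unfold component_def[symmetric]
    by (simp del: MC_simps cong: ball_cong) blast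
qed (auto simp: B.ex_def exact_at_def)

lemma ses_iff: "B.ses i p \<longleftrightarrow> short_exact C i p"
  by (auto simp: B.ses_def short_exact_def inj_iff sur_iff ex_iff)

sublocale B: presheaf_setting C "mod_cat C :: (('o, 'm, 'v) presheaf, ('o, 'm, 'v) presheaf_map) pcat" "repr C e" "repr_map C e"
proof (intro presheaf_setting.intro presheaf_setting_axioms.intro B.presheaf_base_axioms)
  fix \<phi> :: "('o, 'm, 'v) presheaf_map" assume \<phi>: "\<phi> \<in> Arr MC"
  note D = arrD[OF \<phi>]
  have g: "group_hom (PObj (fst \<phi>) X) (PObj (fst (snd \<phi>)) X) (component \<phi> X)" if X: "X \<in> Obj C" for X
    using D(3)[OF X] moduleD(1)[OF D(1) X] moduleD(1)[OF D(2) X] by (simp add: group_hom_def group_hom_axioms_def comm_group_def)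
  show "\<phi> = Zero MC (Dom MC \<phi>) (Cod MC \<phi>)" if "\<And>x. B.T x (Dom MC \<phi>) \<Longrightarrow> \<phi> \<star>\<^bsub>MC\<^esub> x = Zero MC (Dom MC x) (Cod MC \<phi>)"
  proof -
    have "component \<phi> X u = \<one>\<^bsub>PObj (fst (snd \<phi>)) X\<^esub>" if X: "X \<in> Obj C" "u \<in> carrier (PObj (fst \<phi>) X)" for X u
      using \<open>\<And>x. B.T x (Dom MC \<phi>) \<Longrightarrow> _\<close>[of "yel (fst \<phi>) X u"] T_yel[OF D(1) X] cmp_yel_zero[OF \<phi> X]
      unfolding MC_simps(2,3) yel_arr(2)[OF D(1) X] by blast
    then show ?thesis using nat_map_zero[OF D(1,2)] \<phi> by (intro arr_ext) simp_all
  qed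
  obtain \<kappa> where \<kappa>: "\<kappa> \<in> Arr MC" "fst (snd \<kappa>) = fst \<phi>"
    "\<And>X. X \<in> Obj C \<Longrightarrow> carrier (PObj (fst \<kappa>) X) = kernel (PObj (fst \<phi>) X) (PObj (fst (snd \<phi>)) X) (component \<phi> X)"
    "\<And>X u. X \<in> Obj C \<Longrightarrow> u \<in> carrier (PObj (fst \<kappa>) X) \<Longrightarrow> component \<kappa> X u = u"
    using kernel_module_ex[OF \<phi>] by blast
  have "pointwise_inj C \<kappa>" using \<kappa>(4) by (auto simp: pointwise_inj_def component_def[symmetric] case_prod_unfold inj_on_def)
  moreover have "exact_at C \<kappa> \<phi>"
    using \<kappa>(2,3,4) by (simp add: exact_at_def component_def[symmetric] case_prod_unfold)
  ultimately show "\<exists>\<kappa>. B.inj \<kappa> \<and> B.ex \<kappa> \<phi>" using \<kappa>(1) \<phi> inj_iff ex_iff by blast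
  \<comment> \<open>The cokernel is the quotient by the objectwise image, which is stable under
    restriction by naturality of \<open>\<phi>\<close>.\<close>
  have "\<exists>\<pi> \<in> Arr MC. fst \<pi> = fst (snd \<phi>) \<and> (\<forall>X \<in> Obj C. component \<pi> X ` carrier (PObj (fst (snd \<phi>)) X) = carrier (PObj (fst (snd \<pi>)) X) \<and>
    kernel (PObj (fst (snd \<phi>)) X) (PObj (fst (snd \<pi>)) X) (component \<pi> X) = component \<phi> X ` carrier (PObj (fst \<phi>) X))"
  proof (rule quotient_module_ex[OF D(2)])
    show "subgroup (component \<phi> X ` carrier (PObj (fst \<phi>) X)) (PObj (fst (snd \<phi>)) X)" if "X \<in> Obj C" for X
      by (rule group_hom.img_is_subgroup[OF g[OF that]])
    show "PArr (fst (snd \<phi>)) f u \<in> component \<phi> (Dom C f) ` carrier (PObj (fst \<phi>) (Dom C f))"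
      if f: "f \<in> Arr C" and u: "u \<in> component \<phi> (Cod C f) ` carrier (PObj (fst \<phi>) (Cod C f))" for f u
    proof -
      obtain v where v: "v \<in> carrier (PObj (fst \<phi>) (Cod C f))" "u = component \<phi> (Cod C f) v" using u by blast
      show ?thesis unfolding v(2) using D(5)[OF f v(1), symmetric] PArr_in[OF D(1) f v(1)] by simp
    qed
  qed
  then obtain \<pi> where \<pi>: "\<pi> \<in> Arr MC" "fst \<pi> = fst (snd \<phi>)"
    "\<And>X. X \<in> Obj C \<Longrightarrow> component \<pi> X ` carrier (PObj (fst (snd \<phi>)) X) = carrier (PObj (fst (snd \<pi>)) X)"
    "\<And>X. X \<in> Obj C \<Longrightarrow> kernel (PObj (fst (snd \<phi>)) X) (PObj (fst (snd \<pi>)) X) (component \<pi> X) = component \<phi> X ` carrier (PObj (fst \<phi>) X)"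
    by (elim bexE conjE) simp
  have "pointwise_surj C \<pi>" using \<pi> by (simp add: pointwise_surj_def component_def[symmetric] case_prod_unfold)
  moreover have "exact_at C \<phi> \<pi>" using \<pi> by (simp add: exact_at_def component_def[symmetric] case_prod_unfold)
  ultimately show "\<exists>\<pi>. B.sur \<pi> \<and> B.ex \<phi> \<pi>" using \<pi>(1) \<phi> sur_iff ex_iff by blast
next
  fix \<pi> h :: "('o, 'm, 'v) presheaf_map"
  assume s: "B.sur \<pi>" and h: "h \<in> Arr MC" "Dom MC h = Dom MC \<pi>"
    and k: "\<And>x. B.T x (Dom MC \<pi>) \<Longrightarrow> \<pi> \<star>\<^bsub>MC\<^esub> x = Zero MC (Dom MC x) (Cod MC \<pi>) \<Longrightarrow> h \<star>\<^bsub>MC\<^esub> x = Zero MC (Dom MC x) (Cod MC h)"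
  have \<pi>: "\<pi> \<in> Arr MC" "pointwise_surj C \<pi>" using s sur_iff by auto
  have t: "fst h = fst \<pi>" using h by simp
  note D = arrD[OF \<pi>(1)]
  have "\<exists>w \<in> Arr MC. fst w = fst (snd \<pi>) \<and> fst (snd w) = fst (snd h) \<and> w \<star>\<^bsub>MC\<^esub> \<pi> = h"
  proof (rule module_cok_fac[OF \<pi>(1) h(1) t])
    show "component \<pi> X ` carrier (PObj (fst \<pi>) X) = carrier (PObj (fst (snd \<pi>)) X)" if "X \<in> Obj C" for X
      using \<pi>(2) that by (simp add: pointwise_surj_def component_def[symmetric] case_prod_unfold)
    fix X u assume X: "X \<in> Obj C" "u \<in> carrier (PObj (fst \<pi>) X)" and z: "component \<pi> X u = \<one>\<^bsub>PObj (fst (snd \<pi>)) X\<^esub>"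
    have u: "u \<in> carrier (PObj (fst h) X)" using X t by simp
    have "h \<star>\<^bsub>MC\<^esub> yel (fst \<pi>) X u = Zero MC (y X) (fst (snd h))"
      using k[of "yel (fst \<pi>) X u"] T_yel[OF D(1) X] iffD2[OF cmp_yel_zero[OF \<pi>(1) X] z]
      unfolding MC_simps(2,3) yel_arr(2)[OF D(1) X] by blast
    then show "component h X u = \<one>\<^bsub>PObj (fst (snd h)) X\<^esub>" using cmp_yel_zero[OF h(1) X(1) u] unfolding t by blast
  qed
  then show "\<exists>w \<in> Arr MC. Dom MC w = Cod MC \<pi> \<and> Cod MC w = Cod MC h \<and> w \<star>\<^bsub>MC\<^esub> \<pi> = h" unfolding MC_simps(2,3) .
next
  fix i h :: "('o, 'm, 'v) presheaf_map"
  assume s: "B.inj i" and h: "h \<in> Arr MC" "Cod MC h = Cod MC i"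
    and k: "\<And>x. B.T x (Dom MC h) \<Longrightarrow> \<exists>z. B.T z (Dom MC i) \<and> Dom MC z = Dom MC x \<and> i \<star>\<^bsub>MC\<^esub> z = h \<star>\<^bsub>MC\<^esub> x"
  have i: "i \<in> Arr MC" "pointwise_inj C i" using s inj_iff by auto
  have t: "fst (snd h) = fst (snd i)" using h by simp
  note D = arrD[OF h(1)]
  have "\<exists>w \<in> Arr MC. fst w = fst h \<and> fst (snd w) = fst i \<and> i \<star>\<^bsub>MC\<^esub> w = h"
  proof (rule module_ker_fac[OF i(1) h(1) t])
    show "inj_on (component i X) (carrier (PObj (fst i) X))" if "X \<in> Obj C" for X
      using i(2) that by (simp add: pointwise_inj_def component_def[symmetric] case_prod_unfold)
    fix X u assume X: "X \<in> Obj C" "u \<in> carrier (PObj (fst h) X)"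
    have v: "component h X u \<in> carrier (PObj (fst (snd i)) X)" using D(4)[OF X] t by simp
    have "\<exists>z. B.T z (fst i) \<and> fst z = y X \<and> i \<star>\<^bsub>MC\<^esub> z = yel (fst (snd i)) X (component h X u)"
      using k[of "yel (fst h) X u"] T_yel[OF D(1) X] cmp_yel[OF h(1) X]
      unfolding MC_simps(2,3) yel_arr(2)[OF D(1) X] t by metis
    then show "\<exists>v \<in> carrier (PObj (fst i) X). component i X v = component h X u" unfolding lift_iff[OF i(1) X(1) v] by (metis imageE)
  qed
  then show "\<exists>w \<in> Arr MC. Dom MC w = Dom MC h \<and> Cod MC w = Dom MC i \<and> i \<star>\<^bsub>MC\<^esub> w = h" unfolding MC_simps(2,3) .
qed

section \<open>Identification with the categories of the theorem\<close>

lemma P_eq: "B.P = adm_presented C e"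
proof (rule Set.set_eqI)
  fix F
  have "B.pres f \<pi> F \<longleftrightarrow> f \<in> Arr C \<and> \<pi> \<in> Hom MC (y (Cod C f)) F \<and> exact_at C (Y f) \<pi> \<and> pointwise_surj C \<pi>" for f \<pi>
  proof (cases "f \<in> Arr C")
    case True
    \<comment> \<open>\<open>B.pres\<close> leaves the source of \<open>\<pi>\<close> implicit; it
      is recovered from the matching condition in \<open>exact_at\<close>.\<close>
    have "exact_at C (Y f) \<pi> \<Longrightarrow> fst \<pi> = y (Cod C f)"
      using Y_arr(3)[OF True] by (simp add: exact_at_def case_prod_unfold)
    then show ?thesis using Y_arr(1)[OF True] True unfolding B.pres_def sur_iff ex_iff hom_iff MC_simps(2,3) by blast
  qed (simp add: B.pres_def)
  then show "F \<in> B.P \<longleftrightarrow> F \<in> adm_presented C e" unfolding B.P_def adm_presented_def by blast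
qed

lemma N_eq: "B.N = mod_adm C e"
  by (simp add: B.N_def mod_adm_def P_eq ses_iff)

lemma Eff_eq: "B.Eff = eff C e"
proof -
  have "Obj (mod_adm C e) = B.P" unfolding N_eq[symmetric] by (rule B.N_simps(1))
  then show ?thesis unfolding B.Eff_def eff_def Hom_def by auto
qed

end

theorem theorem1p2:
  fixes E :: "('o, 'm) excat"
    and e :: "'m \<Rightarrow> 'v"
  assumes "exact_category E"
    and "inj_on e (Arr E)"
  shows "percolating_subcategory (mod_adm E e) (eff E e) \<and>
      is_exact_quotient TYPE('p \<times> 'q) (mod_adm E e) (eff E e)
        (exact_quot (mod_adm E e) (eff E e)) (quot_ftor (mod_adm E e) (eff E e)) \<and>
      exact_equivalent (exact_quot (mod_adm E e) (eff E e)) E"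
proof -
  \<comment> \<open>The abstract development applies with \<open>mod_cat E\<close> as the ambient
    category; \<open>B.N\<close> and \<open>B.Eff\<close> are then the two categories of the
    statement.\<close>
  interpret representables E e
    using assms by (simp add: representables_def representables_axioms_def)
  show ?thesis
    using B.percolating B.Q.exact_quotient[where ?'r = 'p and ?'s = 'q] B.Q.exact_equivalence
    unfolding N_eq Eff_eq by blast
qed

end
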